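(* For each of the nine types of internal dynamics of escaping wandering domains, and for each of the six types of internal dynamics of oscillating wandering domains, there exists a transcendental entire function having an escaping (respectively, oscillating) wandering domain $U$ with this type of internal dynamics and such that $\partial U$ is a $\mathcal{C}^{\infty}$ Jordan curve. In the case of eventually isometric internal dynamics, we may in fact take $U=\mathbb{D}$, the unit disc.
   Context: Let $f$ be a transcendental entire function (a holomorphic $f\colon\mathbb{C}\to\mathbb{C}$ that is not a polynomial). The Fatou set is the set of points having a neighbourhood on which the iterates $f^n$ form a normal family; a Fatou component is a connected component of the Fatou set; a wandering domain is a Fatou component that is not eventually periodic. A wandering domain $U$ is escaping if $U\subseteq I(f)=\{z: f^n(z)\to\infty\}$, and oscillating if $U\subseteq BU(f)=\{z:\liminf_{n\to\infty}|f^n(z)|<\infty=\limsup_{n\to\infty}|f^n(z)|\}$. Let $U$ be a simply connected wandering domain of $f$ and let $U_n$ be the Fatou component containing $f^n(U)$, $n\ge 0$. Write $\operatorname{dist}_{U_n}$ for hyperbolic distance in $U_n$ and $\operatorname{dist}$ for Euclidean distance. Let $E=\{(z,z')\in U\times U: f^k(z)=f^k(z')\text{ for some }k\in\mathbb{N}\}$. First classification (exactly one holds): (1) $U$ is contracting: $\operatorname{dist}_{U_n}(f^n(z),f^n(z'))\to 0$ for all $z,z'\in U$; (2) $U$ is semi-contracting: for all $(z,z')\in(U\times U)\setminus E$, $\operatorname{dist}_{U_n}(f^n(z),f^n(z'))\to c(z,z')>0$ and $\operatorname{dist}_{U_n}(f^n(z),f^n(z'))\neq c(z,z')$ for all $n\in\mathbb{N}$;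 (3) $U$ is eventually isometric: there is $N>0$ such that for all $n\geq N$, $\operatorname{dist}_{U_n}(f^n(z),f^n(z'))=c(z,z')>0$ for all $(z,z')\in(U\times U)\setminus E$. Second classification (exactly one holds): (a) $\liminf_{n\to\infty}\operatorname{dist}(f^n(z),\partial U_n)>0$ for all $z\in U$; (b) there is a subsequence $n_k\to\infty$ with $\operatorname{dist}(f^{n_k}(z),\partial U_{n_k})\to 0$ for all $z\in U$, while for a different subsequence $m_k\to\infty$ we have $\liminf_{k\to\infty}\operatorname{dist}(f^{m_k}(z),\partial U_{m_k})>0$ for $z\in U$; (c) $\operatorname{dist}(f^n(z),\partial U_n)\to 0$ for all $z\in U$. The nine types of internal dynamics for escaping wandering domains are the combinations of one of (1), (2), (3) with one of (a), (b), (c). The six types for oscillating wandering domains are the combinations of one of (1), (2), (3) with one of (b), (c) (type (a) cannot occur for oscillating wandering domains). *)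

theory Defs
  imports "HOL-Complex_Analysis.Complex_Analysis"
begin

section \<open>Iteration of transcendental entire functions\<close>

definition transcendental_entire :: "(complex \<Rightarrow> complex) \<Rightarrow> bool" where
  "transcendental_entire f \<longleftrightarrow> f holomorphic_on UNIV \<and> \<not> (\<exists>p. f = poly p)"

text \<open>
  Normality is with respect to the spherical metric: the constant limit infinity is allowed.
  The two alternatives below exhaust the locally uniform limits of holomorphic functions into
  the Riemann sphere only if \<open>S\<close> is connected, so this is used for open connected \<open>S\<close> only.
\<close>

definition normal_family_on :: "complex set \<Rightarrow> (complex \<Rightarrow> complex) set \<Rightarrow> bool" where
  "normal_family_on S \<F> \<longleftrightarrow>
     (\<forall>F :: nat \<Rightarrow> complex \<Rightarrow> complex. range F \<subseteq> \<F> \<longrightarrow>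
        (\<exists>r :: nat \<Rightarrow> nat. strict_mono r \<and>
           ((\<exists>g. \<forall>K. compact K \<and> K \<subseteq> S \<longrightarrow> uniform_limit K (\<lambda>n. F (r n)) g sequentially) \<or>
            (\<forall>K. compact K \<and> K \<subseteq> S \<longrightarrow>
               (\<forall>B. \<forall>\<^sub>F n in sequentially. \<forall>z\<in>K. B \<le> norm (F (r n) z))))))"

definition fatou_set :: "(complex \<Rightarrow> complex) \<Rightarrow> complex set" where
  "fatou_set f =
     {z. \<exists>S. open S \<and> connected S \<and> z \<in> S \<and> normal_family_on S (range (\<lambda>n. f ^^ n))}"

definition fatou_component :: "(complex \<Rightarrow> complex) \<Rightarrow> complex set \<Rightarrow> bool" where
  "fatou_component f U \<longleftrightarrow> U \<in> components (fatou_set f)"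

text \<open>The component \<open>U\<^sub>n\<close>; it exists and is unique because the Fatou set is forward invariant.\<close>

definition orbit_component :: "(complex \<Rightarrow> complex) \<Rightarrow> complex set \<Rightarrow> nat \<Rightarrow> complex set" where
  "orbit_component f U n = (THE V. fatou_component f V \<and> (f ^^ n) ` U \<subseteq> V)"

definition eventually_periodic :: "(complex \<Rightarrow> complex) \<Rightarrow> complex set \<Rightarrow> bool" where
  "eventually_periodic f U \<longleftrightarrow>
     (\<exists>m. \<exists>p>0. orbit_component f U (m + p) = orbit_component f U m)"

definition wandering_domain :: "(complex \<Rightarrow> complex) \<Rightarrow> complex set \<Rightarrow> bool" where
  "wandering_domain f U \<longleftrightarrow> fatou_component f U \<and> \<not> eventually_periodic f U"

definition escaping_set :: "(complex \<Rightarrow> complex) \<Rightarrow> complex set" where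
  "escaping_set f = {z. filterlim (\<lambda>n. (f ^^ n) z) at_infinity sequentially}"

definition bungee_set :: "(complex \<Rightarrow> complex) \<Rightarrow> complex set" where
  "bungee_set f =
     {z. liminf (\<lambda>n. ereal (norm ((f ^^ n) z))) < \<infinity> \<and>
         limsup (\<lambda>n. ereal (norm ((f ^^ n) z))) = \<infinity>}"

definition escaping_wandering_domain :: "(complex \<Rightarrow> complex) \<Rightarrow> complex set \<Rightarrow> bool" where
  "escaping_wandering_domain f U \<longleftrightarrow> wandering_domain f U \<and> U \<subseteq> escaping_set f"

definition oscillating_wandering_domain :: "(complex \<Rightarrow> complex) \<Rightarrow> complex set \<Rightarrow> bool" where
  "oscillating_wandering_domain f U \<longleftrightarrow> wandering_domain f U \<and> U \<subseteq> bungee_set f"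


section \<open>Hyperbolic distance\<close>

text \<open>Distance in the unit disc for the metric \<open>2 |dz| / (1 - |z|\<^sup>2)\<close> of curvature -1.\<close>

definition disc_hyp_dist :: "complex \<Rightarrow> complex \<Rightarrow> real" where
  "disc_hyp_dist a b = 2 * artanh (norm ((a - b) / (1 - cnj a * b)))"

text \<open>
  The hyperbolic distance of a hyperbolic domain is pushed forward from the disc by a holomorphic
  universal covering. Any two such coverings differ by an automorphism of the disc, which is an
  isometry, so letting \<open>p\<close> range over all of them does not change the infimum. If the domain is
  simply connected, \<open>p\<close> is a Riemann map and the infimum is over copies of a single value.
\<close>

definition hyp_dist :: "complex set \<Rightarrow> complex \<Rightarrow> complex \<Rightarrow> real" where
  "hyp_dist \<Omega> z w =
     Inf {disc_hyp_dist a b | p a b.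
            p holomorphic_on ball 0 1 \<and> covering_space (ball 0 1) p \<Omega> \<and>
            a \<in> ball 0 1 \<and> b \<in> ball 0 1 \<and> p a = z \<and> p b = w}"


section \<open>Internal dynamics of simply connected wandering domains\<close>

definition orbit_hyp_dist ::
    "(complex \<Rightarrow> complex) \<Rightarrow> complex set \<Rightarrow> complex \<Rightarrow> complex \<Rightarrow> nat \<Rightarrow> real" where
  "orbit_hyp_dist f U z z' n = hyp_dist (orbit_component f U n) ((f ^^ n) z) ((f ^^ n) z')"

definition orbit_boundary_dist ::
    "(complex \<Rightarrow> complex) \<Rightarrow> complex set \<Rightarrow> complex \<Rightarrow> nat \<Rightarrow> real" where
  "orbit_boundary_dist f U z n = infdist ((f ^^ n) z) (frontier (orbit_component f U n))"

definition merging_pairs :: "(complex \<Rightarrow> complex) \<Rightarrow> complex set \<Rightarrow> (complex \<times> complex) set" where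
  "merging_pairs f U = {(z, z') \<in> U \<times> U. \<exists>k. (f ^^ k) z = (f ^^ k) z'}"

datatype hyperbolic_type = Contracting | Semi_contracting | Eventually_isometric

datatype boundary_type = Bounded_away | Alternating | Converging

primrec has_hyperbolic_type ::
    "(complex \<Rightarrow> complex) \<Rightarrow> complex set \<Rightarrow> hyperbolic_type \<Rightarrow> bool" where
  "has_hyperbolic_type f U Contracting \<longleftrightarrow>
     (\<forall>z\<in>U. \<forall>z'\<in>U. orbit_hyp_dist f U z z' \<longlonglongrightarrow> 0)"
| "has_hyperbolic_type f U Semi_contracting \<longleftrightarrow>
     (\<exists>c :: complex \<Rightarrow> complex \<Rightarrow> real.
        \<forall>(z, z') \<in> U \<times> U - merging_pairs f U.
          c z z' > 0 \<and> orbit_hyp_dist f U z z' \<longlonglongrightarrow> c z z' \<and>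
          (\<forall>n. orbit_hyp_dist f U z z' n \<noteq> c z z'))"
| "has_hyperbolic_type f U Eventually_isometric \<longleftrightarrow>
     (\<exists>c :: complex \<Rightarrow> complex \<Rightarrow> real. \<exists>N>0. \<forall>n\<ge>N.
        \<forall>(z, z') \<in> U \<times> U - merging_pairs f U.
          c z z' > 0 \<and> orbit_hyp_dist f U z z' n = c z z')"

primrec has_boundary_type ::
    "(complex \<Rightarrow> complex) \<Rightarrow> complex set \<Rightarrow> boundary_type \<Rightarrow> bool" where
  "has_boundary_type f U Bounded_away \<longleftrightarrow>
     (\<forall>z\<in>U. liminf (\<lambda>n. ereal (orbit_boundary_dist f U z n)) > 0)"
| "has_boundary_type f U Alternating \<longleftrightarrow>
     (\<exists>n :: nat \<Rightarrow> nat. \<exists>m :: nat \<Rightarrow> nat. strict_mono n \<and> strict_mono m \<and>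
        (\<forall>z\<in>U. (\<lambda>k. orbit_boundary_dist f U z (n k)) \<longlonglongrightarrow> 0) \<and>
        (\<forall>z\<in>U. liminf (\<lambda>k. ereal (orbit_boundary_dist f U z (m k))) > 0))"
| "has_boundary_type f U Converging \<longleftrightarrow>
     (\<forall>z\<in>U. orbit_boundary_dist f U z \<longlonglongrightarrow> 0)"


section \<open>Smooth Jordan curves\<close>

text \<open>
  The parametrization is a 1-periodic smooth immersion of the line, so it is also smooth and
  regular at the closing point, and \<open>C\<close> is an embedded smooth closed curve (no corners or cusps).
\<close>

definition smooth_Jordan_curve :: "complex set \<Rightarrow> bool" where
  "smooth_Jordan_curve C \<longleftrightarrow>
     (\<exists>\<gamma> :: real \<Rightarrow> complex.
        (\<forall>k. ((\<lambda>g t. vector_derivative g (at t)) ^^ k) \<gamma> differentiable_on UNIV) \<and>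
        (\<forall>t. vector_derivative \<gamma> (at t) \<noteq> 0) \<and>
        (\<forall>t. \<gamma> (t + 1) = \<gamma> t) \<and>
        simple_path \<gamma> \<and> path_image \<gamma> = C)"

end

theory Submission
  imports Defs "HOL-Computational_Algebra.Fundamental_Theorem_Algebra"
begin

text \<open>
  \<open>f\<close> is a locally uniform limit of entire functions. Each is obtained from the previous one by Runge
  approximation on three disjoint discs: a large disc on which the map is kept, the present station,
  which is sent to the next station by a rescaling of a prescribed finite Blaschke product \<open>b k\<close>, and a
  small disc around the end of an orbit segment of 20, by which the curve can be brought back to a
  bounded distance. Points of a finite net just outside the boundary curve are sent into the basin of
  an attracting fixed point near 10, so that the limit curve is in the Julia set. In the isometric case
  the curve stays the unit circle and the chart at the station is corrected; otherwise the curve is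
  corrected, by perturbations of the identity so small that the limit is smooth.

  In the coordinates of the stations the orbit of \<open>z\<close> satisfies \<open>w (k + 1) = b k (w k)\<close> up to a
  summable error, and the images of \<open>U\<close> are almost discs. The radii of the stations decide the boundary
  type, the returns decide between escaping and oscillating, and \<open>b k\<close> decides the hyperbolic type:
  \<open>z\<^sup>2\<close> contracts, \<open>z\<close> gives an isometry, and \<open>z (z + a) / (1 + a z)\<close> with \<open>a\<close> tending to 1
  fast is not injective, so that distances never stop decreasing, but the total loss is bounded.
\<close>


section \<open>Runge approximation on disjoint discs\<close>

text \<open>Each stage hits its target only up to an error, and errors of past stages cannot be
  removed later: on a disc already used the map may change only by amounts fixed before. If the next
  stage started from an inexact position, errors would compound. So the iterate leading to a station
  is straightened at once: a simplified Newton iteration solves Q(\<sigma> z) = B z, and \<sigma> is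
  absorbed either by the curve or by the chart at the station, so that the induction always starts
  from an exact equation. The return works because the construction also carries the orbit of 20,
  whose exit time from the controlled disc is k at stage k. At the exit the map is still free, and a
  translation there closes the route. The net points can be told from the curve because
  \<open>B k\<close> sends them strictly outside the unit circle: one polynomial can follow the
  prescribed map on a disc around 0 and still send their images to 10. Normality of the iterates
  needs small images only along bounded stretches: the intermediate positions of a return have
  diameters of order 1/k, while stations may keep radius 1 because their centres tend to
  infinity.\<close>

definition poly_approx_on :: "complex set \<Rightarrow> (complex \<Rightarrow> complex) \<Rightarrow> bool" where
  "poly_approx_on K g \<longleftrightarrow> (\<forall>e>0. \<exists>p. \<forall>z\<in>K. norm (g z - poly p z) < e)"

lemma poly_approx_onD:
  assumes "poly_approx_on K g" "e > 0"
  obtains p where "\<And>z. z \<in> K \<Longrightarrow> norm (g z - poly p z) < e"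
  using assms unfolding poly_approx_on_def by meson

lemma poly_approx_on_cong:
  "(\<And>z. z \<in> K \<Longrightarrow> f z = g z) \<Longrightarrow> poly_approx_on K f = poly_approx_on K g"
  unfolding poly_approx_on_def by simp

lemma poly_approx_on_poly: "poly_approx_on K (poly p)"
  unfolding poly_approx_on_def by (intro allI impI exI[of _ p]) simp

lemma poly_approx_on_const: "poly_approx_on K (\<lambda>z. c)"
proof -
  have "(\<lambda>z. c) = poly [:c:]" by auto
  then show ?thesis by (simp only: poly_approx_on_poly)
qed

lemma poly_approx_on_close:
  assumes "\<And>e. e > 0 \<Longrightarrow> \<exists>h. poly_approx_on K h \<and> (\<forall>z\<in>K. norm (g z - h z) < e)"
  shows "poly_approx_on K g"
  unfolding poly_approx_on_def
proof (intro allI impI)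
  fix e :: real assume "e > 0"
  then obtain h where h: "poly_approx_on K h" "\<forall>z\<in>K. norm (g z - h z) < e/2"
    using assms[of "e/2"] by auto
  obtain p where p: "\<And>z. z \<in> K \<Longrightarrow> norm (h z - poly p z) < e/2"
    using poly_approx_onD[OF h(1), of "e/2"] \<open>e > 0\<close> by auto
  show "\<exists>p. \<forall>z\<in>K. norm (g z - poly p z) < e"
  proof (intro exI[of _ p] ballI)
    fix z assume "z \<in> K"
    then show "norm (g z - poly p z) < e"
      using h(2) p[of z] norm_diff_triangle_less[of "g z" "h z" "e/2" "poly p z" "e/2"] by auto
  qed
qed

lemma poly_approx_on_add:
  assumes "poly_approx_on K f" "poly_approx_on K g"
  shows "poly_approx_on K (\<lambda>z. f z + g z)"
  unfolding poly_approx_on_def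
proof (intro allI impI)
  fix e :: real assume "e > 0"
  obtain p where p: "\<And>z. z \<in> K \<Longrightarrow> norm (f z - poly p z) < e/2"
    using poly_approx_onD[OF assms(1), of "e/2"] \<open>e > 0\<close> by auto
  obtain q where q: "\<And>z. z \<in> K \<Longrightarrow> norm (g z - poly q z) < e/2"
    using poly_approx_onD[OF assms(2), of "e/2"] \<open>e > 0\<close> by auto
  show "\<exists>p. \<forall>z\<in>K. norm (f z + g z - poly p z) < e"
  proof (intro exI[of _ "p + q"] ballI)
    fix z assume "z \<in> K"
    have "norm (f z + g z - poly (p + q) z) \<le> norm (f z - poly p z) + norm (g z - poly q z)"
      by (metis add_diff_add norm_triangle_ineq poly_add)
    then show "norm (f z + g z - poly (p + q) z) < e"
      using p[of z] q[of z] \<open>z \<in> K\<close> by simp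
  qed
qed

lemma poly_approx_on_bounded:
  assumes "poly_approx_on K f" "compact K"
  obtains M where "M > 0" "\<And>z. z \<in> K \<Longrightarrow> norm (f z) \<le> M"
proof -
  obtain p where p: "\<And>z. z \<in> K \<Longrightarrow> norm (f z - poly p z) < 1"
    using poly_approx_onD[OF assms(1), of 1] by auto
  have "bounded (poly p ` K)"
    by (intro compact_imp_bounded compact_continuous_image assms continuous_intros)
  then obtain B where B: "\<And>z. z \<in> K \<Longrightarrow> norm (poly p z) \<le> B"
    unfolding bounded_iff by auto
  show ?thesis
  proof (rule that[of "max 0 B + 1"])
    fix z assume "z \<in> K"
    have "norm (f z) \<le> norm (f z - poly p z) + norm (poly p z)"
      by (metis add.commute norm_triangle_sub)
    then show "norm (f z) \<le> max 0 B + 1" using p[of z] B[of z] \<open>z \<in> K\<close> by auto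
  qed auto
qed

lemma poly_approx_on_mult:
  assumes "poly_approx_on K f" "poly_approx_on K g" "compact K"
  shows "poly_approx_on K (\<lambda>z. f z * g z)"
  unfolding poly_approx_on_def
proof (intro allI impI)
  fix e :: real assume "e > 0"
  obtain M where M: "M > 0" "\<And>z. z \<in> K \<Longrightarrow> norm (f z) \<le> M"
    using poly_approx_on_bounded assms by metis
  obtain q where q: "\<And>z. z \<in> K \<Longrightarrow> norm (g z - poly q z) < e/(2*M)"
    using poly_approx_onD[OF assms(2), of "e/(2*M)"] \<open>e > 0\<close> M by auto
  obtain L where L: "L > 0" "\<And>z. z \<in> K \<Longrightarrow> norm (poly q z) \<le> L"
    using poly_approx_on_bounded poly_approx_on_poly assms by metis
  obtain p where p: "\<And>z. z \<in> K \<Longrightarrow> norm (f z - poly p z) < e/(2*L)"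
    using poly_approx_onD[OF assms(1), of "e/(2*L)"] \<open>e > 0\<close> L by auto
  show "\<exists>p. \<forall>z\<in>K. norm (f z * g z - poly p z) < e"
  proof (intro exI[of _ "p * q"] ballI)
    fix z assume z: "z \<in> K"
    have "f z * g z - poly (p * q) z = f z * (g z - poly q z) + (f z - poly p z) * poly q z"
      by (simp add: algebra_simps)
    then have "norm (f z * g z - poly (p * q) z) \<le> norm (f z) * norm (g z - poly q z) + norm (f z - poly p z) * norm (poly q z)"
      by (metis norm_mult norm_triangle_ineq)
    also have "\<dots> \<le> M * norm (g z - poly q z) + norm (f z - poly p z) * L"
      by (intro add_mono mult_mono M L z order_refl) (use M L in auto)
    also have "\<dots> < M * (e/(2*M)) + e/(2*L) * L"
      by (intro add_strict_mono mult_strict_left_mono mult_strict_right_mono p q z M L)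
    also have "\<dots> = e" using M L by simp
    finally show "norm (f z * g z - poly (p * q) z) < e" .
  qed
qed

lemma poly_approx_on_sum:
  assumes "finite I" "\<And>i. i \<in> I \<Longrightarrow> poly_approx_on K (f i)"
  shows "poly_approx_on K (\<lambda>z. \<Sum>i\<in>I. f i z)"
  using assms by (induction I) (auto intro: poly_approx_on_add poly_approx_on_const)

lemma poly_approx_on_power:
  assumes "poly_approx_on K f" "compact K"
  shows "poly_approx_on K (\<lambda>z. f z ^ n)"
  using assms by (induction n) (auto intro: poly_approx_on_mult poly_approx_on_const)

section \<open>Rational functions with poles off a compact set: pole pushing\<close>

lemma geometric_remainder:
  fixes u :: complex
  assumes "u \<noteq> 1"
  shows "1/(1-u) - (\<Sum>n<N. u^n) = u^N / (1-u)"
proof -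
  have "(\<Sum>n<N. u^n) = (1 - u^N) / (1-u)"
    using assms geometric_sum[OF assms, of N] by (simp add: nonzero_eq_divide_eq nonzero_divide_eq_eq algebra_simps)
  then show ?thesis by (simp add: diff_divide_distrib)
qed

lemma poly_approx_on_geometric:
  assumes "poly_approx_on K u" "compact K" "\<rho> < 1" "\<And>z. z \<in> K \<Longrightarrow> norm (u z) \<le> \<rho>"
  shows "poly_approx_on K (\<lambda>z. 1 / (1 - u z))"
proof (rule poly_approx_on_close)
  fix e :: real assume "e > 0"
  \<comment> \<open>A negative \<open>\<rho>\<close> is possible only for empty K; the power
    estimates need a nonnegative ratio.\<close>
  define s where "s = max 0 \<rho>"
  have s: "0 \<le> s" "s < 1" "\<And>z. z \<in> K \<Longrightarrow> norm (u z) \<le> s" using assms(3,4) by (force simp: s_def)+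
  have "(\<lambda>N. s^N / (1-s)) \<longlonglongrightarrow> 0 / (1-s)"
    using s by (intro tendsto_intros LIMSEQ_power_zero) auto
  then have "\<forall>\<^sub>F N in sequentially. s^N / (1-s) < e"
    using \<open>e > 0\<close> by (auto dest: order_tendstoD)
  then obtain N where N: "s^N / (1-s) < e" by (auto simp: eventually_sequentially)
  show "\<exists>h. poly_approx_on K h \<and> (\<forall>z\<in>K. norm (1 / (1 - u z) - h z) < e)"
  proof (intro exI conjI ballI)
    show "poly_approx_on K (\<lambda>z. \<Sum>n<N. u z ^ n)"
      by (intro poly_approx_on_sum poly_approx_on_power assms) auto
    fix z assume z: "z \<in> K"
    have "norm (1 / (1 - u z) - (\<Sum>n<N. u z ^ n)) = norm (u z)^N / norm (1 - u z)"
      using s(2) s(3)[OF z] by (subst geometric_remainder) (auto simp: norm_divide norm_power)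
    also have "\<dots> \<le> s^N / (1-s)"
      using s(1,2) s(3)[OF z] norm_triangle_ineq2[of 1 "u z"]
      by (intro frac_le power_mono) auto
    finally show "norm (1 / (1 - u z) - (\<Sum>n<N. u z ^ n)) < e" using N by simp
  qed
qed

text \<open>Expanding 1/(z - b) around the pole a gives 1/(z - a) times a geometric series in (b -
  a)/(z - a), whose ratio is at most 1/2 on K.\<close>

lemma poly_approx_on_pole_shift:
  assumes "poly_approx_on K (\<lambda>z. 1 / (z - a))" "compact K" "d > 0"
    "\<And>z. z \<in> K \<Longrightarrow> d \<le> norm (z - a)" "norm (b - a) \<le> d/2"
  shows "poly_approx_on K (\<lambda>z. 1 / (z - b))"
proof -
  have "poly_approx_on K (\<lambda>z. (1 / (z-a)) * (1 / (1 - (b-a) * (1/(z-a)))))"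
  proof (intro poly_approx_on_mult poly_approx_on_geometric[where \<rho>="1/2"] assms poly_approx_on_const)
    fix z assume "z \<in> K"
    then have "norm (b - a) / norm (z - a) \<le> (d/2) / d"
      using assms by (intro frac_le) auto
    then show "norm ((b-a) * (1/(z-a))) \<le> 1/2"
      using assms by (simp add: norm_divide norm_mult)
  qed auto
  moreover have "(1 / (z-a)) * (1 / (1 - (b-a) * (1/(z-a)))) = 1 / (z - b)" if "z \<in> K" for z
  proof -
    have "z \<noteq> a" using assms(3) assms(4)[OF that] by auto
    then show ?thesis by (simp add: divide_simps)
  qed
  ultimately show ?thesis by (simp cong: poly_approx_on_cong)
qed

text \<open>The admissible poles form a nonempty set that is open and closed relative to the
  connected complement of K. Openness and closedness are one shift of the pole each.\<close>

lemma poly_approx_on_pole: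
  assumes K: "compact K" "connected (- K)" and a: "a \<notin> K"
  shows "poly_approx_on K (\<lambda>z. 1 / (z - a))"
proof (cases "K = {}")
  case True then show ?thesis by (simp add: poly_approx_on_def)
next
  case False
  define S where "S = {a \<in> - K. poly_approx_on K (\<lambda>z. 1 / (z - a))}"
  have d: "infdist b K > 0" "z \<in> K \<Longrightarrow> infdist b K \<le> norm (z - b)" if "b \<notin> K" for b z
  proof -
    show "infdist b K > 0" using False K that
      by (simp add: compact_imp_closed infdist_pos_not_in_closed)
    show "infdist b K \<le> norm (z - b)" if "z \<in> K"
      using infdist_le[OF that, of b] by (simp add: dist_norm norm_minus_commute)
  qed
  have "open S" unfolding open_dist
  proof
    fix b assume b: "b \<in> S"
    then have bK: "b \<notin> K" by (simp add: S_def)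
    show "\<exists>e>0. \<forall>y. dist y b < e \<longrightarrow> y \<in> S"
    proof (intro exI conjI allI impI)
      show "infdist b K / 2 > 0" using d(1)[OF bK] by simp
      fix y assume y: "dist y b < infdist b K / 2"
      have "poly_approx_on K (\<lambda>z. 1 / (z - y))"
        by (rule poly_approx_on_pole_shift[of K b "infdist b K"])
          (use b y d(1)[OF bK] K d(2)[OF bK] in \<open>auto simp: S_def dist_norm\<close>)
      moreover have "y \<notin> K" using d(1)[OF bK] d(2)[OF bK, of y] y by (auto simp: dist_norm)
      ultimately show "y \<in> S" by (simp add: S_def)
    qed
  qed
  then have "openin (top_of_set (- K)) S" by (rule open_subset[rotated]) (auto simp: S_def)
  moreover have "closedin (top_of_set (- K)) S" unfolding closedin_limpt
  proof (intro conjI allI impI)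
    fix b assume b: "b islimpt S \<and> b \<in> - K"
    then have bK: "b \<notin> K" by auto
    \<comment> \<open>A quarter of the distance suffices: K stays at distance 3/4 from y, and 1/4 is
      below half of 3/4.\<close>
    from b obtain y where y: "y \<in> S" "dist y b < infdist b K / 4"
      using d(1)[OF bK] unfolding islimpt_approachable by (meson divide_pos_pos zero_less_numeral)
    have "poly_approx_on K (\<lambda>z. 1 / (z - b))"
    proof (rule poly_approx_on_pole_shift[of K y "infdist b K * (3/4)"])
      fix z assume "z \<in> K"
      then have "infdist b K \<le> norm (z - b)" by (rule d(2)[OF bK])
      also have "\<dots> \<le> norm (z - y) + norm (y - b)" using norm_triangle_ineq[of "z - y" "y - b"] by simp
      finally show "infdist b K * (3/4) \<le> norm (z - y)" using y by (simp add: dist_norm)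
    qed (use y K d(1)[OF bK] in \<open>auto simp: S_def dist_norm norm_minus_commute\<close>)
    then show "b \<in> S" using bK by (simp add: S_def)
  qed (auto simp: S_def)
  moreover have "S \<noteq> {}"
  proof -
    obtain M where M: "M > 0" "\<And>z. z \<in> K \<Longrightarrow> norm z \<le> M"
      using compact_imp_bounded[OF K(1)] unfolding bounded_pos by auto
    \<comment> \<open>A pole twice as far out as K: there 1/(z - b) is a geometric series in z/b of
      ratio at most 1/2.\<close>
    define b :: complex where "b = of_real (2*M)"
    have nb: "norm b = 2*M" using M by (simp add: b_def)
    have "b \<noteq> 0" using nb M by auto
    have "poly_approx_on K (\<lambda>z. (-1/b) * (1 / (1 - poly [:0, 1/b:] z)))"
    proof (intro poly_approx_on_mult poly_approx_on_geometric[where \<rho>="1/2"] K poly_approx_on_const poly_approx_on_poly)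
      fix z assume "z \<in> K"
      then show "norm (poly [:0, 1/b:] z) \<le> 1/2" using M nb by (simp add: norm_divide)
    qed auto
    moreover have "(-1/b) * (1 / (1 - poly [:0, 1/b:] z)) = 1 / (z - b)" for z
      using \<open>b \<noteq> 0\<close> by (simp add: divide_simps)
    ultimately have "poly_approx_on K (\<lambda>z. 1 / (z - b))" by simp
    moreover have "b \<notin> K" using M(1) M(2)[of b] nb by auto
    ultimately show ?thesis by (auto simp: S_def)
  qed
  ultimately have "S = - K"
    using K(2) unfolding connected_clopen by blast
  then show ?thesis using a by (auto simp: S_def)
qed

text \<open>By the fundamental theorem of algebra the reciprocal is a product of factors 1/(z - a)
  with a off K, and the approximable functions are closed under products.\<close>

lemma poly_approx_on_inverse_poly:
  assumes K: "compact K" "connected (- K)" and "\<And>z. z \<in> K \<Longrightarrow> poly q z \<noteq> 0" "q \<noteq> 0"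
  shows "poly_approx_on K (\<lambda>z. 1 / poly q z)"
  using assms(3,4)
proof (induction "degree q" arbitrary: q)
  case 0
  then obtain c where "q = [:c:]" by (metis degree_eq_zeroE)
  then show ?case by (simp add: poly_approx_on_const)
next
  case (Suc n)
  have "\<not> constant (poly q)" using Suc.hyps(2) by (simp add: constant_degree)
  then obtain a where a: "poly q a = 0" using fundamental_theorem_of_algebra by blast
  then obtain q' where q': "q = [:-a, 1:] * q'" by (auto simp: poly_eq_0_iff_dvd elim: dvdE)
  then have "q' \<noteq> 0" using Suc.prems by auto
  then have "degree q = Suc (degree q')" using q' by (subst q', subst degree_mult_eq) auto
  then have "poly_approx_on K (\<lambda>z. 1 / poly q' z)"
    using Suc q' \<open>q' \<noteq> 0\<close> by (intro Suc.hyps(1)) auto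
  moreover have "a \<notin> K" using a Suc.prems by auto
  ultimately have "poly_approx_on K (\<lambda>z. (1 / (z - a)) * (1 / poly q' z))"
    using K by (intro poly_approx_on_mult poly_approx_on_pole) auto
  moreover have "(1 / (z - a)) * (1 / poly q' z) = 1 / poly q z" for z by (simp add: q' algebra_simps)
  ultimately show ?case by (simp only:)
qed

text \<open>With w = (z - c)/t and r < t < s, the function 1/(1 - w^N) tends to 1 where |w| < 1 and
  to 0 where |w| > 1. Its poles lie on the circle of radius t, in the gap that K avoids.\<close>

lemma poly_approx_on_disc_indicator:
  assumes K: "compact K" "connected (- K)" and rs: "0 \<le> r" "r < s" "cball c s \<inter> K \<subseteq> cball c r"
  shows "poly_approx_on K (\<lambda>z. if z \<in> cball c r then 1 else 0)"
proof (rule poly_approx_on_close)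
  fix e :: real assume e: "e > 0"
  define t where "t = (r + s)/2"
  have t: "r < t" "t < s" "0 < t" using rs by (auto simp: t_def)
  \<comment> \<open>One ratio for both sides: it bounds |w| on the part of K in the disc and 1/|w|
    on the rest.\<close>
  define \<rho> where "\<rho> = max (r/t) (t/s)"
  have \<rho>: "0 \<le> \<rho>" "\<rho> < 1" "r \<le> \<rho> * t" "t \<le> \<rho> * s"
    using t rs by (auto simp: \<rho>_def max_def field_simps)
  have "(\<lambda>N. \<rho>^N / (1-\<rho>^N)) \<longlonglongrightarrow> 0 / (1-0)"
    using \<rho> by (intro tendsto_intros LIMSEQ_power_zero) auto
  then have "\<forall>\<^sub>F N in sequentially. \<rho>^N / (1-\<rho>^N) < e"
    using e by (auto dest: order_tendstoD)
  then obtain N0 where N0: "\<And>N. N \<ge> N0 \<Longrightarrow> \<rho>^N / (1-\<rho>^N) < e" by (auto simp: eventually_sequentially)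
  \<comment> \<open>The exponent must be positive, both for \<open>\<rho>^N < 1\<close> and for
    \<open>poly q c = 1\<close>.\<close>
  define N where "N = Suc N0"
  have N: "\<rho>^N / (1-\<rho>^N) < e" using N0[of N] by (simp add: N_def)
  have \<rho>N: "\<rho>^N < 1" using \<rho> unfolding N_def by (cases "\<rho> = 0") (auto intro!: power_Suc_less_one simp del: power_Suc)
  define q where "q = 1 - [:-c/of_real t, 1/of_real t:]^N"
  define w where "w z = (z - c)/of_real t" for z
  have q: "poly q z = 1 - w z^N" for z by (simp add: q_def w_def poly_power diff_divide_distrib)
  have w: "(z \<in> cball c r \<and> norm (w z^N) \<le> \<rho>^N) \<or> (z \<notin> cball c r \<and> z \<noteq> c \<and> norm (1/w z^N) \<le> \<rho>^N \<and> w z \<noteq> 0)" if "z \<in> K" for z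
  proof (cases "z \<in> cball c r")
    case True
    then have "norm (w z) \<le> \<rho>" using t \<rho> by (simp add: w_def norm_divide field_simps dist_norm norm_minus_commute)
    then show ?thesis using True by (simp add: norm_power power_mono)
  next
    case False
    then have "norm (z - c) > s" using that rs(3) by (force simp: dist_norm norm_minus_commute)
    then have "t \<le> \<rho> * norm (z - c)" using \<rho> t
      by (meson less_eq_real_def mult_left_mono order_trans)
    then have "norm (1/w z) \<le> \<rho>" using t \<rho> \<open>norm (z - c) > s\<close> rs by (simp add: w_def norm_divide pos_divide_le_eq divide_le_eq)
    then have "norm (1/w z)^N \<le> \<rho>^N" by (simp add: power_mono)
    moreover have "norm (1/w z)^N = norm (1/w z^N)" by (simp add: norm_power norm_divide power_divide)
    moreover have "z \<noteq> c" using \<open>norm (z - c) > s\<close> rs by auto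
    ultimately show ?thesis using False t by (simp add: w_def)
  qed
  show "\<exists>h. poly_approx_on K h \<and> (\<forall>z\<in>K. norm ((if z \<in> cball c r then 1 else 0) - h z) < e)"
  proof (intro exI conjI ballI)
    show "poly_approx_on K (\<lambda>z. 1 / poly q z)"
    proof (intro poly_approx_on_inverse_poly K)
      show "poly q z \<noteq> 0" if z: "z \<in> K" for z
        using w[OF z] \<rho>N by (auto simp: q norm_divide dest!: sym[of "1::complex"])
      have "poly q c = 1" by (simp add: q w_def N_def)
      then show "q \<noteq> 0" by auto
    qed
    fix z assume z: "z \<in> K"
    have key: "norm (v/(1-v)) \<le> \<rho>^N/(1-\<rho>^N)" if "norm v \<le> \<rho>^N" for v :: complex
      using that \<rho>N \<rho>(1) norm_triangle_ineq2[of 1 v] unfolding norm_divide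
      by (intro frac_le) auto
    show "norm ((if z \<in> cball c r then 1 else 0) - 1 / poly q z) < e"
    proof (cases "z \<in> cball c r")
      case True
      then have *: "norm (w z^N) \<le> \<rho>^N" using w[OF z] by auto
      then have "w z^N \<noteq> 1" using \<rho>N by force
      then have "1 - 1 / poly q z = - (w z^N / (1 - w z^N))" by (simp add: q field_simps)
      then show ?thesis using key[OF *] True N by simp
    next
      case False
      then have *: "norm (1/w z^N) \<le> \<rho>^N" "w z \<noteq> 0" using w[OF z] by auto
      have "w z^N \<noteq> 1" using *(1) \<rho>N by force
      then have "1 / poly q z = - ((1/w z^N) / (1 - 1/w z^N))" using *(2) by (simp add: q field_simps)
      then show ?thesis using key[OF *(1)] False N by simp
    qed
  qed
qed

section \<open>Taylor approximation on one disc and gluing over several\<close>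

lemma poly_approx_on_holomorphic_cball:
  assumes f: "f holomorphic_on ball c R" and r: "0 \<le> r" "r < R"
  shows "poly_approx_on (cball c r) f"
  unfolding poly_approx_on_def
proof (intro allI impI)
  fix e :: real assume e: "e > 0"
  define a where "a n = (deriv ^^ n) f c / fact n" for n
  have sums: "(\<lambda>n. a n * (z - c)^n) sums f z" if "z \<in> ball c R" for z
    unfolding a_def using holomorphic_power_series[OF f that] .
  \<comment> \<open>Boundedness of the Taylor terms at the intermediate radius t gives the geometric
    majorant (r/t)^n on the smaller disc.\<close>
  define t where "t = (r + R)/2"
  have t: "r < t" "t < R" "0 < t" using r by (auto simp: t_def)
  have "summable (\<lambda>n. a n * of_real t^n)"
    using sums[of "c + of_real t"] t by (auto simp: dist_norm sums_iff)
  then have "Bseq (\<lambda>n. a n * of_real t^n)" by (rule summable_imp_Bseq)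
  then obtain M where M: "\<And>n. norm (a n * of_real t^n) \<le> M" unfolding Bseq_def by auto
  have ul: "uniform_limit (cball c r) (\<lambda>n z. \<Sum>i<n. a i * (z - c)^i) (\<lambda>z. \<Sum>i. a i * (z - c)^i) sequentially"
  proof (rule Weierstrass_m_test)
    show "summable (\<lambda>n. M * (r/t)^n)" using r t by (intro summable_mult summable_geometric) auto
    fix n z assume z: "z \<in> cball c r"
    have "norm (a n * (z-c)^n) = norm (a n * of_real t^n) * (norm (z - c) / t)^n"
      using t by (simp add: norm_mult norm_power power_divide)
    also have "\<dots> \<le> M * (r/t)^n"
      using z t M[of n] by (intro mult_mono power_mono divide_right_mono) (auto simp: dist_norm norm_minus_commute intro: order_trans[OF norm_ge_zero])
    finally show "norm (a n * (z-c)^n) \<le> M * (r/t)^n" .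
  qed
  then obtain n where n: "\<And>z. z \<in> cball c r \<Longrightarrow> dist (\<Sum>i<n. a i * (z - c)^i) (\<Sum>i. a i * (z - c)^i) < e"
    using e unfolding uniform_limit_iff eventually_sequentially by (meson order_refl)
  show "\<exists>p. \<forall>z\<in>cball c r. norm (f z - poly p z) < e"
  proof (intro exI[of _ "\<Sum>i<n. smult (a i) ([:-c,1:]^i)"] ballI)
    fix z assume z: "z \<in> cball c r"
    then have "(\<Sum>i. a i * (z - c)^i) = f z" using sums[of z] r by (auto simp: sums_iff)
    then show "norm (f z - poly (\<Sum>i<n. smult (a i) ([:-c,1:]^i)) z) < e"
      using n[OF z] by (simp add: poly_sum poly_power dist_norm norm_minus_commute)
  qed
qed

text \<open>Janiszewski's theorem adds one disc at a time; the intersection with the previous discs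
  is empty, hence connected.\<close>

lemma connected_Compl_Union_cballs:
  fixes c :: "'i \<Rightarrow> complex"
  assumes "finite I" "disjoint_family_on (\<lambda>i. cball (c i) (r i)) I"
  shows "connected (- (\<Union>i\<in>I. cball (c i) (r i)))"
  using assms
proof (induction I)
  case empty
  then show ?case by (simp add: connected_UNIV)
next
  case (insert i I)
  have "connected (- (cball (c i) (r i) \<union> (\<Union>i\<in>I. cball (c i) (r i))))"
  proof (rule Janiszewski_connected)
    show "closed (\<Union>i\<in>I. cball (c i) (r i))" using insert by auto
    have "cball (c i) (r i) \<inter> (\<Union>i\<in>I. cball (c i) (r i)) = {}"
      using insert by (fastforce simp: disjoint_family_on_def)
    then show "connected (cball (c i) (r i) \<inter> (\<Union>i\<in>I. cball (c i) (r i)))" by simp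
    show "connected (- cball (c i) (r i))"
      by (intro connected_complement_bounded_convex) auto
    show "connected (- (\<Union>i\<in>I. cball (c i) (r i)))"
      using insert by (auto simp: disjoint_family_on_def)
  qed auto
  then show ?case by simp
qed

text \<open>Each piece has its own Taylor polynomial; multiplied by the approximable indicator of
  its disc and summed, these polynomials agree with the right piece on every disc of the
  union.\<close>

theorem Runge_disjoint_discs:
  fixes c :: "'i \<Rightarrow> complex"
  assumes I: "finite I" "disjoint_family_on (\<lambda>i. cball (c i) (r i)) I"
    and r: "\<And>i. i \<in> I \<Longrightarrow> 0 \<le> r i \<and> r i < R i"
    and f: "\<And>i. i \<in> I \<Longrightarrow> f i holomorphic_on ball (c i) (R i)"
    and e: "e > 0"
  obtains p where "\<And>i z. i \<in> I \<Longrightarrow> z \<in> cball (c i) (r i) \<Longrightarrow> norm (poly p z - f i z) < e"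
proof -
  define K where "K = (\<Union>i\<in>I. cball (c i) (r i))"
  have K: "compact K" "connected (- K)"
    unfolding K_def using connected_Compl_Union_cballs[OF I] I(1) by auto
  have "\<exists>p. \<forall>z\<in>cball (c i) (r i). norm (f i z - poly p z) < e/2" if "i \<in> I" for i
    using poly_approx_on_holomorphic_cball[OF f[OF that], of "r i"] r[OF that] e
    unfolding poly_approx_on_def by (meson half_gt_zero)
  then obtain P where P: "\<And>i z. i \<in> I \<Longrightarrow> z \<in> cball (c i) (r i) \<Longrightarrow> norm (f i z - poly (P i) z) < e/2"
    by metis
  have ind: "poly_approx_on K (\<lambda>z. if z \<in> cball (c i) (r i) then 1 else 0)" if i: "i \<in> I" for i
  proof -
    define T where "T = (\<Union>j\<in>I-{i}. cball (c j) (r j))"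
    have "cball (c i) (r i) \<inter> T = {}" using I i unfolding T_def disjoint_family_on_def by fastforce
    moreover have "compact T" unfolding T_def using I by auto
    ultimately have "cball (c i) (r i) \<subseteq> - T" "open (- T)" by (auto simp: compact_imp_closed)
    then obtain d where d: "d > 0" "(\<Union>x\<in>cball (c i) (r i). cball x d) \<subseteq> - T"
      using compact_subset_open_imp_cball_epsilon_subset[of "cball (c i) (r i)" "- T"] by auto
    \<comment> \<open>A point of the larger disc is within d of its radial projection to the smaller
      one, so the thickened disc still misses the others. This is the gap that the indicator
      needs.\<close>
    have "cball (c i) (r i + d) \<subseteq> (\<Union>x\<in>cball (c i) (r i). cball x d)"
    proof
      fix z assume z: "z \<in> cball (c i) (r i + d)"
      show "z \<in> (\<Union>x\<in>cball (c i) (r i). cball x d)"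
      proof (cases "norm (z - c i) \<le> r i")
        case True then show ?thesis using d by (intro UN_I[of z]) (auto simp: dist_norm norm_minus_commute)
      next
        case False
        define x where "x = c i + of_real (r i / norm (z - c i)) * (z - c i)"
        have nz: "norm (z - c i) > 0" using False r[OF i] by linarith
        have "norm (x - c i) = r i" using nz r[OF i] by (simp add: x_def norm_mult norm_divide)
        moreover have "z - x = of_real (1 - r i / norm (z - c i)) * (z - c i)"
          by (simp add: x_def algebra_simps)
        then have "norm (z - x) = \<bar>1 - r i / norm (z - c i)\<bar> * norm (z - c i)"
          by (metis norm_mult norm_of_real)
        then have "norm (z - x) = norm (z - c i) - r i"
          using nz False by (simp add: abs_if left_diff_distrib)
        ultimately show ?thesis using z by (intro UN_I[of x]) (auto simp: dist_norm norm_minus_commute)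
      qed
    qed
    then have "cball (c i) (r i + d) \<inter> K \<subseteq> cball (c i) (r i)" using d(2) unfolding K_def T_def by fastforce
    then show ?thesis using K r[OF i] d(1) by (intro poly_approx_on_disc_indicator[of K "r i" "r i + d"]) auto
  qed
  have "poly_approx_on K (\<lambda>z. \<Sum>i\<in>I. (if z \<in> cball (c i) (r i) then 1 else 0) * poly (P i) z)"
    (is "poly_approx_on K ?g")
    by (intro poly_approx_on_sum poly_approx_on_mult ind K poly_approx_on_poly I)
  from poly_approx_onD[OF this, of "e/2"] e
  obtain p where p: "\<And>z. z \<in> K \<Longrightarrow> norm (?g z - poly p z) < e/2" by auto
  show thesis
  proof (rule that)
    fix i z assume i: "i \<in> I" and z: "z \<in> cball (c i) (r i)"
    have "(\<Sum>j\<in>I. (if z \<in> cball (c j) (r j) then 1 else 0) * poly (P j) z) = (\<Sum>j\<in>I. if j = i then poly (P i) z else 0)"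
    proof (intro sum.cong refl)
      fix j assume "j \<in> I"
      then have "z \<notin> cball (c j) (r j)" if "j \<noteq> i"
        using disjoint_family_onD[OF I(2) _ i that] z by blast
      then show "(if z \<in> cball (c j) (r j) then 1 else 0) * poly (P j) z = (if j = i then poly (P i) z else 0)"
        using z by auto
    qed
    also have "\<dots> = poly (P i) z" using I(1) i by simp
    finally have "norm (poly (P i) z - poly p z) < e/2" using p[of z] i z by (auto simp: K_def)
    then show "norm (poly p z - f i z) < e"
      using P[OF i z] norm_triangle_ineq[of "f i z - poly (P i) z" "poly (P i) z - poly p z"]
      by (simp add: norm_minus_commute)
  qed
qed

section \<open>Stability of iterates and Newton iteration\<close>

lemma continuous_on_funpow:
  assumes "continuous_on K M" and "\<And>j. j < n \<Longrightarrow> (M ^^ j) ` C \<subseteq> K"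
  shows "continuous_on C (M ^^ n)"
  using assms(2)
proof (induction n)
  case 0
  then show ?case by (simp add: continuous_on_id)
next
  case (Suc n)
  have "continuous_on ((M ^^ n) ` C) M"
    using assms(1) Suc.prems[of n] continuous_on_subset by blast
  with Suc have "continuous_on C (M \<circ> (M ^^ n))" by (intro continuous_on_compose) auto
  then show ?case by simp
qed

text \<open>Induction over the iterates with uniform continuity of M. The tolerance d serves all
  maps g and all starting points v at once, so it can be fixed before later stages change the map
  and the curve. Orbits in the interior of K leave room for the perturbed orbit to stay in
  K.\<close>

lemma iterate_stable:
  fixes M :: "complex \<Rightarrow> complex"
  assumes K: "compact K" "continuous_on K M" and C: "compact C"
    and orb: "\<And>j. j < n \<Longrightarrow> (M ^^ j) ` C \<subseteq> interior K" and e: "e > 0"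
  shows "\<exists>d>0. \<forall>g. (\<forall>z\<in>K. dist (g z) (M z) \<le> d) \<longrightarrow>
           (\<forall>z\<in>C. \<forall>v. dist v z \<le> d \<longrightarrow> (\<forall>j\<le>n. dist ((g ^^ j) v) ((M ^^ j) z) < e))"
  using orb e
proof (induction n arbitrary: e)
  case 0
  then show ?case by (intro exI[of _ "e/2"]) (auto intro: le_less_trans[of _ "e/2"])
next
  case (Suc n)
  have "continuous_on C (M ^^ n)"
    using Suc.prems(1) interior_subset[of K]
    by (intro continuous_on_funpow[OF K(2)]) (meson less_SucI order_trans)
  then have "compact ((M ^^ n) ` C)" using C by (rule compact_continuous_image)
  have sub: "(M ^^ n) ` C \<subseteq> interior K" using Suc.prems(1)[of n] by simp
  obtain \<delta> where \<delta>: "\<delta> > 0" "(\<Union>x\<in>(M ^^ n) ` C. cball x \<delta>) \<subseteq> interior K"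
    using compact_subset_open_imp_cball_epsilon_subset[OF \<open>compact ((M ^^ n) ` C)\<close> open_interior sub] by auto
  obtain \<eta> where \<eta>: "\<eta> > 0" "\<And>x y. x \<in> K \<Longrightarrow> y \<in> K \<Longrightarrow> dist y x < \<eta> \<Longrightarrow> dist (M y) (M x) < e/2"
    using compact_uniformly_continuous[OF K(2,1)] Suc.prems(2) unfolding uniformly_continuous_on_def
    by (metis half_gt_zero)
  obtain d where d: "d > 0" "\<And>g. (\<forall>z\<in>K. dist (g z) (M z) \<le> d) \<Longrightarrow>
      (\<forall>z\<in>C. \<forall>v. dist v z \<le> d \<longrightarrow> (\<forall>j\<le>n. dist ((g ^^ j) v) ((M ^^ j) z) < min e (min \<delta> \<eta>)))"
    using Suc.IH[of "min e (min \<delta> \<eta>)"] Suc.prems \<delta> \<eta> by (auto simp: less_Suc_eq)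
  show ?case
  proof (intro exI[of _ "min d (e/2)"] conjI allI impI ballI)
    show "min d (e/2) > 0" using d Suc.prems by auto
    fix g z v j assume g: "\<forall>z\<in>K. dist (g z) (M z) \<le> min d (e/2)" and z: "z \<in> C"
      and v: "dist v z \<le> min d (e/2)" and j: "j \<le> Suc n"
    have IH: "\<forall>j\<le>n. dist ((g ^^ j) v) ((M ^^ j) z) < min e (min \<delta> \<eta>)"
      using d(2)[of g] g z v by auto
    show "dist ((g ^^ j) v) ((M ^^ j) z) < e"
    proof (cases "j \<le> n")
      case True then show ?thesis using IH by auto
    next
      case False
      then have j: "j = Suc n" using j by simp
      have nn: "dist ((g ^^ n) v) ((M ^^ n) z) < min e (min \<delta> \<eta>)" using IH by auto
      have Mz: "(M ^^ n) z \<in> K" using sub z interior_subset by blast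
      have "(g ^^ n) v \<in> (\<Union>x\<in>(M ^^ n) ` C. cball x \<delta>)"
        using z nn by (auto intro!: bexI[of _ z] simp: dist_commute)
      then have gv: "(g ^^ n) v \<in> K" using \<delta>(2) interior_subset by blast
      have "dist (M ((g ^^ n) v)) (M ((M ^^ n) z)) < e/2"
        using \<eta>(2)[OF Mz gv] nn by simp
      moreover have "dist (g ((g ^^ n) v)) (M ((g ^^ n) v)) \<le> e/2" using g gv by auto
      ultimately show ?thesis unfolding j
        using dist_triangle[of "g ((g ^^ n) v)" "M ((M ^^ n) z)" "M ((g ^^ n) v)"] by simp
    qed
  qed
qed

text \<open>For each z the map w - (Q w - B z)/B'(z), with the derivative frozen at z, is a
  contraction of \<open>cball z \<kappa>\<close>; its fixed point is \<sigma> z. Being a locally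
  uniform limit of iterates that are holomorphic in z, \<sigma> is holomorphic. Uniqueness within
  \<kappa> is kept because it later identifies \<sigma> as a left inverse of Q.\<close>

lemma holomorphic_newton_near:
  fixes B :: "complex \<Rightarrow> complex"
  assumes B: "B holomorphic_on \<Omega>" "open \<Omega>" and S: "compact S" "S \<subseteq> \<Omega>"
    and nz: "\<And>z. z \<in> S \<Longrightarrow> deriv B z \<noteq> 0" and \<eta>: "\<eta> > 0"
  shows "\<exists>\<epsilon>>0. \<exists>\<kappa>>0. \<kappa> \<le> \<eta> \<and> (\<forall>Q. Q holomorphic_on \<Omega> \<and> (\<forall>z\<in>\<Omega>. norm (Q z - B z) \<le> \<epsilon>) \<longrightarrow>
     (\<exists>\<sigma>. \<sigma> holomorphic_on interior S \<and>
        (\<forall>z\<in>S. norm (\<sigma> z - z) \<le> \<kappa> \<and> \<sigma> z \<in> \<Omega> \<and> Q (\<sigma> z) = B z \<and>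
           (\<forall>w. norm (w - z) \<le> \<kappa> \<and> Q w = B z \<longrightarrow> w = \<sigma> z))))"
proof (cases "S = {}")
  case True
  then show ?thesis using \<eta> by (intro exI[of _ 1] conjI exI[of _ \<eta>]) (auto intro!: exI[of _ "\<lambda>z. z"])
next
  case False
  obtain \<delta>0 where \<delta>0: "\<delta>0 > 0" "(\<Union>x\<in>S. cball x \<delta>0) \<subseteq> \<Omega>"
    using compact_subset_open_imp_cball_epsilon_subset[OF S(1) B(2) S(2)] by auto
  \<comment> \<open>Half of the available room: a Cauchy disc of radius \<delta> around a point near
    S must still lie in \<Omega>.\<close>
  define \<delta> where "\<delta> = \<delta>0/2"
  have \<delta>: "\<delta> > 0" using \<delta>0 by (simp add: \<delta>_def)
  have in\<Omega>: "y \<in> \<Omega>" if "z \<in> S" "norm (y - z) \<le> 2 * \<delta>" for y z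
    using that \<delta>0(2) by (auto simp: \<delta>_def dist_norm norm_minus_commute subset_iff)
  define K where "K = {x + y |x y. x \<in> S \<and> y \<in> cball 0 \<delta>}"
  have "compact K" unfolding K_def by (intro compact_sums S) auto
  have KI: "y \<in> K" if "z \<in> S" "norm (y - z) \<le> \<delta>" for y z
    proof -
    have "y = z + (y - z) \<and> z \<in> S \<and> y - z \<in> cball 0 \<delta>" using that by simp
    then show ?thesis unfolding K_def by blast
  qed
  have "K \<subseteq> \<Omega>" unfolding K_def using in\<Omega> \<delta> by fastforce
  have cd: "continuous_on \<Omega> (deriv B)" using B by (intro holomorphic_on_imp_continuous_on holomorphic_deriv)
  have "compact (deriv B ` S)"
    using continuous_on_subset[OF cd S(2)] S(1) by (rule compact_continuous_image)
  define m where "m = infdist 0 (deriv B ` S)"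
  have m: "m > 0"
    unfolding m_def using False nz \<open>compact (deriv B ` S)\<close>
    by (intro infdist_pos_not_in_closed) (auto simp: compact_imp_closed dest: nz)
  have mle: "m \<le> norm (deriv B z)" if "z \<in> S" for z
    using infdist_le[of "deriv B z" "deriv B ` S" 0] that by (auto simp: m_def)
  obtain \<kappa>1 where \<kappa>1: "\<kappa>1 > 0" "\<And>x y. x \<in> K \<Longrightarrow> y \<in> K \<Longrightarrow> dist y x < \<kappa>1 \<Longrightarrow> dist (deriv B y) (deriv B x) < m/4"
    using compact_uniformly_continuous[OF continuous_on_subset[OF cd \<open>K \<subseteq> \<Omega>\<close>] \<open>compact K\<close>] m
    unfolding uniformly_continuous_on_def by (metis divide_pos_pos zero_less_numeral)
  define \<kappa> where "\<kappa> = min (\<kappa>1/2) (min \<delta> \<eta>)"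
  have \<kappa>: "\<kappa> > 0" "\<kappa> < \<kappa>1" "\<kappa> \<le> \<delta>" "\<kappa> \<le> \<eta>" using \<kappa>1 \<delta> \<eta> by (auto simp: \<kappa>_def)
  \<comment> \<open>The first bound moves the centre by at most \<kappa>/2, the second keeps |Q' -
    B'| below m/4 by Cauchy's inequality. With the oscillation m/4 of B' this makes the contraction
    factor (m/2)/m = 1/2.\<close>
  define \<epsilon> where "\<epsilon> = min (\<kappa> * m / 2) (\<delta> * m / 4)"
  have \<epsilon>: "\<epsilon> > 0" "\<epsilon> \<le> \<kappa> * m / 2" "\<epsilon> \<le> \<delta> * m / 4" using \<kappa> m \<delta> by (auto simp: \<epsilon>_def)
  show ?thesis
  proof (rule exI[of _ \<epsilon>], intro conjI, rule \<epsilon>(1), rule exI[of _ \<kappa>], intro conjI allI impI)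
    fix Q assume "Q holomorphic_on \<Omega> \<and> (\<forall>z\<in>\<Omega>. norm (Q z - B z) \<le> \<epsilon>)"
    then have Q: "Q holomorphic_on \<Omega>" "\<And>z. z \<in> \<Omega> \<Longrightarrow> norm (Q z - B z) \<le> \<epsilon>" by auto
    have dQ: "norm (deriv Q w - deriv B z) \<le> m/2" if z: "z \<in> S" and w: "norm (w - z) \<le> \<kappa>" for z w
    proof -
      have sub: "cball w \<delta> \<subseteq> \<Omega>"
      proof
        fix y assume "y \<in> cball w \<delta>"
        then show "y \<in> \<Omega>" using in\<Omega>[OF z, of y] w \<kappa> norm_triangle_ineq[of "y - w" "w - z"]
          by (auto simp: dist_norm norm_minus_commute)
      qed
      have h: "(\<lambda>z. Q z - B z) holomorphic_on ball w \<delta>" "continuous_on (cball w \<delta>) (\<lambda>z. Q z - B z)"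
        using Q(1) B(1) sub
        by (auto intro!: holomorphic_intros holomorphic_on_imp_continuous_on elim!: holomorphic_on_subset)
      have "norm ((deriv ^^ 1) (\<lambda>z. Q z - B z) w) \<le> fact 1 * \<epsilon> / \<delta> ^ 1"

      proof (rule Cauchy_inequality[OF h \<delta>])
        fix x assume "norm (w - x) = \<delta>"
        then have "x \<in> \<Omega>" using sub by (auto simp: dist_norm)
        then show "norm (Q x - B x) \<le> \<epsilon>" by (rule Q(2))
      qed
      moreover have "w \<in> \<Omega>" using sub \<delta> by auto
      then have "deriv (\<lambda>z. Q z - B z) w = deriv Q w - deriv B w"
        using Q(1) B holomorphic_on_imp_differentiable_at by (intro deriv_diff) auto
      moreover have "\<epsilon> / \<delta> \<le> m/4" using \<epsilon>(3) \<delta> by (simp add: pos_divide_le_eq mult.commute)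
      ultimately have "norm (deriv Q w - deriv B w) \<le> m/4" by (simp del: le_divide_eq_numeral1 divide_le_eq_numeral1)
      moreover have "dist (deriv B w) (deriv B z) < m/4"
        using z w \<kappa> \<delta> by (intro \<kappa>1(2) KI[of z]) (auto simp: dist_norm)
      ultimately show ?thesis
        using norm_triangle_ineq[of "deriv Q w - deriv B w" "deriv B w - deriv B z"] by (simp add: dist_norm)
    qed
    define T where "T z w = w - (Q w - B z) / deriv B z" for z w
    have lip: "dist (T z x) (T z y) \<le> 1/2 * dist x y" if z: "z \<in> S" and xy: "x \<in> cball z \<kappa>" "y \<in> cball z \<kappa>" for z x y
    proof -
      have "norm (T z x - T z y) \<le> 1/2 * norm (x - y)"
      proof (rule field_differentiable_bound[of "cball z \<kappa>" "T z" "\<lambda>w. 1 - deriv Q w / deriv B z"])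
        fix w assume w: "w \<in> cball z \<kappa>"
        then have "w \<in> \<Omega>" using in\<Omega>[OF z, of w] \<kappa> \<delta> by (auto simp: dist_norm norm_minus_commute)
        then have dQw: "(Q has_field_derivative deriv Q w) (at w)"
          using Q(1) B(2) holomorphic_derivI by blast
        have "(T z has_field_derivative 1 - (deriv Q w - 0) / deriv B z) (at w)"
          unfolding T_def by (intro DERIV_diff DERIV_cdivide DERIV_ident DERIV_const dQw)
        then show "(T z has_field_derivative 1 - deriv Q w / deriv B z) (at w within cball z \<kappa>)"
          by (simp add: has_field_derivative_at_within)
        have "1 - deriv Q w / deriv B z = - ((deriv Q w - deriv B z) / deriv B z)"
          using nz[OF z] by (simp add: field_simps)
        then have "norm (1 - deriv Q w / deriv B z) = norm (deriv Q w - deriv B z) / norm (deriv B z)"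
          by (simp add: norm_divide)
        also have "\<dots> \<le> (m/2) / m"
          using dQ[OF z, of w] w mle[OF z] m by (intro frac_le) (auto simp: dist_norm norm_minus_commute)
        finally show "norm (1 - deriv Q w / deriv B z) \<le> 1/2" using m by simp
      qed (use xy in auto)
      then show ?thesis by (simp add: dist_norm)
    qed
    have Tz: "dist (T z z) z \<le> \<kappa>/2" if z: "z \<in> S" for z
    proof -
      have "dist (T z z) z = norm (Q z - B z) / norm (deriv B z)" by (simp add: T_def dist_norm norm_divide)
      also have "\<dots> \<le> \<epsilon> / m" using Q(2)[of z] z S(2) mle[OF z] m \<epsilon>(1) by (intro frac_le) auto
      also have "\<dots> \<le> \<kappa>/2" using \<epsilon>(2) m by (simp add: field_simps)
      finally show ?thesis .
    qed
    have maps: "T z w \<in> cball z \<kappa>" if z: "z \<in> S" and w: "w \<in> cball z \<kappa>" for z w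
    proof -
      have "dist (T z w) z \<le> dist (T z w) (T z z) + dist (T z z) z" by (rule dist_triangle)
      also have "\<dots> \<le> 1/2 * dist w z + \<kappa>/2" using lip[OF z w, of z] Tz[OF z] \<kappa> by auto
      also have "\<dots> \<le> \<kappa>" using w by (auto simp: dist_commute)
      finally show ?thesis by (simp add: dist_commute)
    qed
    have fixp: "\<exists>!w\<in>cball z \<kappa>. T z w = w" if z: "z \<in> S" for z
      by (rule Banach_fix[where c="1/2"]) (use maps[OF z] lip[OF z] \<kappa> in \<open>auto simp: complete_eq_closed\<close>)
    have fix_iff: "T z w = w \<longleftrightarrow> Q w = B z" if "z \<in> S" for z w using nz[OF that] by (auto simp: T_def)
    define \<sigma> where "\<sigma> z = (THE w. w \<in> cball z \<kappa> \<and> T z w = w)" for z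
    have \<sigma>: "\<sigma> z \<in> cball z \<kappa>" "T z (\<sigma> z) = \<sigma> z" if "z \<in> S" for z
      using theI'[OF fixp[OF that]] unfolding \<sigma>_def by auto
    define s where "s k z = (T z ^^ k) z" for k z
    have s0: "s 0 z = z" and sS: "s (Suc k) z = T z (s k z)" for k z by (auto simp: s_def)
    have s_in: "s k z \<in> cball z \<kappa>" if "z \<in> S" for k z
      by (induction k) (use \<kappa> maps[OF that] in \<open>auto simp: s0 sS\<close>)
    have s_close: "dist (s k z) (\<sigma> z) \<le> (1/2)^k * \<kappa>" if z: "z \<in> S" for k z
    proof (induction k)
      case 0 then show ?case using \<sigma>[OF z] by (simp add: s0)
    next
      case (Suc k)
      have "dist (s (Suc k) z) (\<sigma> z) \<le> 1/2 * dist (s k z) (\<sigma> z)"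
        using lip[OF z s_in[OF z, of k] \<sigma>(1)[OF z]] \<sigma>(2)[OF z] by (simp add: sS)
      also have "\<dots> \<le> 1/2 * ((1/2)^k * \<kappa>)" using Suc by simp
      finally show ?case by simp
    qed
    have s_hol: "s k holomorphic_on interior S" for k
    proof (induction k)
      case 0 show ?case by (simp add: s0[abs_def] holomorphic_on_ident cong: holomorphic_cong)
    next
      case (Suc k)
      have sub: "s k ` interior S \<subseteq> \<Omega>"
      proof
        fix y assume "y \<in> s k ` interior S"
        then obtain z where z: "z \<in> S" "y = s k z" using interior_subset by blast
        then have "norm (y - z) \<le> 2 * \<delta>"
          using s_in[OF z(1), of k] \<kappa>(3) \<delta> by (simp add: dist_norm norm_minus_commute)
        then show "y \<in> \<Omega>" by (rule in\<Omega>[OF z(1)])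
      qed
      have "(\<lambda>z. Q (s k z)) holomorphic_on interior S"
        using holomorphic_on_compose_gen[OF Suc Q(1)] sub by (auto simp: o_def)
      moreover have "B holomorphic_on interior S" using B(1) S(2) interior_subset holomorphic_on_subset by blast
      moreover have "deriv B holomorphic_on interior S"
        using holomorphic_deriv[OF B] S(2) interior_subset holomorphic_on_subset by blast
      ultimately show ?case
        unfolding sS[abs_def] T_def
        using Suc nz interior_subset[of S] by (intro holomorphic_intros) (auto simp: subset_iff)
    qed
    have "\<sigma> holomorphic_on interior S"
    proof (rule holomorphic_uniform_sequence[OF open_interior s_hol])
      fix x assume x: "x \<in> interior S"
      then obtain d where d: "d > 0" "cball x d \<subseteq> interior S" using open_contains_cball open_interior by blast
      have "uniform_limit (cball x d) s \<sigma> sequentially"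
      proof (rule uniform_limitI)
        fix e :: real assume "e > 0"
        have "(\<lambda>k. (1/2)^k * \<kappa>) \<longlonglongrightarrow> 0 * \<kappa>" by (intro tendsto_intros LIMSEQ_power_zero) auto
        then have "\<forall>\<^sub>F k in sequentially. (1/2)^k * \<kappa> < e" using \<open>e > 0\<close> by (auto dest: order_tendstoD)
        then show "\<forall>\<^sub>F k in sequentially. \<forall>z\<in>cball x d. dist (s k z) (\<sigma> z) < e"
        proof eventually_elim
          case (elim k)
          show ?case
          proof
            fix z assume "z \<in> cball x d"
            then have "z \<in> S" using d(2) interior_subset by blast
            then show "dist (s k z) (\<sigma> z) < e" using s_close[of z k] elim by linarith
          qed
        qed
      qed
      then show "\<exists>d>0. cball x d \<subseteq> interior S \<and> uniform_limit (cball x d) s \<sigma> sequentially" using d by blast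
    qed
    moreover have "norm (\<sigma> z - z) \<le> \<kappa> \<and> \<sigma> z \<in> \<Omega> \<and> Q (\<sigma> z) = B z \<and>
           (\<forall>w. norm (w - z) \<le> \<kappa> \<and> Q w = B z \<longrightarrow> w = \<sigma> z)" if z: "z \<in> S" for z
    proof -
      have *: "norm (\<sigma> z - z) \<le> \<kappa>" using \<sigma>(1)[OF z] by (simp add: dist_norm norm_minus_commute)
      then have "\<sigma> z \<in> \<Omega>" using in\<Omega>[OF z, of "\<sigma> z"] \<kappa> \<delta> by simp
      moreover have "w = \<sigma> z" if "norm (w - z) \<le> \<kappa>" "Q w = B z" for w
      proof -
        have "w \<in> cball z \<kappa> \<and> T z w = w" using that fix_iff[OF z] by (simp add: dist_norm norm_minus_commute)
        then show ?thesis using fixp[OF z] \<sigma>[OF z] by blast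
      qed
      ultimately show ?thesis using * \<sigma>(2)[OF z] fix_iff[OF z] by blast
    qed
    ultimately show "\<exists>\<sigma>. \<sigma> holomorphic_on interior S \<and>
        (\<forall>z\<in>S. norm (\<sigma> z - z) \<le> \<kappa> \<and> \<sigma> z \<in> \<Omega> \<and> Q (\<sigma> z) = B z \<and>
           (\<forall>w. norm (w - z) \<le> \<kappa> \<and> Q w = B z \<longrightarrow> w = \<sigma> z))" by blast
  qed (use \<epsilon> \<kappa> in auto)
qed

section \<open>Hyperbolic distance in simply connected domains\<close>

lemma artanh_mono_real: "-1 < x \<Longrightarrow> x \<le> y \<Longrightarrow> y < (1::real) \<Longrightarrow> artanh x \<le> artanh y"
  unfolding artanh_def by (auto simp: frac_le)

lemma artanh_strict_mono_real: "-1 < x \<Longrightarrow> x < y \<Longrightarrow> y < (1::real) \<Longrightarrow> artanh x < artanh y"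
  unfolding artanh_def by (auto simp: frac_less)

lemma artanh_inj_real: "-1 < x \<Longrightarrow> x < 1 \<Longrightarrow> -1 < y \<Longrightarrow> y < (1::real) \<Longrightarrow> artanh x = artanh y \<Longrightarrow> x = y"
  by (metis artanh_strict_mono_real less_irrefl linorder_neqE_linordered_idom)

lemma disc_hyp_dist_Moebius: "disc_hyp_dist a b = 2 * artanh (norm (Moebius_function 0 a b))"
  by (simp add: disc_hyp_dist_def Moebius_function_simple norm_divide norm_minus_commute)

lemma Moebius_function_norm_lt_1':
  assumes "a \<in> ball 0 1" "b \<in> ball 0 1"
  shows "norm (Moebius_function 0 a b) < 1"
  using Moebius_function_norm_lt_1 assms by simp

lemma Moebius_function_eq_0_iff:
  assumes "a \<in> ball 0 1" "b \<in> ball 0 1"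
  shows "Moebius_function 0 a b = 0 \<longleftrightarrow> b = a"
proof -
  have "norm (cnj a * b) < 1"
    using assms mult_strict_mono'[of "norm a" 1 "norm b" 1] by (simp add: norm_mult)
  then have "1 - cnj a * b \<noteq> 0" by (metis norm_one less_irrefl right_minus_eq)
  then show ?thesis by (simp add: Moebius_function_simple)
qed

text \<open>Automorphisms of the disc move a and g a to 0, where the Schwarz lemma applies. Equality
  at a single pair of distinct points makes the conjugated map a rotation, hence g
  injective.\<close>

lemma Schwarz_Pick:
  assumes g: "g holomorphic_on ball 0 1" "g ` ball 0 1 \<subseteq> ball 0 1"
    and ab: "a \<in> ball 0 1" "b \<in> ball 0 1"
  shows "norm (Moebius_function 0 (g a) (g b)) \<le> norm (Moebius_function 0 a b)"
    and "norm (Moebius_function 0 (g a) (g b)) = norm (Moebius_function 0 a b) \<Longrightarrow> a \<noteq> b \<Longrightarrow> inj_on g (ball 0 1)"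
proof -
  define M where "M = Moebius_function 0 (g a)"
  define L where "L = Moebius_function 0 (-a)"
  define h where "h = (\<lambda>z. M (g (L z)))"
  have ga: "g a \<in> ball 0 1" "g b \<in> ball 0 1" using g(2) ab by blast+
  have M: "M holomorphic_on ball 0 1" "M ` ball 0 1 \<subseteq> ball 0 1"
    using Moebius_function_holomorphic Moebius_function_norm_lt_1 ga by (auto simp: M_def)
  have L: "L holomorphic_on ball 0 1" "L ` ball 0 1 \<subseteq> ball 0 1"
    using Moebius_function_holomorphic Moebius_function_norm_lt_1 ab by (auto simp: L_def)
  have "(M \<circ> g \<circ> L) holomorphic_on ball 0 1"
    using M L g by (intro holomorphic_on_compose_gen[of _ _ _ "ball 0 1"] holomorphic_on_compose_gen[of g _ _ "ball 0 1"]) auto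
  then have h: "h holomorphic_on ball 0 1" by (simp add: h_def o_def)
  have h1: "norm (h z) < 1" if "norm z < 1" for z
    using that L(2) g(2) M(2) unfolding h_def by (simp add: image_subset_iff)
  have h0: "h 0 = 0" by (simp add: h_def L_def M_def Moebius_function_of_zero Moebius_function_eq_zero)
  have LM: "L (Moebius_function 0 a z) = z" if "z \<in> ball 0 1" for z
    unfolding L_def using ab that by (intro Moebius_function_compose) auto
  have hM: "h (Moebius_function 0 a b) = M (g b)" unfolding h_def using LM ab by simp
  have n1: "norm (Moebius_function 0 a b) < 1" using Moebius_function_norm_lt_1' ab by simp
  show "norm (Moebius_function 0 (g a) (g b)) \<le> norm (Moebius_function 0 a b)"
    using Schwarz_Lemma(1)[OF h h0 h1 n1] hM by (simp add: M_def)
  assume eq: "norm (Moebius_function 0 (g a) (g b)) = norm (Moebius_function 0 a b)" and "a \<noteq> b"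
  then have "\<exists>z. norm z < 1 \<and> z \<noteq> 0 \<and> norm (h z) = norm z"
    using hM n1 Moebius_function_eq_0_iff[OF ab] by (auto simp: M_def intro!: exI[of _ "Moebius_function 0 a b"])
  then obtain \<alpha> where \<alpha>: "\<And>z. norm z < 1 \<Longrightarrow> h z = \<alpha> * z" "norm \<alpha> = 1"
    using Schwarz_Lemma(3)[OF h h0 h1 n1] by auto
  show "inj_on g (ball 0 1)"
  proof (rule inj_onI)
    fix x y assume xy: "x \<in> ball 0 1" "y \<in> ball 0 1" "g x = g y"
    let ?A = "Moebius_function 0 a"
    have "h (?A x) = h (?A y)" unfolding h_def using LM xy by simp
    moreover have "norm (?A x) < 1" "norm (?A y) < 1" using Moebius_function_norm_lt_1' ab xy by auto
    ultimately have "?A x = ?A y" using \<alpha> by auto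
    then show "x = y" using LM xy by metis
  qed
qed

section \<open>Hyperbolic distance through Riemann maps\<close>

definition biholomorphic_pair :: "complex set \<Rightarrow> (complex \<Rightarrow> complex) \<Rightarrow> (complex \<Rightarrow> complex) \<Rightarrow> bool" where
  "biholomorphic_pair V h g \<longleftrightarrow> h holomorphic_on V \<and> g holomorphic_on ball 0 1 \<and>
     (\<forall>z\<in>V. h z \<in> ball 0 1 \<and> g (h z) = z) \<and> (\<forall>z\<in>ball 0 1. g z \<in> V \<and> h (g z) = z)"

lemma biholomorphic_pairD:
  assumes "biholomorphic_pair V h g"
  shows "h holomorphic_on V" "g holomorphic_on ball 0 1" "z \<in> V \<Longrightarrow> h z \<in> ball 0 1"
    "z \<in> V \<Longrightarrow> g (h z) = z" "w \<in> ball 0 1 \<Longrightarrow> g w \<in> V" "w \<in> ball 0 1 \<Longrightarrow> h (g w) = w"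
  using assms unfolding biholomorphic_pair_def by auto

lemma biholomorphic_pair_exists:
  assumes "open V" "simply_connected V" "V \<noteq> {}" "V \<noteq> UNIV"
  obtains h g where "biholomorphic_pair V h g"
  using assms simply_connected_eq_biholomorphic_to_disc[OF assms(1)]
  unfolding biholomorphic_pair_def by auto

lemma biholomorphic_pair_ball: "biholomorphic_pair (ball 0 1) (\<lambda>z. z) (\<lambda>z. z)"
  by (simp add: biholomorphic_pair_def)

lemma biholomorphic_pair_inj:
  assumes "inj_on g (ball 0 1)" "g holomorphic_on ball 0 1"
  obtains h where "biholomorphic_pair (g ` ball 0 1) h g"
proof -
  obtain h where "h holomorphic_on g ` ball 0 1" "\<And>z. z \<in> ball 0 1 \<Longrightarrow> h (g z) = z"
    using holomorphic_has_inverse[OF assms(2) open_ball assms(1)] by metis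
  then show ?thesis by (intro that[of h]) (auto simp: biholomorphic_pair_def assms)
qed

text \<open>A holomorphic covering of a simply connected domain by the disc is itself a Riemann map,
  so it differs from g by an automorphism of the disc, an isometry. The set under the infimum is
  therefore a singleton.\<close>

lemma hyp_dist_eq:
  assumes bi: "biholomorphic_pair V h g" and zw: "z \<in> V" "w \<in> V"
  shows "hyp_dist V z w = disc_hyp_dist (h z) (h w)"
proof -
  note B = biholomorphic_pairD[OF bi]
  have homeo: "homeomorphism (ball 0 1) V g h"
    using B by (intro homeomorphismI) (auto intro: holomorphic_on_imp_continuous_on)
  have "disc_hyp_dist a b = disc_hyp_dist (h z) (h w)"
    if p: "p holomorphic_on ball 0 1" "covering_space (ball 0 1) p V"
      and ab: "a \<in> ball 0 1" "b \<in> ball 0 1" "p a = z" "p b = w" for p a b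
  proof -
    have pV: "p ` ball 0 1 = V" using p(2) covering_space_imp_surjective by blast
    define k where "k = (\<lambda>x. h (p x))"
    have k: "k holomorphic_on ball 0 1"
      unfolding k_def using holomorphic_on_compose_gen[OF p(1) B(1)] pV by (auto simp: o_def)
    have kb: "k x \<in> ball 0 1" if "x \<in> ball 0 1" for x unfolding k_def using that pV B by blast
    \<comment> \<open>G lifts the Riemann map g through the covering p, normalized to hit a.\<close>
    obtain G where G: "continuous_on (ball 0 1) G" "G \<in> ball 0 1 \<rightarrow> ball 0 1" "G (k a) = a"
        "\<And>y. y \<in> ball 0 1 \<Longrightarrow> p (G y) = g y"
    proof (rule covering_space_lift_strong[OF p(2) ab(1) kb[OF ab(1)], where f=g])
      show "simply_connected (ball 0 (1::real) :: complex set)"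
        by (simp add: convex_imp_simply_connected)
      show "locally path_connected (ball 0 (1::real) :: complex set)"
        by (simp add: convex_imp_locally_path_connected)
      show "continuous_on (ball 0 1) g" using B by (intro holomorphic_on_imp_continuous_on)
      show "g \<in> ball 0 1 \<rightarrow> V" using B by auto
      show "g (k a) = p a" unfolding k_def using B ab pV by auto
    qed auto
    \<comment> \<open>Both sides are lifts of p through p itself and agree at a.\<close>
    have Gk: "G (k x) = x" if x: "x \<in> ball 0 1" for x
    proof (rule covering_space_lift_unique[OF p(2), of "\<lambda>x. G (k x)" a "\<lambda>x. x" "ball 0 1" p])
      show "continuous_on (ball 0 1) p" using p by (intro holomorphic_on_imp_continuous_on)
      show "continuous_on (ball 0 1) (\<lambda>x. G (k x))"
        using kb k by (intro continuous_on_compose2[OF G(1)] holomorphic_on_imp_continuous_on) auto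
      show "p x = p (G (k x))" if "x \<in> ball 0 1" for x
        using G(4)[OF kb[OF that]] B(4) pV that by (auto simp: k_def)
    qed (use G ab x pV kb in \<open>auto simp: continuous_on_id\<close>)
    have "inj_on k (ball 0 1)" by (metis Gk inj_onI)
    then obtain q where q: "q holomorphic_on k ` ball 0 1" "\<And>x. x \<in> ball 0 1 \<Longrightarrow> q (k x) = x"
      using holomorphic_has_inverse[OF k open_ball] by metis
    have "k ` ball 0 1 = ball 0 1"
    proof
      show "ball 0 1 \<subseteq> k ` ball 0 1"
      proof
        fix y :: complex assume y: "y \<in> ball 0 1"
        then have "g y \<in> p ` ball 0 1" using B pV by auto
        then obtain x where "x \<in> ball 0 1" "p x = g y" by force
        then show "y \<in> k ` ball 0 1" using B y by (auto simp: k_def intro!: image_eqI[of _ _ x])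
      qed
    qed (use kb in auto)
    then have q1: "q holomorphic_on ball 0 1" using q(1) by simp
    have q2: "q ` ball 0 1 \<subseteq> ball 0 1"
    proof
      fix y assume "y \<in> q ` ball 0 1"
      then have "y \<in> q ` k ` ball 0 1" using \<open>k ` ball 0 1 = ball 0 1\<close> by simp
      then obtain x where "x \<in> ball 0 1" "y = q (k x)" by (auto simp del: mem_ball)
      then show "y \<in> ball 0 1" using q(2) by simp
    qed
    \<comment> \<open>Schwarz-Pick for k and for its inverse q gives the two inequalities of the
      isometry.\<close>
    have "norm (Moebius_function 0 (k a) (k b)) \<le> norm (Moebius_function 0 a b)"
      by (rule Schwarz_Pick(1)[OF k image_subsetI[OF kb] ab(1,2)])
    moreover have "norm (Moebius_function 0 (q (k a)) (q (k b))) \<le> norm (Moebius_function 0 (k a) (k b))"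
      by (rule Schwarz_Pick(1)[OF q1 q2 kb kb]) (fact ab)+
    ultimately have "norm (Moebius_function 0 (k a) (k b)) = norm (Moebius_function 0 a b)"
      using q(2)[OF ab(1)] q(2)[OF ab(2)] by simp
    then show ?thesis using ab(3,4) by (simp add: disc_hyp_dist_Moebius k_def)
  qed
  moreover have "g holomorphic_on ball 0 1 \<and> covering_space (ball 0 1) g V \<and> h z \<in> ball 0 1 \<and> h w \<in> ball 0 1 \<and> g (h z) = z \<and> g (h w) = w"
    using B zw homeomorphism_imp_covering_space[OF homeo] by auto
  ultimately have "{disc_hyp_dist a b | p a b.
            p holomorphic_on ball 0 1 \<and> covering_space (ball 0 1) p V \<and>
            a \<in> ball 0 1 \<and> b \<in> ball 0 1 \<and> p a = z \<and> p b = w} = {disc_hyp_dist (h z) (h w)}"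
    by blast
  then show ?thesis by (simp add: hyp_dist_def)
qed

lemma hyp_dist_ball: "z \<in> ball 0 1 \<Longrightarrow> w \<in> ball 0 1 \<Longrightarrow> hyp_dist (ball 0 1) z w = disc_hyp_dist z w"
  using hyp_dist_eq[OF biholomorphic_pair_ball] .

definition hyperbolic_simply_connected :: "complex set \<Rightarrow> bool" where
  "hyperbolic_simply_connected V \<longleftrightarrow> open V \<and> simply_connected V \<and> V \<noteq> {} \<and> V \<noteq> UNIV"

lemma hyperbolic_simply_connected_ball: "hyperbolic_simply_connected (ball 0 1)"
proof -
  have "ball 0 1 \<noteq> (UNIV :: complex set)"
    by (metis UNIV_I bounded_ball not_bounded_UNIV)
  then show ?thesis by (simp add: hyperbolic_simply_connected_def convex_imp_simply_connected)
qed

text \<open>Riemann maps transport the Schwarz-Pick lemma. The second part is used in the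
  contrapositive: a map that is not injective strictly decreases the distance of every pair of
  distinct points.\<close>

lemma
  assumes V: "hyperbolic_simply_connected V" and W: "hyperbolic_simply_connected W"
    and \<phi>: "\<phi> holomorphic_on V" "\<phi> ` V \<subseteq> W" and xy: "x \<in> V" "y \<in> V"
  shows hyp_dist_contract: "hyp_dist W (\<phi> x) (\<phi> y) \<le> hyp_dist V x y"
    and hyp_dist_eq_imp_inj: "hyp_dist W (\<phi> x) (\<phi> y) = hyp_dist V x y \<Longrightarrow> x \<noteq> y \<Longrightarrow> inj_on \<phi> V"
proof -
  obtain h g where hg: "biholomorphic_pair V h g"
    using biholomorphic_pair_exists V unfolding hyperbolic_simply_connected_def by metis
  obtain h' g' where hg': "biholomorphic_pair W h' g'"
    using biholomorphic_pair_exists W unfolding hyperbolic_simply_connected_def by metis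
  note B = biholomorphic_pairD[OF hg] and B' = biholomorphic_pairD[OF hg']
  define k where "k = h' \<circ> \<phi> \<circ> g"
  have k: "k holomorphic_on ball 0 1"
    unfolding k_def using B B' \<phi>
    by (intro holomorphic_on_compose_gen[of _ _ _ W] holomorphic_on_compose_gen[of _ _ _ V]) auto
  have kb: "k ` ball 0 1 \<subseteq> ball 0 1" unfolding k_def using B B' \<phi> by (auto simp: image_subset_iff simp del: mem_ball)
  have \<phi>xy: "\<phi> x \<in> W" "\<phi> y \<in> W" using \<phi> xy by auto
  have hxy: "h x \<in> ball 0 1" "h y \<in> ball 0 1" using B xy by auto
  have kh: "k (h z) = h' (\<phi> z)" if "z \<in> V" for z using B that by (simp add: k_def)
  have le1: "norm (Moebius_function 0 (h x) (h y)) < 1" "norm (Moebius_function 0 (h' (\<phi> x)) (h' (\<phi> y))) < 1"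
    using Moebius_function_norm_lt_1' hxy B'(3) \<phi>xy by auto
  have d: "hyp_dist V x y = 2 * artanh (norm (Moebius_function 0 (h x) (h y)))"
      "hyp_dist W (\<phi> x) (\<phi> y) = 2 * artanh (norm (Moebius_function 0 (h' (\<phi> x)) (h' (\<phi> y))))"
    using hyp_dist_eq[OF hg xy] hyp_dist_eq[OF hg' \<phi>xy] by (auto simp: disc_hyp_dist_Moebius)
  show "hyp_dist W (\<phi> x) (\<phi> y) \<le> hyp_dist V x y"
    unfolding d using Schwarz_Pick(1)[OF k kb hxy] le1 xy kh
    by (auto intro!: artanh_mono_real simp: less_le_trans[OF _ norm_ge_zero])
  assume "hyp_dist W (\<phi> x) (\<phi> y) = hyp_dist V x y" "x \<noteq> y"
  then have "norm (Moebius_function 0 (h' (\<phi> x)) (h' (\<phi> y))) = norm (Moebius_function 0 (h x) (h y))"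
    using artanh_inj_real[OF _ le1(2) _ le1(1)] unfolding d by (simp add: less_le_trans[OF _ norm_ge_zero])
  moreover have "h x \<noteq> h y" using B(4) xy \<open>x \<noteq> y\<close> by metis
  ultimately have ik: "inj_on k (ball 0 1)" using Schwarz_Pick(2)[OF k kb hxy] kh xy by auto
  show "inj_on \<phi> V"
  proof (rule inj_onI)
    fix u v assume uv: "u \<in> V" "v \<in> V" "\<phi> u = \<phi> v"
    then have "k (h u) = k (h v)" using kh by simp
    then have "h u = h v" using inj_onD[OF ik] B(3) uv(1,2) by blast
    then show "u = v" using B(4) uv by metis
  qed
qed

text \<open>The denominator |1 - conj(a) b| is at most 2, which bounds the pseudohyperbolic distance
  from below by half the Euclidean one.\<close>

lemma disc_hyp_dist_lower:
  assumes "a \<in> ball 0 1" "b \<in> ball 0 1" "0 \<le> \<delta>" "\<delta> \<le> norm (a - b)"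
  shows "2 * artanh (\<delta>/2) \<le> disc_hyp_dist a b"
proof -
  have "norm (cnj a * b) < 1"
    using assms mult_strict_mono'[of "norm a" 1 "norm b" 1] by (simp add: norm_mult)
  then have n: "norm (1 - cnj a * b) \<le> 2" "norm (1 - cnj a * b) > 0"
    using norm_triangle_ineq4[of 1 "cnj a * b"] norm_triangle_ineq2[of 1 "cnj a * b"] by auto
  have "\<delta>/2 \<le> norm (a - b) / norm (1 - cnj a * b)" using assms n by (intro frac_le) auto
  also have "\<dots> = norm (Moebius_function 0 a b)" by (simp add: Moebius_function_simple norm_divide norm_minus_commute)
  finally show ?thesis unfolding disc_hyp_dist_Moebius
    using assms Moebius_function_norm_lt_1'[OF assms(1,2)] by (auto intro!: artanh_mono_real)
qed

lemma disc_hyp_dist_pos: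
  assumes "a \<in> ball 0 1" "b \<in> ball 0 1" "a \<noteq> b"
  shows "disc_hyp_dist a b > 0"
proof -
  have "0 < artanh (norm (Moebius_function 0 a b))"
    using artanh_strict_mono_real[of 0 "norm (Moebius_function 0 a b)"] Moebius_function_norm_lt_1'[OF assms(1,2)]
      Moebius_function_eq_0_iff[OF assms(1,2)] assms(3) by auto
  then show ?thesis by (simp add: disc_hyp_dist_Moebius)
qed

lemma tendsto_disc_hyp_dist_0:
  assumes "a \<longlonglongrightarrow> 0" "b \<longlonglongrightarrow> 0"
  shows "(\<lambda>n. disc_hyp_dist (a n) (b n)) \<longlonglongrightarrow> 0"
proof -
  have "(\<lambda>n. disc_hyp_dist (a n) (b n)) \<longlonglongrightarrow> 2 * artanh (norm ((0 - 0) / (1 - cnj 0 * (0::complex))))"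
    unfolding disc_hyp_dist_def using assms by (intro tendsto_intros) auto
  then show ?thesis by simp
qed

section \<open>Orbits with a prescribed itinerary\<close>

lemma holomorphic_on_funpow:
  assumes "f holomorphic_on UNIV"
  shows "(f ^^ n) holomorphic_on S"
proof -
  have "(f ^^ n) holomorphic_on UNIV"
  proof (induction n)
    case 0 then show ?case by (simp add: holomorphic_on_id)
  next
    case (Suc n)
    then have "f \<circ> (f ^^ n) holomorphic_on UNIV"
      using assms by (intro holomorphic_on_compose_gen[of _ _ _ UNIV]) auto
    then show ?case by (simp add: o_def)
  qed
  then show ?thesis by (rule holomorphic_on_subset) simp
qed

lemma continuous_on_entire_funpow: "f holomorphic_on UNIV \<Longrightarrow> continuous_on S (f ^^ n)"
  by (intro holomorphic_on_imp_continuous_on holomorphic_on_funpow)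

lemma nonconstant_entire_open_image:
  assumes f: "f holomorphic_on UNIV" "\<not> f constant_on UNIV" and "open U"
  shows "open ((f ^^ n) ` U)"
proof (induction n)
  case 0 then show ?case using assms by simp
next
  case (Suc n)
  have "open (f ` ((f ^^ n) ` U))"
    by (rule open_mapping_thm[OF f(1) open_UNIV connected_UNIV Suc subset_UNIV f(2)])
  then show ?case by (simp add: image_image)
qed

text \<open>
  The itinerary of a wandering domain: the \<open>n\<close>-th image lies in the disc with centre \<open>d n\<close> and
  radius \<open>e n\<close>, the spherical diameters of these discs tend to 0, and the points with bounded orbit
  are dense near the boundary, which keeps the boundary out of the Fatou set.
\<close>

definition wandering_itinerary ::
    "(complex \<Rightarrow> complex) \<Rightarrow> complex set \<Rightarrow> (nat \<Rightarrow> complex) \<Rightarrow> (nat \<Rightarrow> real) \<Rightarrow> bool" where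
  "wandering_itinerary f U d e \<longleftrightarrow>
     f holomorphic_on UNIV \<and> \<not> f constant_on UNIV \<and>
     open U \<and> connected U \<and> bounded U \<and> U \<noteq> {} \<and>
     (\<forall>n. \<forall>z\<in>U. (f ^^ n) z \<in> cball (d n) (e n)) \<and>
     (\<exists>E. \<forall>n. e n \<le> E) \<and>
     (\<forall>B. \<forall>\<epsilon>>0. finite {n. norm (d n) \<le> B \<and> e n \<ge> \<epsilon>}) \<and>
     (\<exists>k. filterlim (\<lambda>n. norm (d (k n))) at_top sequentially) \<and>
     (\<forall>\<zeta>\<in>frontier U. \<forall>r>0. \<exists>p\<in>ball \<zeta> r. bounded (range (\<lambda>n. (f ^^ n) p)))"

lemma wandering_itineraryD:
  assumes "wandering_itinerary f U d e"
  shows "f holomorphic_on UNIV" "\<not> f constant_on UNIV" "open U" "connected U" "bounded U" "U \<noteq> {}"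
    "\<And>n z. z \<in> U \<Longrightarrow> norm ((f ^^ n) z - d n) \<le> e n"
    "\<exists>E. \<forall>n. e n \<le> E"
    "\<And>B \<epsilon>. \<epsilon> > 0 \<Longrightarrow> finite {n. norm (d n) \<le> B \<and> e n \<ge> \<epsilon>}"
    "\<exists>k. filterlim (\<lambda>n. norm (d (k n))) at_top sequentially"
    "\<And>\<zeta> r. \<zeta> \<in> frontier U \<Longrightarrow> r > 0 \<Longrightarrow> \<exists>p\<in>ball \<zeta> r. bounded (range (\<lambda>n. (f ^^ n) p))"
  using assms unfolding wandering_itinerary_def by (auto simp: dist_norm norm_minus_commute)

text \<open>Makes every result about U available for all its images. A frontier point of the image
  comes from a frontier point of U, because closure U is compact and iterates are open; bounded
  orbits near the latter are carried along.\<close>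

lemma wandering_itinerary_shift:
  assumes W: "wandering_itinerary f U d e"
  shows "wandering_itinerary f ((f ^^ n) ` U) (\<lambda>m. d (m + n)) (\<lambda>m. e (m + n))"
proof -
  note D = wandering_itineraryD[OF W]
  obtain E where E: "\<And>n. e n \<le> E" using D(8) by auto
  obtain k where k: "filterlim (\<lambda>n. norm (d (k n))) at_top sequentially" using D(10) by auto
  have cont: "continuous_on S (f ^^ n)" for S using continuous_on_entire_funpow D(1) by blast
  \<comment> \<open>The finitely many centres below a given index are bounded, so an index sequence
    along which the centres are unbounded tends to infinity and is eventually at least n.\<close>
  have "filterlim k at_top sequentially"
    unfolding filterlim_at_top
  proof
    fix Z :: nat
    define B where "B = Max ((\<lambda>m. norm (d m)) ` {..Z}) + 1"
    have "\<forall>\<^sub>F i in sequentially. B \<le> norm (d (k i))" using k by (auto simp: filterlim_at_top)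
    then show "\<forall>\<^sub>F i in sequentially. Z \<le> k i"
    proof eventually_elim
      case (elim i)
      show ?case
      proof (rule ccontr)
        assume "\<not> Z \<le> k i"
        then have "norm (d (k i)) \<le> Max ((\<lambda>m. norm (d m)) ` {..Z})" by (intro Max_ge) auto
        then show False using elim by (simp add: B_def)
      qed
    qed
  qed
  then have kn: "\<forall>\<^sub>F i in sequentially. k i \<ge> n" by (auto simp: filterlim_at_top)
  have k': "filterlim (\<lambda>i. norm (d (k i - n + n))) at_top sequentially"
  proof (rule filterlim_cong[THEN iffD1, OF refl refl _ k])
    show "\<forall>\<^sub>F i in sequentially. norm (d (k i)) = norm (d (k i - n + n))"
      using kn by eventually_elim simp
  qed
  have fin: "finite {m. norm (d (m + n)) \<le> B \<and> e (m + n) \<ge> \<epsilon>}" if "\<epsilon> > 0" for B \<epsilon>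
  proof -
    have "(\<lambda>m. m + n) ` {m. norm (d (m + n)) \<le> B \<and> e (m + n) \<ge> \<epsilon>} \<subseteq> {m. norm (d m) \<le> B \<and> e m \<ge> \<epsilon>}" by auto
    then have "finite ((\<lambda>m. m + n) ` {m. norm (d (m + n)) \<le> B \<and> e (m + n) \<ge> \<epsilon>})"
      using D(9)[OF that] finite_subset by blast
    then show ?thesis by (rule finite_imageD) (auto simp: inj_on_def)
  qed
  have fr: "\<exists>p\<in>ball \<zeta> r. bounded (range (\<lambda>m. (f ^^ m) p))" if \<zeta>: "\<zeta> \<in> frontier ((f ^^ n) ` U)" and r: "r > 0" for \<zeta> r
  proof -
    have "compact ((f ^^ n) ` closure U)"
      using D(5) cont by (intro compact_continuous_image) (auto simp: compact_closure)
    then have "closure ((f ^^ n) ` U) \<subseteq> (f ^^ n) ` closure U"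
      by (intro closure_minimal image_mono closure_subset compact_imp_closed)
    moreover have "open ((f ^^ n) ` U)" using nonconstant_entire_open_image D by blast
    ultimately obtain z where z: "z \<in> closure U" "\<zeta> = (f ^^ n) z" "z \<notin> U"
      using \<zeta> by (auto simp: frontier_def interior_open)
    then have zf: "z \<in> frontier U" using D(3) by (simp add: frontier_def interior_open)
    obtain \<delta> where \<delta>: "\<delta> > 0" "\<And>x. dist x z < \<delta> \<Longrightarrow> dist ((f ^^ n) x) ((f ^^ n) z) < r"
      using cont[of UNIV] r unfolding continuous_on_iff by (metis UNIV_I)
    obtain p where p: "p \<in> ball z \<delta>" "bounded (range (\<lambda>m. (f ^^ m) p))" using D(11)[OF zf \<delta>(1)] by auto
    have "range (\<lambda>m. (f ^^ m) ((f ^^ n) p)) \<subseteq> range (\<lambda>m. (f ^^ m) p)"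
    proof safe
      fix m
      have "(f ^^ m) ((f ^^ n) p) = (f ^^ (m + n)) p" by (simp add: funpow_add)
      then show "(f ^^ m) ((f ^^ n) p) \<in> range (\<lambda>m. (f ^^ m) p)" by auto
    qed
    then have "bounded (range (\<lambda>m. (f ^^ m) ((f ^^ n) p)))" using p(2) bounded_subset by blast
    moreover have "(f ^^ n) p \<in> ball \<zeta> r" using \<delta>(2)[of p] p(1) z(2) by (simp add: dist_commute)
    ultimately show ?thesis by blast
  qed
  show ?thesis unfolding wandering_itinerary_def
  proof (intro conjI allI impI ballI)
    show "open ((f ^^ n) ` U)" using nonconstant_entire_open_image D by blast
    show "connected ((f ^^ n) ` U)" using D cont by (intro connected_continuous_image)
    have "bounded ((f ^^ n) ` closure U)"
      using D(5) cont by (intro compact_imp_bounded compact_continuous_image) (auto simp: compact_closure)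
    then show "bounded ((f ^^ n) ` U)" using bounded_subset closure_subset image_mono by metis
    fix m z assume "z \<in> (f ^^ n) ` U"
    then obtain u where "u \<in> U" "z = (f ^^ n) u" by auto
    then show "(f ^^ m) z \<in> cball (d (m + n)) (e (m + n))"
      using D(7)[of u "m+n"] by (simp add: funpow_add dist_norm norm_minus_commute)
  qed (use D E k' fin fr in auto)
qed

text \<open>Either one iterate occurs infinitely often, or the centres tend to infinity, or a
  subsequence of centres converges. In the last case the radii tend to 0 there, because only
  finitely many discs with bounded centres have radius at least \<epsilon>, and the limit is
  constant.\<close>

lemma itinerary_normal:
  assumes W: "wandering_itinerary f U d e"
  shows "normal_family_on U (range (\<lambda>n. f ^^ n))"
  unfolding normal_family_on_def
proof (intro allI impI)
  note D = wandering_itineraryD[OF W]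
  obtain E where E: "\<And>n. e n \<le> E" using D(8) by auto
  fix F :: "nat \<Rightarrow> complex \<Rightarrow> complex" assume "range F \<subseteq> range (\<lambda>n. f ^^ n)"
  then have "\<forall>i. \<exists>k. F i = f ^^ k" by auto
  then obtain k where k: "\<And>i. F i = f ^^ k i" by metis
  show "\<exists>r :: nat \<Rightarrow> nat. strict_mono r \<and>
           ((\<exists>g. \<forall>K. compact K \<and> K \<subseteq> U \<longrightarrow> uniform_limit K (\<lambda>n. F (r n)) g sequentially) \<or>
            (\<forall>K. compact K \<and> K \<subseteq> U \<longrightarrow> (\<forall>B. \<forall>\<^sub>F n in sequentially. \<forall>z\<in>K. B \<le> norm (F (r n) z))))"
  proof (cases "\<exists>m. infinite {i. k i = m}")
    case True
    then obtain m where m: "infinite {i. k i = m}" by auto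
    define r where "r = enumerate {i. k i = m}"
    have "strict_mono r" using m by (simp add: r_def strict_mono_enumerate)
    moreover have "F (r i) = f ^^ m" for i
      using enumerate_in_set[OF m, of i] by (simp add: r_def k)
    then have "uniform_limit K (\<lambda>n. F (r n)) (f ^^ m) sequentially" for K
      by (auto intro!: uniform_limitI)
    ultimately show ?thesis by blast
  next
    case False
    then have fink: "finite {i. k i \<in> S}" if "finite S" for S
    proof -
      have "{i. k i \<in> S} = (\<Union>m\<in>S. {i. k i = m})" by auto
      then show ?thesis using False that by auto
    qed
    show ?thesis
    proof (cases "\<forall>B. \<forall>\<^sub>F i in sequentially. B \<le> norm (d (k i))")
      case True
      show ?thesis
      proof (intro exI[of _ "\<lambda>i. i"] conjI disjI2 allI impI)
        fix K B assume K: "compact K \<and> K \<subseteq> U"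
        show "\<forall>\<^sub>F n in sequentially. \<forall>z\<in>K. B \<le> norm (F n z)"
          using True[rule_format, of "B + E"]
        proof eventually_elim
          case (elim i)
          show ?case
          proof
            fix z assume "z \<in> K"
            then have "norm ((f ^^ k i) z - d (k i)) \<le> E" using K D(7)[of z "k i"] E[of "k i"] by fastforce
            then show "B \<le> norm (F i z)"
              using elim norm_triangle_ineq2[of "d (k i)" "(f ^^ k i) z"] by (simp add: k norm_minus_commute)
          qed
        qed
      qed (simp add: strict_mono_def)
    next
      case False
      then obtain B where "\<not> (\<forall>\<^sub>F i in sequentially. B \<le> norm (d (k i)))" by auto
      then have "\<exists>\<^sub>\<infinity>i. norm (d (k i)) \<le> B"
        unfolding cofinite_eq_sequentially[symmetric] by (auto simp: not_eventually elim!: frequently_elim1)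
      then have inf: "infinite {i. norm (d (k i)) \<le> B}" by (simp add: INFM_iff_infinite)
      define r1 where "r1 = enumerate {i. norm (d (k i)) \<le> B}"
      have r1: "strict_mono r1" "\<And>i. norm (d (k (r1 i))) \<le> B"
        using strict_mono_enumerate[OF inf] enumerate_in_set[OF inf] by (auto simp: r1_def)
      have "bounded (range (\<lambda>i. d (k (r1 i))))" using r1(2) by (auto simp: bounded_iff)
      then obtain L r2 where r2: "strict_mono r2" "((\<lambda>i. d (k (r1 i))) \<circ> r2) \<longlonglongrightarrow> L"
        using bounded_imp_convergent_subsequence by blast
      define r where "r = r1 \<circ> r2"
      have r: "strict_mono r" using r1 r2 by (simp add: r_def strict_mono_o)
      have "uniform_limit K (\<lambda>n. F (r n)) (\<lambda>_. L) sequentially" if K: "K \<subseteq> U" for K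
      proof (rule uniform_limitI)
        fix \<epsilon> :: real assume \<epsilon>: "\<epsilon> > 0"
        have "finite {n. norm (d n) \<le> B \<and> e n \<ge> \<epsilon>/2}" using D(9)[of "\<epsilon>/2" B] \<epsilon> by auto
        then have "finite {i. k i \<in> {n. norm (d n) \<le> B \<and> e n \<ge> \<epsilon>/2}}" by (rule fink)
        then have "finite (r -` {i. k i \<in> {n. norm (d n) \<le> B \<and> e n \<ge> \<epsilon>/2}})"
          using r by (intro finite_vimageI) (auto simp: strict_mono_imp_inj_on)
        then have "\<forall>\<^sub>F i in sequentially. i \<notin> r -` {i. k i \<in> {n. norm (d n) \<le> B \<and> e n \<ge> \<epsilon>/2}}"
          unfolding cofinite_eq_sequentially[symmetric] eventually_cofinite by simp
        moreover have "\<forall>\<^sub>F i in sequentially. dist (d (k (r i))) L < \<epsilon>/2"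
          using r2(2) \<epsilon> unfolding r_def o_def by (intro tendstoD) auto
        ultimately show "\<forall>\<^sub>F i in sequentially. \<forall>z\<in>K. dist (F (r i) z) L < \<epsilon>"
        proof eventually_elim
          case (elim i)
          have e: "e (k (r i)) < \<epsilon>/2" using elim(1) r1(2)[of "r2 i"] by (auto simp: r_def)
          show ?case
          proof
            fix z assume "z \<in> K"
            then have "dist (F (r i) z) (d (k (r i))) \<le> e (k (r i))" using D(7)[of z "k (r i)"] K by (auto simp: k dist_norm)
            then show "dist (F (r i) z) L < \<epsilon>" using e elim(2) dist_triangle[of "F (r i) z" L "d (k (r i))"] by linarith
          qed
        qed
      qed
      then show ?thesis using r by blast
    qed
  qed
qed

lemma itinerary_subset_fatou:
  assumes W: "wandering_itinerary f U d e"
  shows "U \<subseteq> fatou_set f"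
  using itinerary_normal[OF W] wandering_itineraryD[OF W] unfolding fatou_set_def by blast

text \<open>The conclusion is about every point satisfying the disc estimate, not only points of U:
  it is also applied to boundary points and to points in the holes of U.\<close>

lemma itinerary_unbounded:
  assumes W: "wandering_itinerary f U d e"
  obtains k where "\<And>B. \<forall>\<^sub>F i in sequentially. \<forall>z. norm ((f ^^ k i) z - d (k i)) \<le> e (k i) \<longrightarrow> B \<le> norm ((f ^^ k i) z)"
proof -
  note D = wandering_itineraryD[OF W]
  obtain E where E: "\<And>n. e n \<le> E" using D(8) by auto
  obtain k where k: "filterlim (\<lambda>n. norm (d (k n))) at_top sequentially" using D(10) by auto
  show thesis
  proof (rule that[of k])
    fix B
    have "\<forall>\<^sub>F i in sequentially. B + E \<le> norm (d (k i))" using k by (auto simp: filterlim_at_top)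
    then show "\<forall>\<^sub>F i in sequentially. \<forall>z. norm ((f ^^ k i) z - d (k i)) \<le> e (k i) \<longrightarrow> B \<le> norm ((f ^^ k i) z)"
    proof eventually_elim
      case (elim i)
      show ?case
      proof (intro allI impI)
        fix z assume "norm ((f ^^ k i) z - d (k i)) \<le> e (k i)"
        then show "B \<le> norm ((f ^^ k i) z)"
          using elim E[of "k i"] norm_triangle_ineq2[of "d (k i)" "(f ^^ k i) z"] by (simp add: norm_minus_commute)
      qed
    qed
  qed
qed

text \<open>A normal neighbourhood of a frontier point would contain points of U, which are
  unbounded along the chosen iterates, and points with bounded orbit. A finite limit contradicts the
  former, the limit infinity the latter.\<close>

lemma itinerary_frontier_fatou:
  assumes W: "wandering_itinerary f U d e"
  shows "frontier U \<inter> fatou_set f = {}"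
proof (rule ccontr)
  note D = wandering_itineraryD[OF W]
  assume "frontier U \<inter> fatou_set f \<noteq> {}"
  then obtain \<zeta> S where \<zeta>: "\<zeta> \<in> frontier U" and S: "open S" "connected S" "\<zeta> \<in> S" "normal_family_on S (range (\<lambda>n. f ^^ n))"
    unfolding fatou_set_def by auto
  obtain k where k: "\<And>B. \<forall>\<^sub>F i in sequentially. \<forall>z. norm ((f ^^ k i) z - d (k i)) \<le> e (k i) \<longrightarrow> B \<le> norm ((f ^^ k i) z)"
    using itinerary_unbounded[OF W] by blast
  have "range (\<lambda>i. f ^^ k i) \<subseteq> range (\<lambda>n. f ^^ n)" by auto
  then obtain r :: "nat \<Rightarrow> nat" where r: "strict_mono r"
    "(\<exists>g. \<forall>K. compact K \<and> K \<subseteq> S \<longrightarrow> uniform_limit K (\<lambda>n. f ^^ k (r n)) g sequentially) \<or>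
            (\<forall>K. compact K \<and> K \<subseteq> S \<longrightarrow> (\<forall>B. \<forall>\<^sub>F n in sequentially. \<forall>z\<in>K. B \<le> norm ((f ^^ k (r n)) z)))"
    using S(4)[unfolded normal_family_on_def, rule_format, of "\<lambda>i. f ^^ k i"] by auto
  have kr: "\<forall>\<^sub>F i in sequentially. \<forall>z. norm ((f ^^ k (r i)) z - d (k (r i))) \<le> e (k (r i)) \<longrightarrow> B \<le> norm ((f ^^ k (r i)) z)" for B
    using eventually_subseq[OF r(1) k] .
  from r(2) show False
  proof
    assume "\<exists>g. \<forall>K. compact K \<and> K \<subseteq> S \<longrightarrow> uniform_limit K (\<lambda>n. f ^^ k (r n)) g sequentially"
    then obtain g where g: "\<And>K. compact K \<Longrightarrow> K \<subseteq> S \<Longrightarrow> uniform_limit K (\<lambda>n. f ^^ k (r n)) g sequentially" by auto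
    have "\<zeta> \<in> closure U" using \<zeta> by (simp add: frontier_def)
    then obtain z where z: "z \<in> U" "z \<in> S" using S(1,3) by (meson disjoint_iff open_Int_closure_eq_empty)
    have "uniform_limit {z} (\<lambda>n. f ^^ k (r n)) g sequentially" using z by (intro g) auto
    then have "\<forall>\<^sub>F n in sequentially. norm ((f ^^ k (r n)) z) < norm (g z) + 1"
    proof -
      assume "uniform_limit {z} (\<lambda>n. f ^^ k (r n)) g sequentially"
      then have "\<forall>\<^sub>F n in sequentially. \<forall>x\<in>{z}. dist ((f ^^ k (r n)) x) (g x) < 1" by (rule uniform_limitD) auto
      then show ?thesis
      proof eventually_elim
        case (elim n)
        then show ?case using norm_triangle_ineq2[of "(f ^^ k (r n)) z" "g z"] by (auto simp: dist_norm)
      qed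
    qed
    moreover have "\<forall>\<^sub>F n in sequentially. norm (g z) + 1 \<le> norm ((f ^^ k (r n)) z)"
      using kr[of "norm (g z) + 1"] by eventually_elim (use D(7)[OF z(1)] in auto)
    ultimately have "\<forall>\<^sub>F n :: nat in sequentially. False" by eventually_elim auto
    then show False by simp
  next
    assume inf: "\<forall>K. compact K \<and> K \<subseteq> S \<longrightarrow> (\<forall>B. \<forall>\<^sub>F n in sequentially. \<forall>z\<in>K. B \<le> norm ((f ^^ k (r n)) z))"
    obtain \<rho> where \<rho>: "\<rho> > 0" "ball \<zeta> \<rho> \<subseteq> S" using S(1,3) open_contains_ball by blast
    obtain p where p: "p \<in> ball \<zeta> \<rho>" "bounded (range (\<lambda>n. (f ^^ n) p))" using D(11)[OF \<zeta> \<rho>(1)] by auto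
    obtain M where M: "\<And>n. norm ((f ^^ n) p) \<le> M" using p(2) by (auto simp: bounded_iff)
    have "\<forall>\<^sub>F n in sequentially. \<forall>z\<in>{p}. M + 1 \<le> norm ((f ^^ k (r n)) z)"
      using inf[rule_format, of "{p}"] p \<rho> by auto
    then have "\<forall>\<^sub>F n :: nat in sequentially. False"
    proof eventually_elim
      case (elim n) then show ?case using M[of "k (r n)"] by auto
    qed
    then show False by simp
  qed
qed

section \<open>The images as Fatou components that are never periodic\<close>

lemma itinerary_fatou_component:
  assumes W: "wandering_itinerary f U d e"
  shows "fatou_component f U"
  unfolding fatou_component_def in_components_maximal
proof (intro conjI allI impI)
  note D = wandering_itineraryD[OF W]
  fix T assume T: "T \<noteq> {} \<and> U \<subseteq> T \<and> T \<subseteq> fatou_set f \<and> connected T"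
  show "T = U"
  proof (rule ccontr)
    assume "T \<noteq> U"
    then have "T - U \<noteq> {}" "T \<inter> U \<noteq> {}" using T D(6) by auto
    then have "T \<inter> frontier U \<noteq> {}" using connected_Int_frontier T by blast
    then show False using itinerary_frontier_fatou[OF W] T by blast
  qed
qed (use wandering_itineraryD[OF W] itinerary_subset_fatou[OF W] in auto)

lemma itinerary_orbit_component:
  assumes W: "wandering_itinerary f U d e"
  shows "orbit_component f U n = (f ^^ n) ` U"
  unfolding orbit_component_def
proof (rule the_equality)
  have c: "fatou_component f ((f ^^ n) ` U)"
    using itinerary_fatou_component[OF wandering_itinerary_shift[OF W]] .
  then show "fatou_component f ((f ^^ n) ` U) \<and> (f ^^ n) ` U \<subseteq> (f ^^ n) ` U" by simp
  fix V assume V: "fatou_component f V \<and> (f ^^ n) ` U \<subseteq> V"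
  have "(f ^^ n) ` U \<noteq> {}" using wandering_itineraryD(6)[OF W] by simp
  then show "V = (f ^^ n) ` U"
    using V c components_nonoverlap[of V "fatou_set f" "(f ^^ n) ` U"] unfolding fatou_component_def by blast
qed

lemma itinerary_wandering:
  assumes W: "wandering_itinerary f U d e"
  shows "wandering_domain f U"
  unfolding wandering_domain_def
proof
  note D = wandering_itineraryD[OF W]
  show "fatou_component f U" by (rule itinerary_fatou_component[OF W])
  show "\<not> eventually_periodic f U"
  proof
    assume "eventually_periodic f U"
    then obtain m p where p: "p > 0" "(f ^^ (m + p)) ` U = (f ^^ m) ` U"
      unfolding eventually_periodic_def itinerary_orbit_component[OF W] by auto
    have per: "(f ^^ (m + p + i)) ` U = (f ^^ (m + i)) ` U" for i
    proof -
      have *: "(f ^^ (q + i)) ` U = (f ^^ i) ` ((f ^^ q) ` U)" for q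
        using funpow_add[of i q f] by (simp add: image_image add.commute)
      show ?thesis unfolding * p(2) ..
    qed
    \<comment> \<open>Periodicity would leave only the first m + p images, finitely many bounded
      sets, against the unbounded itinerary.\<close>
    have ex: "\<exists>j<m+p. (f ^^ n) ` U = (f ^^ j) ` U" for n
    proof (induction n rule: less_induct)
      case (less n)
      show ?case
      proof (cases "n < m + p")
        case False
        then have "(f ^^ n) ` U = (f ^^ (n - p)) ` U" using per[of "n - (m + p)"] by (simp add: algebra_simps)
        moreover have "n - p < n" using False p(1) by simp
        ultimately show ?thesis using less by metis
      qed auto
    qed
    have "bounded (\<Union>j<m+p. (f ^^ j) ` U)"
      using wandering_itineraryD(5)[OF wandering_itinerary_shift[OF W]] by (intro bounded_UN) auto
    then obtain M where M: "\<And>j z. j < m + p \<Longrightarrow> z \<in> U \<Longrightarrow> norm ((f ^^ j) z) \<le> M"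
      by (fastforce simp: bounded_iff)
    have bd: "norm ((f ^^ n) z) \<le> M" if z: "z \<in> U" for n z
    proof -
      obtain j where j: "j < m + p" "(f ^^ n) ` U = (f ^^ j) ` U" using ex by blast
      then have "(f ^^ n) z \<in> (f ^^ j) ` U" using z by blast
      then show ?thesis using M[OF j(1)] by auto
    qed
    obtain z where z: "z \<in> U" using D(6) by auto
    obtain k where "\<And>B. \<forall>\<^sub>F i in sequentially. \<forall>z. norm ((f ^^ k i) z - d (k i)) \<le> e (k i) \<longrightarrow> B \<le> norm ((f ^^ k i) z)"
      using itinerary_unbounded[OF W] by blast
    from this[of "M + 1"] have "\<forall>\<^sub>F i :: nat in sequentially. False"
    proof eventually_elim
      case (elim i)
      then have "M + 1 \<le> norm ((f ^^ k i) z)" using D(7)[OF z] by blast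
      then show ?case using bd[OF z, of "k i"] by simp
    qed
    then show False by simp
  qed
qed

section \<open>Simple connectivity of the domain\<close>

lemma closed_outside_open:
  fixes V :: "'a::euclidean_space set"
  assumes "open V" "bounded V" "2 \<le> DIM('a)"
  shows "closed (outside V)"
proof -
  \<comment> \<open>The closure is connected and avoids V, so it cannot leave the complementary
    component that it closes.\<close>
  have "closure (outside V) \<subseteq> - V"
    using assms(1) by (intro closure_minimal) (auto simp: outside_inside)
  moreover have "connected (closure (outside V))"
    using connected_outside[OF assms(2,3)] by (rule connected_imp_connected_closure)
  moreover obtain x where x: "x \<in> outside V" using outside_bounded_nonempty[OF assms(2)] by auto
  ultimately have "closure (outside V) \<subseteq> outside V"
  proof (intro subsetI)
    fix y assume *: "closure (outside V) \<subseteq> - V" "connected (closure (outside V))" "x \<in> outside V" "y \<in> closure (outside V)"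
    then have "connected_component (- V) x y"
      unfolding connected_component_def using closure_subset by blast
    then show "y \<in> outside V" using outside_same_component x by blast
  qed
  then show ?thesis by (simp add: closure_subset_eq)
qed

lemma frontier_outside_open:
  fixes V :: "'a::euclidean_space set"
  assumes "open V" "bounded V" "2 \<le> DIM('a)"
  shows "frontier (outside V) \<subseteq> closure V"
proof
  fix y assume y: "y \<in> frontier (outside V)"
  then have yo: "y \<in> outside V" using closed_outside_open[OF assms] by (auto simp: frontier_def)
  show "y \<in> closure V"
  proof (rule ccontr)
    assume "y \<notin> closure V"
    then obtain r where r: "r > 0" "ball y r \<subseteq> - closure V"
      by (metis ComplI closed_closure open_Compl open_contains_ball)
    have "ball y r \<subseteq> outside V"
    proof
      fix x assume "x \<in> ball y r"
      then have "connected_component (- V) y x"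
        unfolding connected_component_def using r closure_subset[of V] by (intro exI[of _ "ball y r"]) auto
      then show "x \<in> outside V" using outside_same_component yo by blast
    qed
    then have "y \<in> interior (outside V)" using r(1) by (meson centre_in_ball interior_maximal open_ball subsetD)
    then show False using y by (simp add: frontier_def)
  qed
qed

text \<open>
  By the maximum principle the orbit estimates extend to the bounded complementary components of \<open>U\<close>;
  these would contain points of the boundary in their interior, and hence points with bounded orbit.
\<close>

lemma itinerary_simply_connected:
  assumes W: "wandering_itinerary f U d e"
  shows "simply_connected U"
proof -
  note D = wandering_itineraryD[OF W]
  have "inside U = {}"
  proof (rule ccontr)
    assume "inside U \<noteq> {}"
    then obtain x where x: "x \<in> inside U" by auto
    \<comment> \<open>A bounded component of the complement. It is closed, and its frontier point w
      must lie on the frontier of U.\<close>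
    define C where "C = connected_component_set (- U) x"
    have xC: "x \<notin> U" "bounded C" using x by (auto simp: inside_def C_def)
    have Cin: "C \<subseteq> inside U"
      using inside_same_component x unfolding C_def by blast
    have "closed C" unfolding C_def using D(3) by (intro closed_connected_component) auto
    have "x \<in> C" using xC by (simp add: C_def)
    then have "C \<noteq> {}" "C \<noteq> UNIV" using xC not_bounded_UNIV by auto
    then obtain w where w: "w \<in> frontier C" using frontier_eq_empty[of C] by auto
    then have wC: "w \<in> C" using \<open>closed C\<close> by (auto simp: frontier_def)
    then have wU: "w \<notin> U" unfolding C_def using connected_component_in by fastforce
    have "w \<in> closure U"
    proof (rule ccontr)
      assume "w \<notin> closure U"
      then obtain r where r: "r > 0" "ball w r \<subseteq> - closure U"
        by (metis ComplI closed_closure open_Compl open_contains_ball)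
      have "ball w r \<subseteq> C"
      proof
        fix y assume "y \<in> ball w r"
        then have "connected_component (- U) w y"
          unfolding connected_component_def using r closure_subset[of U] by (intro exI[of _ "ball w r"]) auto
        then show "y \<in> C" using wC unfolding C_def by (auto intro: connected_component_trans)
      qed
      then have "w \<in> interior C" using r(1) by (meson centre_in_ball interior_maximal open_ball subsetD)
      then show False using w by (simp add: frontier_def)
    qed
    then have wf: "w \<in> frontier U" using wU D(3) by (simp add: frontier_def interior_open)
    \<comment> \<open>U with its holes filled. It is open, has its frontier in closure U, and
      contains w in its interior, hence also points with bounded orbit.\<close>
    define H where "H = - outside U"
    have H: "open H" "bounded H" "w \<in> H"
      using closed_outside_open[OF D(3,5)] cobounded_outside[OF D(5)] Cin wC
      by (auto simp: H_def inside_outside)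
    have fH: "frontier H \<subseteq> closure U" using frontier_outside_open[OF D(3,5)] by (simp add: H_def)
    have est: "norm ((f ^^ n) z - d n) \<le> e n" if "z \<in> H" for n z
    proof (rule maximum_modulus_frontier[of "\<lambda>z. (f ^^ n) z - d n" H "e n" z])
      have h: "(f ^^ n) holomorphic_on UNIV" using holomorphic_on_funpow D(1) by blast
      show "(\<lambda>z. (f ^^ n) z - d n) holomorphic_on interior H"
        using h by (intro holomorphic_intros) (auto intro: holomorphic_on_subset)
      show "continuous_on (closure H) (\<lambda>z. (f ^^ n) z - d n)"
        using D(1) by (intro continuous_intros continuous_on_entire_funpow)
      fix z assume "z \<in> frontier H"
      then have z: "z \<in> closure U" using fH by auto
      have "continuous_on (closure U) (\<lambda>z. norm ((f ^^ n) z - d n))"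
        using D(1) by (intro continuous_intros continuous_on_entire_funpow)
      then show "norm ((f ^^ n) z - d n) \<le> e n"
        using continuous_le_on_closure[OF _ z] D(7) by blast
    qed (use H that in auto)
    obtain r where r: "r > 0" "ball w r \<subseteq> H" using H open_contains_ball by blast
    obtain p where p: "p \<in> ball w r" "bounded (range (\<lambda>n. (f ^^ n) p))" using D(11)[OF wf r(1)] by auto
    obtain M where M: "\<And>n. norm ((f ^^ n) p) \<le> M" using p(2) by (auto simp: bounded_iff)
    obtain k where "\<And>B. \<forall>\<^sub>F i in sequentially. \<forall>z. norm ((f ^^ k i) z - d (k i)) \<le> e (k i) \<longrightarrow> B \<le> norm ((f ^^ k i) z)"
      using itinerary_unbounded[OF W] by blast
    from this[of "M + 1"] have "\<forall>\<^sub>F i :: nat in sequentially. False"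
    proof eventually_elim
      case (elim i)
      then have "M + 1 \<le> norm ((f ^^ k i) p)" using est p(1) r(2) by blast
      then show ?case using M[of "k i"] by simp
    qed
    then show False by simp
  qed
  then show ?thesis using simply_connected_eq_empty_inside[OF D(3)] D(4) by simp
qed

section \<open>Maps that behave like finite Blaschke products\<close>

text \<open>The features of a finite Blaschke product that the construction uses, in a form closed
  under composition. The last clause keeps net points outside the circle separable from the disc;
  the derivative clause permits Newton's method near the circle.\<close>

definition blaschke_like :: "(complex \<Rightarrow> complex) \<Rightarrow> bool" where
  "blaschke_like b \<longleftrightarrow> (\<exists>\<rho>>0. b holomorphic_on ball 0 (1 + \<rho>) \<and>
     (\<forall>z. norm z < 1 \<longrightarrow> norm (b z) < 1) \<and>
     (\<forall>z. norm z = 1 \<longrightarrow> norm (b z) = 1 \<and> deriv b z \<noteq> 0) \<and>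
     (\<forall>z. 1 < norm z \<and> norm z < 1 + \<rho> \<longrightarrow> 1 < norm (b z)))"

lemma blaschke_like_id: "blaschke_like (\<lambda>z. z)"
  unfolding blaschke_like_def by (intro exI[of _ 1]) auto

lemma continuous_on_ball_radius:
  fixes b :: "complex \<Rightarrow> complex"
  assumes "continuous_on (ball 0 (1 + \<rho>)) b" "\<rho> > 0" "\<And>z. norm z \<le> 1 \<Longrightarrow> norm (b z) \<le> 1" "\<eta> > 0"
  obtains \<delta> where "\<delta> > 0" "\<delta> < \<rho>" "\<And>z. norm z \<le> 1 + \<delta> \<Longrightarrow> norm (b z) < 1 + \<eta>"
proof -
  have "continuous_on (cball 0 (1 + \<rho>/2)) b"
    using assms(2) by (intro continuous_on_subset[OF assms(1)]) auto
  from compact_uniformly_continuous[OF this compact_cball]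
  obtain d where d: "d > 0" "\<And>x y. x \<in> cball 0 (1 + \<rho>/2) \<Longrightarrow> y \<in> cball 0 (1 + \<rho>/2) \<Longrightarrow> dist y x < d \<Longrightarrow> dist (b y) (b x) < \<eta>"
    using assms(4) unfolding uniformly_continuous_on_def by meson
  define \<delta> where "\<delta> = min d \<rho> / 2"
  have \<delta>: "\<delta> > 0" "\<delta> < d" "\<delta> \<le> \<rho>/2" using d assms(2) by (auto simp: \<delta>_def)
  show thesis
  proof (rule that[of \<delta>])
    fix z :: complex assume z: "norm z \<le> 1 + \<delta>"
    show "norm (b z) < 1 + \<eta>"
    proof (cases "norm z \<le> 1")
      case True then show ?thesis using assms(3)[of z] assms(4) by simp
    next
      case False
      define x where "x = sgn z"
      have x: "norm x = 1" using False by (auto simp: x_def norm_sgn)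
      have "z = of_real (norm z) * x" using False by (auto simp: x_def sgn_eq)
      then have "z - x = of_real (norm z - 1) * x" by (simp add: algebra_simps)
      then have "norm (z - x) = \<bar>norm z - 1\<bar>" using x by (metis norm_mult norm_of_real mult.right_neutral)
      then have "dist z x < d" using z False \<delta> by (auto simp: dist_norm)
      then have "dist (b z) (b x) < \<eta>" using z x \<delta> assms(2) by (intro d(2)) auto
      then show ?thesis using assms(3)[of x] x norm_triangle_ineq2[of "b z" "b x"] by (auto simp: dist_norm)
    qed
  qed (use \<delta> assms(2) in auto)
qed

lemma blaschke_like_le: "blaschke_like b \<Longrightarrow> norm z \<le> 1 \<Longrightarrow> norm (b z) \<le> 1"
  unfolding blaschke_like_def by (metis less_eq_real_def)

lemma blaschke_like_compose:
  assumes b: "blaschke_like b" and c: "blaschke_like c"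
  shows "blaschke_like (\<lambda>z. b (c z))"
proof -
  from b obtain \<rho> where \<rho>: "\<rho> > 0" "b holomorphic_on ball 0 (1 + \<rho>)" "\<And>z. norm z < 1 \<Longrightarrow> norm (b z) < 1"
      "\<And>z. norm z = 1 \<Longrightarrow> norm (b z) = 1" "\<And>z. norm z = 1 \<Longrightarrow> deriv b z \<noteq> 0"
      "\<And>z. 1 < norm z \<Longrightarrow> norm z < 1 + \<rho> \<Longrightarrow> 1 < norm (b z)"
    unfolding blaschke_like_def by auto
  from c obtain \<sigma> where \<sigma>: "\<sigma> > 0" "c holomorphic_on ball 0 (1 + \<sigma>)" "\<And>z. norm z < 1 \<Longrightarrow> norm (c z) < 1"
      "\<And>z. norm z = 1 \<Longrightarrow> norm (c z) = 1" "\<And>z. norm z = 1 \<Longrightarrow> deriv c z \<noteq> 0"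
      "\<And>z. 1 < norm z \<Longrightarrow> norm z < 1 + \<sigma> \<Longrightarrow> 1 < norm (c z)"
    unfolding blaschke_like_def by auto
  obtain \<delta> where \<delta>: "\<delta> > 0" "\<delta> < \<sigma>" "\<And>z. norm z \<le> 1 + \<delta> \<Longrightarrow> norm (c z) < 1 + \<rho>"
    using continuous_on_ball_radius[OF holomorphic_on_imp_continuous_on[OF \<sigma>(2)] \<sigma>(1) blaschke_like_le[OF c] \<rho>(1)] by blast
  have "(b \<circ> c) holomorphic_on ball 0 (1 + \<delta>)"
  proof (rule holomorphic_on_compose_gen[of _ _ _ "ball 0 (1 + \<rho>)"])
    show "c holomorphic_on ball 0 (1 + \<delta>)" using \<sigma>(2) by (rule holomorphic_on_subset) (use \<delta> in auto)
    show "c ` ball 0 (1 + \<delta>) \<subseteq> ball 0 (1 + \<rho>)" using \<delta>(3) by force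
  qed (use \<rho> in auto)
  moreover have "deriv (\<lambda>z. b (c z)) z \<noteq> 0" if z: "norm z = 1" for z
  proof -
    have "c field_differentiable at z"
      using \<sigma>(1,2) z by (intro holomorphic_on_imp_differentiable_at[of _ "ball 0 (1 + \<sigma>)"]) auto
    moreover have "b field_differentiable at (c z)"
      using \<rho>(1,2) \<sigma>(4)[OF z] by (intro holomorphic_on_imp_differentiable_at[of _ "ball 0 (1 + \<rho>)"]) auto
    ultimately have "deriv (b \<circ> c) z = deriv b (c z) * deriv c z" by (intro deriv_chain)
    then show ?thesis using \<rho>(5)[OF \<sigma>(4)[OF z]] \<sigma>(5)[OF z] by (simp add: o_def)
  qed
  ultimately show ?thesis unfolding blaschke_like_def
    using \<delta> \<rho> \<sigma> by (intro exI[of _ \<delta>]) (auto simp: o_def intro: less_imp_le)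
qed

primrec blaschke_iter :: "(nat \<Rightarrow> complex \<Rightarrow> complex) \<Rightarrow> nat \<Rightarrow> complex \<Rightarrow> complex" where
  "blaschke_iter b 0 = (\<lambda>z. z)"
| "blaschke_iter b (Suc k) = (\<lambda>z. b k (blaschke_iter b k z))"

lemma blaschke_like_iter: "(\<And>k. blaschke_like (b k)) \<Longrightarrow> blaschke_like (blaschke_iter b k)"
  by (induction k) (auto intro: blaschke_like_id blaschke_like_compose)

text \<open>
  Neighbourhoods of the unit circle on which parametrizations of boundaries live. In the isometric
  case everything is controlled on a full disc, otherwise the interior contains critical points.
\<close>

definition region :: "bool \<Rightarrow> real \<Rightarrow> complex set" where
  "region full \<rho> = {z. norm z < 1 + \<rho> \<and> (full \<or> 1 - \<rho> < norm z)}"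

definition closed_region :: "bool \<Rightarrow> real \<Rightarrow> complex set" where
  "closed_region full \<rho> = {z. norm z \<le> 1 + \<rho> \<and> (full \<or> 1 - \<rho> \<le> norm z)}"

lemma open_region: "open (region full \<rho>)"
proof -
  have "region full \<rho> = {z. norm z < 1 + \<rho>} \<inter> (if full then UNIV else {z. 1 - \<rho> < norm z})"
    by (auto simp: region_def)
  then show ?thesis by (auto intro!: open_Int open_Collect_less continuous_intros)
qed

lemma compact_closed_region: "compact (closed_region full \<rho>)"
proof -
  have "closed_region full \<rho> = cball 0 (1 + \<rho>) \<inter> (if full then UNIV else {z. 1 - \<rho> \<le> norm z})"
    by (auto simp: closed_region_def)
  then show ?thesis by (auto intro!: compact_Int_closed closed_Collect_le continuous_intros)
qed

lemma region_subset_closed: "region full \<rho> \<subseteq> closed_region full \<rho>"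
  by (auto simp: region_def closed_region_def)

lemma region_subset_interior: "region full \<rho> \<subseteq> interior (closed_region full \<rho>)"
  by (simp add: interior_maximal open_region region_subset_closed)

lemma closed_region_subset: "\<rho>' < \<rho> \<Longrightarrow> closed_region full \<rho>' \<subseteq> region full \<rho>"
  by (auto simp: region_def closed_region_def)

lemma region_mono: "\<rho>' \<le> \<rho> \<Longrightarrow> region full \<rho>' \<subseteq> region full \<rho>"
  by (auto simp: region_def)

lemma circle_in_region: "norm z = 1 \<Longrightarrow> \<rho> > 0 \<Longrightarrow> z \<in> region full \<rho>"
  by (simp add: region_def)

lemma annulus_in_open:
  assumes "open S" "sphere 0 1 \<subseteq> (S :: complex set)"
  obtains \<rho> where "\<rho> > 0" "closed_region False \<rho> \<subseteq> S"
proof -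
  obtain d where d: "d > 0" "(\<Union>x\<in>sphere 0 1. cball x d) \<subseteq> S"
    using compact_subset_open_imp_cball_epsilon_subset[OF _ assms(1,2)] by auto
  show thesis
  proof (rule that[of "min d (1/2)"])
    show "closed_region False (min d (1/2)) \<subseteq> S"
    proof
      fix z assume z: "z \<in> closed_region False (min d (1/2))"
      have nz: "z \<noteq> 0" using z by (auto simp: closed_region_def min_def split: if_splits)
      define x where "x = sgn z"
      have x: "norm x = 1" using nz by (auto simp: x_def norm_sgn)
      have "z = of_real (norm z) * x" using nz by (auto simp: x_def sgn_eq)
      then have "z - x = of_real (norm z - 1) * x" by (simp add: algebra_simps)
      then have "norm (z - x) = \<bar>norm z - 1\<bar>" using x by (metis norm_mult norm_of_real mult.right_neutral)
      then have "z \<in> cball x d" using z by (auto simp: closed_region_def dist_norm norm_minus_commute)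
      moreover have "x \<in> sphere 0 1" using x by simp
      ultimately show "z \<in> S" using d(2) by blast
    qed
  qed (use d in auto)
qed

section \<open>Runge approximation of the data of one stage\<close>

lemma Runge_disc_points:
  fixes h :: "complex \<Rightarrow> complex"
  assumes h: "h holomorphic_on ball 0 R" and r: "0 < r" "r < R" and P: "finite P" "\<And>p. p \<in> P \<Longrightarrow> r < norm p" and e: "e > 0"
  obtains q where "\<And>z. norm z \<le> r \<Longrightarrow> norm (poly q z - h z) < e" "\<And>p. p \<in> P \<Longrightarrow> norm (poly q p - a) < e"
proof -
  \<comment> \<open>\<open>None\<close> indexes the large disc, \<open>Some p\<close> the degenerate
    disc of radius 0 at p.\<close>
  define I where "I = insert None (Some ` P)"
  define c where "c = case_option 0 (\<lambda>p::complex. p)"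
  define \<rho> where "\<rho> = case_option r (\<lambda>p::complex. 0::real)"
  define \<rho>' where "\<rho>' = case_option R (\<lambda>p::complex. 1::real)"
  define f where "f = case_option h (\<lambda>(p::complex) (z::complex). a)"
  obtain q where q: "\<And>i z. i \<in> I \<Longrightarrow> z \<in> cball (c i) (\<rho> i) \<Longrightarrow> norm (poly q z - f i z) < e"
  proof (rule Runge_disjoint_discs[of I c \<rho> \<rho>' f e])
    show "finite I" using P by (simp add: I_def)
    show "disjoint_family_on (\<lambda>i. cball (c i) (\<rho> i)) I"
      unfolding disjoint_family_on_def I_def c_def \<rho>_def using P(2) by force
    show "0 \<le> \<rho> i \<and> \<rho> i < \<rho>' i" if "i \<in> I" for i using that r by (auto simp: I_def \<rho>_def \<rho>'_def)
    show "f i holomorphic_on ball (c i) (\<rho>' i)" if "i \<in> I" for i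
      using that h by (auto simp: I_def f_def c_def \<rho>'_def)
  qed (use e in auto)
  show thesis
  proof (rule that[of q])
    show "norm (poly q z - h z) < e" if "norm z \<le> r" for z
      using q[of None z] that by (simp add: I_def c_def \<rho>_def f_def)
    show "norm (poly q p - a) < e" if "p \<in> P" for p
      using q[of "Some p" p] that by (simp add: I_def c_def \<rho>_def f_def)
  qed
qed

text \<open>The third disc has no test of its own: the translation is prescribed everywhere off the
  first two, and only its values on the channel are approximated.\<close>

definition model_map :: "complex \<Rightarrow> (complex \<Rightarrow> complex) \<Rightarrow> real \<Rightarrow> complex \<Rightarrow> real \<Rightarrow> (complex \<Rightarrow> complex) \<Rightarrow> complex \<Rightarrow> complex \<Rightarrow> complex" where
  "model_map a f R c s T v z = (if z \<in> cball a R then f z else if z \<in> cball c s then T z else z + v)"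

lemma
  fixes f T :: "complex \<Rightarrow> complex"
  assumes f: "f holomorphic_on UNIV" and T: "T holomorphic_on ball c s'" and s: "0 \<le> s" "s < s'" and R: "0 \<le> R" "0 \<le> t"
    and disj: "cball a R \<inter> cball c s = {}" "cball a R \<inter> cball y t = {}" "cball c s \<inter> cball y t = {}"
  defines "K \<equiv> cball a R \<union> cball c s \<union> cball y t"
  shows continuous_on_model_map: "continuous_on K (model_map a f R c s T v)"
    and model_map_approx: "\<epsilon> > 0 \<Longrightarrow> \<exists>g. g holomorphic_on UNIV \<and> (\<forall>z\<in>K. norm (g z - model_map a f R c s T v z) < \<epsilon>)"
proof -
  have M: "z \<in> cball a R \<Longrightarrow> model_map a f R c s T v z = f z"
    "z \<in> cball c s \<Longrightarrow> model_map a f R c s T v z = T z"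
    "z \<in> cball y t \<Longrightarrow> model_map a f R c s T v z = z + v" for z
    using disj unfolding model_map_def by (auto simp del: mem_cball)
  show "continuous_on K (model_map a f R c s T v)"
    unfolding K_def
  proof (intro continuous_on_closed_Un)
    have "continuous_on (cball a R) f"
      using holomorphic_on_imp_continuous_on[OF f] continuous_on_subset by blast
    then show "continuous_on (cball a R) (model_map a f R c s T v)"
      by (rule continuous_on_eq) (simp only: M)
    have "continuous_on (cball c s) T"
      using holomorphic_on_imp_continuous_on[OF T] by (rule continuous_on_subset) (use s in auto)
    then show "continuous_on (cball c s) (model_map a f R c s T v)"
      by (rule continuous_on_eq) (simp only: M)
    have "continuous_on (cball y t) (\<lambda>z. z + v)" by (intro continuous_intros)
    then show "continuous_on (cball y t) (model_map a f R c s T v)"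
      by (rule continuous_on_eq) (simp only: M)
  qed auto
  assume e: "\<epsilon> > 0"
  define C where "C = (\<lambda>i::nat. if i = 0 then a else if i = 1 then c else y)"
  define P where "P = (\<lambda>i::nat. if i = 0 then R else if i = 1 then s else t)"
  define P' where "P' = (\<lambda>i::nat. if i = 0 then R + 1 else if i = 1 then s' else t + 1)"
  define F where "F = (\<lambda>i::nat. if i = 0 then f else if i = 1 then T else (\<lambda>z. z + v))"
  obtain q where q: "\<And>i z. i \<in> {0,1,2} \<Longrightarrow> z \<in> cball (C i) (P i) \<Longrightarrow> norm (poly q z - F i z) < \<epsilon>"
  proof (rule Runge_disjoint_discs[of "{0,1,2}" C P P' F \<epsilon>])
    show "disjoint_family_on (\<lambda>i. cball (C i) (P i)) {0,1,2}"
      unfolding disjoint_family_on_def C_def P_def using disj by (auto simp: Int_commute simp del: mem_cball)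
    show "F i holomorphic_on ball (C i) (P' i)" if "i \<in> {0,1,2}" for i
      unfolding F_def C_def P'_def using f T by (auto intro!: holomorphic_intros elim: holomorphic_on_subset)
  qed (use e s R in \<open>auto simp: P_def P'_def\<close>)
  show "\<exists>g. g holomorphic_on UNIV \<and> (\<forall>z\<in>K. norm (g z - model_map a f R c s T v z) < \<epsilon>)"
  proof (intro exI[of _ "poly q"] conjI ballI)
    fix z assume "z \<in> K"
    then consider "z \<in> cball a R" | "z \<in> cball c s" | "z \<in> cball y t" unfolding K_def by blast
    then show "norm (poly q z - model_map a f R c s T v z) < \<epsilon>"
    proof cases
      case 1 then show ?thesis using q[of 0 z] M(1) by (simp add: C_def P_def F_def)
    next
      case 2 then show ?thesis using q[of 1 z] M(2) by (simp add: C_def P_def F_def)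
    next
      case 3 then show ?thesis using q[of 2 z] M(3) by (simp add: C_def P_def F_def)
    qed
  qed (intro holomorphic_intros)
qed

section \<open>The inductive construction\<close>

lemma compact_in_smaller_ball:
  fixes c :: "'a::metric_space"
  assumes "compact S" "S \<subseteq> ball c s" "s > 0"
  obtains s1 where "0 < s1" "s1 < s" "S \<subseteq> ball c s1"
proof (cases "S = {}")
  case True
  then show ?thesis using that[of "s/2"] assms by auto
next
  case False
  then obtain x where x: "x \<in> S" "\<And>y. y \<in> S \<Longrightarrow> dist c y \<le> dist c x"
    using continuous_attains_sup[OF assms(1) False continuous_on_dist[OF continuous_on_const continuous_on_id], of c] by auto
  then have xs: "dist c x < s" using assms by auto
  show ?thesis
  proof (rule that[of "(dist c x + s)/2"])
    show "0 < (dist c x + s)/2" using assms(3) by (simp add: add_nonneg_pos)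
    show "S \<subseteq> ball c ((dist c x + s)/2)"
    proof
      fix y assume "y \<in> S"
      then show "y \<in> ball c ((dist c x + s)/2)" using x(2)[of y] xs by simp
    qed
  qed (use xs in simp)
qed

lemma compact_uniform_nbhd:
  fixes G :: "'a::euclidean_space \<Rightarrow> 'b::metric_space"
  assumes "compact \<Lambda>" "open W" "\<Lambda> \<subseteq> W" "continuous_on W G" "\<eta> > 0"
  obtains d where "d > 0" "\<And>x y. x \<in> \<Lambda> \<Longrightarrow> dist y x < d \<Longrightarrow> y \<in> W \<and> dist (G y) (G x) < \<eta>"
proof -
  obtain d0 where d0: "d0 > 0" "(\<Union>x\<in>\<Lambda>. cball x d0) \<subseteq> W"
    using compact_subset_open_imp_cball_epsilon_subset[OF assms(1-3)] by auto
  define K where "K = {x + y |x y. x \<in> \<Lambda> \<and> y \<in> cball 0 d0}"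
  have "compact K" unfolding K_def by (intro compact_sums assms) auto
  have KW: "y \<in> K" if "x \<in> \<Lambda>" "dist y x \<le> d0" for x y
  proof -
    have "y = x + (y - x) \<and> x \<in> \<Lambda> \<and> y - x \<in> cball 0 d0" using that by (simp add: dist_norm norm_minus_commute)
    then show ?thesis unfolding K_def by blast
  qed
  have "K \<subseteq> W"
  proof
    fix z assume "z \<in> K"
    then obtain x y where "z = x + y" "x \<in> \<Lambda>" "y \<in> cball 0 d0" unfolding K_def by auto
    then have "z \<in> cball x d0" "x \<in> \<Lambda>" by (auto simp: dist_norm)
    then show "z \<in> W" using d0(2) by blast
  qed
  then have "continuous_on K G" using assms(4) continuous_on_subset by blast
  from compact_uniformly_continuous[OF this \<open>compact K\<close>] assms(5)
  obtain d1 where d1: "d1 > 0" "\<And>x y. x \<in> K \<Longrightarrow> y \<in> K \<Longrightarrow> dist y x < d1 \<Longrightarrow> dist (G y) (G x) < \<eta>"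
    unfolding uniformly_continuous_on_def by meson
  show thesis
  proof (rule that[of "min d0 d1"])
    fix x y assume xy: "x \<in> \<Lambda>" "dist y x < min d0 d1"
    then have "x \<in> K" "y \<in> K" using KW[of x y] KW[of x x] d0(1) by auto
    then show "y \<in> W \<and> dist (G y) (G x) < \<eta>" using d1(2)[of x y] xy \<open>K \<subseteq> W\<close> by auto
  qed (use d0 d1 in auto)
qed

lemma finite_outer_net:
  fixes \<psi> :: "complex \<Rightarrow> complex"
  assumes "continuous_on (closed_region full \<rho>) \<psi>" "\<rho> > 0" "\<eta> > 0"
  obtains Z where "finite Z" "Z \<subseteq> closed_region full \<rho>" "\<And>z. z \<in> Z \<Longrightarrow> 1 < norm z"
    "\<And>u. norm u = 1 \<Longrightarrow> \<exists>z\<in>Z. norm (\<psi> z - \<psi> u) < \<eta>"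
proof -
  from compact_uniformly_continuous[OF assms(1) compact_closed_region] assms(3)
  obtain d where d: "d > 0" "\<And>x y. x \<in> closed_region full \<rho> \<Longrightarrow> y \<in> closed_region full \<rho> \<Longrightarrow> dist y x < d \<Longrightarrow> dist (\<psi> y) (\<psi> x) < \<eta>"
    unfolding uniformly_continuous_on_def by meson
  \<comment> \<open>The radial offset is at most d/4 and the net on the circle has mesh d/2, which
    together stay below d.\<close>
  define \<delta> where "\<delta> = min d \<rho> / 4"
  have \<delta>: "\<delta> > 0" "\<delta> \<le> d/4" "\<delta> \<le> \<rho>" using d assms by (auto simp: \<delta>_def)
  have "compact (sphere (0::complex) 1)" by simp
  then obtain X where X: "X \<subseteq> sphere (0::complex) 1" "finite X" "sphere 0 1 \<subseteq> (\<Union>x\<in>X. ball x (d/2))"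
    by (rule compactE_image[of "sphere 0 1" "sphere 0 1" "\<lambda>x. ball x (d/2)"]) (use d(1) in auto)
  define Z where "Z = (\<lambda>x. of_real (1 + \<delta>) * x) ` X"
  have nZ: "norm (of_real (1 + \<delta>) * x) = 1 + \<delta>" if "x \<in> X" for x
  proof -
    have "norm x = 1" using X(1) that by auto
    then show ?thesis using \<delta>(1) unfolding norm_mult norm_of_real by simp
  qed
  have Zr: "Z \<subseteq> closed_region full \<rho>" using nZ \<delta> assms(2) by (auto simp: Z_def closed_region_def)
  show thesis
  proof (rule that[of Z])
    show "1 < norm z" if "z \<in> Z" for z using that nZ \<delta> by (auto simp: Z_def)
    fix u :: complex assume u: "norm u = 1"
    then obtain x where x: "x \<in> X" "dist x u < d/2" using X(3) by fastforce
    have *: "of_real (1 + \<delta>) * x - u = of_real \<delta> * x + (x - u)" by (simp add: algebra_simps)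
    have "norm (of_real (1 + \<delta>) * x - u) \<le> \<delta> * norm x + norm (x - u)"
      unfolding * using norm_triangle_ineq[of "of_real \<delta> * x" "x - u"] \<delta>(1) by (simp add: norm_mult)
    moreover have "norm x = 1" using X(1) x(1) by auto
    ultimately have "dist (of_real (1 + \<delta>) * x) u < d" using x \<delta> d(1) by (simp add: dist_norm)
    moreover have "u \<in> closed_region full \<rho>" using u assms(2) by (simp add: closed_region_def)
    moreover have "of_real (1 + \<delta>) * x \<in> Z" unfolding Z_def using x(1) by (rule imageI)
    ultimately show "\<exists>z\<in>Z. norm (\<psi> z - \<psi> u) < \<eta>"
      using d(2) Zr by (metis dist_norm subsetD)
  qed (use X Zr Z_def in auto)
qed

section \<open>The return channel along the orbit of \<open>x0\<close>\<close>

lemma deriv_nonzero_exists: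
  fixes g :: "complex \<Rightarrow> complex"
  assumes g: "g holomorphic_on UNIV" and nc: "\<And>U. open U \<Longrightarrow> U \<noteq> {} \<Longrightarrow> \<not> (\<exists>c. \<forall>z\<in>U. g z = c)"
    and U: "open U" "x \<in> U"
  obtains e V where "e \<in> V" "open V" "V \<subseteq> U" "inj_on g V" "g e \<noteq> g x"
proof -
  obtain r where r: "r > 0" "ball x r \<subseteq> U" using U open_contains_ball by blast
  have "\<exists>w\<in>ball x r. deriv g w \<noteq> 0"
  proof (rule ccontr)
    assume "\<not> ?thesis"
    then have d0: "(g has_field_derivative 0) (at w within ball x r)" if "w \<in> ball x r" for w
      using that holomorphic_derivI[OF g open_UNIV, of w] has_field_derivative_at_within by fastforce
    have "\<exists>c. \<forall>z\<in>ball x r. g z = c"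
      using has_field_derivative_zero_constant[OF convex_ball d0] by auto
    then show False using nc[of "ball x r"] r by auto
  qed
  then obtain w where w: "w \<in> ball x r" "deriv g w \<noteq> 0" by auto
  obtain r1 where r1: "r1 > 0" "ball w r1 \<subseteq> ball x r" "inj_on g (ball w r1)"
    using has_complex_derivative_locally_injective[OF holomorphic_on_subset[OF g] w(1) open_ball w(2)] by auto
  \<comment> \<open>The value at x is avoided because the next station must be separated from the
    continued orbit of \<open>x0\<close>.\<close>
  have "\<exists>e\<in>ball w r1. g e \<noteq> g x"
    using nc[of "ball w r1"] r1(1) by auto
  then show thesis using that[of _ "ball w r1"] r1 r by auto
qed

text \<open>Nonconstancy is asked for only when k > 0: the induction starts from a constant map,
  where only the zeroth iterate, the identity, occurs.\<close>

lemma funpow_nonconstant: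
  assumes f: "f holomorphic_on UNIV" and nc: "k > 0 \<Longrightarrow> \<not> f constant_on UNIV" and U: "open U" "U \<noteq> {}"
  shows "\<not> (\<exists>c::complex. \<forall>z\<in>U. (f ^^ k) z = c)"
proof
  assume "\<exists>c. \<forall>z\<in>U. (f ^^ k) z = c"
  then obtain c where c: "\<forall>z\<in>U. (f ^^ k) z = c" by auto
  then have eq: "(f ^^ k) ` U = {c}" using U(2) by auto
  have "open ((f ^^ k) ` U)"
  proof (cases "k = 0")
    case True then show ?thesis using U by simp
  next
    case False then show ?thesis using nonconstant_entire_open_image[OF f nc U(1)] by simp
  qed
  then show False using eq not_open_singleton by metis
qed

text \<open>Any nonconstant iterate is injective near some point e arbitrarily close to
  \<open>x0\<close>. Its local inverse \<open>lam\<close> tells from where to start near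
  \<open>x0\<close> in order to land, after k steps and the translation, at a prescribed point of
  the new station.\<close>

lemma return_exit:
  fixes f :: "complex \<Rightarrow> complex" and v :: complex
  assumes f: "f holomorphic_on UNIV" and nc: "k > 0 \<Longrightarrow> \<not> f constant_on UNIV"
    and orb: "\<And>j. j < k \<Longrightarrow> (f ^^ j) x0 \<in> ball a R" and t: "t > 0" and \<mu>: "\<mu> > 0"
  obtains e W \<sigma> lam where "(f ^^ k) e \<noteq> (f ^^ k) x0" "dist ((f ^^ k) e) ((f ^^ k) x0) < t" "open W" "\<sigma> > 0"
    "lam holomorphic_on ball ((f ^^ k) e + v) \<sigma>" "lam ` ball ((f ^^ k) e + v) \<sigma> \<subseteq> W"
    "\<And>w. w \<in> ball ((f ^^ k) e + v) \<sigma> \<Longrightarrow> (f ^^ k) (lam w) + v = w"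
    "\<And>x. x \<in> W \<Longrightarrow> dist x x0 < 1/2"
    "\<And>x j. x \<in> W \<Longrightarrow> j < k \<Longrightarrow> (f ^^ j) x \<in> ball a R"
    "\<And>x. x \<in> W \<Longrightarrow> (f ^^ k) x \<in> ball ((f ^^ k) x0) t"
    "\<And>x j. x \<in> W \<Longrightarrow> j \<le> k \<Longrightarrow> dist ((f ^^ j) x) ((f ^^ j) e) < \<mu>"
proof -
  have cont: "continuous_on S (f ^^ j)" for j S using f by (rule continuous_on_entire_funpow)
  have cd: "continuous_on S (\<lambda>x. dist ((f ^^ j) x) w)" for j w S
    using cont by (intro continuous_intros)
  define W0 where "W0 = {x. dist x x0 < 1/2} \<inter> (\<Inter>j\<in>{..<k}. {x. dist ((f ^^ j) x) a < R}) \<inter> {x. dist ((f ^^ k) x) ((f ^^ k) x0) < t}"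
  have "open W0" unfolding W0_def
    by (intro open_Int open_INT ballI open_Collect_less cd continuous_intros) auto
  moreover have "x0 \<in> W0" using orb t by (auto simp: W0_def dist_commute)
  ultimately obtain e V where e: "e \<in> V" "open V" "V \<subseteq> W0" "inj_on (f ^^ k) V" "(f ^^ k) e \<noteq> (f ^^ k) x0"
    using deriv_nonzero_exists[OF holomorphic_on_funpow[OF f] funpow_nonconstant[OF f nc], of k W0 x0] by metis
  \<comment> \<open>A second shrinking: all orbits from W follow that of e within \<mu>, so the
    intermediate images of a return are small.\<close>
  define W where "W = V \<inter> (\<Inter>j\<in>{..k}. {x. dist ((f ^^ j) x) ((f ^^ j) e) < \<mu>})"
  have W: "open W" unfolding W_def
    by (intro open_Int open_INT ballI open_Collect_less cd continuous_intros e) auto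
  have eW: "e \<in> W" using e(1) \<mu> by (auto simp: W_def)
  have WV: "W \<subseteq> V" by (auto simp: W_def)
  define g where "g = (\<lambda>x. (f ^^ k) x + v)"
  have g: "g holomorphic_on W" unfolding g_def by (intro holomorphic_intros holomorphic_on_funpow f)
  have gi: "inj_on g W" using e(4) WV unfolding g_def inj_on_def by auto
  obtain lam where lam: "lam holomorphic_on g ` W" "\<And>z. z \<in> W \<Longrightarrow> lam (g z) = z"
    using holomorphic_has_inverse[OF g W gi] by metis
  have "open (g ` W)" using open_mapping_thm3[OF g W gi] .
  then obtain \<sigma> where \<sigma>: "\<sigma> > 0" "ball (g e) \<sigma> \<subseteq> g ` W" using eW open_contains_ball by blast
  show thesis
  proof (rule that[of e W \<sigma> lam])
    show "dist ((f ^^ k) e) ((f ^^ k) x0) < t" using e(1,3) by (auto simp: W0_def)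
    show "lam holomorphic_on ball ((f ^^ k) e + v) \<sigma>"
      using holomorphic_on_subset[OF lam(1) \<sigma>(2)] by (simp add: g_def)
    have lw: "lam w \<in> W \<and> g (lam w) = w" if w: "w \<in> ball (g e) \<sigma>" for w
    proof -
      obtain z where "z \<in> W" "w = g z" using w \<sigma>(2) by blast
      then show ?thesis using lam(2) by simp
    qed
    show "lam ` ball ((f ^^ k) e + v) \<sigma> \<subseteq> W" using lw by (auto simp: g_def simp del: mem_ball)
    show "(f ^^ k) (lam w) + v = w" if "w \<in> ball ((f ^^ k) e + v) \<sigma>" for w
      using lw[of w] that by (simp add: g_def)
    fix x assume x: "x \<in> W"
    then have x0: "x \<in> W0" using WV e(3) by auto
    show "dist x x0 < 1/2" "(f ^^ k) x \<in> ball ((f ^^ k) x0) t" using x0 by (auto simp: W0_def dist_commute)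
    show "(f ^^ j) x \<in> ball a R" if "j < k" for j using x0 that by (auto simp: W0_def dist_commute)
    show "dist ((f ^^ j) x) ((f ^^ j) e) < \<mu>" if "j \<le> k" for j using x that by (auto simp: W_def)
  qed (use e W \<sigma> in auto)
qed

lemma model_orbit:
  assumes "\<And>j. j < n \<Longrightarrow> (f ^^ j) p \<in> ball a R" "j \<le> n"
  shows "(model_map a f R c s T v ^^ j) p = (f ^^ j) p"
  using assms(2)
proof (induction j)
  case (Suc j)
  then have "(f ^^ j) p \<in> ball a R" using assms(1)[of j] by simp
  with Suc show ?case by (auto simp: model_map_def less_imp_le)
qed simp

lemma model_orbit_station:
  assumes "\<And>j. j < N \<Longrightarrow> (f ^^ j) p \<in> ball a R" "(f ^^ N) p \<in> ball c s" "cball a R \<inter> cball c s = {}"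
  shows "(model_map a f R c s T v ^^ Suc N) p = T ((f ^^ N) p)"
    and "j \<le> N \<Longrightarrow> (model_map a f R c s T v ^^ j) p \<in> interior (cball a R \<union> cball c s \<union> cball y t)"
proof -
  have o: "(model_map a f R c s T v ^^ j) p = (f ^^ j) p" if "j \<le> N" for j
    using model_orbit[OF assms(1) that] by simp
  have "(f ^^ N) p \<in> cball c s" using assms(2) by auto
  moreover from this have "(f ^^ N) p \<notin> cball a R" using assms(3) by blast
  ultimately show "(model_map a f R c s T v ^^ Suc N) p = T ((f ^^ N) p)"
    using o[of N] by (simp add: model_map_def del: mem_cball)
  assume j: "j \<le> N"
  have "ball a R \<union> ball c s \<subseteq> interior (cball a R \<union> cball c s \<union> cball y t)"
    by (rule interior_maximal) (auto simp: less_imp_le)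
  then show "(model_map a f R c s T v ^^ j) p \<in> interior (cball a R \<union> cball c s \<union> cball y t)"
    using o[OF j] assms(1)[of j] assms(2) j by (cases "j = N") auto
qed

lemma model_orbit_channel:
  assumes "\<And>j. j < k \<Longrightarrow> (f ^^ j) p \<in> ball a R" "(f ^^ k) p \<in> ball y t"
    "cball a R \<inter> cball y t = {}" "cball c s \<inter> cball y t = {}"
  shows "(model_map a f R c s T v ^^ Suc k) p = (f ^^ k) p + v"
    and "j \<le> k \<Longrightarrow> (model_map a f R c s T v ^^ j) p \<in> interior (cball a R \<union> cball c s \<union> cball y t)"
proof -
  have o: "(model_map a f R c s T v ^^ j) p = (f ^^ j) p" if "j \<le> k" for j
    using model_orbit[OF assms(1) that] by simp
  have "(f ^^ k) p \<in> cball y t" using assms(2) by auto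
  moreover from this have "(f ^^ k) p \<notin> cball a R" "(f ^^ k) p \<notin> cball c s" using assms(3,4) by blast+
  ultimately show "(model_map a f R c s T v ^^ Suc k) p = (f ^^ k) p + v"
    using o[of k] by (simp add: model_map_def del: mem_cball)
  assume j: "j \<le> k"
  have "ball a R \<union> ball y t \<subseteq> interior (cball a R \<union> cball c s \<union> cball y t)"
    by (rule interior_maximal) (auto simp: less_imp_le)
  then show "(model_map a f R c s T v ^^ j) p \<in> interior (cball a R \<union> cball c s \<union> cball y t)"
    using o[OF j] assms(1)[of j] assms(2) j by (cases "j = k") auto
qed

text \<open>\<open>ret k\<close> says whether stage k passes near \<open>x0\<close>; otherwise
  \<open>far_rad (Suc k)\<close> is the radius of the next station. \<open>\<tau> k \<rho>\<close>
  limits the correction of the curve on a region of width \<open>\<rho>\<close>. Around a the map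
  stays attracting, and \<open>x0\<close> starts the return route.\<close>

locale wandering_construction =
  fixes full :: bool and b :: "nat \<Rightarrow> complex \<Rightarrow> complex" and \<epsilon> :: "nat \<Rightarrow> real"
    and ret :: "nat \<Rightarrow> bool" and far_rad :: "nat \<Rightarrow> real" and \<tau> :: "nat \<Rightarrow> real \<Rightarrow> real"
    and a x0 :: complex
  assumes bl: "\<And>k. blaschke_like (b k)"
    and full_id: "\<And>k. full \<Longrightarrow> b k = (\<lambda>z. z)"
    and \<epsilon>: "\<And>k. \<epsilon> k > 0"
    and far_rad: "\<And>k. 0 < far_rad k \<and> far_rad k \<le> 1"
    and \<tau>: "\<And>k \<rho>. \<rho> > 0 \<Longrightarrow> \<tau> k \<rho> > 0"
    and base: "x0 \<notin> cball a 2" "x0 \<notin> cball 0 2" "cball 0 2 \<inter> cball a 2 = {}"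
begin

abbreviation B :: "nat \<Rightarrow> complex \<Rightarrow> complex" where "B \<equiv> blaschke_iter b"

lemma B_full: "full \<Longrightarrow> B k = (\<lambda>z. z)"
  by (induction k) (simp_all add: full_id)

lemma B_blaschke: "blaschke_like (B k)"
  using bl by (rule blaschke_like_iter)

lemma norm_B_circle: "norm u = 1 \<Longrightarrow> norm (B k u) = 1"
  using B_blaschke[of k] unfolding blaschke_like_def by blast

text \<open>
  The state of the construction after \<open>k\<close> stages. The orbit of the curve \<open>\<psi>\<close> has just left the disc
  \<open>cball a R\<close> and is in the station \<open>ball c s\<close> at time \<open>N\<close>, tracing \<open>B k\<close> there up to the chart \<open>\<theta>\<close>;
  the orbit of \<open>x0\<close> has just left \<open>cball a R\<close> at time \<open>k\<close>. The map \<open>f\<close> may still be changed by \<open>e\<close> on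
  \<open>cball a R\<close>, and arbitrarily outside.
\<close>

definition stage_inv where
  "stage_inv k f \<psi> \<theta> c r s N R \<rho> e \<longleftrightarrow>
     f holomorphic_on UNIV \<and> (k > 0 \<longrightarrow> \<not> f constant_on UNIV) \<and> 2 \<le> R \<and> real k \<le> R \<and>
     (\<forall>j<k. (f ^^ j) x0 \<in> ball a R) \<and> (f ^^ k) x0 \<notin> cball a R \<and> (f ^^ k) x0 \<notin> cball c s \<and>
     0 < r \<and> r \<le> 1 \<and> r < s \<and> cball a R \<inter> cball c s = {} \<and>
     0 < \<rho> \<and> \<rho> < 1 \<and> \<psi> holomorphic_on region full \<rho> \<and> B k holomorphic_on region full \<rho> \<and>
     \<theta> holomorphic_on ball c s \<and>
     (\<forall>z\<in>region full \<rho>. (f ^^ N) (\<psi> z) \<in> ball c s \<and> \<theta> ((f ^^ N) (\<psi> z)) = B k z \<and>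
        (1 < norm z \<longrightarrow> 1 < norm (B k z)) \<and> (\<forall>j<N. (f ^^ j) (\<psi> z) \<in> ball a R)) \<and>
     (\<forall>u. norm u = 1 \<longrightarrow> norm ((f ^^ N) (\<psi> u) - (c + of_real r * B k u)) \<le> \<epsilon> k * r / 2) \<and>
     (full \<longrightarrow> \<psi> = (\<lambda>z. z)) \<and> 0 < e \<and>
     (\<forall>g u v. (\<forall>z\<in>cball a R. dist (g z) (f z) \<le> e) \<and> norm u = 1 \<and> dist v (\<psi> u) \<le> e \<longrightarrow>
        norm ((g ^^ N) v - (c + of_real r * B k u)) \<le> \<epsilon> k * r)"

text \<open>The last clauses quantify over all nearby g and v, since the limit map and the limit
  curve are known only to be close to those of each stage.\<close>

definition stage_trans where
  "stage_trans k f \<psi> N R \<rho> e f' \<psi>' r' N' R' \<rho>' e' \<longleftrightarrow>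
     R + 1 \<le> R' \<and> (\<forall>z\<in>cball a R. dist (f' z) (f z) \<le> e/2) \<and> e' \<le> e/2 \<and> \<rho>' < \<rho> \<and>
     (\<forall>z\<in>region full \<rho>'. norm (\<psi>' z - \<psi> z) \<le> e/2 \<and> norm (\<psi>' z - \<psi> z) \<le> \<tau> k \<rho>') \<and>
     N' = (if ret k then N + k + 2 else N + 1) \<and>
     (if ret k then r' \<le> 1 / real (k + 2) else r' = far_rad (Suc k)) \<and>
     (\<forall>g. (\<forall>z\<in>cball a R'. dist (g z) (f' z) \<le> e') \<longrightarrow>
        (\<forall>u. norm u = 1 \<longrightarrow> (\<exists>p. dist p (\<psi> u) < 1 / real (k + 1) \<and> dist ((g ^^ Suc N) p) a < 1)) \<and>
        (\<forall>n. N < n \<and> n < N' \<longrightarrow> (\<exists>d. \<forall>u v. norm u = 1 \<and> dist v (\<psi>' u) \<le> e' \<longrightarrow> dist ((g ^^ n) v) d \<le> 1 / real (k + 1))) \<and>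
        (ret k \<longrightarrow> (\<forall>u v. norm u = 1 \<and> dist v (\<psi>' u) \<le> e' \<longrightarrow> dist ((g ^^ Suc N) v) x0 < 1)))"

lemma stage_regions:
  assumes "\<delta> > 0" "\<rho> > 0" "B k holomorphic_on region full \<rho>"
  obtains \<rho>2 where "0 < \<rho>2" "\<rho>2 < \<rho>" "B (Suc k) holomorphic_on region full \<rho>2"
    "\<And>z. z \<in> closed_region full \<rho>2 \<Longrightarrow> norm (B k z) < 1 + \<delta> \<and> norm (B (Suc k) z) < 2 \<and> deriv (B (Suc k)) z \<noteq> 0 \<and>
      (1 < norm z \<longrightarrow> 1 < norm (B (Suc k) z))"
proof (cases full)
  case True
  define \<rho>2 where "\<rho>2 = min (min \<rho> 1) \<delta> / 2"
  have \<rho>2: "0 < \<rho>2" "\<rho>2 < \<rho>" "\<rho>2 < 1" "\<rho>2 < \<delta>" using assms by (auto simp: \<rho>2_def)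
  show thesis
  proof (rule that[of \<rho>2])
    show "norm (B k z) < 1 + \<delta> \<and> norm (B (Suc k) z) < 2 \<and> deriv (B (Suc k)) z \<noteq> 0 \<and>
      (1 < norm z \<longrightarrow> 1 < norm (B (Suc k) z))" if "z \<in> closed_region full \<rho>2" for z
      using that \<rho>2 unfolding B_full[OF True] by (auto simp: closed_region_def)
  qed (use \<rho>2 B_full[OF True] in \<open>auto intro: holomorphic_on_ident simp del: blaschke_iter.simps\<close>)
next
  case False
  obtain \<rho>A where A: "\<rho>A > 0" "B k holomorphic_on ball 0 (1 + \<rho>A)"
    using B_blaschke[of k] unfolding blaschke_like_def by auto
  obtain \<rho>B where C: "\<rho>B > 0" "B (Suc k) holomorphic_on ball 0 (1 + \<rho>B)"
      "\<And>z. norm z = 1 \<Longrightarrow> norm (B (Suc k) z) = 1 \<and> deriv (B (Suc k)) z \<noteq> 0"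
      "\<And>z. 1 < norm z \<and> norm z < 1 + \<rho>B \<Longrightarrow> 1 < norm (B (Suc k) z)"
    using B_blaschke[of "Suc k"] unfolding blaschke_like_def by auto
  \<comment> \<open>All requirements are open and hold on the unit circle, so a thin annulus
    satisfies them.\<close>
  define S where "S = (ball 0 (1 + \<rho>A) \<inter> B k -` ball 0 (1 + \<delta>)) \<inter>
      ((ball 0 (1 + \<rho>B) \<inter> B (Suc k) -` ball 0 2) \<inter> (ball 0 (1 + \<rho>B) \<inter> deriv (B (Suc k)) -` (- {0})))"
  have "open S" unfolding S_def using A C(1,2)
    by (intro open_Int continuous_open_preimage holomorphic_on_imp_continuous_on holomorphic_deriv) auto
  moreover have "sphere 0 1 \<subseteq> S"
    using A(1) C(1,3) norm_B_circle[of _ k] assms(1) by (auto simp: S_def simp del: blaschke_iter.simps)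
  ultimately obtain \<rho>3 where \<rho>3: "\<rho>3 > 0" "closed_region False \<rho>3 \<subseteq> S" using annulus_in_open by blast
  define \<rho>2 where "\<rho>2 = min \<rho> \<rho>3 / 2"
  have \<rho>2: "0 < \<rho>2" "\<rho>2 < \<rho>" "\<rho>2 < \<rho>3" using assms \<rho>3 by (auto simp: \<rho>2_def)
  have sub: "closed_region full \<rho>2 \<subseteq> S"
    using closed_region_subset[OF \<rho>2(3)] region_subset_closed \<rho>3(2) False by (metis (full_types) order_trans)
  show thesis
  proof (rule that[of \<rho>2])
    show "B (Suc k) holomorphic_on region full \<rho>2"
      by (rule holomorphic_on_subset[OF C(2)]) (use sub region_subset_closed in \<open>force simp: S_def\<close>)
    show "norm (B k z) < 1 + \<delta> \<and> norm (B (Suc k) z) < 2 \<and> deriv (B (Suc k)) z \<noteq> 0 \<and>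
      (1 < norm z \<longrightarrow> 1 < norm (B (Suc k) z))" if "z \<in> closed_region full \<rho>2" for z
    proof -
      have "z \<in> S" using that sub by auto
      then show ?thesis unfolding S_def using C(4)[of z] by (auto simp del: blaschke_iter.simps)
    qed
  qed (use \<rho>2 in auto)
qed

text \<open>
  The way from a target point near the next station \<open>c'\<close>: in the return case \<open>lam\<close> is a local inverse of
  the transit through the channel that starts near \<open>x0\<close>, otherwise the target is hit directly.
\<close>

lemma stage_exit:
  assumes f: "f holomorphic_on UNIV" and nc: "k > 0 \<Longrightarrow> \<not> f constant_on UNIV"
    and orb: "\<And>j. j < k \<Longrightarrow> (f ^^ j) x0 \<in> ball a R" and t: "t > 0" "t \<le> 1" and R': "R' > 0"
  defines "v \<equiv> a + of_real (R' + 20) - (f ^^ k) x0"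
  obtains c' \<sigma> lam W G E where "\<sigma> > 0" "R' + 19 \<le> dist c' a" "c' \<noteq> a + of_real (R' + 20)"
    "\<not> ret k \<Longrightarrow> 40 \<le> dist c' (a + of_real (R' + 20)) \<and> \<sigma> = 10 \<and> G = (\<lambda>x. x)"
    "open W" "continuous_on W G" "lam holomorphic_on ball c' \<sigma>" "lam ` ball c' \<sigma> \<subseteq> W"
    "\<And>w. w \<in> ball c' \<sigma> \<Longrightarrow> G (lam w) = w"
    "\<And>x. ret k \<Longrightarrow> x \<in> W \<Longrightarrow> dist x x0 < 1/2 \<and> (\<forall>j<k. (f ^^ j) x \<in> ball a R) \<and> (f ^^ k) x \<in> ball ((f ^^ k) x0) t \<and>
       (\<forall>j\<le>k. dist ((f ^^ j) x) (E j) < 1 / (4 * real (k + 1))) \<and> G x = (f ^^ k) x + v"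
proof (cases "ret k")
  case False
  have d: "dist (a - of_real (R' + 20)) (a + of_real (R' + 20)) = 2 * R' + 40"
  proof -
    have "dist (a - of_real (R' + 20)) (a + of_real (R' + 20)) = norm (of_real (-(2 * R' + 40)) :: complex)"
      unfolding dist_norm by (rule arg_cong[of _ _ norm]) (simp add: algebra_simps)
    then show ?thesis using R' by (simp only: norm_of_real)
  qed
  have d': "dist (a - of_real (R' + 20)) a = R' + 20"
  proof -
    have "dist (a - of_real (R' + 20)) a = norm (of_real (-(R' + 20)) :: complex)" by (simp add: dist_norm)
    then show ?thesis using R' by (simp only: norm_of_real)
  qed
  show thesis
  \<comment> \<open>Without a return the station is put on the side of a opposite to the point where
    the orbit of \<open>x0\<close> continues.\<close>
  proof (rule that[of 10 "a - of_real (R' + 20)" "\<lambda>x. x" UNIV "\<lambda>x. x" "\<lambda>_. 0"])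
    show "a - of_real (R' + 20) \<noteq> a + of_real (R' + 20)"
    proof
      assume "a - of_real (R' + 20) = a + of_real (R' + 20)"
      then have "dist (a - of_real (R' + 20)) (a + of_real (R' + 20)) = 0" by (simp only: dist_self)
      then show False using d R' by linarith
    qed
  qed (use False d d' R' in auto)
next
  case True
  define \<mu> where "\<mu> = 1 / (4 * real (k + 1))"
  have \<mu>: "\<mu> > 0" by (simp add: \<mu>_def)
  obtain e W \<sigma> lam where E: "(f ^^ k) e \<noteq> (f ^^ k) x0" "dist ((f ^^ k) e) ((f ^^ k) x0) < t" "open W" "\<sigma> > 0"
    "lam holomorphic_on ball ((f ^^ k) e + v) \<sigma>" "lam ` ball ((f ^^ k) e + v) \<sigma> \<subseteq> W"
    "\<And>w. w \<in> ball ((f ^^ k) e + v) \<sigma> \<Longrightarrow> (f ^^ k) (lam w) + v = w"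
    "\<And>x. x \<in> W \<Longrightarrow> dist x x0 < 1/2"
    "\<And>x j. x \<in> W \<Longrightarrow> j < k \<Longrightarrow> (f ^^ j) x \<in> ball a R"
    "\<And>x. x \<in> W \<Longrightarrow> (f ^^ k) x \<in> ball ((f ^^ k) x0) t"
    "\<And>x j. x \<in> W \<Longrightarrow> j \<le> k \<Longrightarrow> dist ((f ^^ j) x) ((f ^^ j) e) < \<mu>"
    by (rule return_exit[where k=k and v=v, OF f _ _ t(1) \<mu>])
      (rule nc, assumption, rule orb, assumption, (rule that; assumption))
  show thesis
  \<comment> \<open>The station centre is where e arrives. It differs from the arrival point of
    \<open>x0\<close> by the difference of their k-th iterates, which is nonzero and shorter than
    t.\<close>
  proof (rule that[of \<sigma> "(f ^^ k) e + v" "\<lambda>x. (f ^^ k) x + v" W lam "\<lambda>j. (f ^^ j) e"])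
    have "(f ^^ k) e + v - a = of_real (R' + 20) - ((f ^^ k) x0 - (f ^^ k) e)" by (simp add: v_def)
    then have "dist ((f ^^ k) e + v) a \<ge> norm (of_real (R' + 20) :: complex) - norm ((f ^^ k) x0 - (f ^^ k) e)"
      unfolding dist_norm by (metis norm_triangle_ineq2)
    moreover have "norm (of_real (R' + 20) :: complex) = R' + 20" using R' by (simp only: norm_of_real)
    ultimately show "R' + 19 \<le> dist ((f ^^ k) e + v) a"
      using E(2) t by (simp add: dist_norm norm_minus_commute)
    show "(f ^^ k) e + v \<noteq> a + of_real (R' + 20)" using E(1) by (simp add: v_def)
    show "continuous_on W (\<lambda>x. (f ^^ k) x + v)" using f by (intro continuous_intros continuous_on_entire_funpow)
  qed (use True E \<mu>_def in auto)
qed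

end

section \<open>One stage: prolonging the map to the next station\<close>

context wandering_construction
begin

lemma stage_invD:
  assumes "stage_inv k f \<psi> \<theta> c r s N R \<rho> e"
  shows "f holomorphic_on UNIV" "k > 0 \<Longrightarrow> \<not> f constant_on UNIV" "2 \<le> R" "real k \<le> R"
    "\<And>j. j < k \<Longrightarrow> (f ^^ j) x0 \<in> ball a R" "(f ^^ k) x0 \<notin> cball a R" "(f ^^ k) x0 \<notin> cball c s"
    "0 < r" "r \<le> 1" "r < s" "cball a R \<inter> cball c s = {}"
    "0 < \<rho>" "\<rho> < 1" "\<psi> holomorphic_on region full \<rho>" "B k holomorphic_on region full \<rho>"
    "\<theta> holomorphic_on ball c s"
    "\<And>z. z \<in> region full \<rho> \<Longrightarrow> (f ^^ N) (\<psi> z) \<in> ball c s"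
    "\<And>z. z \<in> region full \<rho> \<Longrightarrow> \<theta> ((f ^^ N) (\<psi> z)) = B k z"
    "\<And>z. z \<in> region full \<rho> \<Longrightarrow> 1 < norm z \<Longrightarrow> 1 < norm (B k z)"
    "\<And>z j. z \<in> region full \<rho> \<Longrightarrow> j < N \<Longrightarrow> (f ^^ j) (\<psi> z) \<in> ball a R"
    "\<And>u. norm u = 1 \<Longrightarrow> norm ((f ^^ N) (\<psi> u) - (c + of_real r * B k u)) \<le> \<epsilon> k * r / 2"
    "full \<Longrightarrow> \<psi> = (\<lambda>z. z)" "0 < e"
    "\<And>g u v. (\<And>z. z \<in> cball a R \<Longrightarrow> dist (g z) (f z) \<le> e) \<Longrightarrow> norm u = 1 \<Longrightarrow> dist v (\<psi> u) \<le> e \<Longrightarrow>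
        norm ((g ^^ N) v - (c + of_real r * B k u)) \<le> \<epsilon> k * r"
  using assms unfolding stage_inv_def by blast+

text \<open>Region, station and radii are fixed before the tolerance \<eta>. This order is
  essential: the Newton tolerance depends on them, and only afterwards is the map chosen accurately
  enough.\<close>

lemma stage_extend:
  assumes inv: "stage_inv k f \<psi> \<theta> c r s N R \<rho> e"
  defines "N' \<equiv> (if ret k then N + k + 2 else N + 1)"
  obtains \<rho>2 c' r' R' E P where
    "0 < \<rho>2" "\<rho>2 < \<rho>" "B (Suc k) holomorphic_on region full \<rho>2"
    "\<And>z. z \<in> closed_region full \<rho>2 \<Longrightarrow> norm (B (Suc k) z) < 2 \<and> deriv (B (Suc k)) z \<noteq> 0 \<and> (1 < norm z \<longrightarrow> 1 < norm (B (Suc k) z))"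
    "compact P" "\<And>u. norm u = 1 \<Longrightarrow> \<exists>p\<in>P. dist p (\<psi> u) < 1 / real (k + 1)"
    "0 < r'" "r' \<le> 1" "if ret k then r' \<le> 1 / real (k + 2) else r' = far_rad (Suc k)"
    "R + 1 \<le> R'" "R' + 19 \<le> dist c' a" "8 * r' \<le> dist c' (a + of_real (R' + 20))"
    "\<And>\<eta>. \<eta> > 0 \<Longrightarrow> \<exists>f'. f' holomorphic_on UNIV \<and> \<not> f' constant_on UNIV \<and>
       (\<forall>z\<in>cball a R. dist (f' z) (f z) < \<eta>) \<and>
       (\<forall>j\<le>k. (f' ^^ j) x0 \<in> ball a R') \<and> dist ((f' ^^ Suc k) x0) (a + of_real (R' + 20)) < \<eta> \<and>
       (\<forall>p\<in>P. dist ((f' ^^ Suc N) p) a < 3/4 \<and> (\<forall>j\<le>N. (f' ^^ j) p \<in> ball a R')) \<and>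
       (\<forall>z\<in>closed_region full \<rho>2. norm ((f' ^^ N') (\<psi> z) - (c' + of_real r' * B (Suc k) z)) < \<eta> \<and>
          (\<forall>j<N'. (f' ^^ j) (\<psi> z) \<in> ball a R') \<and>
          (\<forall>n. N < n \<and> n < N' \<longrightarrow> dist ((f' ^^ n) (\<psi> z)) (E n) < 1 / (2 * real (k + 1))) \<and>
          (ret k \<longrightarrow> dist ((f' ^^ Suc N) (\<psi> z)) x0 < 3/4))"
proof -
  note I = stage_invD[OF inv]
  define F where "F = f ^^ N"
  define y where "y = (f ^^ k) x0"
  define \<rho>1 where "\<rho>1 = \<rho>/2"
  have \<rho>1: "0 < \<rho>1" "\<rho>1 < \<rho>" "\<rho>1 < 1" using I(12,13) by (auto simp: \<rho>1_def)
  have C1: "closed_region full \<rho>1 \<subseteq> region full \<rho>" using closed_region_subset[OF \<rho>1(2)] .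
  have c\<psi>: "continuous_on (closed_region full \<rho>1) \<psi>"
    using holomorphic_on_imp_continuous_on[OF I(14)] C1 by (rule continuous_on_subset)
  have cF: "continuous_on S F" for S unfolding F_def using I(1) by (rule continuous_on_entire_funpow)
  have "compact ((\<lambda>z. F (\<psi> z)) ` closed_region full \<rho>1)"
    by (intro compact_continuous_image compact_closed_region continuous_on_compose2[OF cF c\<psi>]) auto
  moreover have "(\<lambda>z. F (\<psi> z)) ` closed_region full \<rho>1 \<subseteq> ball c s" using I(17) C1 by (auto simp: F_def simp del: mem_ball)
  ultimately obtain s1 where s1: "0 < s1" "s1 < s" "(\<lambda>z. F (\<psi> z)) ` closed_region full \<rho>1 \<subseteq> ball c s1"
    using compact_in_smaller_ball[of _ c s] I(8,10) by (metis less_trans)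
  have Fs1: "F (\<psi> z) \<in> ball c s1" if "z \<in> closed_region full \<rho>1" for z using s1(3) that by blast
  obtain Z where Z: "finite Z" "Z \<subseteq> closed_region full \<rho>1" "\<And>z. z \<in> Z \<Longrightarrow> 1 < norm z"
      "\<And>u. norm u = 1 \<Longrightarrow> \<exists>z\<in>Z. norm (\<psi> z - \<psi> u) < 1 / real (k + 1)"
    using finite_outer_net[OF c\<psi> \<rho>1(1), of "1 / real (k + 1)"] by auto
  have BZ: "1 < norm (B k z)" if "z \<in> Z" for z using I(19) Z C1 that by blast
  obtain \<rho>b where \<rho>b: "\<rho>b > 0" "b k holomorphic_on ball 0 (1 + \<rho>b)"
    using bl[of k] unfolding blaschke_like_def by auto
  obtain \<delta>0 where \<delta>0: "\<delta>0 > 0" "\<delta>0 < \<rho>b" "\<And>z. norm z \<le> 1 + \<delta>0 \<Longrightarrow> norm (b k z) < 1 + 1"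
    using continuous_on_ball_radius[OF holomorphic_on_imp_continuous_on[OF \<rho>b(2)] \<rho>b(1) blaschke_like_le[OF bl] zero_less_one] by metis
  \<comment> \<open>Below half the smallest excess of |B k z| over 1 on the net, so the images of
    net points lie outside the disc of radius 1 + \<delta> on which the polynomial must follow h.
    Below \<delta>0, so that |b k| < 2 on this disc.\<close>
  define \<delta> where "\<delta> = min (\<delta>0/2) (Min (insert 1 ((\<lambda>z. norm (B k z) - 1) ` Z)) / 2)"
  have minpos: "0 < Min (insert 1 ((\<lambda>z. norm (B k z) - 1) ` Z))" using Z(1) BZ by (subst Min_gr_iff) auto
  have \<delta>: "0 < \<delta>" "\<delta> < \<delta>0" using minpos \<delta>0 by (auto simp: \<delta>_def)
  have \<delta>Z: "1 + \<delta> < norm (B k z)" if "z \<in> Z" for z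
  proof -
    have "Min (insert 1 ((\<lambda>z. norm (B k z) - 1) ` Z)) \<le> norm (B k z) - 1" using that Z(1) by (intro Min_le) auto
    then have "\<delta> \<le> (norm (B k z) - 1) / 2" by (simp add: \<delta>_def min_def)
    then show ?thesis using BZ[OF that] by simp
  qed
  have "\<exists>t>0. t \<le> 1 \<and> cball a R \<inter> cball y t = {} \<and> cball c s \<inter> cball y t = {}"
  proof -
    have "y \<in> - (cball a R \<union> cball c s)" using I(6,7) by (simp add: y_def)
    moreover have "open (- (cball a R \<union> cball c s))" by (intro open_Compl closed_Un closed_cball)
    ultimately obtain t where t: "t > 0" "cball y t \<subseteq> - (cball a R \<union> cball c s)" using open_contains_cball by blast
    moreover have "cball y (min t 1) \<subseteq> cball y t" by auto
    ultimately show ?thesis by (intro exI[of _ "min t 1"]) auto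
  qed
  then obtain t where t: "t > 0" "t \<le> 1" "cball a R \<inter> cball y t = {}" "cball c s \<inter> cball y t = {}" by auto
  \<comment> \<open>Large enough to contain the old disc, the station and the channel with a margin
    of 1, and to keep \<open>f a\<close> far from the point Y, which excludes a constant
    map.\<close>
  define R' where "R' = R + real k + dist c a + s + dist y a + dist (f a) a + 5"
  have R': "R' > 0" "R + 1 \<le> R'" using I(3,8,10) by (auto simp: R'_def intro!: add_pos_nonneg add_nonneg_pos)
  define Y where "Y = a + of_real (R' + 20)"
  define v where "v = Y - y"
  obtain c' \<sigma> lam W G E where X: "\<sigma> > 0" "R' + 19 \<le> dist c' a" "c' \<noteq> Y"
    "\<not> ret k \<Longrightarrow> 40 \<le> dist c' Y \<and> \<sigma> = 10 \<and> G = (\<lambda>x. x)"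
    "open W" "continuous_on W G" "lam holomorphic_on ball c' \<sigma>" "lam ` ball c' \<sigma> \<subseteq> W"
    "\<And>w. w \<in> ball c' \<sigma> \<Longrightarrow> G (lam w) = w"
    "\<And>x. ret k \<Longrightarrow> x \<in> W \<Longrightarrow> dist x x0 < 1/2 \<and> (\<forall>j<k. (f ^^ j) x \<in> ball a R) \<and> (f ^^ k) x \<in> ball y t \<and>
       (\<forall>j\<le>k. dist ((f ^^ j) x) (E j) < 1 / (4 * real (k + 1))) \<and> G x = (f ^^ k) x + v"
    by (rule stage_exit[where k=k, OF I(1) _ _ t(1,2) R'(1), folded Y_def, folded y_def, folded v_def])
      (rule I(2), assumption, rule I(5), assumption, (rule that; assumption))
  \<comment> \<open>\<sigma>/4 keeps the target in the domain of \<open>lam\<close>, since |b k| <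
    2; the eighth of the distance keeps Y off the new station; 1/(k + 2) lets the radii of return
    stations tend to 0. In the other case \<sigma> = 10 and the distance 40 leave room for any
    radius up to 1.\<close>
  define r' where "r' = (if ret k then min (min (\<sigma>/4) (dist c' Y / 8)) (1 / real (k + 2)) else far_rad (Suc k))"
  have far: "0 < far_rad (Suc k)" "far_rad (Suc k) \<le> 1" using far_rad[of "Suc k"] by auto
  have r': "0 < r'" "r' \<le> 1" "3 * r' < \<sigma>" "8 * r' \<le> dist c' Y"
  proof -
    have dp: "0 < dist c' Y" using X(3) by simp
    have "1 / real (k + 2) \<le> 1" by simp
    then have "r' \<le> 1" if "ret k" using that unfolding r'_def by (simp add: min.coboundedI2)
    moreover have "r' \<le> \<sigma>/4" "r' \<le> dist c' Y / 8" "0 < r'" if "ret k"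
      using that X(1) dp unfolding r'_def by (simp_all add: min.coboundedI1)
    moreover have "r' \<le> 1" "0 < r'" "\<sigma> = 10" "40 \<le> dist c' Y" if "\<not> ret k"
      using that far X(4)[OF that] by (simp_all add: r'_def)
    ultimately show "0 < r'" "r' \<le> 1" "3 * r' < \<sigma>" "8 * r' \<le> dist c' Y"
      using X(1) by (cases "ret k"; force)+
  qed
  have "B k holomorphic_on region full \<rho>1"
    using I(15) by (rule holomorphic_on_subset) (use C1 region_subset_closed in blast)
  then obtain \<rho>2 where \<rho>2: "0 < \<rho>2" "\<rho>2 < \<rho>1" "B (Suc k) holomorphic_on region full \<rho>2"
    "\<And>z. z \<in> closed_region full \<rho>2 \<Longrightarrow> norm (B k z) < 1 + \<delta> \<and> norm (B (Suc k) z) < 2 \<and> deriv (B (Suc k)) z \<noteq> 0 \<and>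
      (1 < norm z \<longrightarrow> 1 < norm (B (Suc k) z))"
    by (rule stage_regions[OF \<delta>(1) \<rho>1(1)]) (rule that; assumption)
  have C2: "closed_region full \<rho>2 \<subseteq> closed_region full \<rho>1"
    using closed_region_subset[OF \<rho>2(2)] region_subset_closed by blast
  \<comment> \<open>The target pulled back through the rest of the route: G(h w) is the rescaled
    copy of b k w at the new station.\<close>
  define h where "h = (\<lambda>w. lam (c' + of_real r' * b k w))"
  have aff: "c' + of_real r' * b k w \<in> ball c' \<sigma>" if "norm w \<le> 1 + \<delta>0" for w
  proof -
    have "dist c' (c' + of_real r' * b k w) = r' * norm (b k w)" using r'(1) by (simp add: dist_norm norm_mult)
    also have "\<dots> \<le> r' * 2" using \<delta>0(3)[OF that] r'(1) by (intro mult_left_mono) auto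
    finally show ?thesis using r' by simp
  qed
  have hh: "h holomorphic_on ball 0 (1 + \<delta>0)"
  proof -
    have "(\<lambda>w. c' + of_real r' * b k w) holomorphic_on ball 0 (1 + \<delta>0)"
      using \<rho>b(2) \<delta>0(2) by (intro holomorphic_intros) (auto elim!: holomorphic_on_subset)
    then have "lam \<circ> (\<lambda>w. c' + of_real r' * b k w) holomorphic_on ball 0 (1 + \<delta>0)"
      by (rule holomorphic_on_compose_gen[OF _ X(7)]) (use aff in \<open>auto simp del: mem_ball simp: mem_ball_0\<close>)
    then show ?thesis by (simp add: h_def o_def)
  qed
  have hW: "h w \<in> W" and Gh: "G (h w) = c' + of_real r' * b k w" if "norm w \<le> 1 + \<delta>" for w
    using X(8,9) aff[of w] that \<delta>(2) by (auto simp: h_def simp del: mem_ball)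
  define \<Lambda> where "\<Lambda> = h ` cball 0 (1 + \<delta>)"
  have "continuous_on (cball 0 (1 + \<delta>)) h"
    using holomorphic_on_imp_continuous_on[OF hh] by (rule continuous_on_subset) (use \<delta> in auto)
  then have \<Lambda>: "compact \<Lambda>" "\<Lambda> \<subseteq> W" unfolding \<Lambda>_def using hW by (auto intro: compact_continuous_image)
  define P where "P = \<psi> ` Z"
  have "dist c' a \<le> dist c' a" ..
  have Kin: "dist z a \<le> R' - 1" if "z \<in> cball a R \<union> cball c s1 \<union> cball y t" for z
  proof -
    have nn: "0 \<le> dist c a" "0 \<le> dist y a" "0 \<le> dist (f a) a" "0 \<le> real k" "0 < s" "0 < R" using I(3,8,10) by auto
    consider "dist z a \<le> R" | "dist z c \<le> s1" | "dist z y \<le> t" using \<open>z \<in> _\<close> by (auto simp: dist_commute)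
    then show ?thesis
    proof cases
      case 1 then show ?thesis using nn unfolding R'_def by linarith
    next
      case 2 then show ?thesis using nn s1(2) dist_triangle[of z a c] unfolding R'_def by linarith
    next
      case 3 then show ?thesis using nn t(2) dist_triangle[of z a y] unfolding R'_def by linarith
    qed
  qed
  have final: "\<exists>f'. f' holomorphic_on UNIV \<and> \<not> f' constant_on UNIV \<and>
       (\<forall>z\<in>cball a R. dist (f' z) (f z) < \<eta>) \<and>
       (\<forall>j\<le>k. (f' ^^ j) x0 \<in> ball a R') \<and> dist ((f' ^^ Suc k) x0) Y < \<eta> \<and>
       (\<forall>p\<in>P. dist ((f' ^^ Suc N) p) a < 3/4 \<and> (\<forall>j\<le>N. (f' ^^ j) p \<in> ball a R')) \<and>
       (\<forall>z\<in>closed_region full \<rho>2. norm ((f' ^^ N') (\<psi> z) - (c' + of_real r' * B (Suc k) z)) < \<eta> \<and>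
          (\<forall>j<N'. (f' ^^ j) (\<psi> z) \<in> ball a R') \<and>
          (\<forall>n. N < n \<and> n < N' \<longrightarrow> dist ((f' ^^ n) (\<psi> z)) (E (n - Suc N)) < 1 / (2 * real (k + 1))) \<and>
          (ret k \<longrightarrow> dist ((f' ^^ Suc N) (\<psi> z)) x0 < 3/4))" if \<eta>0: "\<eta>0 > 0" and \<eta>: "\<eta> = min \<eta>0 1" for \<eta>0 \<eta>
  proof -
    have \<eta>p: "\<eta> > 0" "\<eta> \<le> 1" using \<eta>0 by (auto simp: \<eta>)
    obtain d1 where d1: "d1 > 0" "\<And>x x'. x \<in> \<Lambda> \<Longrightarrow> dist x' x < d1 \<Longrightarrow> x' \<in> W \<and> dist (G x') (G x) < \<eta>/2"
      using compact_uniform_nbhd[OF \<Lambda>(1) X(5) \<Lambda>(2) X(6), of "\<eta>/2"] \<eta>p by auto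
    \<comment> \<open>The one polynomial that sends the curve on its way and the images of the net
      points to a.\<close>
    obtain q where q: "\<And>w. norm w \<le> 1 + \<delta> \<Longrightarrow> norm (poly q w - h w) < min d1 (1/2)"
        "\<And>w. w \<in> B k ` Z \<Longrightarrow> norm (poly q w - a) < min d1 (1/2)"
    proof (rule Runge_disc_points[OF hh, of "1 + \<delta>" "B k ` Z" "min d1 (1/2)" a])
      show "1 + \<delta> < norm p" if "p \<in> B k ` Z" for p using that \<delta>Z by auto
    qed (use \<delta> d1(1) Z(1) in auto)
    \<comment> \<open>By the exact equation for \<theta>, this makes the model orbit of \<psi> z
      reach q(B k z) one step after the station.\<close>
    define T where "T = (\<lambda>w. poly q (\<theta> w))"
    have T: "T holomorphic_on ball c s" unfolding T_def using I(16) by (intro holomorphic_intros)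
    define M where "M = model_map a f R c s1 T v"
    define K where "K = cball a R \<union> cball c s1 \<union> cball y t"
    have disj: "cball a R \<inter> cball c s1 = {}" "cball c s1 \<inter> cball y t = {}"
    proof -
      have "cball c s1 \<subseteq> cball c s" using s1(2) by auto
      then show "cball a R \<inter> cball c s1 = {}" "cball c s1 \<inter> cball y t = {}" using I(11) t(4) by blast+
    qed
    have K: "compact K" unfolding K_def by (intro compact_Un compact_cball)
    have cM: "continuous_on K M" unfolding K_def M_def
      by (rule continuous_on_model_map[OF I(1) T]) (use s1 I(3) t disj in auto)
    have MF: "\<And>j. j \<le> N \<Longrightarrow> (M ^^ j) (\<psi> z) \<in> interior K" "(M ^^ Suc N) (\<psi> z) = poly q (B k z)"
      if z: "z \<in> closed_region full \<rho>1" for z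
    proof -
      have zr: "z \<in> region full \<rho>" using z C1 by auto
      have o: "(f ^^ N) (\<psi> z) \<in> ball c s1" using Fs1[OF z] by (simp add: F_def)
      show "(M ^^ j) (\<psi> z) \<in> interior K" if "j \<le> N" for j
        unfolding M_def K_def using model_orbit_station(2)[OF I(20)[OF zr] o disj(1) that] .
      show "(M ^^ Suc N) (\<psi> z) = poly q (B k z)"
        unfolding M_def using model_orbit_station(1)[OF I(20)[OF zr] o disj(1)] I(18)[OF zr] by (simp add: T_def)
    qed
    have qW: "poly q (B k z) \<in> W" "dist (G (poly q (B k z))) (c' + of_real r' * B (Suc k) z) < \<eta>/2"
      if z: "z \<in> closed_region full \<rho>2" for z
    proof -
      have n: "norm (B k z) \<le> 1 + \<delta>" using \<rho>2(4)[OF z] by simp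
      have "h (B k z) \<in> \<Lambda>" using n by (simp add: \<Lambda>_def)
      moreover have "dist (poly q (B k z)) (h (B k z)) < d1" using q(1)[OF n] by (simp add: dist_norm)
      ultimately have "poly q (B k z) \<in> W \<and> dist (G (poly q (B k z))) (G (h (B k z))) < \<eta>/2" by (rule d1(2))
      then show "poly q (B k z) \<in> W" "dist (G (poly q (B k z))) (c' + of_real r' * B (Suc k) z) < \<eta>/2"
        unfolding Gh[OF n] by simp_all
    qed
    have MN: "(M ^^ (Suc N + j)) (\<psi> z) = (M ^^ j) (poly q (B k z))" if "z \<in> closed_region full \<rho>1" for z j
      using MF(2)[OF that] funpow_add[of j "Suc N" M] by (simp add: add.commute del: funpow.simps)
    have Mret: "\<And>j. j \<le> k \<Longrightarrow> (M ^^ j) x = (f ^^ j) x \<and> (M ^^ j) x \<in> interior K" "(M ^^ Suc k) x = G x"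
      if "ret k" "x \<in> W" for x
    proof -
      have x: "\<And>j. j < k \<Longrightarrow> (f ^^ j) x \<in> ball a R" "(f ^^ k) x \<in> ball y t" "G x = (f ^^ k) x + v"
        using X(10)[OF that] by auto
      show "(M ^^ j) x = (f ^^ j) x \<and> (M ^^ j) x \<in> interior K" if "j \<le> k" for j
        unfolding M_def K_def using model_orbit[OF x(1) that] model_orbit_channel(2)[OF x(1,2) t(3) disj(2) that] by auto
      show "(M ^^ Suc k) x = G x"
        unfolding M_def using model_orbit_channel(1)[OF x(1,2) t(3) disj(2)] x(3) by simp
    qed
    have M1: "(M ^^ j) (\<psi> z) \<in> interior K" if z: "z \<in> closed_region full \<rho>2" and j: "j < N'" for z j
    proof (cases "j \<le> N")
      case True then show ?thesis using MF(1) z C2 by blast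
    next
      case False
      then have r: "ret k" and j': "j = Suc N + (j - Suc N)" "j - Suc N \<le> k" using j by (auto simp: N'_def split: if_splits)
      have "(M ^^ j) (\<psi> z) = (M ^^ (j - Suc N)) (poly q (B k z))" using MN[of z "j - Suc N"] j'(1) z C2 by (metis subsetD)
      then show ?thesis using Mret(1)[OF r qW(1)[OF z] j'(2)] by metis
    qed
    have M2: "(M ^^ N') (\<psi> z) = G (poly q (B k z))" if z: "z \<in> closed_region full \<rho>2" for z
    proof (cases "ret k")
      case True
      then have "N' = Suc N + Suc k" by (simp add: N'_def)
      moreover have "(M ^^ (Suc N + Suc k)) (\<psi> z) = (M ^^ Suc k) (poly q (B k z))" using MN z C2 by blast
      ultimately show ?thesis using Mret(2)[OF True qW(1)[OF z]] by metis
    next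
      case False
      then have "N' = Suc N" by (simp add: N'_def)
      moreover have "(M ^^ Suc N) (\<psi> z) = poly q (B k z)" using MF(2) z C2 by blast
      ultimately show ?thesis using X(4)[OF False] by metis
    qed
    have x0K: "(M ^^ j) x0 \<in> interior K" if "j \<le> k" for j
      unfolding M_def K_def using model_orbit_channel(2)[OF I(5) _ t(3) disj(2) that] t(1) by (auto simp: y_def)
    have x0Y: "(M ^^ Suc k) x0 = Y"
      unfolding M_def using model_orbit_channel(1)[OF I(5) _ t(3) disj(2)] t(1) by (auto simp: y_def v_def simp del: funpow.simps)
    \<comment> \<open>Half of the deviation 1/(2(k + 1)) allowed during a return; the other half was
      used up by the neighbourhood W.\<close>
    define \<eta>' where "\<eta>' = min (\<eta>/2) (1 / (4 * real (k + 1)))"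
    have \<eta>': "\<eta>' > 0" "\<eta>' \<le> \<eta>/2" "\<eta>' \<le> 1 / (4 * real (k + 1))" using \<eta>p by (auto simp: \<eta>'_def)
    have \<eta>'4: "\<eta>' \<le> 1/4"
    proof -
      have "1 / (4 * real (k + 1)) \<le> 1 / 4" by (intro frac_le) auto
      then show ?thesis using \<eta>'(3) by linarith
    qed
    have cmp1: "compact (\<psi> ` closed_region full \<rho>2)"
      using continuous_on_subset[OF c\<psi> C2] by (intro compact_continuous_image compact_closed_region)
    obtain d2 where d2: "d2 > 0" "\<And>g. (\<forall>z\<in>K. dist (g z) (M z) \<le> d2) \<Longrightarrow>
           (\<forall>z\<in>\<psi> ` closed_region full \<rho>2. \<forall>w. dist w z \<le> d2 \<longrightarrow> (\<forall>j\<le>N'. dist ((g ^^ j) w) ((M ^^ j) z) < \<eta>'))"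
      using iterate_stable[OF K cM cmp1 _ \<eta>'(1), of N'] M1 by blast
    have cmp2: "compact P" unfolding P_def using Z(1) by (intro finite_imp_compact) auto
    have "(M ^^ j) ` P \<subseteq> interior K" if "j < Suc N" for j unfolding P_def using MF(1)[of _ j] that Z(2) by auto
    then obtain d3 where d3: "d3 > 0" "\<And>g. (\<forall>z\<in>K. dist (g z) (M z) \<le> d3) \<Longrightarrow>
           (\<forall>z\<in>P. \<forall>w. dist w z \<le> d3 \<longrightarrow> (\<forall>j\<le>Suc N. dist ((g ^^ j) w) ((M ^^ j) z) < \<eta>'))"
      using iterate_stable[OF K cM cmp2 _ \<eta>'(1), of "Suc N"] by metis
    have "(M ^^ j) ` {x0} \<subseteq> interior K" if "j < Suc k" for j using x0K that by simp
    then obtain d4 where d4: "d4 > 0" "\<And>g. (\<forall>z\<in>K. dist (g z) (M z) \<le> d4) \<Longrightarrow>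
           (\<forall>z\<in>{x0}. \<forall>w. dist w z \<le> d4 \<longrightarrow> (\<forall>j\<le>Suc k. dist ((g ^^ j) w) ((M ^^ j) z) < \<eta>'))"
      using iterate_stable[OF K cM compact_sing _ \<eta>'(1), of "Suc k" x0] by metis
    define d where "d = min (min d2 d3) (min d4 \<eta>')"
    have d: "d > 0" "d \<le> d2" "d \<le> d3" "d \<le> d4" "d \<le> \<eta>'" using d2 d3 d4 \<eta>' by (auto simp: d_def)
    obtain f' where f': "f' holomorphic_on UNIV" "\<And>z. z \<in> K \<Longrightarrow> norm (f' z - M z) < d"
      using model_map_approx[OF I(1) T, of s1 R t a y d] s1 I(3) t disj d(1) unfolding K_def M_def by (metis less_imp_le order_trans zero_le_numeral)
    have g2: "dist ((f' ^^ j) (\<psi> z)) ((M ^^ j) (\<psi> z)) < \<eta>'" if "z \<in> closed_region full \<rho>2" "j \<le> N'" for z j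
    proof -
      have "\<forall>z\<in>K. dist (f' z) (M z) \<le> d2" using f'(2) d(2) by (auto simp: dist_norm intro: less_imp_le less_le_trans)
      from d2(2)[OF this] show ?thesis using that d2(1) by auto
    qed
    have g3: "dist ((f' ^^ j) p) ((M ^^ j) p) < \<eta>'" if "p \<in> P" "j \<le> Suc N" for p j
    proof -
      have "\<forall>z\<in>K. dist (f' z) (M z) \<le> d3" using f'(2) d(3) by (auto simp: dist_norm intro: less_imp_le less_le_trans)
      from d3(2)[OF this] show ?thesis using that d3(1) by auto
    qed
    have g4: "dist ((f' ^^ j) x0) ((M ^^ j) x0) < \<eta>'" if "j \<le> Suc k" for j
    proof -
      have "\<forall>z\<in>K. dist (f' z) (M z) \<le> d4" using f'(2) d(4) by (auto simp: dist_norm intro: less_imp_le less_le_trans)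
      from d4(2)[OF this] show ?thesis using that d4(1) by auto
    qed
    have inR: "w \<in> ball a R'" if "dist w m < \<eta>'" "m \<in> interior K" for w m
    proof -
      have "m \<in> K" using that(2) interior_subset by blast
      then have "dist m a \<le> R' - 1" using Kin by (simp add: K_def)
      then show ?thesis using that(1) \<eta>'4 dist_triangle[of w a m] by (simp add: dist_commute)
    qed
    have fa: "dist (f' z) (f z) < \<eta>" if "z \<in> cball a R" for z
    proof -
      have "M z = f z" using that by (simp add: M_def model_map_def)
      then show ?thesis using f'(2)[of z] that d(5) \<eta>'(2) \<eta>p by (simp add: K_def dist_norm)
    qed
    \<comment> \<open>The value at a stays near f a, whereas the k-th orbit point of
      \<open>x0\<close> is mapped near the distant point Y.\<close>
    have nonconst: "\<not> f' constant_on UNIV"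
    proof
      assume "f' constant_on UNIV"
      then have "f' ((f' ^^ k) x0) = f' a" by (metis constant_on_def UNIV_I)
      then have "dist (f' a) Y < \<eta>'" using g4[of "Suc k"] x0Y by (simp del: funpow.simps add: funpow.simps(2))
      moreover have "dist (f' a) (f a) < \<eta>" using fa[of a] I(3) by simp
      ultimately have "dist Y (f a) < 2"
        using dist_triangle[of Y "f a" "f' a"] \<eta>'4 \<eta>p(2) by (simp add: dist_commute)
      moreover have "dist Y a = R' + 20"
      proof -
        have "dist Y a = norm (of_real (R' + 20) :: complex)" by (simp add: Y_def dist_norm)
        then show ?thesis using R'(1) by (simp only: norm_of_real)
      qed
      moreover have "dist (f a) a + 5 \<le> R'"
        using I(3,8,10) zero_le_dist[of c a] zero_le_dist[of y a] unfolding R'_def by linarith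
      ultimately show False using dist_triangle[of Y a "f a"] by linarith
    qed
    show ?thesis
    proof (intro exI[of _ f'] conjI ballI allI impI)
      show "f' holomorphic_on UNIV" "\<not> f' constant_on UNIV" by fact+
      show "dist (f' z) (f z) < \<eta>" if "z \<in> cball a R" for z using fa that .
      show "(f' ^^ j) x0 \<in> ball a R'" if "j \<le> k" for j using inR[OF g4[of j] x0K[OF that]] that by simp
      show "dist ((f' ^^ Suc k) x0) Y < \<eta>" using g4[of "Suc k"] x0Y \<eta>' \<eta>p by (simp del: funpow.simps)
      fix p assume p: "p \<in> P"
      then obtain z where z: "z \<in> Z" "p = \<psi> z" by (auto simp: P_def)
      have "dist ((M ^^ Suc N) p) a < 1/2"
        using q(2)[of "B k z"] MF(2)[of z] z Z(2) by (auto simp: dist_norm simp del: funpow.simps)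
      then show "dist ((f' ^^ Suc N) p) a < 3/4"
        using g3[OF p, of "Suc N"] \<eta>'4 dist_triangle[of "(f' ^^ Suc N) p" a "(M ^^ Suc N) p"] by (simp del: funpow.simps)
      show "(f' ^^ j) p \<in> ball a R'" if "j \<le> N" for j
        using inR[OF g3[OF p, of j]] MF(1)[of z j] z Z(2) that by auto
    next
      fix z assume z: "z \<in> closed_region full \<rho>2"
      show "norm ((f' ^^ N') (\<psi> z) - (c' + of_real r' * B (Suc k) z)) < \<eta>"
        using g2[OF z order_refl] qW(2)[OF z, folded M2[OF z]] \<eta>'(2)
          dist_triangle[of "(f' ^^ N') (\<psi> z)" "c' + of_real r' * B (Suc k) z" "(M ^^ N') (\<psi> z)"]
        unfolding dist_norm by linarith
      show "(f' ^^ j) (\<psi> z) \<in> ball a R'" if "j < N'" for j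
        using inR[OF g2[OF z, of j] M1[OF z that]] that by simp
      show "dist ((f' ^^ n) (\<psi> z)) (E (n - Suc N)) < 1 / (2 * real (k + 1))" if n: "N < n \<and> n < N'" for n
      proof -
        have r: "ret k" and j': "n = Suc N + (n - Suc N)" "n - Suc N \<le> k" using n by (auto simp: N'_def split: if_splits)
        have "(M ^^ n) (\<psi> z) = (M ^^ (n - Suc N)) (poly q (B k z))" using MN[of z "n - Suc N"] j'(1) z C2 by (metis subsetD)
        also have "\<dots> = (f ^^ (n - Suc N)) (poly q (B k z))" using Mret(1)[OF r qW(1)[OF z] j'(2)] by metis
        finally have "dist ((M ^^ n) (\<psi> z)) (E (n - Suc N)) < 1 / (4 * real (k + 1))"
          using X(10)[OF r qW(1)[OF z]] j'(2) by simp
        moreover have "dist ((f' ^^ n) (\<psi> z)) ((M ^^ n) (\<psi> z)) < 1 / (4 * real (k + 1))"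
          using g2[OF z, of n] n \<eta>'(3) by simp
        moreover have "1 / (4 * real (k + 1)) + 1 / (4 * real (k + 1)) = 1 / (2 * real (k + 1))" by (simp add: field_simps)
        ultimately show ?thesis
          by (metis le_less_trans[OF dist_triangle add_strict_mono])
      qed
      assume r: "ret k"
      have "(M ^^ Suc N) (\<psi> z) = poly q (B k z)" using MF(2) z C2 by blast
      then have "dist ((M ^^ Suc N) (\<psi> z)) x0 < 1/2" using X(10)[OF r qW(1)[OF z]] by simp
      moreover have "dist ((f' ^^ Suc N) (\<psi> z)) ((M ^^ Suc N) (\<psi> z)) < 1/4"
        using g2[OF z, of "Suc N"] r \<eta>'4 by (simp add: N'_def del: funpow.simps)
      ultimately show "dist ((f' ^^ Suc N) (\<psi> z)) x0 < 3/4"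
        using dist_triangle[of "(f' ^^ Suc N) (\<psi> z)" x0 "(M ^^ Suc N) (\<psi> z)"] by linarith
    qed
  qed
  show thesis
  proof (rule that[of \<rho>2 P r' R' c' "\<lambda>n. E (n - Suc N)"])
    show "\<exists>p\<in>P. dist p (\<psi> u) < 1 / real (k + 1)" if "norm u = 1" for u
      using Z(4)[OF that] by (auto simp: P_def dist_norm)
    show "compact P" unfolding P_def using Z(1) by (intro finite_imp_compact) auto
    show "if ret k then r' \<le> 1 / real (k + 2) else r' = far_rad (Suc k)" by (simp add: r'_def)
    show "\<rho>2 < \<rho>" using \<rho>2 \<rho>1 by simp
    show "8 * r' \<le> dist c' (a + of_real (R' + 20))" using r' by (simp add: Y_def)
    fix \<eta>0 :: real assume \<eta>0: "\<eta>0 > 0"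
    define \<eta> where "\<eta> = min \<eta>0 1"
    have "\<eta> \<le> \<eta>0" by (simp add: \<eta>_def)
    with final[OF \<eta>0 \<eta>_def] show "\<exists>f'. f' holomorphic_on UNIV \<and> \<not> f' constant_on UNIV \<and>
       (\<forall>z\<in>cball a R. dist (f' z) (f z) < \<eta>0) \<and>
       (\<forall>j\<le>k. (f' ^^ j) x0 \<in> ball a R') \<and> dist ((f' ^^ Suc k) x0) (a + of_real (R' + 20)) < \<eta>0 \<and>
       (\<forall>p\<in>P. dist ((f' ^^ Suc N) p) a < 3/4 \<and> (\<forall>j\<le>N. (f' ^^ j) p \<in> ball a R')) \<and>
       (\<forall>z\<in>closed_region full \<rho>2. norm ((f' ^^ N') (\<psi> z) - (c' + of_real r' * B (Suc k) z)) < \<eta>0 \<and>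
          (\<forall>j<N'. (f' ^^ j) (\<psi> z) \<in> ball a R') \<and>
          (\<forall>n. N < n \<and> n < N' \<longrightarrow> dist ((f' ^^ n) (\<psi> z)) (E (n - Suc N)) < 1 / (2 * real (k + 1))) \<and>
          (ret k \<longrightarrow> dist ((f' ^^ Suc N) (\<psi> z)) x0 < 3/4))"
      unfolding Y_def by (elim exE conjE, intro exI conjI) (auto intro: less_le_trans simp del: funpow.simps blaschke_iter.simps mem_ball mem_cball)
  qed (use \<rho>2 r' R' X in auto)
qed

end

section \<open>One stage: correcting the curve or the chart\<close>

context wandering_construction
begin

lemma stage_step:
  assumes inv: "stage_inv k f \<psi> \<theta> c r s N R \<rho> e"
  shows "\<exists>f' \<psi>' \<theta>' c' r' s' N' R' \<rho>' e'. stage_inv (Suc k) f' \<psi>' \<theta>' c' r' s' N' R' \<rho>' e' \<and>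
           stage_trans k f \<psi> N R \<rho> e f' \<psi>' r' N' R' \<rho>' e'"
proof -
  note I = stage_invD[OF inv]
  define N' where "N' = (if ret k then N + k + 2 else N + 1)"
  obtain \<rho>2 c' r' R' E P where X:
    "0 < \<rho>2" "\<rho>2 < \<rho>" "B (Suc k) holomorphic_on region full \<rho>2"
    "\<And>z. z \<in> closed_region full \<rho>2 \<Longrightarrow> norm (B (Suc k) z) < 2 \<and> deriv (B (Suc k)) z \<noteq> 0 \<and> (1 < norm z \<longrightarrow> 1 < norm (B (Suc k) z))"
    "compact P" "\<And>u. norm u = 1 \<Longrightarrow> \<exists>p\<in>P. dist p (\<psi> u) < 1 / real (k + 1)"
    "0 < r'" "r' \<le> 1" "if ret k then r' \<le> 1 / real (k + 2) else r' = far_rad (Suc k)"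
    "R + 1 \<le> R'" "R' + 19 \<le> dist c' a" "8 * r' \<le> dist c' (a + of_real (R' + 20))"
    and ext: "\<And>\<eta>. \<eta> > 0 \<Longrightarrow> \<exists>f'. f' holomorphic_on UNIV \<and> \<not> f' constant_on UNIV \<and>
       (\<forall>z\<in>cball a R. dist (f' z) (f z) < \<eta>) \<and>
       (\<forall>j\<le>k. (f' ^^ j) x0 \<in> ball a R') \<and> dist ((f' ^^ Suc k) x0) (a + of_real (R' + 20)) < \<eta> \<and>
       (\<forall>p\<in>P. dist ((f' ^^ Suc N) p) a < 3/4 \<and> (\<forall>j\<le>N. (f' ^^ j) p \<in> ball a R')) \<and>
       (\<forall>z\<in>closed_region full \<rho>2. norm ((f' ^^ N') (\<psi> z) - (c' + of_real r' * B (Suc k) z)) < \<eta> \<and>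
          (\<forall>j<N'. (f' ^^ j) (\<psi> z) \<in> ball a R') \<and>
          (\<forall>n. N < n \<and> n < N' \<longrightarrow> dist ((f' ^^ n) (\<psi> z)) (E n) < 1 / (2 * real (k + 1))) \<and>
          (ret k \<longrightarrow> dist ((f' ^^ Suc N) (\<psi> z)) x0 < 3/4))"
    by (rule stage_extend[OF inv, folded N'_def]) (rule that; assumption)
  define Y where "Y = a + of_real (R' + 20)"
  \<comment> \<open>Two shrinkings: the first gives the compact set S for the Newton lemma, the
    second an open region inside the interior of S, where \<sigma> is holomorphic.\<close>
  define \<rho>3 where "\<rho>3 = \<rho>2/2"
  define \<rho>' where "\<rho>' = \<rho>3/2"
  have \<rho>: "0 < \<rho>3" "\<rho>3 < \<rho>2" "\<rho>3 < 1" "0 < \<rho>'" "\<rho>' < \<rho>3" "\<rho>' < \<rho>" "\<rho>' < 1"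
    using X(1,2) I(12,13) by (auto simp: \<rho>3_def \<rho>'_def)
  define \<tau>' where "\<tau>' = min (e/2) (\<tau> k \<rho>')"
  have \<tau>': "\<tau>' > 0" using I(23) \<tau>[OF \<rho>(4)] by (simp add: \<tau>'_def)
  have C2: "closed_region full \<rho>2 \<subseteq> region full \<rho>" using closed_region_subset[OF X(2)] .
  have c\<psi>: "continuous_on (closed_region full \<rho>2) \<psi>"
    using holomorphic_on_imp_continuous_on[OF I(14)] C2 by (rule continuous_on_subset)
  obtain \<eta>2 where \<eta>2: "\<eta>2 > 0" "\<And>x y. x \<in> closed_region full \<rho>2 \<Longrightarrow> y \<in> closed_region full \<rho>2 \<Longrightarrow> dist y x < \<eta>2 \<Longrightarrow> dist (\<psi> y) (\<psi> x) < \<tau>'"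
    using compact_uniformly_continuous[OF c\<psi> compact_closed_region] \<tau>' unfolding uniformly_continuous_on_def by meson
  define \<Omega> where "\<Omega> = region full \<rho>2"
  define S where "S = closed_region full \<rho>3"
  have \<Omega>: "open \<Omega>" "\<Omega> \<subseteq> closed_region full \<rho>2" by (auto simp: \<Omega>_def open_region region_subset_closed)
  have S: "compact S" "S \<subseteq> \<Omega>" using closed_region_subset[OF \<rho>(2)] by (auto simp: S_def \<Omega>_def compact_closed_region)
  have nz: "deriv (B (Suc k)) z \<noteq> 0" if "z \<in> S" for z using that S \<Omega> X(4) by blast
  have "min (\<eta>2/2) (\<rho>3/4) > 0" using \<eta>2 \<rho> by simp
  from holomorphic_newton_near[OF X(3)[folded \<Omega>_def] \<Omega>(1) S nz this]
  obtain \<epsilon>N \<kappa> where Nw: "\<epsilon>N > 0" "\<kappa> > 0" "\<kappa> \<le> min (\<eta>2/2) (\<rho>3/4)"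
    "\<And>Q. Q holomorphic_on \<Omega> \<Longrightarrow> (\<forall>z\<in>\<Omega>. norm (Q z - B (Suc k) z) \<le> \<epsilon>N) \<Longrightarrow>
     (\<exists>\<sigma>. \<sigma> holomorphic_on interior S \<and>
        (\<forall>z\<in>S. norm (\<sigma> z - z) \<le> \<kappa> \<and> \<sigma> z \<in> \<Omega> \<and> Q (\<sigma> z) = B (Suc k) z \<and>
           (\<forall>w. norm (w - z) \<le> \<kappa> \<and> Q w = B (Suc k) z \<longrightarrow> w = \<sigma> z)))" by blast
  \<comment> \<open>In order: the Newton tolerance; in the full case z must be within \<kappa> of Q
    z for uniqueness to apply; the accuracy required on the circle; the image must stay in a station
    of relative radius 1 + \<rho>3.\<close>
  define err where "err = min (min \<epsilon>N \<kappa>) (min (\<epsilon> (Suc k) / 2) (\<rho>3/4))"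
  have err: "err > 0" "err \<le> \<epsilon>N" "err \<le> \<kappa>" "err \<le> \<epsilon> (Suc k) / 2" "err \<le> \<rho>3/4"
    using Nw \<epsilon>[of "Suc k"] \<rho> by (auto simp: err_def)
  define D where "D = dist c' Y"
  have D: "8 * r' \<le> D" using X(12) by (simp add: D_def Y_def)
  \<comment> \<open>Besides the rescaled error and the budget e/2 for changing f, the bounds 1/2 and
    D/4 keep the new exit point of \<open>x0\<close> outside the disc and the station.\<close>
  define \<eta> where "\<eta> = min (min (r' * err) (e/2)) (min (1/2) (D/4))"
  have \<eta>: "\<eta> > 0" "\<eta> \<le> r' * err" "\<eta> \<le> e/2" "\<eta> \<le> 1/2" "\<eta> \<le> D/4"
    using X(7) err(1) I(23) D by (auto simp: \<eta>_def)
  obtain f' where f': "f' holomorphic_on UNIV" "\<not> f' constant_on UNIV"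
       "\<And>z. z \<in> cball a R \<Longrightarrow> dist (f' z) (f z) < \<eta>"
       "\<And>j. j \<le> k \<Longrightarrow> (f' ^^ j) x0 \<in> ball a R'" "dist ((f' ^^ Suc k) x0) Y < \<eta>"
       "\<And>p. p \<in> P \<Longrightarrow> dist ((f' ^^ Suc N) p) a < 3/4" "\<And>p j. p \<in> P \<Longrightarrow> j \<le> N \<Longrightarrow> (f' ^^ j) p \<in> ball a R'"
       "\<And>z. z \<in> closed_region full \<rho>2 \<Longrightarrow> norm ((f' ^^ N') (\<psi> z) - (c' + of_real r' * B (Suc k) z)) < \<eta>"
       "\<And>z j. z \<in> closed_region full \<rho>2 \<Longrightarrow> j < N' \<Longrightarrow> (f' ^^ j) (\<psi> z) \<in> ball a R'"
       "\<And>z n. z \<in> closed_region full \<rho>2 \<Longrightarrow> N < n \<Longrightarrow> n < N' \<Longrightarrow> dist ((f' ^^ n) (\<psi> z)) (E n) < 1 / (2 * real (k + 1))"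
       "\<And>z. z \<in> closed_region full \<rho>2 \<Longrightarrow> ret k \<Longrightarrow> dist ((f' ^^ Suc N) (\<psi> z)) x0 < 3/4"
    using ext[OF \<eta>(1)] unfolding Y_def by blast
  define Q where "Q = (\<lambda>z. ((f' ^^ N') (\<psi> z) - c') / of_real r')"
  have r0: "of_real r' \<noteq> (0::complex)" using X(7) by simp
  have FQ: "(f' ^^ N') (\<psi> z) = c' + of_real r' * Q z" for z using r0 by (simp add: Q_def)
  have Qerr: "norm (Q z - B (Suc k) z) \<le> err" if "z \<in> closed_region full \<rho>2" for z
  proof -
    have "c' + of_real r' * Q z - (c' + of_real r' * B (Suc k) z) = of_real r' * (Q z - B (Suc k) z)"
      by (simp only: right_diff_distrib add_diff_cancel_left)
    then have "r' * norm (Q z - B (Suc k) z) < r' * err"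
      using f'(8)[OF that] \<eta>(2) X(7) unfolding FQ by (simp only: norm_mult norm_of_real)
    then show ?thesis using X(7) by simp
  qed
  have \<psi>\<Omega>: "\<psi> holomorphic_on \<Omega>" using I(14) by (rule holomorphic_on_subset) (use \<Omega>(2) C2 in blast)
  have "(f' ^^ N') \<circ> \<psi> holomorphic_on \<Omega>"
    by (rule holomorphic_on_compose_gen[OF \<psi>\<Omega> holomorphic_on_funpow[OF f'(1)]]) auto
  then have "Q holomorphic_on \<Omega>" unfolding Q_def o_def using r0 by (intro holomorphic_intros) auto
  moreover have "\<forall>z\<in>\<Omega>. norm (Q z - B (Suc k) z) \<le> \<epsilon>N" using Qerr \<Omega>(2) err(2) by force
  ultimately obtain \<sigma> where \<sigma>: "\<sigma> holomorphic_on interior S" "\<And>z. z \<in> S \<Longrightarrow> norm (\<sigma> z - z) \<le> \<kappa>"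
      "\<And>z. z \<in> S \<Longrightarrow> \<sigma> z \<in> \<Omega>" "\<And>z. z \<in> S \<Longrightarrow> Q (\<sigma> z) = B (Suc k) z"
      "\<And>z w. z \<in> S \<Longrightarrow> norm (w - z) \<le> \<kappa> \<Longrightarrow> Q w = B (Suc k) z \<Longrightarrow> w = \<sigma> z"
    using Nw(4) by blast
  \<comment> \<open>Reparametrizing the curve by \<sigma> makes it trace \<open>B (Suc k)\<close>
    exactly. In the full case the unit disc may not move, so \<sigma> enters the chart
    instead.\<close>
  define \<zeta> where "\<zeta> = (if full then (\<lambda>z. z) else \<sigma>)"
  define \<psi>' where "\<psi>' = (\<lambda>z. \<psi> (\<zeta> z))"
  define \<theta>' where "\<theta>' = (if full then (\<lambda>w. \<sigma> ((w - c') / of_real r')) else (\<lambda>w. (w - c') / of_real r'))"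
  define s' where "s' = (if full then r' * (1 + \<rho>3) else 2 * r')"
  have s': "r' < s'" "s' \<le> 2 * r'" using X(7) \<rho> by (auto simp: s'_def)
  have RS: "region full \<rho>' \<subseteq> interior S" "region full \<rho>3 \<subseteq> interior S"
    using region_subset_interior[of full \<rho>3] region_mono[of \<rho>' \<rho>3 full] \<rho> by (auto simp: S_def)
  have zS: "z \<in> S" if "z \<in> region full \<rho>'" for z using that RS(1) interior_subset by blast
  have \<zeta>\<Omega>: "\<zeta> z \<in> \<Omega>" if "z \<in> region full \<rho>'" for z
    using zS[OF that] S(2) \<sigma>(3) by (auto simp: \<zeta>_def)
  have \<zeta>2: "\<zeta> z \<in> closed_region full \<rho>2" if "z \<in> region full \<rho>'" for z using \<zeta>\<Omega>[OF that] \<Omega>(2) by blast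
  have \<zeta>\<kappa>: "norm (\<zeta> z - z) \<le> \<kappa>" if "z \<in> region full \<rho>'" for z
    using \<sigma>(2)[OF zS[OF that]] Nw(2) by (auto simp: \<zeta>_def)
  have \<psi>'\<psi>: "norm (\<psi>' z - \<psi> z) \<le> \<tau>'" if z: "z \<in> region full \<rho>'" for z
  proof -
    have "z \<in> closed_region full \<rho>2" using zS[OF z] S(2) \<Omega>(2) by blast
    moreover have "dist (\<zeta> z) z < \<eta>2" using \<zeta>\<kappa>[OF z] Nw(3) \<eta>2(1) by (simp add: dist_norm)
    ultimately have "dist (\<psi> (\<zeta> z)) (\<psi> z) < \<tau>'" using \<eta>2(2) \<zeta>2[OF z] by blast
    then show ?thesis by (simp add: \<psi>'_def dist_norm)
  qed
  have \<psi>'h: "\<psi>' holomorphic_on region full \<rho>'"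
  proof -
    have "\<zeta> holomorphic_on region full \<rho>'"
      using \<sigma>(1) RS(1) by (auto simp: \<zeta>_def intro: holomorphic_on_subset)
    then have "\<psi> \<circ> \<zeta> holomorphic_on region full \<rho>'"
      by (rule holomorphic_on_compose_gen[OF _ \<psi>\<Omega>]) (use \<zeta>\<Omega> in blast)
    then show ?thesis by (simp add: \<psi>'_def o_def)
  qed
  have F': "(f' ^^ N') (\<psi>' z) = c' + of_real r' * Q (\<zeta> z)" for z unfolding \<psi>'_def FQ ..
  have Q\<zeta>: "norm (Q (\<zeta> z) - B (Suc k) z) \<le> err" if z: "z \<in> region full \<rho>'" for z
  proof (cases full)
    case True then show ?thesis using Qerr[OF \<zeta>2[OF z]] by (simp add: \<zeta>_def del: blaschke_iter.simps)
  next
    case False then show ?thesis using \<sigma>(4)[OF zS[OF z]] err(1) by (simp add: \<zeta>_def del: blaschke_iter.simps)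
  qed
  have inball: "(f' ^^ N') (\<psi>' z) \<in> ball c' s'" if z: "z \<in> region full \<rho>'" for z
  proof -
    have "r' * norm (Q (\<zeta> z)) < s'"
    proof (cases full)
      case True
      then have "norm z < 1 + \<rho>'" "norm (Q (\<zeta> z) - z) \<le> err" using Q\<zeta>[OF z] z unfolding B_full[OF True] by (auto simp: region_def)
      then have "norm (Q (\<zeta> z)) < 1 + \<rho>' + \<rho>3/4" using err(5) norm_triangle_ineq2[of "Q (\<zeta> z)" z] by linarith
      also have "\<dots> < 1 + \<rho>3" using \<rho> by (simp add: \<rho>'_def)
      finally show ?thesis using X(7) True by (simp add: s'_def)
    next
      case False
      have "norm (Q (\<zeta> z)) < 2" using \<sigma>(4)[OF zS[OF z]] X(4)[of z] zS[OF z] S(2) \<Omega>(2) False by (auto simp: \<zeta>_def)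
      then show ?thesis using X(7) False by (simp add: s'_def)
    qed
    then show ?thesis unfolding F' using X(7) by (simp add: dist_norm norm_mult)
  qed
  have \<theta>'eq: "\<theta>' ((f' ^^ N') (\<psi>' z)) = B (Suc k) z" if z: "z \<in> region full \<rho>'" for z
  proof (cases full)
    case True
    have "(f' ^^ N') (\<psi>' z) \<in> ball c' (r' * (1 + \<rho>3))" using inball[OF z] True by (simp add: s'_def)
    then have "r' * norm (Q (\<zeta> z)) < r' * (1 + \<rho>3)" unfolding F' using X(7) by (simp add: dist_norm norm_mult)
    then have "norm (Q z) \<le> 1 + \<rho>3" using X(7) True by (simp add: \<zeta>_def)
    then have QS: "Q z \<in> S" using True by (simp add: S_def closed_region_def)
    \<comment> \<open>Here B is the identity, so \<sigma> inverts Q from the right; z and \<sigma>(Q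
      z) are both \<kappa>-close to Q z and have the same image under Q, hence coincide.\<close>
    have "norm (z - Q z) \<le> \<kappa>"
      using Q\<zeta>[OF z] err(3) True unfolding B_full[OF True] by (simp add: \<zeta>_def norm_minus_commute)
    then have "z = \<sigma> (Q z)" using \<sigma>(5)[OF QS] unfolding B_full[OF True] by blast
    then show ?thesis unfolding F' B_full[OF True] using True r0 by (simp add: \<theta>'_def \<zeta>_def)
  next
    case False
    then show ?thesis unfolding F' using \<sigma>(4)[OF zS[OF z]] r0 by (simp add: \<theta>'_def \<zeta>_def del: blaschke_iter.simps)
  qed
  have \<theta>'h: "\<theta>' holomorphic_on ball c' s'"
  proof (cases full)
    case True
    have "(\<lambda>w. (w - c') / of_real r') holomorphic_on ball c' s'" using r0 by (intro holomorphic_intros) auto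
    moreover have "(\<lambda>w. (w - c') / of_real r') ` ball c' s' \<subseteq> interior S"
    proof
      fix v assume "v \<in> (\<lambda>w. (w - c') / of_real r') ` ball c' s'"
      then have "norm v < 1 + \<rho>3" using X(7) True
        by (auto simp: s'_def dist_norm norm_divide norm_minus_commute field_simps)
      then have "v \<in> region full \<rho>3" using True by (simp add: region_def)
      then show "v \<in> interior S" using RS(2) by blast
    qed
    ultimately have "\<sigma> \<circ> (\<lambda>w. (w - c') / of_real r') holomorphic_on ball c' s'"
      by (intro holomorphic_on_compose_gen[OF _ \<sigma>(1)])
    then show ?thesis using True by (simp add: \<theta>'_def o_def)
  next
    case False
    then show ?thesis unfolding \<theta>'_def using r0 by (auto intro!: holomorphic_intros)
  qed
  have six: "norm ((f' ^^ N') (\<psi>' u) - (c' + of_real r' * B (Suc k) u)) \<le> \<epsilon> (Suc k) * r' / 2" if u: "norm u = 1" for u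
  proof -
    have "(f' ^^ N') (\<psi>' u) - (c' + of_real r' * B (Suc k) u) = of_real r' * (Q (\<zeta> u) - B (Suc k) u)"
      unfolding F' by (simp only: right_diff_distrib add_diff_cancel_left)
    then have "norm ((f' ^^ N') (\<psi>' u) - (c' + of_real r' * B (Suc k) u)) = r' * norm (Q (\<zeta> u) - B (Suc k) u)"
      using X(7) by (simp only: norm_mult norm_of_real)
    also have "\<dots> \<le> r' * (\<epsilon> (Suc k) / 2)"
      using Q\<zeta>[OF circle_in_region[OF u \<rho>(4)]] err(4) X(7) by (intro mult_left_mono) auto
    finally show ?thesis by (simp add: mult.commute)
  qed
  have orb': "(f' ^^ j) (\<psi>' z) \<in> ball a R'" if "z \<in> region full \<rho>'" "j < N'" for z j
    unfolding \<psi>'_def using f'(9)[OF \<zeta>2[OF that(1)] that(2)] .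
  have YR: "dist Y a = R' + 20"
  proof -
    have "dist Y a = norm (of_real (R' + 20) :: complex)" by (simp add: Y_def dist_norm)
    then show ?thesis using X(10) I(3) by (simp only: norm_of_real)
  qed
  have chan: "(f' ^^ Suc k) x0 \<notin> cball a R'" "(f' ^^ Suc k) x0 \<notin> cball c' s'"
  proof -
    let ?y = "(f' ^^ Suc k) x0"
    have "dist ?y Y < 1/2" "dist ?y Y < D/4" using f'(5) \<eta> by linarith+
    then show "?y \<notin> cball a R'"
      using YR dist_triangle[of Y a ?y] by (simp add: dist_commute del: funpow.simps)
    have "D \<le> dist c' ?y + dist ?y Y" unfolding D_def by (rule dist_triangle)
    then show "?y \<notin> cball c' s'" using \<open>dist ?y Y < D/4\<close> s'(2) D X(7) unfolding mem_cball by linarith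
  qed
  have disj: "cball a R' \<inter> cball c' s' = {}"
  proof -
    have "False" if "dist a z \<le> R'" "dist c' z \<le> s'" for z
      using that X(8,11) s'(2) dist_triangle[of c' a z] by (simp add: dist_commute)
    then show ?thesis by auto
  qed
  define e1 where "e1 = min (\<epsilon> (Suc k) * r' / 2) (min (1 / (2 * real (k + 1))) (1/4))"
  have e1: "e1 > 0" "e1 \<le> \<epsilon> (Suc k) * r' / 2" "e1 \<le> 1 / (2 * real (k + 1))" "e1 \<le> 1/4"
    using \<epsilon>[of "Suc k"] X(7) by (auto simp: e1_def)
  have cf': "continuous_on (cball a R') f'"
    using holomorphic_on_imp_continuous_on[OF f'(1)] continuous_on_subset by blast
  have cs: "compact (\<psi>' ` sphere 0 1)"
  proof (rule compact_continuous_image)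
    show "continuous_on (sphere 0 1) \<psi>'"
      using holomorphic_on_imp_continuous_on[OF \<psi>'h] by (rule continuous_on_subset) (use circle_in_region \<rho>(4) in auto)
  qed simp
  have "(f' ^^ j) ` (\<psi>' ` sphere 0 1) \<subseteq> interior (cball a R')" if "j < N'" for j
    using orb'[OF circle_in_region[OF _ \<rho>(4)] that] by (auto simp: interior_cball)
  from iterate_stable[OF compact_cball cf' cs this e1(1)]
  obtain d1 where d1: "d1 > 0" "\<And>g. (\<forall>z\<in>cball a R'. dist (g z) (f' z) \<le> d1) \<Longrightarrow>
      (\<forall>z\<in>\<psi>' ` sphere 0 1. \<forall>v. dist v z \<le> d1 \<longrightarrow> (\<forall>j\<le>N'. dist ((g ^^ j) v) ((f' ^^ j) z) < e1))" by blast
  have "(f' ^^ j) ` P \<subseteq> interior (cball a R')" if "j < Suc N" for j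
    using f'(7)[of _ j] that by (auto simp: interior_cball)
  from iterate_stable[OF compact_cball cf' X(5) this e1(1)]
  obtain d2 where d2: "d2 > 0" "\<And>g. (\<forall>z\<in>cball a R'. dist (g z) (f' z) \<le> d2) \<Longrightarrow>
      (\<forall>z\<in>P. \<forall>v. dist v z \<le> d2 \<longrightarrow> (\<forall>j\<le>Suc N. dist ((g ^^ j) v) ((f' ^^ j) z) < e1))" by blast
  \<comment> \<open>Halving the tolerance at each stage bounds the sum of all later changes by the
    tolerance of the present one.\<close>
  define e' where "e' = min (min d1 d2) (e/2)"
  have e': "e' > 0" "e' \<le> d1" "e' \<le> d2" "e' \<le> e/2" using d1 d2 I(23) by (auto simp: e'_def)
  have near: "dist ((g ^^ j) v) ((f' ^^ j) (\<psi>' u)) < e1"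
    if g: "\<forall>z\<in>cball a R'. dist (g z) (f' z) \<le> e'" and u: "norm u = 1" and v: "dist v (\<psi>' u) \<le> e'" and j: "j \<le> N'" for g u v j
  proof -
    have "\<forall>z\<in>cball a R'. dist (g z) (f' z) \<le> d1" using g e'(2) by force
    from d1(2)[OF this] show ?thesis using u v j e'(2) by auto
  qed
  have NN': "N' = (if ret k then N + k + 2 else N + 1)" by (simp add: N'_def)
  show ?thesis
  proof (intro exI conjI)
    show "stage_inv (Suc k) f' \<psi>' \<theta>' c' r' s' N' R' \<rho>' e'"
      unfolding stage_inv_def
    proof (intro conjI allI impI ballI)
      show "2 \<le> R'" "real (Suc k) \<le> R'" using I(3,4) X(10) by auto
      show "(f' ^^ j) x0 \<in> ball a R'" if "j < Suc k" for j using f'(4) that by auto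
      show "B (Suc k) holomorphic_on region full \<rho>'"
        using X(3) by (rule holomorphic_on_subset) (use region_mono[of \<rho>' \<rho>2 full] \<rho> in auto)
      show "1 < norm (B (Suc k) z)" if "z \<in> region full \<rho>'" "1 < norm z" for z
      proof -
        have "z \<in> closed_region full \<rho>2" using zS[OF that(1)] S(2) \<Omega>(2) by blast
        then show ?thesis using X(4) that(2) by blast
      qed
      show "\<psi>' = (\<lambda>z. z)" if full using that I(22) by (simp add: \<psi>'_def \<zeta>_def)
      fix g u v assume *: "(\<forall>z\<in>cball a R'. dist (g z) (f' z) \<le> e') \<and> norm u = 1 \<and> dist v (\<psi>' u) \<le> e'"
      then have "dist ((g ^^ N') v) ((f' ^^ N') (\<psi>' u)) < e1" using near by blast
      moreover have "norm ((f' ^^ N') (\<psi>' u) - (c' + of_real r' * B (Suc k) u)) \<le> \<epsilon> (Suc k) * r' / 2" using six * by blast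
      ultimately show "norm ((g ^^ N') v - (c' + of_real r' * B (Suc k) u)) \<le> \<epsilon> (Suc k) * r'"
        using e1(2) dist_triangle[of "(g ^^ N') v" "c' + of_real r' * B (Suc k) u" "(f' ^^ N') (\<psi>' u)"]
        unfolding dist_norm by linarith
    qed (rule f'(1,2) chan X(7,8) disj s'(1) \<rho>(4,7) \<psi>'h \<theta>'h inball \<theta>'eq orb' six e'(1) | assumption)+
    show "stage_trans k f \<psi> N R \<rho> e f' \<psi>' r' N' R' \<rho>' e'"
      unfolding stage_trans_def
    proof (intro conjI allI impI ballI)
      show "dist (f' z) (f z) \<le> e/2" if "z \<in> cball a R" for z using f'(3)[OF that] \<eta>(3) by linarith
      show "norm (\<psi>' z - \<psi> z) \<le> e/2" "norm (\<psi>' z - \<psi> z) \<le> \<tau> k \<rho>'" if "z \<in> region full \<rho>'" for z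
        using \<psi>'\<psi>[OF that] by (auto simp: \<tau>'_def)
      fix g assume g: "\<forall>z\<in>cball a R'. dist (g z) (f' z) \<le> e'"
      show "\<exists>p. dist p (\<psi> u) < 1 / real (k + 1) \<and> dist ((g ^^ Suc N) p) a < 1" if u: "norm u = 1" for u
      proof -
        obtain p where p: "p \<in> P" "dist p (\<psi> u) < 1 / real (k + 1)" using X(6)[OF u] by auto
        have "\<forall>z\<in>cball a R'. dist (g z) (f' z) \<le> d2" using g e'(3) by force
        from d2(2)[OF this] have "dist ((g ^^ Suc N) p) ((f' ^^ Suc N) p) < e1" using p(1) d2(1) by (simp del: funpow.simps)
        then have "dist ((g ^^ Suc N) p) a < 1"
          using f'(6)[OF p(1)] e1(4) dist_triangle[of "(g ^^ Suc N) p" a "(f' ^^ Suc N) p"] by linarith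
        then show ?thesis using p(2) by blast
      qed
      show "\<exists>d. \<forall>u v. norm u = 1 \<and> dist v (\<psi>' u) \<le> e' \<longrightarrow> dist ((g ^^ n) v) d \<le> 1 / real (k + 1)" if n: "N < n \<and> n < N'" for n
      proof (intro exI[of _ "E n"] allI impI)
        fix u v assume uv: "norm u = 1 \<and> dist v (\<psi>' u) \<le> e'"
        have "dist ((g ^^ n) v) ((f' ^^ n) (\<psi>' u)) < e1" using near[OF g] uv n by simp
        moreover have "dist ((f' ^^ n) (\<psi>' u)) (E n) < 1 / (2 * real (k + 1))"
          unfolding \<psi>'_def using f'(10)[OF \<zeta>2] circle_in_region[OF _ \<rho>(4)] uv n by blast
        moreover have "1 / (2 * real (k + 1)) + 1 / (2 * real (k + 1)) = 1 / real (k + 1)" by (simp add: field_simps)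
        ultimately show "dist ((g ^^ n) v) (E n) \<le> 1 / real (k + 1)"
          using e1(3) dist_triangle[of "(g ^^ n) v" "E n" "(f' ^^ n) (\<psi>' u)"] by argo
      qed
      show "dist ((g ^^ Suc N) v) x0 < 1" if r: "ret k" and uv: "norm u = 1 \<and> dist v (\<psi>' u) \<le> e'" for u v
      proof -
        have "Suc N \<le> N'" using r by (simp add: N'_def)
        then have "dist ((g ^^ Suc N) v) ((f' ^^ Suc N) (\<psi>' u)) < e1" using near[OF g] uv by blast
        moreover have "dist ((f' ^^ Suc N) (\<psi>' u)) x0 < 3/4"
          unfolding \<psi>'_def using f'(11)[OF \<zeta>2 r] circle_in_region[OF _ \<rho>(4)] uv by blast
        ultimately show ?thesis
          using e1(4) dist_triangle[of "(g ^^ Suc N) v" x0 "(f' ^^ Suc N) (\<psi>' u)"] by linarith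
      qed
    qed (rule X(10) e'(4) \<rho>(6) NN' X(9))+
  qed
qed

end

section \<open>The limit of the construction\<close>

text \<open>Since \<open>e (Suc k)\<close> is at most half of \<open>e k\<close>, a step of length
  \<open>e k / 2\<close> is at most \<open>e k - e (Suc k)\<close>, and the steps telescope. The
  starting index m is there because the maps are controlled at a point only after it has entered the
  disc.\<close>

lemma halving_telescope:
  fixes x :: "nat \<Rightarrow> 'a::complete_space" and e :: "nat \<Rightarrow> real"
  assumes x: "\<And>k. k \<ge> m \<Longrightarrow> dist (x (Suc k)) (x k) \<le> e k / 2" and e: "\<And>k. e (Suc k) \<le> e k / 2" "\<And>k. 0 < e k"
  shows "convergent x" "k \<ge> m \<Longrightarrow> dist (lim x) (x k) \<le> e k"
proof -
  have step: "dist (x (k + j)) (x k) \<le> e k - e (k + j)" if "k \<ge> m" for k j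
  proof (induction j)
    case (Suc j)
    have "dist (x (k + Suc j)) (x k) \<le> dist (x (Suc (k + j))) (x (k + j)) + dist (x (k + j)) (x k)"
      using dist_triangle by simp
    also have "\<dots> \<le> e (k + j) / 2 + (e k - e (k + j))" using x[of "k + j"] Suc that by (intro add_mono) auto
    finally show ?case using e(1)[of "k + j"] by simp
  qed simp
  have le: "dist (x j) (x k) \<le> e k" if "k \<ge> m" "j \<ge> k" for k j
    using step[OF that(1), of "j - k"] e(2)[of j] that(2) by simp
  have e0: "e k \<le> e 0 * (1/2)^k" for k
    by (induction k) (use e(1) in \<open>auto intro: order_trans\<close>)
  have lim0: "(\<lambda>k. e 0 * (1/2)^k) \<longlonglongrightarrow> 0"
    using tendsto_mult_left[OF LIMSEQ_power_zero[of "1/2::real"], of "e 0"] by simp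
  have "Cauchy x"
  proof (rule metric_CauchyI)
    fix \<eta> :: real assume "\<eta> > 0"
    then have "\<forall>\<^sub>F k in sequentially. e 0 * (1/2)^k < \<eta>/2" by (intro order_tendstoD(2)[OF lim0]) simp
    then obtain K where K: "\<And>k. k \<ge> K \<Longrightarrow> e 0 * (1/2)^k < \<eta>/2" by (auto simp: eventually_sequentially)
    define M where "M = max K m"
    have "dist (x i) (x j) < \<eta>" if "i \<ge> M" "j \<ge> M" for i j
    proof -
      have "dist (x i) (x M) \<le> e M" "dist (x j) (x M) \<le> e M" using le that by (auto simp: M_def)
      moreover have "e M < \<eta>/2" using e0[of M] K[of M] by (simp add: M_def)
      ultimately show ?thesis using dist_triangle2[of "x i" "x j" "x M"] by simp
    qed
    then show "\<exists>M. \<forall>i\<ge>M. \<forall>j\<ge>M. dist (x i) (x j) < \<eta>" by blast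
  qed
  then show conv: "convergent x" by (rule Cauchy_convergent)
  assume "k \<ge> m"
  have "(\<lambda>j. dist (x j) (x k)) \<longlonglongrightarrow> dist (lim x) (x k)"
    using conv by (intro tendsto_dist tendsto_const) (simp add: convergent_LIMSEQ_iff)
  then show "dist (lim x) (x k) \<le> e k"
    by (rule tendsto_upperbound) (use le \<open>k \<ge> m\<close> in \<open>auto simp: eventually_sequentially\<close>)
qed

context wandering_construction
begin

text \<open>The constant map a makes a attracting from the start. At time 0 the curve is the unit
  circle in the station \<open>ball 0 2\<close> with the identity as chart, and the channel begins
  at \<open>x0\<close> itself.\<close>

lemma stage_init: "stage_inv 0 (\<lambda>z. a) (\<lambda>z. z) (\<lambda>z. z) 0 1 2 0 2 (1/2) (min (1/2) (\<epsilon> 0))"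
  unfolding stage_inv_def
proof (intro conjI allI impI ballI)
  show "cball a 2 \<inter> cball 0 2 = {}" using base(3) by blast
  fix g :: "complex \<Rightarrow> complex" and u v :: complex
  assume "(\<forall>z\<in>cball a 2. dist (g z) a \<le> min (1/2) (\<epsilon> 0)) \<and> norm u = 1 \<and> dist v u \<le> min (1/2) (\<epsilon> 0)"
  then show "norm ((g ^^ 0) v - (0 + of_real 1 * B 0 u)) \<le> \<epsilon> 0 * 1" by (simp add: dist_norm)
qed (use base \<epsilon>[of 0] in \<open>auto simp: region_def\<close>)

lemma stages_exist:
  obtains f \<psi> \<theta> c r s N R \<rho> e where
    "\<And>k. stage_inv k (f k) (\<psi> k) (\<theta> k) (c k) (r k) (s k) (N k) (R k) (\<rho> k) (e k)"
    "\<And>k. stage_trans k (f k) (\<psi> k) (N k) (R k) (\<rho> k) (e k) (f (Suc k)) (\<psi> (Suc k)) (r (Suc k)) (N (Suc k)) (R (Suc k)) (\<rho> (Suc k)) (e (Suc k))"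
    "f 0 = (\<lambda>z. a)" "\<psi> 0 = (\<lambda>z. z)" "c 0 = 0" "r 0 = 1" "N 0 = 0" "R 0 = 2" "\<rho> 0 = 1/2" "e 0 \<le> 1/2"
proof -
  define P where "P k S = (case S of (f,\<psi>,\<theta>,c,r,s,N,R,\<rho>,e) \<Rightarrow> stage_inv k f \<psi> \<theta> c r s N R \<rho> e \<and>
      (k = 0 \<longrightarrow> f = (\<lambda>z. a) \<and> \<psi> = (\<lambda>z. z) \<and> c = 0 \<and> r = 1 \<and> N = 0 \<and> R = 2 \<and> \<rho> = 1/2 \<and> e \<le> 1/2))" for k S
  define Q where "Q k S S' = (case S of (f,\<psi>,\<theta>,c,r,s,N,R,\<rho>,e) \<Rightarrow> case S' of (f',\<psi>',\<theta>',c',r',s',N',R',\<rho>',e') \<Rightarrow>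
      stage_trans k f \<psi> N R \<rho> e f' \<psi>' r' N' R' \<rho>' e')"
    for k and S S' :: "(complex \<Rightarrow> complex) \<times> (complex \<Rightarrow> complex) \<times> (complex \<Rightarrow> complex) \<times> complex \<times> real \<times> real \<times> nat \<times> real \<times> real \<times> real"
  have "\<exists>F. \<forall>k. P k (F k) \<and> Q k (F k) (F (Suc k))"
  proof (rule dependent_nat_choice)
    have "P 0 ((\<lambda>z. a), (\<lambda>z. z), (\<lambda>z. z), 0, 1, 2, 0, 2, 1/2, min (1/2) (\<epsilon> 0))"
      using stage_init by (simp add: P_def)
    then show "\<exists>S. P 0 S" by blast
    fix S k assume "P k S"
    then obtain f \<psi> \<theta> c r s N R \<rho> e where S: "S = (f,\<psi>,\<theta>,c,r,s,N,R,\<rho>,e)" "stage_inv k f \<psi> \<theta> c r s N R \<rho> e"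
      by (auto simp: P_def split: prod.splits)
    obtain f' \<psi>' \<theta>' c' r' s' N' R' \<rho>' e' where "stage_inv (Suc k) f' \<psi>' \<theta>' c' r' s' N' R' \<rho>' e'"
        "stage_trans k f \<psi> N R \<rho> e f' \<psi>' r' N' R' \<rho>' e'"
      using stage_step[OF S(2)] by blast
    then have "P (Suc k) (f',\<psi>',\<theta>',c',r',s',N',R',\<rho>',e') \<and> Q k S (f',\<psi>',\<theta>',c',r',s',N',R',\<rho>',e')"
      by (simp add: P_def Q_def S(1))
    then show "\<exists>S'. P (Suc k) S' \<and> Q k S S'" by blast
  qed
  then obtain F where F: "\<And>k. P k (F k)" "\<And>k. Q k (F k) (F (Suc k))" by blast
  define f \<psi> \<theta> c r s N R \<rho> e where
    "f = (\<lambda>k. fst (F k))" and "\<psi> = (\<lambda>k. fst (snd (F k)))" and "\<theta> = (\<lambda>k. fst (snd (snd (F k))))"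
    and "c = (\<lambda>k. fst (snd (snd (snd (F k)))))" and "r = (\<lambda>k. fst (snd (snd (snd (snd (F k))))))"
    and "s = (\<lambda>k. fst (snd (snd (snd (snd (snd (F k)))))))" and "N = (\<lambda>k. fst (snd (snd (snd (snd (snd (snd (F k))))))))"
    and "R = (\<lambda>k. fst (snd (snd (snd (snd (snd (snd (snd (F k)))))))))"
    and "\<rho> = (\<lambda>k. fst (snd (snd (snd (snd (snd (snd (snd (snd (F k))))))))))"
    and "e = (\<lambda>k. snd (snd (snd (snd (snd (snd (snd (snd (snd (F k))))))))))"
  have FF: "F k = (f k, \<psi> k, \<theta> k, c k, r k, s k, N k, R k, \<rho> k, e k)" for k
    by (simp add: f_def \<psi>_def \<theta>_def c_def r_def s_def N_def R_def \<rho>_def e_def)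
  show thesis
    by (rule that[of f \<psi> \<theta> c r s N R \<rho> e]) (use F[unfolded P_def Q_def FF] in auto)
qed

theorem construction_limit:
  obtains f \<psi> \<psi>k \<rho> c r N where
    "f holomorphic_on UNIV" "\<not> f constant_on UNIV"
    "c 0 = 0" "r 0 = 1" "N 0 = 0" "\<And>k. 0 < r k \<and> r k \<le> 1"
    "\<And>k. N (Suc k) = (if ret k then N k + k + 2 else N k + 1)"
    "\<And>k. if ret k then r (Suc k) \<le> 1 / real (k + 2) else r (Suc k) = far_rad (Suc k)"
    "\<And>k. real k \<le> dist (c k) a"
    "\<And>k u. norm u = 1 \<Longrightarrow> norm ((f ^^ N k) (\<psi> u) - (c k + of_real (r k) * B k u)) \<le> \<epsilon> k * r k"
    "\<And>u \<eta>. norm u = 1 \<Longrightarrow> \<eta> > 0 \<Longrightarrow> \<exists>p. dist p (\<psi> u) < \<eta> \<and> bounded (range (\<lambda>n. (f ^^ n) p))"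
    "\<And>k n. N k < n \<Longrightarrow> n < N (Suc k) \<Longrightarrow> \<exists>d. \<forall>u. norm u = 1 \<longrightarrow> dist ((f ^^ n) (\<psi> u)) d \<le> 1 / real (k + 1)"
    "\<And>k u. ret k \<Longrightarrow> norm u = 1 \<Longrightarrow> dist ((f ^^ Suc (N k)) (\<psi> u)) x0 < 1"
    "full \<Longrightarrow> \<psi> = (\<lambda>z. z)"
    "\<psi>k 0 = (\<lambda>z. z)" "\<And>k. 0 < \<rho> k \<and> \<rho> k < 1" "\<And>k. \<rho> (Suc k) < \<rho> k"
    "\<And>k. \<psi>k k holomorphic_on region full (\<rho> k)"
    "\<And>k z. z \<in> region full (\<rho> (Suc k)) \<Longrightarrow> norm (\<psi>k (Suc k) z - \<psi>k k z) \<le> \<tau> k (\<rho> (Suc k))"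
    "\<And>u. norm u = 1 \<Longrightarrow> (\<lambda>k. \<psi>k k u) \<longlonglongrightarrow> \<psi> u"
proof -
  obtain fk \<psi>k \<theta> c r s N R \<rho> e where
    inv: "\<And>k. stage_inv k (fk k) (\<psi>k k) (\<theta> k) (c k) (r k) (s k) (N k) (R k) (\<rho> k) (e k)" and
    tr: "\<And>k. stage_trans k (fk k) (\<psi>k k) (N k) (R k) (\<rho> k) (e k) (fk (Suc k)) (\<psi>k (Suc k)) (r (Suc k)) (N (Suc k)) (R (Suc k)) (\<rho> (Suc k)) (e (Suc k))" and
    init: "fk 0 = (\<lambda>z. a)" "\<psi>k 0 = (\<lambda>z. z)" "c 0 = 0" "r 0 = 1" "N 0 = 0" "R 0 = 2" "\<rho> 0 = 1/2" "e 0 \<le> 1/2"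
    by (rule stages_exist) (rule that; assumption)
  note I = stage_invD[OF inv]
  have T: "R k + 1 \<le> R (Suc k)" "\<forall>z\<in>cball a (R k). dist (fk (Suc k) z) (fk k z) \<le> e k/2" "e (Suc k) \<le> e k/2" "\<rho> (Suc k) < \<rho> k"
     "\<forall>z\<in>region full (\<rho> (Suc k)). norm (\<psi>k (Suc k) z - \<psi>k k z) \<le> e k/2 \<and> norm (\<psi>k (Suc k) z - \<psi>k k z) \<le> \<tau> k (\<rho> (Suc k))"
     "N (Suc k) = (if ret k then N k + k + 2 else N k + 1)"
     "if ret k then r (Suc k) \<le> 1 / real (k + 2) else r (Suc k) = far_rad (Suc k)"
     "(\<forall>g. (\<forall>z\<in>cball a (R (Suc k)). dist (g z) (fk (Suc k) z) \<le> e (Suc k)) \<longrightarrow>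
        (\<forall>u. norm u = 1 \<longrightarrow> (\<exists>p. dist p (\<psi>k k u) < 1 / real (k + 1) \<and> dist ((g ^^ Suc (N k)) p) a < 1)) \<and>
        (\<forall>n. N k < n \<and> n < N (Suc k) \<longrightarrow> (\<exists>d. \<forall>u v. norm u = 1 \<and> dist v (\<psi>k (Suc k) u) \<le> e (Suc k) \<longrightarrow> dist ((g ^^ n) v) d \<le> 1 / real (k + 1))) \<and>
        (ret k \<longrightarrow> (\<forall>u v. norm u = 1 \<and> dist v (\<psi>k (Suc k) u) \<le> e (Suc k) \<longrightarrow> dist ((g ^^ Suc (N k)) v) x0 < 1)))" for k
    using tr[of k] unfolding stage_trans_def by blast+
  have Rm: "R k \<le> R j" if "k \<le> j" for k j
    using that by (induction rule: dec_induct) (use T(1) in \<open>auto intro: order_trans less_imp_le\<close>, meson T(1) add_increasing2 order_trans zero_le_one le_add_same_cancel1)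
  have Rk: "cball a (real k) \<subseteq> cball a (R k)" for k using I(4)[of k] by auto
  have stepf: "dist (fk (Suc j) z) (fk j z) \<le> e j/2" if "z \<in> cball a (R k)" "k \<le> j" for z j k
    using T(2)[of j] Rm[OF that(2)] that(1) by auto
  define f where "f z = lim (\<lambda>k. fk k z)" for z
  have fk: "dist (f z) (fk k z) \<le> e k" if "z \<in> cball a (R k)" for z k
    unfolding f_def by (rule halving_telescope(2)[where m=k]) (use stepf[OF that] T(3) I(23) in auto)
  have e0: "e k \<le> e 0 * (1/2)^k" for k
    by (induction k) (use T(3) in \<open>auto intro: order_trans\<close>)
  have elim: "e \<longlonglongrightarrow> 0"
  proof (rule tendsto_sandwich[of "\<lambda>_. 0" _ _ "\<lambda>k. e 0 * (1/2)^k"])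
    show "(\<lambda>k. e 0 * (1/2)^k) \<longlonglongrightarrow> 0"
      using tendsto_mult_left[OF LIMSEQ_power_zero[of "1/2::real"], of "e 0"] by simp
  qed (use e0 I(23) in \<open>auto intro: less_imp_le always_eventually\<close>)
  have fhol: "f holomorphic_on UNIV"
  proof (rule holomorphic_uniform_sequence[OF open_UNIV I(1)])
    fix x :: complex
    obtain K where K: "dist a x + 1 \<le> real K" using real_arch_simple by blast
    have sub: "cball x 1 \<subseteq> cball a (R k)" if "k \<ge> K" for k
    proof
      fix y assume "y \<in> cball x 1"
      then have "dist a y \<le> dist a x + 1" using dist_triangle[of a y x] by simp
      also have "\<dots> \<le> R k" using K I(4)[of K] Rm[OF that] by linarith
      finally show "y \<in> cball a (R k)" by simp
    qed
    have "uniform_limit (cball x 1) fk f sequentially"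
    proof (rule uniform_limitI)
      fix \<eta> :: real assume "\<eta> > 0"
      then have "\<forall>\<^sub>F k in sequentially. e k < \<eta>" using elim by (auto dest: order_tendstoD)
      then show "\<forall>\<^sub>F k in sequentially. \<forall>y\<in>cball x 1. dist (fk k y) (f y) < \<eta>"
        using eventually_ge_at_top[of K]
      proof eventually_elim
        case (elim k)
        show ?case
        proof
          fix y assume "y \<in> cball x 1"
          then have "dist (f y) (fk k y) \<le> e k" using fk sub[OF elim(2)] by blast
          then show "dist (fk k y) (f y) < \<eta>" using elim(1) by (simp add: dist_commute)
        qed
      qed
    qed
    then show "\<exists>d>0. cball x d \<subseteq> UNIV \<and> uniform_limit (cball x d) fk f sequentially"
      by (intro exI[of _ 1]) auto
  qed
  have stepp: "dist (\<psi>k (Suc k) u) (\<psi>k k u) \<le> e k/2" if "norm u = 1" for u k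
    using T(5)[of k] circle_in_region[OF that I(12)] by (auto simp: dist_norm)
  define \<psi> where "\<psi> = (if full then (\<lambda>z. z) else (\<lambda>u. lim (\<lambda>k. \<psi>k k u)))"
  have \<psi>lim: "\<psi> u = lim (\<lambda>k. \<psi>k k u)" for u
    using I(22) by (auto simp: \<psi>_def)
  have \<psi>: "dist (\<psi> u) (\<psi>k k u) \<le> e k" if "norm u = 1" for u k
    unfolding \<psi>lim by (rule halving_telescope(2)[where m=0]) (use stepp[OF that] T(3) I(23) in auto)
  have \<psi>conv: "(\<lambda>k. \<psi>k k u) \<longlonglongrightarrow> \<psi> u" if "norm u = 1" for u
  proof -
    have "convergent (\<lambda>k. \<psi>k k u)"
      by (rule halving_telescope(1)[where m=0 and e=e]) (use stepp[OF that] T(3) I(23) in auto)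
    then show ?thesis unfolding \<psi>lim by (simp add: convergent_LIMSEQ_iff)
  qed
  have main: "norm ((f ^^ N k) (\<psi> u) - (c k + of_real (r k) * B k u)) \<le> \<epsilon> k * r k" if "norm u = 1" for k u
    by (rule I(24)) (use fk \<psi> that in auto)
  have far: "real k \<le> dist (c k) a" for k
  proof -
    have "c k \<in> cball (c k) (s k)" using I(8,10)[of k] by simp
    then have "c k \<notin> cball a (R k)" using I(11)[of k] by blast
    then show ?thesis using I(4)[of k] by (simp add: dist_commute)
  qed
  \<comment> \<open>The limit is within \<open>e 0\<close>, at most 1/2, of the constant a on
    \<open>cball a 2\<close>, so an orbit that has come within 1 of a never leaves this disc
    again.\<close>
  have attract: "bounded (range (\<lambda>n. (f ^^ n) p))" if "dist ((f ^^ m) p) a < 1" for p m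
  proof -
    have fa: "dist (f z) a \<le> 1/2" if "z \<in> cball a 2" for z
      using fk[of z 0] that init by simp
    have "(f ^^ n) p \<in> cball a 2" if "n \<ge> m" for n
      using that
    proof (induction n rule: dec_induct)
      case base then show ?case using \<open>dist ((f ^^ m) p) a < 1\<close> by (simp add: dist_commute)
    next
      case (step n) then show ?case using fa[of "(f ^^ n) p"] by (simp add: dist_commute)
    qed
    then have "range (\<lambda>n. (f ^^ n) p) \<subseteq> (\<lambda>n. (f ^^ n) p) ` {..<m} \<union> cball a 2"
      by (auto simp del: mem_cball) (metis imageI lessThan_iff not_less)
    then show ?thesis by (rule bounded_subset[rotated]) (simp add: finite_imp_bounded)
  qed
  have gf: "\<forall>z\<in>cball a (R (Suc k)). dist (f z) (fk (Suc k) z) \<le> e (Suc k)" for k using fk by blast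
  note T8 = T(8)[THEN spec, THEN mp, OF gf]
  \<comment> \<open>A constant value would be near a, because net points are sent there, and also
    near \<open>fk 1 x0\<close>, which lies outside \<open>cball a (R 1)\<close>.\<close>
  have nonconst: "\<not> f constant_on UNIV"
  proof
    assume "f constant_on UNIV"
    then obtain w where w: "\<And>z. f z = w" by (auto simp: constant_on_def)
    show False
    proof -
      obtain p where p: "dist p (\<psi>k 0 1) < 1 / real (0 + 1)" "dist ((f ^^ Suc (N 0)) p) a < 1"
        using T8[of 0] norm_one by blast
      then have wa: "dist w a < 1" using w by simp
      have "dist (f ((fk 1 ^^ 0) x0)) (fk 1 x0) \<le> e 1" using fk[of x0 1] I(5)[of 0 1] by simp
      then have "dist w (fk 1 x0) \<le> 1/2" using w e0[of 1] init(8) I(23)[of 0] by simp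
      then have "dist a (fk 1 x0) < 2" using wa dist_triangle[of a "fk 1 x0" w] by (simp add: dist_commute)
      moreover have "fk 1 x0 \<notin> cball a (R 1)" using I(6)[of 1] by simp
      ultimately show False using I(3)[of 1] by simp
    qed
  qed
  show thesis
  proof (rule that[of f c r N \<psi> \<psi>k \<rho>])
    show "\<exists>p. dist p (\<psi> u) < \<eta> \<and> bounded (range (\<lambda>n. (f ^^ n) p))" if u: "norm u = 1" and \<eta>: "\<eta> > 0" for u \<eta>
    proof -
      have "(\<lambda>k. 1 / real (k + 1)) \<longlonglongrightarrow> 0"
        using LIMSEQ_ignore_initial_segment[OF lim_1_over_n, of 1] by simp
      then have "\<forall>\<^sub>F k in sequentially. 1 / real (k + 1) < \<eta>/2" using \<eta> by (intro order_tendstoD(2)) auto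
      moreover have "\<forall>\<^sub>F k in sequentially. e k < \<eta>/2" using \<eta> by (intro order_tendstoD(2)[OF elim]) auto
      ultimately have "\<forall>\<^sub>F k in sequentially. 1 / real (k + 1) < \<eta>/2 \<and> e k < \<eta>/2" by eventually_elim auto
      then obtain k where k: "1 / real (k + 1) < \<eta>/2" "e k < \<eta>/2" by (auto simp: eventually_sequentially)
      obtain p where p: "dist p (\<psi>k k u) < 1 / real (k + 1)" "dist ((f ^^ Suc (N k)) p) a < 1"
        using T8[of k] u by blast
      have "dist p (\<psi> u) < \<eta>"
        using p(1) k \<psi>[OF u, of k] dist_triangle[of p "\<psi> u" "\<psi>k k u"] by (simp add: dist_commute)
      then show ?thesis using attract[OF p(2)] by blast
    qed
    show "\<exists>d. \<forall>u. norm u = 1 \<longrightarrow> dist ((f ^^ n) (\<psi> u)) d \<le> 1 / real (k + 1)" if kn: "N k < n" "n < N (Suc k)" for k n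
    proof -
      obtain d where d: "\<forall>u v. norm u = 1 \<and> dist v (\<psi>k (Suc k) u) \<le> e (Suc k) \<longrightarrow> dist ((f ^^ n) v) d \<le> 1 / real (k + 1)"
        using T8[of k] kn by blast
      then show ?thesis using \<psi> by blast
    qed
    show "dist ((f ^^ Suc (N k)) (\<psi> u)) x0 < 1" if "ret k" "norm u = 1" for k u
      using T8[of k] that \<psi> by blast
    show "\<psi> = (\<lambda>z. z)" if full using that by (simp add: \<psi>_def)
    show "norm (\<psi>k (Suc k) z - \<psi>k k z) \<le> \<tau> k (\<rho> (Suc k))" if "z \<in> region full (\<rho> (Suc k))" for k z
      using T(5) that by blast
    show "if ret k then r (Suc k) \<le> 1 / real (k + 2) else r (Suc k) = far_rad (Suc k)" for k by (rule T(7))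
    show "N (Suc k) = (if ret k then N k + k + 2 else N k + 1)" for k by (rule T(6))
  qed (use fhol nonconst init I(8,9,12,13,14) far main T(4) \<psi>conv in auto)
qed

end

section \<open>Smoothness of the boundary curve\<close>

text \<open>Defined for complex parameters: a strip around the real axis is mapped into an annulus,
  where Cauchy estimates are available.\<close>

definition circle_param :: "complex \<Rightarrow> complex" where
  "circle_param t = exp (2 * of_real pi * \<i> * t)"

lemma circle_param_holomorphic [holomorphic_intros]: "circle_param holomorphic_on S"
  unfolding circle_param_def by (intro holomorphic_intros)

lemma norm_circle_param: "norm (circle_param t) = exp (- 2 * pi * Im t)"
  by (simp add: circle_param_def)

lemma norm_circle_param_real [simp]: "norm (circle_param (of_real t)) = 1"
  by (simp add: norm_circle_param)

lemma circle_param_in_region: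
  assumes "\<bar>Im t\<bar> \<le> \<rho>/16" "0 < \<rho>" "\<rho> < 1"
  shows "circle_param t \<in> region False \<rho>"
proof -
  define x where "x = - 2 * pi * Im t"
  have "\<bar>x\<bar> = 2 * pi * \<bar>Im t\<bar>" by (simp add: x_def abs_mult)
  \<comment> \<open>The crude bound pi < 4 explains the strip of half-width \<rho>/16.\<close>
  also have "\<dots> \<le> 2 * 4 * (\<rho>/16)" using assms(1) pi_less_4 by (intro mult_mono) auto
  finally have x: "\<bar>x\<bar> \<le> \<rho>/2" by simp
  have "1 - \<rho>/2 \<le> exp x" using exp_ge_add_one_self[of x] x by linarith
  moreover have "exp x < 1 + \<rho>"
  proof (cases "x \<le> 0")
    case True then show ?thesis using assms by (smt (verit) exp_le_one_iff)
  next
    case False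
    have "exp x \<le> 1 + x + x\<^sup>2" using False x assms by (intro exp_bound) auto
    also have "x\<^sup>2 \<le> x * (1/2)" unfolding power2_eq_square using False x assms by (intro mult_left_mono) auto
    finally show ?thesis using x assms False by linarith
  qed
  moreover have "norm (circle_param t) = exp x" by (simp add: norm_circle_param x_def)
  ultimately show ?thesis using assms by (auto simp: region_def)
qed

text \<open>Jordan's inequality: sin is concave on the interval and therefore lies above its
  chord.\<close>

lemma sin_lower_bound:
  fixes x :: real
  assumes "0 \<le> x" "x \<le> pi/2"
  shows "2 * x / pi \<le> sin x"
proof -
  have "convex_on {0..pi/2} (\<lambda>x. - sin x)"
  proof (rule f''_ge0_imp_convex[of _ _ "\<lambda>x. - cos x" "\<lambda>x. sin x"])
    show "((\<lambda>x. - cos x) has_real_derivative sin x) (at x)" for x :: real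
      by (auto intro!: derivative_eq_intros)
    show "((\<lambda>x. - sin x) has_real_derivative - cos x) (at x)" for x :: real
      by (auto intro!: derivative_eq_intros)
    show "0 \<le> sin x" if "x \<in> {0..pi/2}" for x :: real using that by (intro sin_ge_zero) auto
  qed auto
  from convex_onD[OF this, of "2*x/pi" 0 "pi/2"] assms
  have "- sin ((1 - 2*x/pi) * 0 + (2*x/pi) * (pi/2)) \<le> (1 - 2*x/pi) * (- sin 0) + (2*x/pi) * (- sin (pi/2))"
    by (auto simp: field_simps)
  then show ?thesis by simp
qed

lemma circle_param_dist:
  assumes "\<bar>s - t\<bar> \<le> 1/2"
  shows "4 * \<bar>s - t\<bar> \<le> norm (circle_param (of_real s) - circle_param (of_real t))"
proof -
  have *: "circle_param (of_real s) = cis (2 * pi * s)" for s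
    by (simp add: circle_param_def cis_conv_exp algebra_simps)
  have "norm (cis (2 * pi * s) - cis (2 * pi * t)) = 2 * \<bar>sin (pi * (s - t))\<bar>"
  proof -
    have "cis (2 * pi * s) - cis (2 * pi * t) = 2 * \<i> * of_real (sin (pi * (s - t))) * cis (pi * (s + t))"
    proof -
      have "cis (2 * pi * s) = cis (pi * (s - t)) * cis (pi * (s + t))" "cis (2 * pi * t) = cis (- (pi * (s - t))) * cis (pi * (s + t))"
        by (simp_all add: cis_mult algebra_simps)
      moreover have "cis x - cis (- x) = 2 * \<i> * of_real (sin x)" for x by (simp add: complex_eq_iff)
      ultimately show ?thesis by (metis left_diff_distrib)
    qed
    then show ?thesis by (simp add: norm_mult)
  qed
  moreover have "2 * \<bar>s - t\<bar> \<le> \<bar>sin (pi * (s - t))\<bar>"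
  proof -
    have "2 * (pi * \<bar>s - t\<bar>) / pi \<le> sin (pi * \<bar>s - t\<bar>)"
      using assms mult_left_mono[OF assms, of pi] by (intro sin_lower_bound) auto
    then have "2 * \<bar>s - t\<bar> \<le> sin (pi * \<bar>s - t\<bar>)" by simp
    also have "\<dots> \<le> \<bar>sin (pi * (s - t))\<bar>"
    proof (cases "s \<ge> t")
      case False
      then have "pi * \<bar>s - t\<bar> = - (pi * (s - t))" by (simp add: abs_if algebra_simps)
      then show ?thesis by (simp only: sin_minus)
    qed simp
    finally show ?thesis .
  qed
  ultimately show ?thesis unfolding * by linarith
qed

lemma circle_param_periodic: "circle_param (t + of_int n) = circle_param t"
proof -
  have "2 * of_real pi * \<i> * (t + of_int n) = 2 * of_real pi * \<i> * t + of_int n * (of_real (2 * pi) * \<i>)"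
    by (simp add: algebra_simps)
  then show ?thesis unfolding circle_param_def by (simp add: exp_add exp_integer_2pi mult.commute mult.left_commute)
qed

lemma circle_param_image: "(\<lambda>t. circle_param (of_real t)) ` {0..1} = sphere 0 1"
proof -
  have "(\<lambda>t. circle_param (of_real t)) ` {0..1} = path_image (circlepath 0 1)"
    by (simp add: path_image_def circlepath circle_param_def del: path_image_circlepath)
  then show ?thesis by simp
qed

text \<open>
  Cauchy estimates on shrinking strips turn the rate below into uniform convergence of all derivatives.
\<close>

definition smoothing_rate :: "nat \<Rightarrow> real \<Rightarrow> real" where
  "smoothing_rate k \<rho> = (\<rho>/32) ^ (k + 1) * (1/2) ^ k / 8"

lemma smoothing_rate_pos: "\<rho> > 0 \<Longrightarrow> smoothing_rate k \<rho> > 0"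
  by (simp add: smoothing_rate_def)

text \<open>On discs of radius \<rho>/32 Cauchy's inequality divides by (\<rho>/32)^j, which the
  factor (\<rho>/32)^(k + 1) of the rate absorbs as soon as j \<le> k + 1. What remains is a
  geometric series, so every derivative converges. For j = 0 and j = 1 the total change is at most
  1/4, too little to destroy the injectivity or regularity of the circle.\<close>

lemma
  fixes \<psi>k :: "nat \<Rightarrow> complex \<Rightarrow> complex"
  assumes init: "\<psi>k 0 = (\<lambda>z. z)" and \<rho>: "\<And>k. 0 < \<rho> k \<and> \<rho> k < 1" "\<And>k. \<rho> (Suc k) < \<rho> k"
    and hol: "\<And>k. \<psi>k k holomorphic_on region False (\<rho> k)"
    and rate: "\<And>k z. z \<in> region False (\<rho> (Suc k)) \<Longrightarrow> norm (\<psi>k (Suc k) z - \<psi>k k z) \<le> smoothing_rate k (\<rho> (Suc k))"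
    and lim: "\<And>u. norm u = 1 \<Longrightarrow> (\<lambda>k. \<psi>k k u) \<longlonglongrightarrow> \<psi> u"
  shows smooth_limit_near_id: "norm u = 1 \<Longrightarrow> norm (\<psi> u - u) \<le> 1/4"
    and smooth_limit_simple_path: "simple_path (\<lambda>t. \<psi> (circle_param (of_real t)))"
    and smooth_limit_smooth: "smooth_Jordan_curve (\<psi> ` sphere 0 1)"
proof -
  define \<Gamma> where "\<Gamma> k = (\<lambda>t. \<psi>k k (circle_param t))" for k
  define strip where "strip \<delta> = {t :: complex. \<bar>Im t\<bar> < \<delta> / 16}" for \<delta> :: real
  have os: "open (strip \<delta>)" for \<delta>
    unfolding strip_def by (intro open_Collect_less continuous_intros)
  have \<Gamma>hol: "\<Gamma> k holomorphic_on strip \<delta>" if "0 < \<delta>" "\<delta> \<le> \<rho> k" for k \<delta>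
  proof -
    have "circle_param ` strip \<delta> \<subseteq> region False (\<rho> k)"
      using that \<rho>(1)[of k] by (auto simp: strip_def intro!: circle_param_in_region)
    then have "\<psi>k k \<circ> circle_param holomorphic_on strip \<delta>"
      by (intro holomorphic_on_compose_gen[OF circle_param_holomorphic hol])
    then show ?thesis by (simp add: \<Gamma>_def o_def)
  qed
  define h where "h j k t = (deriv ^^ j) (\<Gamma> k) (of_real t)" for j k and t :: real
  have real_strip: "of_real t \<in> strip \<delta>" if "\<delta> > 0" for t \<delta> using that by (simp add: strip_def)
  have hstep: "dist (h j (Suc k) t) (h j k t) \<le> (fact j / 4 * (1/2)^k) / 2" if "j \<le> Suc k" for j k t
  proof -
    let ?\<delta> = "\<rho> (Suc k)" and ?D = "\<lambda>w. \<Gamma> (Suc k) w - \<Gamma> k w"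
    have \<delta>: "0 < ?\<delta>" "?\<delta> < 1" "?\<delta> \<le> \<rho> k" using \<rho>(1)[of "Suc k"] \<rho>(2)[of k] by auto
    have H: "\<Gamma> (Suc k) holomorphic_on strip ?\<delta>" "\<Gamma> k holomorphic_on strip ?\<delta>" using \<Gamma>hol \<delta> by auto
    have sub: "cball (complex_of_real t) (?\<delta>/32) \<subseteq> strip ?\<delta>"
    proof
      fix w assume "w \<in> cball (complex_of_real t) (?\<delta>/32)"
      then have "\<bar>Im (of_real t - w)\<bar> \<le> ?\<delta>/32" using abs_Im_le_cmod[of "of_real t - w"] by (auto simp: dist_norm)
      then show "w \<in> strip ?\<delta>" using \<delta>(1) by (simp add: strip_def)
    qed
    have D: "?D holomorphic_on strip ?\<delta>" using H by (intro holomorphic_intros)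
    have "norm ((deriv ^^ j) ?D (of_real t)) \<le> fact j * smoothing_rate k ?\<delta> / (?\<delta>/32)^j"
    proof (rule Cauchy_inequality)
      show "?D holomorphic_on ball (of_real t) (?\<delta>/32)" using D by (rule holomorphic_on_subset) (use sub in auto)
      show "continuous_on (cball (of_real t) (?\<delta>/32)) ?D"
        using holomorphic_on_imp_continuous_on[OF D] sub by (rule continuous_on_subset)
      fix w assume "norm (complex_of_real t - w) = ?\<delta>/32"
      then have "w \<in> strip ?\<delta>" using sub by (auto simp: dist_norm)
      then have "circle_param w \<in> region False ?\<delta>" using \<delta> by (intro circle_param_in_region) (auto simp: strip_def)
      then show "norm (?D w) \<le> smoothing_rate k ?\<delta>" unfolding \<Gamma>_def by (rule rate)
    qed (use \<delta> in auto)
    also have "(deriv ^^ j) ?D (of_real t) = h j (Suc k) t - h j k t"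
      unfolding h_def by (rule higher_deriv_diff[OF H os real_strip]) (use \<delta> in auto)
    also have "fact j * smoothing_rate k ?\<delta> / (?\<delta>/32)^j \<le> fact j * ((1/2)^k / 8)"
    proof -
      have "(?\<delta>/32)^(k+1) \<le> (?\<delta>/32)^j" using that \<delta> by (intro power_decreasing) auto
      then have "(?\<delta>/32)^(k+1) / (?\<delta>/32)^j \<le> 1" using \<delta> by simp
      then have "(?\<delta>/32)^(k+1) / (?\<delta>/32)^j * ((1/2)^k / 8) \<le> 1 * ((1/2)^k / 8)" by (intro mult_right_mono) auto
      then have "smoothing_rate k ?\<delta> / (?\<delta>/32)^j \<le> (1/2)^k / 8" by (simp add: smoothing_rate_def field_simps)
      then have "fact j * (smoothing_rate k ?\<delta> / (?\<delta>/32)^j) \<le> fact j * ((1/2)^k / 8)" by (intro mult_left_mono) auto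
      then show ?thesis by simp
    qed
    finally show ?thesis by (simp add: dist_norm)
  qed
  have e: "fact j / 4 * (1/2)^(Suc k) \<le> (fact j / 4 * (1/2)^k) / (2::real)" "0 < fact j / 4 * (1/2::real)^k" for j k by auto
  define G where "G j t = lim (\<lambda>k. h j k t)" for j t
  have conv: "(\<lambda>k. h j k t) \<longlonglongrightarrow> G j t" for j t
    unfolding G_def convergent_LIMSEQ_iff[symmetric]
    by (rule halving_telescope(1)[where m=j and e="\<lambda>k. fact j / 4 * (1/2)^k", OF hstep e]) simp
  \<comment> \<open>The index j - 1, truncated at 0, is the first at which the estimate of
    \<open>hstep\<close> is available.\<close>
  have Gh: "dist (G j t) (h j k t) \<le> fact j / 4 * (1/2)^k" if "j \<le> Suc k" for j k t
    unfolding G_def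
    by (rule halving_telescope(2)[where m="j-1" and e="\<lambda>k. fact j / 4 * (1/2)^k", OF hstep e]) (use that in auto)
  have hder: "(h j k has_vector_derivative h (Suc j) k t) (at t)" for j k t
  proof -
    have "(deriv ^^ j) (\<Gamma> k) holomorphic_on strip (\<rho> k)"
      using \<Gamma>hol[of "\<rho> k" k] \<rho>(1)[of k] os by (intro holomorphic_higher_deriv) auto
    then have "((deriv ^^ j) (\<Gamma> k) has_field_derivative deriv ((deriv ^^ j) (\<Gamma> k)) (of_real t)) (at (of_real t))"
      by (rule holomorphic_derivI[OF _ os real_strip]) (use \<rho>(1) in auto)
    then show ?thesis unfolding h_def by (auto intro: has_vector_derivative_real_field)
  qed
  have Gder: "(G j has_vector_derivative G (Suc j) t) (at t)" for j t
  proof -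
    have "\<exists>g. \<forall>x\<in>UNIV. (\<lambda>k. h j k x) \<longlonglongrightarrow> g x \<and> (g has_derivative (\<lambda>y. y *\<^sub>R G (Suc j) x)) (at x within UNIV)"
    proof (rule has_derivative_sequence[where f'="\<lambda>k x y. y *\<^sub>R h (Suc j) k x" and ?x0.0=0])
      show "(h j k has_derivative (\<lambda>y. y *\<^sub>R h (Suc j) k x)) (at x within UNIV)" for k x
        using hder unfolding has_vector_derivative_def by simp
      fix \<eta> :: real assume \<eta>: "\<eta> > 0"
      have "(\<lambda>k. fact (Suc j) / 4 * (1/2::real)^k) \<longlonglongrightarrow> fact (Suc j) / 4 * 0"
        by (intro tendsto_intros LIMSEQ_power_zero) auto
      then have "\<forall>\<^sub>F k in sequentially. fact (Suc j) / 4 * (1/2::real)^k < \<eta>" using \<eta> by (intro order_tendstoD(2)) auto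
      then show "\<forall>\<^sub>F k in sequentially. \<forall>x\<in>UNIV. \<forall>y. norm (y *\<^sub>R h (Suc j) k x - y *\<^sub>R G (Suc j) x) \<le> \<eta> * norm y"
        using eventually_ge_at_top[of j]
      proof eventually_elim
        case (elim k)
        show ?case
        proof (intro ballI allI)
          fix x y :: real
          have "norm (h (Suc j) k x - G (Suc j) x) \<le> \<eta>" using Gh[of "Suc j" k x] elim by (simp add: dist_norm norm_minus_commute)
          then have "\<bar>y\<bar> * norm (h (Suc j) k x - G (Suc j) x) \<le> \<bar>y\<bar> * \<eta>" by (intro mult_left_mono) auto
          then show "norm (y *\<^sub>R h (Suc j) k x - y *\<^sub>R G (Suc j) x) \<le> \<eta> * norm y"
            by (simp flip: scaleR_diff_right add: mult.commute)
        qed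
      qed
    qed (use conv in auto)
    then obtain g where g: "\<And>x. (\<lambda>k. h j k x) \<longlonglongrightarrow> g x" "\<And>x. (g has_derivative (\<lambda>y. y *\<^sub>R G (Suc j) x)) (at x)" by auto
    have "g = G j" using g(1) conv LIMSEQ_unique by blast
    then show ?thesis using g(2) by (simp add: has_vector_derivative_def)
  qed
  define \<gamma> where "\<gamma> = (\<lambda>t::real. \<psi> (circle_param (of_real t)))"
  have \<gamma>G: "\<gamma> = G 0"
  proof
    fix t
    have "(\<lambda>k. h 0 k t) \<longlonglongrightarrow> \<gamma> t" unfolding h_def \<Gamma>_def \<gamma>_def by (simp add: lim)
    then show "\<gamma> t = G 0 t" using conv LIMSEQ_unique by blast
  qed
  have iter: "((\<lambda>g t. vector_derivative g (at t)) ^^ j) \<gamma> = G j" for j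
  proof (induction j)
    case 0 then show ?case by (simp add: \<gamma>G)
  next
    case (Suc j) then show ?case using Gder[THEN vector_derivative_at] by auto
  qed
  have \<Gamma>0: "\<Gamma> 0 = circle_param" by (simp add: \<Gamma>_def init)
  have h0: "h 0 0 t = circle_param (of_real t)" for t by (simp add: h_def \<Gamma>0)
  have "deriv circle_param t = 2 * of_real pi * \<i> * circle_param t" for t
    unfolding circle_param_def by (rule DERIV_imp_deriv) (auto intro!: derivative_eq_intros)
  then have h1: "h 1 0 t = 2 * of_real pi * \<i> * circle_param (of_real t)" for t by (simp add: h_def \<Gamma>0)
  show near: "norm (\<psi> u - u) \<le> 1/4" if u: "norm u = 1" for u
  proof -
    have "u \<in> (\<lambda>t. circle_param (of_real t)) ` {0..1}" using u unfolding circle_param_image by simp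
    then obtain t :: real where t: "u = circle_param (of_real t)" by auto
    have "dist (G 0 t) (h 0 0 t) \<le> 1/4" using Gh[of 0 0 t] by simp
    then show ?thesis using h0 by (simp add: dist_norm t \<gamma>G[symmetric] \<gamma>_def)
  qed
  \<comment> \<open>The perturbation of the circle is 1/4-Lipschitz, whereas chords of the circle
    over parameter distances up to 1/2 have at least 4 times that length.\<close>
  define g where "g t = \<gamma> t - circle_param (of_real t)" for t :: real
  have gder: "(g has_vector_derivative (G 1 t - h 1 0 t)) (at t)" for t
    unfolding g_def \<gamma>G h0[symmetric] using Gder[of 0 t] hder[of 0 0 t] by (auto intro!: derivative_intros)
  have glip: "norm (g s - g t) \<le> 1/4 * norm (s - t)" for s t
  proof (rule differentiable_bound[of UNIV g "\<lambda>t x. x *\<^sub>R (G 1 t - h 1 0 t)"])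
    show "(g has_derivative (\<lambda>x. x *\<^sub>R (G 1 t - h 1 0 t))) (at t within UNIV)" for t
      using gder[of t] by (simp add: has_vector_derivative_def)
    fix t
    have "norm (G 1 t - h 1 0 t) \<le> 1/4" using Gh[of 1 0 t] by (simp add: dist_norm)
    then show "onorm (\<lambda>x. x *\<^sub>R (G 1 t - h 1 0 t)) \<le> 1/4"
      by (simp add: onorm_scaleR_left onorm_id)
  qed auto
  have close: "s = t" if "\<gamma> s = \<gamma> t" "\<bar>s - t\<bar> \<le> 1/2" for s t
  proof -
    have "circle_param (of_real s) - circle_param (of_real t) = g t - g s" using that by (simp add: g_def)
    then have "4 * \<bar>s - t\<bar> \<le> norm (g t - g s)" using circle_param_dist[OF that(2)] by simp
    moreover have "norm (g t - g s) \<le> 1/4 * \<bar>s - t\<bar>" using glip[of t s] by (simp add: abs_minus_commute)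
    ultimately have "4 * \<bar>s - t\<bar> \<le> 1/4 * \<bar>s - t\<bar>" by (rule order_trans)
    then show ?thesis by (simp add: abs_if split: if_splits)
  qed
  have per: "\<gamma> (t + 1) = \<gamma> t" for t
    using circle_param_periodic[of "of_real t" 1] by (simp add: \<gamma>_def)
  have path: "path \<gamma>"
    unfolding path_def using Gder[of 0] \<gamma>G
    by (metis continuous_at_imp_continuous_on has_vector_derivative_continuous)
  show sp: "simple_path (\<lambda>t. \<psi> (circle_param (of_real t)))"
    unfolding \<gamma>_def[symmetric] simple_path_def loop_free_def
  proof (intro conjI ballI impI path)
    fix s t :: real assume st: "s \<in> {0..1}" "t \<in> {0..1}" "\<gamma> s = \<gamma> t"
    have "0 \<le> s" "s \<le> 1" "0 \<le> t" "t \<le> 1" using st by auto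
    \<comment> \<open>Up to a period two parameters are at most 1/2 apart, which is where the chord
      bound holds.\<close>
    then have "\<bar>s - t\<bar> \<le> 1/2 \<or> \<bar>(s + 1) - t\<bar> \<le> 1/2 \<or> \<bar>s - (t + 1)\<bar> \<le> 1/2"
      unfolding abs_le_iff by linarith
    then consider "\<bar>s - t\<bar> \<le> 1/2" | "\<bar>(s + 1) - t\<bar> \<le> 1/2" | "\<bar>s - (t + 1)\<bar> \<le> 1/2" by blast
    then show "s = t \<or> s = 0 \<and> t = 1 \<or> s = 1 \<and> t = 0"
    proof cases
      case 1 then show ?thesis using close st by blast
    next
      case 2 then have "s + 1 = t" using close[of "s+1" t] st per by simp
      then show ?thesis using st by auto
    next
      case 3 then have "s = t + 1" using close[of s "t+1"] st per by simp
      then show ?thesis using st by auto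
    qed
  qed
  have G1: "G 1 t \<noteq> 0" for t
  proof
    assume "G 1 t = 0"
    then have "norm (h 1 0 t) \<le> 1/4" using Gh[of 1 0 t] by (simp add: dist_norm)
    moreover have "norm (h 1 0 t) = 2 * pi" unfolding h1 by (simp add: norm_mult)
    ultimately show False using pi_gt3 by simp
  qed
  show "smooth_Jordan_curve (\<psi> ` sphere 0 1)"
    unfolding smooth_Jordan_curve_def
  proof (intro exI[of _ \<gamma>] conjI allI)
    show "((\<lambda>g t. vector_derivative g (at t)) ^^ k) \<gamma> differentiable_on UNIV" for k
      unfolding iter differentiable_on_def using Gder[of k]
      by (auto simp: has_vector_derivative_def differentiable_def)
    show "vector_derivative \<gamma> (at t) \<noteq> 0" for t using G1 Gder[of 0 t] \<gamma>G vector_derivative_at by fastforce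
    show "\<gamma> (t + 1) = \<gamma> t" for t by (rule per)
    show "simple_path \<gamma>" using sp by (simp add: \<gamma>_def)
    show "path_image \<gamma> = \<psi> ` sphere 0 1"
      unfolding path_image_def \<gamma>_def circle_param_image[symmetric] by (simp add: image_image)
  qed
qed

section \<open>The domain enclosed by the curve\<close>

lemma
  fixes \<psi> :: "complex \<Rightarrow> complex"
  assumes near: "\<And>u. norm u = 1 \<Longrightarrow> norm (\<psi> u - u) \<le> 1/4"
    and sp: "simple_path (\<lambda>t. \<psi> (circle_param (of_real t)))"
  defines "U \<equiv> inside (\<psi> ` sphere 0 1)"
  shows near_circle_inside: "open U" "connected U" "bounded U" "frontier U = \<psi> ` sphere 0 1" "0 \<in> U"
proof -
  define \<gamma> where "\<gamma> = (\<lambda>t::real. \<psi> (circle_param (of_real t)))"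
  have im: "path_image \<gamma> = \<psi> ` sphere 0 1"
    unfolding path_image_def \<gamma>_def circle_param_image[symmetric] by (simp add: image_image)
  have sp': "simple_path \<gamma>" using sp by (simp add: \<gamma>_def)
  have loop: "pathfinish \<gamma> = pathstart \<gamma>"
    using circle_param_periodic[of 0 1] by (simp add: pathfinish_def pathstart_def \<gamma>_def)
  have J: "inside (path_image \<gamma>) \<noteq> {} \<and> open (inside (path_image \<gamma>)) \<and> connected (inside (path_image \<gamma>)) \<and>
      bounded (inside (path_image \<gamma>)) \<and> frontier (inside (path_image \<gamma>)) = path_image \<gamma>"
    using Jordan_inside_outside[OF sp' loop] by blast
  then show "open U" "connected U" "bounded U" "frontier U = \<psi> ` sphere 0 1" by (simp_all add: U_def im)
  have cp: "circlepath 0 1 t = circle_param (of_real t)" for t by (simp add: circlepath circle_param_def)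
  \<comment> \<open>The straight homotopy to the unit circle moves points by at most 1/4 and avoids
    0, so the winding number about 0 is 1 and 0 is not outside.\<close>
  have "homotopic_loops (- {0}) \<gamma> (circlepath 0 1)"
  proof (rule homotopic_loops_linear)
    show "path \<gamma>" using sp' by (rule simple_path_imp_path)
    fix t
    show "closed_segment (\<gamma> t) (circlepath 0 1 t) \<subseteq> - {0}"
    proof
      fix w assume "w \<in> closed_segment (\<gamma> t) (circlepath 0 1 t)"
      then have "dist w (circlepath 0 1 t) \<le> dist (\<gamma> t) (circlepath 0 1 t)"
        by (metis dist_commute segment_bound(2) dist_norm norm_minus_commute)
      also have "\<dots> \<le> 1/4" unfolding cp \<gamma>_def dist_norm by (rule near) simp
      finally show "w \<in> - {0}" unfolding cp by (auto simp: dist_norm)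
    qed
  qed (use loop in auto)
  then have "winding_number \<gamma> 0 = winding_number (circlepath 0 1) 0" by (rule winding_number_homotopic_loops)
  then have w: "winding_number \<gamma> 0 = 1" by (simp add: winding_number_circlepath_centre)
  have n0: "0 \<notin> path_image \<gamma>"
  proof
    assume "0 \<in> path_image \<gamma>"
    then obtain u where "norm u = 1" "\<psi> u = 0" unfolding im by auto
    then show False using near[of u] by simp
  qed
  have "0 \<notin> outside (path_image \<gamma>)"
    using winding_number_zero_in_outside[OF simple_path_imp_path[OF sp'] loop] w by fastforce
  then show "0 \<in> U" using n0 unfolding U_def im[symmetric] by (auto simp: inside_outside)
qed

section \<open>Transcendence\<close>

lemma itinerary_orbit_closure:
  assumes W: "wandering_itinerary f U d e" and \<zeta>: "\<zeta> \<in> closure U"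
  shows "norm ((f ^^ n) \<zeta> - d n) \<le> e n"
proof (rule continuous_le_on_closure[OF _ \<zeta>])
  show "continuous_on (closure U) (\<lambda>z. norm ((f ^^ n) z - d n))"
    using wandering_itineraryD(1)[OF W] by (intro continuous_intros continuous_on_entire_funpow)
qed (use wandering_itineraryD(7)[OF W] in auto)

lemma poly_superlinear:
  fixes p :: "complex poly"
  assumes "degree p \<ge> 2"
  obtains R where "R \<ge> 1" "\<And>z. norm z \<ge> R \<Longrightarrow> norm (poly p z) \<ge> 2 * norm z"
proof -
  obtain a q where p: "p = pCons a q" by (rule pCons_cases)
  obtain b q' where q: "q = pCons b q'" by (rule pCons_cases)
  have "q' \<noteq> 0" using assms p q by (auto split: if_splits)
  then obtain r where r: "\<And>z. r \<le> norm z \<Longrightarrow> 3 \<le> norm (poly (pCons b q') z)"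
    using poly_infinity[of q' 3 b] by auto
  show thesis
  proof (rule that[of "max 1 (max r (norm a))"])
    fix z :: complex assume z: "max 1 (max r (norm a)) \<le> norm z"
    then have "norm z * 3 \<le> norm (z * poly q z)" using r[of z] q by (simp add: norm_mult mult_left_mono)
    moreover have "norm (z * poly q z) - norm a \<le> norm (poly p z)"
      using norm_diff_ineq[of "z * poly q z" a] by (simp add: p add.commute)
    ultimately show "2 * norm z \<le> norm (poly p z)" using z by linarith
  qed simp
qed

text \<open>A polynomial of degree at least 2 expands near infinity, so points near a boundary point
  with a large iterate could not have bounded orbits. For degree at most 1 all iterates are affine,
  and boundedness at two points would spread to the boundary point, whose orbit is
  unbounded.\<close>

lemma itinerary_transcendental:
  assumes W: "wandering_itinerary f U d e"
  shows "transcendental_entire f"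
  unfolding transcendental_entire_def
proof
  note D = wandering_itineraryD[OF W]
  show "f holomorphic_on UNIV" by fact
  show "\<nexists>p. f = poly p"
  proof
    assume "\<exists>p. f = poly p"
    then obtain p where p: "f = poly p" by auto
    have "U \<noteq> UNIV" using D(5) not_bounded_UNIV by metis
    then obtain \<zeta> where \<zeta>: "\<zeta> \<in> frontier U" using frontier_eq_empty[of U] D(6) by auto
    then have \<zeta>c: "\<zeta> \<in> closure U" by (simp add: frontier_def)
    have big: "\<exists>m. B \<le> norm ((f ^^ m) \<zeta>)" for B
    proof -
      obtain k where "\<And>B. \<forall>\<^sub>F i in sequentially. \<forall>z. norm ((f ^^ k i) z - d (k i)) \<le> e (k i) \<longrightarrow> B \<le> norm ((f ^^ k i) z)"
        using itinerary_unbounded[OF W] by blast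
      from this[of B] have "\<forall>\<^sub>F i in sequentially. B \<le> norm ((f ^^ k i) \<zeta>)"
        by eventually_elim (use itinerary_orbit_closure[OF W \<zeta>c] in blast)
      then show ?thesis by (auto simp: eventually_sequentially)
    qed
    show False
    proof (cases "degree p \<ge> 2")
      case True
      then obtain R where R: "R \<ge> 1" "\<And>z. norm z \<ge> R \<Longrightarrow> norm (f z) \<ge> 2 * norm z"
        using poly_superlinear p by metis
      obtain m where m: "R + 1 \<le> norm ((f ^^ m) \<zeta>)" using big by blast
      have "continuous_on UNIV (f ^^ m)" using D(1) by (rule continuous_on_entire_funpow)
      then obtain \<delta> where \<delta>: "\<delta> > 0" "\<And>x. dist x \<zeta> < \<delta> \<Longrightarrow> dist ((f ^^ m) x) ((f ^^ m) \<zeta>) < 1"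
        unfolding continuous_on_iff by (metis UNIV_I zero_less_one)
      obtain q where q: "q \<in> ball \<zeta> \<delta>" "bounded (range (\<lambda>n. (f ^^ n) q))" using D(11)[OF \<zeta> \<delta>(1)] by blast
      have "dist ((f ^^ m) q) ((f ^^ m) \<zeta>) < 1" by (rule \<delta>(2)) (use q(1) in \<open>simp add: dist_commute\<close>)
      then have q0: "norm ((f ^^ m) q) \<ge> R"
        using m norm_triangle_ineq2[of "(f ^^ m) \<zeta>" "(f ^^ m) q"] by (simp add: dist_norm norm_minus_commute)
      have grow: "norm ((f ^^ (j + m)) q) \<ge> 2 ^ j * R" for j
      proof (induction j)
        case (Suc j)
        have "R \<le> 2 ^ j * R" using R(1) by simp
        then have "R \<le> norm ((f ^^ (j + m)) q)" using Suc by linarith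
        then have "2 * norm ((f ^^ (j + m)) q) \<le> norm (f ((f ^^ (j + m)) q))" by (rule R(2))
        then show ?case using Suc by simp
      qed (use q0 in simp)
      obtain M where M: "\<And>n. norm ((f ^^ n) q) \<le> M" using q(2) by (auto simp: bounded_iff)
      obtain j where "M < 2 ^ j" using real_arch_pow[of 2 M] by auto
      also have "(2::real) ^ j \<le> 2 ^ j * R" using R(1) by simp
      also have "\<dots> \<le> M" using grow[of j] M[of "j + m"] by linarith
      finally show False by simp
    next
      case False
      obtain \<beta> \<alpha> where "p = [:\<beta>, \<alpha>:]"
      proof -
        have "degree p < 2" using False by simp
        then have "p = [:coeff p 0, coeff p 1:]"
          by (intro poly_eqI) (auto simp: coeff_pCons coeff_eq_0 split: nat.splits)
        then show ?thesis using that by blast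
      qed
      then have f: "f z = \<alpha> * z + \<beta>" for z by (simp add: p algebra_simps)
      have aff: "\<exists>A C. \<forall>z. (f ^^ n) z = A * z + C" for n
      proof (induction n)
        case 0 show ?case by (intro exI[of _ 1] exI[of _ 0]) simp
      next
        case (Suc n)
        then obtain A C where AC: "\<And>z. (f ^^ n) z = A * z + C" by blast
        have "(f ^^ Suc n) z = (\<alpha> * A) * z + (\<alpha> * C + \<beta>)" for z
          by (simp only: funpow.simps o_apply AC f) (simp add: algebra_simps)
        then show ?case by blast
      qed
      have unb: "\<not> bounded (range (\<lambda>n. (f ^^ n) \<zeta>))"
      proof
        assume "bounded (range (\<lambda>n. (f ^^ n) \<zeta>))"
        then obtain M where M: "\<And>n. norm ((f ^^ n) \<zeta>) \<le> M" by (auto simp: bounded_iff)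
        obtain m where "M + 1 \<le> norm ((f ^^ m) \<zeta>)" using big by blast
        then show False using M[of m] by simp
      qed
      obtain x where x: "x \<in> ball \<zeta> 1" "bounded (range (\<lambda>n. (f ^^ n) x))" using D(11)[OF \<zeta>, of 1] by auto
      have "x \<noteq> \<zeta>" using x(2) unb by blast
      \<comment> \<open>The radius is the distance to x, so y differs from x.\<close>
      then obtain y where y: "y \<in> ball \<zeta> (dist \<zeta> x)" "bounded (range (\<lambda>n. (f ^^ n) y))" using D(11)[OF \<zeta>, of "dist \<zeta> x"] by auto
      have "y \<noteq> x" using y(1) by auto
      define t where "t = (\<zeta> - x) / (y - x)"
      have \<zeta>t: "\<zeta> = x + t * (y - x)" using \<open>y \<noteq> x\<close> by (simp add: t_def)
      have comb: "(f ^^ n) \<zeta> = (f ^^ n) x + t * ((f ^^ n) y - (f ^^ n) x)" for n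
      proof -
        obtain A C where AC: "\<And>z. (f ^^ n) z = A * z + C" using aff by blast
        show ?thesis unfolding AC by (subst \<zeta>t) (simp add: algebra_simps)
      qed
      obtain M1 where M1: "\<And>n. norm ((f ^^ n) x) \<le> M1" using x(2) by (auto simp: bounded_iff)
      obtain M2 where M2: "\<And>n. norm ((f ^^ n) y) \<le> M2" using y(2) by (auto simp: bounded_iff)
      have "norm ((f ^^ n) \<zeta>) \<le> M1 + norm t * (M2 + M1)" for n
      proof -
        have "norm ((f ^^ n) \<zeta>) \<le> norm ((f ^^ n) x) + norm t * norm ((f ^^ n) y - (f ^^ n) x)"
          unfolding comb by (metis norm_mult norm_triangle_ineq)
        also have "norm ((f ^^ n) y - (f ^^ n) x) \<le> M2 + M1"
          using norm_triangle_ineq4[of "(f ^^ n) y" "(f ^^ n) x"] M1[of n] M2[of n] by linarith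
        finally show ?thesis using M1[of n] by (simp add: mult_left_mono)
      qed
      then show False using unb by (auto simp: bounded_iff)
    qed
  qed
qed

section \<open>Existence of the model domains\<close>

lemma blaschke_like_modulus:
  assumes "blaschke_like b" "\<nu> > 0"
  obtains \<delta> where "\<delta> > 0" "\<delta> \<le> \<nu>" "b holomorphic_on ball 0 (1 + 2 * \<delta>)"
    "\<And>x y. norm x = 1 \<Longrightarrow> norm (y - x) \<le> \<delta> \<Longrightarrow> norm (b y - b x) \<le> \<nu>"
proof -
  obtain \<rho> where \<rho>: "\<rho> > 0" "b holomorphic_on ball 0 (1 + \<rho>)"
    using assms(1) unfolding blaschke_like_def by auto
  have "continuous_on (cball 0 (1 + \<rho>/2)) b"
    using holomorphic_on_imp_continuous_on[OF \<rho>(2)] by (rule continuous_on_subset) (use \<rho> in auto)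
  from compact_uniformly_continuous[OF this compact_cball] assms(2)
  obtain \<eta> where \<eta>: "\<eta> > 0" "\<And>x y. x \<in> cball 0 (1 + \<rho>/2) \<Longrightarrow> y \<in> cball 0 (1 + \<rho>/2) \<Longrightarrow> dist y x < \<eta> \<Longrightarrow> dist (b y) (b x) < \<nu>"
    unfolding uniformly_continuous_on_def by meson
  define \<delta> where "\<delta> = min (\<eta>/2) (min \<nu> (\<rho>/2))"
  have \<delta>: "\<delta> > 0" "\<delta> \<le> \<nu>" "\<delta> < \<eta>" "\<delta> \<le> \<rho>/2" using \<eta> \<rho> assms(2) by (auto simp: \<delta>_def)
  show thesis
  proof (rule that[of \<delta>])
    show "b holomorphic_on ball 0 (1 + 2 * \<delta>)" using \<rho>(2) by (rule holomorphic_on_subset) (use \<delta> in auto)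
    fix x y :: complex assume xy: "norm x = 1" "norm (y - x) \<le> \<delta>"
    have "norm y \<le> 1 + \<rho>/2" using xy \<delta> norm_triangle_ineq2[of y x] by linarith
    then have "dist (b y) (b x) < \<nu>" using xy \<delta> \<rho> by (intro \<eta>(2)) (auto simp: dist_norm)
    then show "norm (b y - b x) \<le> \<nu>" by (simp add: dist_norm)
  qed (use \<delta> in auto)
qed

lemma strict_mono_interval:
  fixes N :: "nat \<Rightarrow> nat"
  assumes "strict_mono N" "N 0 = 0"
  obtains k where "N k \<le> n" "n < N (Suc k)"
proof -
  have "\<exists>k. N k \<le> n \<and> n < N (Suc k)"
  proof (induction n)
    case 0 then show ?case using assms strict_monoD[OF assms(1), of 0 1] by (intro exI[of _ 0]) auto
  next
    case (Suc n)
    then obtain k where k: "N k \<le> n" "n < N (Suc k)" by blast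
    show ?case
    proof (cases "Suc n < N (Suc k)")
      case True then show ?thesis using k by (intro exI[of _ k]) auto
    next
      case False
      then have "N (Suc k) = Suc n" using k by simp
      then show ?thesis using strict_monoD[OF assms(1), of "Suc k" "Suc (Suc k)"] by (intro exI[of _ "Suc k"]) auto
    qed
  qed
  then show ?thesis using that by blast
qed

text \<open>The construction controls only the boundary curve. The maximum principle carries its
  estimates to the enclosed domain U, in particular the approximate recursion w (k + 1) = b k (w k)
  in normalized coordinates.\<close>

theorem wandering_model_exists:
  fixes full :: bool and b :: "nat \<Rightarrow> complex \<Rightarrow> complex" and \<nu> far_rad :: "nat \<Rightarrow> real" and ret :: "nat \<Rightarrow> bool"
  assumes bl: "\<And>k. blaschke_like (b k)" and full_id: "\<And>k. full \<Longrightarrow> b k = (\<lambda>z. z)"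
    and \<nu>: "\<And>k. \<nu> k > 0" and far_rad: "\<And>k. 0 < far_rad k \<and> far_rad k \<le> 1"
  obtains f U c r N d e where
    "wandering_itinerary f U d e" "smooth_Jordan_curve (frontier U)" "full \<Longrightarrow> U = ball 0 1" "0 \<in> U"
    "c 0 = 0" "r 0 = 1" "N 0 = 0" "\<And>k. 0 < r k \<and> r k \<le> 1"
    "\<And>k. N (Suc k) = (if ret k then N k + k + 2 else N k + 1)"
    "\<And>k. if ret k then r (Suc k) \<le> 1 / real (k + 2) else r (Suc k) = far_rad (Suc k)"
    "\<And>k. d (N k) = c k \<and> e (N k) = 2 * r k"
    "\<And>k n. N k < n \<Longrightarrow> n < N (Suc k) \<Longrightarrow> e n = 1 / real (k + 1)"
    "\<And>k z. z \<in> closure U \<Longrightarrow> norm ((f ^^ N k) z - c k) \<le> (1 + \<nu> k) * r k"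
    "\<And>k z. z \<in> frontier U \<Longrightarrow> (1 - \<nu> k) * r k \<le> norm ((f ^^ N k) z - c k)"
    "\<And>k z. z \<in> U \<Longrightarrow> norm (((f ^^ N (Suc k)) z - c (Suc k)) / of_real (r (Suc k)) - b k (((f ^^ N k) z - c k) / of_real (r k))) \<le> \<nu> k"
    "\<And>k z. full \<Longrightarrow> z \<in> U \<Longrightarrow> norm (((f ^^ N k) z - c k) / of_real (r k) - z) \<le> \<nu> k"
    "\<And>k z. ret k \<Longrightarrow> z \<in> U \<Longrightarrow> dist ((f ^^ Suc (N k)) z) 20 \<le> 1"
    "filterlim (\<lambda>k. norm (c k)) at_top sequentially"
proof -
  have "\<exists>\<delta>>0. \<delta> \<le> \<nu> k / 2 \<and> b k holomorphic_on ball 0 (1 + 2 * \<delta>) \<and>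
      (\<forall>x y. norm x = 1 \<and> norm (y - x) \<le> \<delta> \<longrightarrow> norm (b k y - b k x) \<le> \<nu> k / 2)" for k
    using blaschke_like_modulus[OF bl, of "\<nu> k / 2" k] \<nu>[of k] by (metis half_gt_zero)
  then obtain \<delta> where \<delta>: "\<And>k. \<delta> k > 0" "\<And>k. \<delta> k \<le> \<nu> k / 2" "\<And>k. b k holomorphic_on ball 0 (1 + 2 * \<delta> k)"
      "\<And>k x y. norm x = 1 \<Longrightarrow> norm (y - x) \<le> \<delta> k \<Longrightarrow> norm (b k y - b k x) \<le> \<nu> k / 2" by metis
  \<comment> \<open>Below \<delta> k, so that b k changes by at most \<nu> k / 2 at the position
    reached at station k; and at station k + 1 below \<nu> k / 2 again. The two halves give the
    error \<nu> k of the recursion.\<close>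
  define \<epsilon> where "\<epsilon> k = min (min (\<delta> k) 1) (if k = 0 then 1 else \<nu> (k - 1) / 2)" for k
  have eps: "\<epsilon> k > 0" "\<epsilon> k \<le> \<delta> k" "\<epsilon> k \<le> 1" "\<epsilon> (Suc k) \<le> \<nu> k / 2" for k
    using \<delta>(1)[of k] \<nu>[of "k - 1"] by (auto simp: \<epsilon>_def)
  have \<epsilon>\<nu>: "\<epsilon> k \<le> \<nu> k" for k using eps(2)[of k] \<delta>(2)[of k] \<nu>[of k] by simp
  interpret wandering_construction full b \<epsilon> ret far_rad smoothing_rate 10 20
  proof
    show "(20::complex) \<notin> cball 10 2" "(20::complex) \<notin> cball 0 2" by (simp_all add: dist_norm)
    have "False" if "norm (0 - z) \<le> 2" "norm (10 - z) \<le> 2" for z :: complex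
      using that norm_triangle_ineq4[of "10 - z" "0 - z"] by simp
    then show "cball 0 2 \<inter> cball (10::complex) 2 = {}" by (auto simp: dist_norm)
  qed (use bl full_id eps far_rad smoothing_rate_pos in auto)
  obtain f \<psi> \<psi>k \<rho> c r N where
    f: "f holomorphic_on UNIV" "\<not> f constant_on UNIV" and
    init: "c 0 = 0" "r 0 = 1" "N 0 = 0" and r: "\<And>k. 0 < r k \<and> r k \<le> 1" and
    N: "\<And>k. N (Suc k) = (if ret k then N k + k + 2 else N k + 1)" and
    rS: "\<And>k. if ret k then r (Suc k) \<le> 1 / real (k + 2) else r (Suc k) = far_rad (Suc k)" and
    far: "\<And>k. real k \<le> dist (c k) 10" and
    main: "\<And>k u. norm u = 1 \<Longrightarrow> norm ((f ^^ N k) (\<psi> u) - (c k + of_real (r k) * B k u)) \<le> \<epsilon> k * r k" and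
    bdd: "\<And>u \<eta>. norm u = 1 \<Longrightarrow> \<eta> > 0 \<Longrightarrow> \<exists>p. dist p (\<psi> u) < \<eta> \<and> bounded (range (\<lambda>n. (f ^^ n) p))" and
    mid: "\<And>k n. N k < n \<Longrightarrow> n < N (Suc k) \<Longrightarrow> \<exists>d. \<forall>u. norm u = 1 \<longrightarrow> dist ((f ^^ n) (\<psi> u)) d \<le> 1 / real (k + 1)" and
    retx: "\<And>k u. ret k \<Longrightarrow> norm u = 1 \<Longrightarrow> dist ((f ^^ Suc (N k)) (\<psi> u)) 20 < 1" and
    fullpsi: "full \<Longrightarrow> \<psi> = (\<lambda>z. z)" and
    \<psi>k: "\<psi>k 0 = (\<lambda>z. z)" "\<And>k. 0 < \<rho> k \<and> \<rho> k < 1" "\<And>k. \<rho> (Suc k) < \<rho> k"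
    "\<And>k. \<psi>k k holomorphic_on region full (\<rho> k)"
    "\<And>k z. z \<in> region full (\<rho> (Suc k)) \<Longrightarrow> norm (\<psi>k (Suc k) z - \<psi>k k z) \<le> smoothing_rate k (\<rho> (Suc k))"
    "\<And>u. norm u = 1 \<Longrightarrow> (\<lambda>k. \<psi>k k u) \<longlonglongrightarrow> \<psi> u"
    by (rule construction_limit) (rule that; assumption)
  have sub: "region False \<rho> \<subseteq> region full \<rho>" for \<rho> by (auto simp: region_def)
  have hol: "\<psi>k k holomorphic_on region False (\<rho> k)" for k using \<psi>k(4) sub by (rule holomorphic_on_subset)
  have rate: "norm (\<psi>k (Suc k) z - \<psi>k k z) \<le> smoothing_rate k (\<rho> (Suc k))" if "z \<in> region False (\<rho> (Suc k))" for k z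
    using \<psi>k(5) sub that by blast
  note smooth = smooth_limit_near_id[OF \<psi>k(1-3) hol rate \<psi>k(6)] smooth_limit_simple_path[OF \<psi>k(1-3) hol rate \<psi>k(6)]
    smooth_limit_smooth[OF \<psi>k(1-3) hol rate \<psi>k(6)]
  define U where "U = inside (\<psi> ` sphere 0 1)"
  have U: "open U" "connected U" "bounded U" "frontier U = \<psi> ` sphere 0 1" "0 \<in> U"
    unfolding U_def by (rule near_circle_inside[OF smooth(1,2)]; assumption)+
  have Uball: "U = ball 0 1" if full
  proof -
    have "sphere 0 1 = frontier (cball (0::complex) 1)" by simp
    moreover have "inside (frontier (cball (0::complex) 1)) = interior (cball 0 1)"
      by (rule inside_frontier_eq_interior) auto
    ultimately show ?thesis unfolding U_def fullpsi[OF that] by (simp add: interior_cball)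
  qed
  have maxp: "norm (g z) \<le> M" if "g holomorphic_on U" "continuous_on (closure U) g" "\<And>\<zeta>. \<zeta> \<in> frontier U \<Longrightarrow> norm (g \<zeta>) \<le> M" "z \<in> closure U" for g M z
  proof (cases "z \<in> U")
    case True
    show ?thesis by (rule maximum_modulus_frontier[of g U]) (use that True U in \<open>auto simp: interior_open\<close>)
  next
    case False
    then have "z \<in> frontier U" using that(4) U(1) by (simp add: frontier_def interior_open)
    then show ?thesis by (rule that(3))
  qed
  have fh: "(f ^^ n) holomorphic_on S" "continuous_on S (f ^^ n)" for n S
    using f(1) by (auto intro: holomorphic_on_funpow continuous_on_entire_funpow)
  have maxf: "norm ((f ^^ n) z - d) \<le> M" if "\<And>u. norm u = 1 \<Longrightarrow> norm ((f ^^ n) (\<psi> u) - d) \<le> M" "z \<in> closure U" for n z d M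
    by (rule maxp[OF _ _ _ that(2)]) (use that(1) U(4) in \<open>auto intro!: holomorphic_intros continuous_intros fh\<close>)
  have NS: "N k < N (Suc k)" for k using N[of k] by auto
  have sm: "strict_mono N" using NS by (rule strict_mono_Suc_iff[THEN iffD2, rule_format])
  have bound: "norm ((f ^^ N k) (\<psi> u) - c k) \<le> (1 + \<epsilon> k) * r k" "(1 - \<epsilon> k) * r k \<le> norm ((f ^^ N k) (\<psi> u) - c k)"
    if u: "norm u = 1" for k u
  proof -
    have "norm (of_real (r k) * B k u) = r k" using norm_B_circle[OF u, of k] r[of k] by (simp add: norm_mult)
    moreover have "(f ^^ N k) (\<psi> u) - c k = ((f ^^ N k) (\<psi> u) - (c k + of_real (r k) * B k u)) + of_real (r k) * B k u" by simp
    ultimately show "norm ((f ^^ N k) (\<psi> u) - c k) \<le> (1 + \<epsilon> k) * r k" "(1 - \<epsilon> k) * r k \<le> norm ((f ^^ N k) (\<psi> u) - c k)"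
      using main[OF u, of k]
        norm_triangle_ineq[of "(f ^^ N k) (\<psi> u) - (c k + of_real (r k) * B k u)" "of_real (r k) * B k u"]
        norm_diff_ineq[of "of_real (r k) * B k u" "(f ^^ N k) (\<psi> u) - (c k + of_real (r k) * B k u)"]
      by (simp_all add: algebra_simps)
  qed
  have "\<exists>d e. (\<forall>k. n = N k \<longrightarrow> d = c k \<and> e = 2 * r k) \<and> (\<forall>k. N k < n \<and> n < N (Suc k) \<longrightarrow> e = 1 / real (k + 1)) \<and>
      (\<forall>z\<in>U. norm ((f ^^ n) z - d) \<le> e)" for n
  proof -
    obtain k where k: "N k \<le> n" "n < N (Suc k)" using strict_mono_interval[OF sm init(3)] by blast
    \<comment> \<open>A time belongs to exactly one stage, so discs can be chosen separately for
      station times and for the times between them.\<close>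
    have uniq: "j = k" if "N j \<le> n" "n < N (Suc j)" for j
    proof (rule ccontr)
      assume "j \<noteq> k"
      then consider "Suc j \<le> k" | "Suc k \<le> j" by linarith
      then show False
        using k that strict_mono_less_eq[OF sm] by cases (metis le_less_trans not_less)+
    qed
    show ?thesis
    proof (cases "n = N k")
      case True
      show ?thesis
      proof (intro exI[of _ "c k"] exI[of _ "2 * r k"] conjI allI impI ballI)
        fix z assume "z \<in> U"
        then have "z \<in> closure U" using closure_subset by blast
        then have "norm ((f ^^ n) z - c k) \<le> (1 + \<epsilon> k) * r k"
          unfolding True by (rule maxf[rotated]) (rule bound(1))
        also have "\<dots> \<le> 2 * r k" using eps(3)[of k] r[of k] by (intro mult_right_mono) auto
        finally show "norm ((f ^^ n) z - c k) \<le> 2 * r k" .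
      next
        fix j assume "n = N j"
        then have "j = k" using True sm by (simp add: strict_mono_eq)
        then show "c k = c j" "2 * r k = 2 * r j" by auto
      next
        fix j assume "N j < n \<and> n < N (Suc j)"
        then show "2 * r k = 1 / real (j + 1)" using uniq[of j] True by auto
      qed
    next
      case False
      then obtain d where d: "\<And>u. norm u = 1 \<Longrightarrow> dist ((f ^^ n) (\<psi> u)) d \<le> 1 / real (k + 1)"
        using mid[of k n] k by auto
      show ?thesis
      proof (intro exI[of _ d] exI[of _ "1 / real (k + 1)"] conjI allI impI ballI)
        fix z assume "z \<in> U"
        then have "z \<in> closure U" using closure_subset by blast
        then show "norm ((f ^^ n) z - d) \<le> 1 / real (k + 1)"
          by (rule maxf[rotated]) (rule d[unfolded dist_norm])
      next
        fix j assume "n = N j"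
        then have "j = k" using uniq NS by simp
        then show "d = c j" "1 / real (k + 1) = 2 * r j" using False \<open>n = N j\<close> by auto
      next
        fix j assume "N j < n \<and> n < N (Suc j)"
        then show "1 / real (k + 1) = 1 / real (j + 1)" using uniq[of j] by auto
      qed
    qed
  qed
  then obtain d e where de: "\<And>k. d (N k) = c k \<and> e (N k) = 2 * r k"
      "\<And>k n. N k < n \<Longrightarrow> n < N (Suc k) \<Longrightarrow> e n = 1 / real (k + 1)"
      "\<And>n z. z \<in> U \<Longrightarrow> norm ((f ^^ n) z - d n) \<le> e n" by metis
  have cnorm: "real k - 10 \<le> norm (c k)" for k
    using far[of k] norm_triangle_ineq4[of "c k" 10] by (simp add: dist_norm)
  have ctop: "filterlim (\<lambda>k. norm (c k)) at_top sequentially"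
  proof (rule filterlim_at_top_mono[of "\<lambda>k. real k - 10"])
    show "filterlim (\<lambda>k. real k - 10) at_top sequentially"
      using filterlim_tendsto_add_at_top[OF tendsto_const[of "-10::real"] filterlim_real_sequentially] by simp
  qed (use cnorm in auto)
  have W: "wandering_itinerary f U d e"
    unfolding wandering_itinerary_def
  proof (intro conjI allI impI ballI)
    show "U \<noteq> {}" using U by auto
    show "(f ^^ n) z \<in> cball (d n) (e n)" if "z \<in> U" for n z
      using de(3)[OF that] by (simp add: dist_norm norm_minus_commute)
    have "e n \<le> 2" for n
    proof -
      obtain k where k: "N k \<le> n" "n < N (Suc k)" using strict_mono_interval[OF sm init(3)] by blast
      show ?thesis
      proof (cases "n = N k")
        case True then show ?thesis using de(1) r[of k] by auto
      next
        case False
        then have "e n = 1 / real (k + 1)" using de(2) k by auto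
        also have "\<dots> \<le> 1" by simp
        finally show ?thesis by simp
      qed
    qed
    then show "\<exists>E. \<forall>n. e n \<le> E" by blast
    show "finite {n. norm (d n) \<le> M \<and> e n \<ge> \<eta>}" if \<eta>: "\<eta> > 0" for M \<eta>
    proof -
      obtain K where K: "max (M + 10) (1/\<eta>) \<le> real K" using real_arch_simple by blast
      have "{n. norm (d n) \<le> M \<and> e n \<ge> \<eta>} \<subseteq> {..<N (Suc K)}"
      proof
        fix n assume n: "n \<in> {n. norm (d n) \<le> M \<and> e n \<ge> \<eta>}"
        obtain k where k: "N k \<le> n" "n < N (Suc k)" using strict_mono_interval[OF sm init(3)] by blast
        have "k \<le> K"
        proof (cases "n = N k")
          case True
          then have "real k \<le> M + 10" using n de(1) cnorm[of k] by auto
          then show ?thesis using K by simp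
        next
          case False
          then have "\<eta> \<le> 1 / real (k + 1)" using False k n de(2)[of k n] by simp
          then have "real (k + 1) \<le> 1 / \<eta>" using \<eta> by (simp add: field_simps)
          then show ?thesis using K by simp
        qed
        then have "N (Suc k) \<le> N (Suc K)" using sm by (simp add: strict_mono_less_eq)
        then show "n \<in> {..<N (Suc K)}" using k by simp
      qed
      then show ?thesis using finite_subset by blast
    qed
    show "\<exists>k. filterlim (\<lambda>n. norm (d (k n))) at_top sequentially"
      using ctop de(1) by (intro exI[of _ N]) simp
    show "\<exists>p\<in>ball \<zeta> \<eta>. bounded (range (\<lambda>n. (f ^^ n) p))" if "\<zeta> \<in> frontier U" "\<eta> > 0" for \<zeta> \<eta>
      using that bdd unfolding U(4) by (fastforce simp: dist_commute)
  qed (use f U in auto)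
  define w where "w k z = ((f ^^ N k) z - c k) / of_real (r k)" for k z
  have w: "norm (w k (\<psi> u) - B k u) \<le> \<epsilon> k" if "norm u = 1" for k u
  proof -
    have r0: "of_real (r k) \<noteq> (0::complex)" "r k > 0" using r[of k] by auto
    have "w k (\<psi> u) - B k u = ((f ^^ N k) (\<psi> u) - (c k + of_real (r k) * B k u)) / of_real (r k)"
      using r0 by (simp add: w_def field_simps)
    then have "norm (w k (\<psi> u) - B k u) = norm ((f ^^ N k) (\<psi> u) - (c k + of_real (r k) * B k u)) / r k"
      using r0 by (simp add: norm_divide)
    also have "\<dots> \<le> \<epsilon> k" using main[OF that, of k] r0 by (simp add: pos_divide_le_eq)
    finally show ?thesis .
  qed
  have wh: "w k holomorphic_on S" "continuous_on S (w k)" for k S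
    unfolding w_def using r[of k] by (auto intro!: holomorphic_intros continuous_intros fh)
  have wle: "norm (w k z) \<le> 1 + \<epsilon> k" if "z \<in> closure U" for k z
  proof (rule maxp[OF wh(1,2) _ that])
    fix \<zeta> assume "\<zeta> \<in> frontier U"
    then obtain u where u: "norm u = 1" "\<zeta> = \<psi> u" unfolding U(4) by auto
    then show "norm (w k \<zeta>) \<le> 1 + \<epsilon> k"
      using w[OF u(1), of k] norm_B_circle[OF u(1), of k] norm_triangle_ineq2[of "w k (\<psi> u)" "B k u"] by simp
  qed
  have step: "norm (w (Suc k) z - b k (w k z)) \<le> \<nu> k" if z: "z \<in> closure U" for k z
  proof (rule maxp[OF _ _ _ z])
    have im: "w k ` closure U \<subseteq> ball 0 (1 + 2 * \<delta> k)"
    proof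
      fix x assume "x \<in> w k ` closure U"
      then have "norm x \<le> 1 + \<epsilon> k" using wle by auto
      then show "x \<in> ball 0 (1 + 2 * \<delta> k)" using eps(2)[of k] \<delta>(1)[of k] by simp
    qed
    have "(b k \<circ> w k) holomorphic_on U"
      using im closure_subset[of U] by (intro holomorphic_on_compose_gen[OF wh(1) \<delta>(3)]) blast
    then show "(\<lambda>z. w (Suc k) z - b k (w k z)) holomorphic_on U"
      unfolding o_def by (intro holomorphic_intros wh)
    have "continuous_on (closure U) (\<lambda>z. b k (w k z))"
      by (rule continuous_on_compose2[OF holomorphic_on_imp_continuous_on[OF \<delta>(3)] wh(2) im])
    then show "continuous_on (closure U) (\<lambda>z. w (Suc k) z - b k (w k z))"
      by (intro continuous_intros wh)
    fix \<zeta> assume "\<zeta> \<in> frontier U"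
    then obtain u where u: "norm u = 1" "\<zeta> = \<psi> u" unfolding U(4) by auto
    have "norm (w k \<zeta> - B k u) \<le> \<delta> k" using w[OF u(1), of k] eps(2)[of k] u(2) by simp
    then have 1: "norm (b k (w k \<zeta>) - b k (B k u)) \<le> \<nu> k / 2" by (rule \<delta>(4)[OF norm_B_circle[OF u(1)]])
    have "norm (w (Suc k) \<zeta> - B (Suc k) u) \<le> \<nu> k / 2" using w[OF u(1), of "Suc k"] eps(4)[of k] u(2) by simp
    then have 2: "norm (w (Suc k) \<zeta> - b k (B k u)) \<le> \<nu> k / 2" by simp
    have "w (Suc k) \<zeta> - b k (w k \<zeta>) = (w (Suc k) \<zeta> - b k (B k u)) - (b k (w k \<zeta>) - b k (B k u))" by simp
    then show "norm (w (Suc k) \<zeta> - b k (w k \<zeta>)) \<le> \<nu> k"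
      using 1 2 norm_triangle_ineq4[of "w (Suc k) \<zeta> - b k (B k u)" "b k (w k \<zeta>) - b k (B k u)"] by simp
  qed
  show thesis
  proof (rule that[of f U d e c r N])
    show "norm ((f ^^ N k) z - c k) \<le> (1 + \<nu> k) * r k" if "z \<in> closure U" for k z
    proof -
      have "norm ((f ^^ N k) z - c k) \<le> (1 + \<epsilon> k) * r k" using that by (rule maxf[rotated]) (rule bound(1))
      also have "\<dots> \<le> (1 + \<nu> k) * r k" using \<epsilon>\<nu>[of k] r[of k] by (intro mult_right_mono) auto
      finally show ?thesis .
    qed
    show "(1 - \<nu> k) * r k \<le> norm ((f ^^ N k) z - c k)" if "z \<in> frontier U" for k z
    proof -
      have "(1 - \<nu> k) * r k \<le> (1 - \<epsilon> k) * r k" using \<epsilon>\<nu>[of k] r[of k] by (intro mult_right_mono) auto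
      also have "\<dots> \<le> norm ((f ^^ N k) z - c k)" using bound(2) that unfolding U(4) by auto
      finally show ?thesis .
    qed
    show "norm (((f ^^ N (Suc k)) z - c (Suc k)) / of_real (r (Suc k)) - b k (((f ^^ N k) z - c k) / of_real (r k))) \<le> \<nu> k"
      if "z \<in> U" for k z
      using step[of z k] that closure_subset[of U] unfolding w_def by blast
    show "norm (((f ^^ N k) z - c k) / of_real (r k) - z) \<le> \<nu> k" if full "z \<in> U" for k z
    proof -
      have "norm (w k z - z) \<le> \<epsilon> k"
      proof (rule maxp[of "\<lambda>z. w k z - z"])
        fix \<zeta> assume "\<zeta> \<in> frontier U"
        then obtain u where u: "norm u = 1" "\<zeta> = \<psi> u" unfolding U(4) by auto
        then show "norm (w k \<zeta> - \<zeta>) \<le> \<epsilon> k" using w[OF u(1), of k] fullpsi[OF that(1)] B_full[OF that(1)] by simp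
      qed (use that closure_subset[of U] in \<open>auto intro!: holomorphic_intros continuous_intros wh\<close>)
      then show ?thesis using \<epsilon>\<nu>[of k] unfolding w_def by simp
    qed
    show "dist ((f ^^ Suc (N k)) z) 20 \<le> 1" if "ret k" "z \<in> U" for k z
      unfolding dist_norm
    proof (rule maxf[of "Suc (N k)"])
      show "norm ((f ^^ Suc (N k)) (\<psi> u) - 20) \<le> 1" if "norm u = 1" for u
        using retx[OF \<open>ret k\<close> that] unfolding dist_norm by simp
    qed (use that(2) closure_subset[of U] in blast)
    show "smooth_Jordan_curve (frontier U)" unfolding U(4) using smooth(3) .
    show "if ret k then r (Suc k) \<le> 1 / real (k + 2) else r (Suc k) = far_rad (Suc k)" for k
      by (rule rS)
    show "e n = 1 / real (k + 1)" if "N k < n" "n < N (Suc k)" for k n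
      using that by (rule de(2))
  qed (use W Uball U init r N de(1) ctop in auto)
qed

section \<open>Two-to-one Blaschke products\<close>

text \<open>For 0 \<le> a < 1 the Blaschke product of degree two with zeros 0 and -a: the square at
  a = 0, close to the identity on compact subsets of the disc as a tends to 1.\<close>

definition blaschke_pair :: "real \<Rightarrow> complex \<Rightarrow> complex" where
  "blaschke_pair a z = z * ((z + of_real a) / (1 + of_real a * z))"

lemma cmod_diff_identity:
  "norm (1 - cnj a * b)^2 - norm (a - b)^2 = (1 - norm a^2) * (1 - norm b^2)"
proof -
  have "complex_of_real (norm (1 - cnj a * b)^2 - norm (a - b)^2) = complex_of_real ((1 - norm a^2) * (1 - norm b^2))"
    unfolding of_real_diff of_real_mult complex_norm_square by (simp add: algebra_simps)
  then show ?thesis unfolding of_real_eq_iff .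
qed

lemma blaschke_denominator_nonzero:
  fixes z :: complex
  assumes "0 \<le> a" "a * norm z < 1"
  shows "1 + of_real a * z \<noteq> 0"
proof
  assume "1 + of_real a * z = 0"
  then have "of_real a * z = - 1" by (simp add: add_eq_0_iff)
  then have "norm (of_real a * z) = norm (- 1 :: complex)" by (rule arg_cong)
  then show False using assms by (simp add: norm_mult)
qed

lemma holomorphic_on_blaschke_pair:
  assumes "0 \<le> a" "\<And>z. z \<in> S \<Longrightarrow> a * norm z < 1"
  shows "blaschke_pair a holomorphic_on S"
  unfolding blaschke_pair_def
  by (intro holomorphic_intros blaschke_denominator_nonzero assms)

text \<open>The difference |1 + a z|^2 - |z + a|^2 equals (1 - a^2)(1 - |z|^2), so the Moebius
  factor exceeds 1 in modulus exactly outside the circle.\<close>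

lemma
  assumes a: "0 \<le> a" "a < 1" and z: "a * norm z < 1"
  shows blaschke_pair_le: "norm z \<le> 1 \<Longrightarrow> norm (blaschke_pair a z) \<le> norm z"
    and blaschke_pair_eq: "norm z = 1 \<Longrightarrow> norm (blaschke_pair a z) = 1"
    and blaschke_pair_gt: "1 < norm z \<Longrightarrow> 1 < norm (blaschke_pair a z)"
proof -
  let ?m = "(z + of_real a) / (1 + of_real a * z)"
  have n0: "norm (1 + of_real a * z) > 0" using blaschke_denominator_nonzero[OF a(1) z] by simp
  have "norm (1 + of_real a * z)^2 - norm (z + of_real a)^2 = (1 - a^2) * (1 - norm z^2)"
    using cmod_diff_identity[of "- of_real a" z] norm_minus_cancel[of "- of_real a - z"] by (simp add: add.commute)
  then have id: "norm (1 + of_real a * z)^2 = norm (z + of_real a)^2 + (1 - a^2) * (1 - norm z^2)" by simp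
  have a1: "1 - a^2 > 0" using a by (simp add: power_less_one_iff abs_square_less_1)
  have b: "norm (blaschke_pair a z) = norm z * (norm (z + of_real a) / norm (1 + of_real a * z))"
    by (simp add: blaschke_pair_def norm_mult norm_divide)
  show "norm (blaschke_pair a z) \<le> norm z" if "norm z \<le> 1"
  proof -
    have "norm z^2 \<le> 1" using that by (simp add: power_le_one)
    then have "norm (z + of_real a)^2 \<le> norm (1 + of_real a * z)^2"
      unfolding id using a1 by simp
    then have "norm (z + of_real a) \<le> norm (1 + of_real a * z)" by (rule power2_le_imp_le) simp
    then have "norm (z + of_real a) / norm (1 + of_real a * z) \<le> 1" using n0 by simp
    then show ?thesis unfolding b by (rule mult_left_le) simp
  qed
  show "norm (blaschke_pair a z) = 1" if "norm z = 1"
  proof -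
    have "norm (z + of_real a) = norm (1 + of_real a * z)"
      using id that by simp
    then show ?thesis unfolding b using n0 that by simp
  qed
  show "1 < norm (blaschke_pair a z)" if "1 < norm z"
  proof -
    have "norm z^2 > 1" using that by (simp add: one_less_power)
    then have "(1 - a^2) * (1 - norm z^2) < 0" using a1 by (simp add: mult_less_0_iff)
    then have "norm (1 + of_real a * z)^2 < norm (z + of_real a)^2" unfolding id by simp
    then have "norm (1 + of_real a * z) < norm (z + of_real a)" by (rule power_less_imp_less_base) simp
    then have "1 < norm (z + of_real a) / norm (1 + of_real a * z)" using n0 by simp
    then show ?thesis unfolding b using that by (rule less_1_mult[rotated])
  qed
qed

text \<open>The numerator a z^2 + 2 z + a cannot vanish when |z| = 1: its middle term has modulus 2,
  the others together at most 2 a.\<close>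

lemma deriv_blaschke_pair_circle:
  assumes a: "0 \<le> a" "a < 1" and z: "norm z = 1"
  shows "deriv (blaschke_pair a) z \<noteq> 0"
proof -
  have d0: "1 + of_real a * z \<noteq> 0" using blaschke_denominator_nonzero[of a z] a z by simp
  have "(blaschke_pair a has_field_derivative (of_real a * z^2 + 2 * z + of_real a) / (1 + of_real a * z)^2) (at z)"
    unfolding blaschke_pair_def using d0
    by (auto intro!: derivative_eq_intros simp: field_simps power2_eq_square)
  then have "deriv (blaschke_pair a) z = (of_real a * z^2 + 2 * z + of_real a) / (1 + of_real a * z)^2"
    by (rule DERIV_imp_deriv)
  moreover have "of_real a * z^2 + 2 * z + of_real a \<noteq> 0"
  proof
    assume "of_real a * z^2 + 2 * z + of_real a = 0"
    then have "2 * z = - (of_real a * z^2 + of_real a)" by (simp add: algebra_simps eq_neg_iff_add_eq_0)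
    then have "norm (2 * z) = norm (of_real a * z^2 + of_real a)" by (metis norm_minus_cancel)
    also have "\<dots> \<le> a + a"
      by (rule order_trans[OF norm_triangle_ineq]) (use a z in \<open>simp add: norm_mult norm_power\<close>)
    finally show False using a z by (simp add: norm_mult)
  qed
  ultimately show ?thesis using d0 by simp
qed

lemma blaschke_like_pair:
  assumes a: "0 \<le> a" "a < 1"
  shows "blaschke_like (blaschke_pair a)"
proof -
  have small: "a * norm z < 1" if "norm z < 1 + (1 - a) / 2" for z :: complex
  proof -
    have "a * norm z \<le> a * (1 + (1 - a) / 2)" using that a by (intro mult_left_mono) auto
    also have "\<dots> = 1 - (1 - a) * (1 - a / 2)" by (simp add: field_simps)
    also have "\<dots> < 1" using a by simp
    finally show ?thesis .
  qed
  show ?thesis unfolding blaschke_like_def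
  proof (intro exI[of _ "(1 - a) / 2"] conjI allI impI)
    show "blaschke_pair a holomorphic_on ball 0 (1 + (1 - a) / 2)"
      using a(1) small by (intro holomorphic_on_blaschke_pair) auto
    fix z :: complex
    show "norm (blaschke_pair a z) < 1" if "norm z < 1"
    proof (rule le_less_trans[OF blaschke_pair_le[OF a small] that])
      show "norm z < 1 + (1 - a) / 2" using that a(2) by (simp add: field_simps)
    qed (use that in simp)
    show "norm (blaschke_pair a z) = 1" if "norm z = 1"
      by (rule blaschke_pair_eq[OF a small that]) (use that a(2) in \<open>simp add: field_simps\<close>)
    show "deriv (blaschke_pair a) z \<noteq> 0" if "norm z = 1" using deriv_blaschke_pair_circle[OF a that] .
    show "1 < norm (blaschke_pair a z)" if "1 < norm z \<and> norm z < 1 + (1 - a) / 2"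
      by (rule blaschke_pair_gt[OF a small]) (use that in simp_all)
  qed (use a in auto)
qed

text \<open>The difference is -z (1 - z)(1 - a)/(1 + a z), linear in 1 - a. Summable 1 - a therefore
  gives summable deviations from the identity on each smaller disc.\<close>

lemma blaschke_pair_near_id:
  assumes a: "0 \<le> a" "a < 1" and z: "norm z < 1"
  shows "norm (blaschke_pair a z - z) \<le> 2 * (1 - a) / (1 - norm z)"
proof -
  have az: "a * norm z < 1" using mult_strict_mono[of a 1 "norm z" 1] a z by simp
  note d0 = blaschke_denominator_nonzero[OF a(1) az]
  have "blaschke_pair a z - z = - (z * (1 - z) * of_real (1 - a)) / (1 + of_real a * z)"
    using d0 by (simp add: blaschke_pair_def field_simps)
  then have "norm (blaschke_pair a z - z) = norm z * norm (1 - z) * (1 - a) / norm (1 + of_real a * z)"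
    using a by (simp add: norm_divide norm_mult del: of_real_diff)
  also have "\<dots> \<le> 2 * (1 - a) / (1 - norm z)"
  proof (rule frac_le)
    have "norm (1 - z) \<le> 2" using norm_triangle_ineq4[of 1 z] z by simp
    then have "norm z * norm (1 - z) \<le> 1 * 2" using z by (intro mult_mono) auto
    then show "norm z * norm (1 - z) * (1 - a) \<le> 2 * (1 - a)" using a by (intro mult_right_mono) auto
    have "a * norm z \<le> norm z" using a by (simp add: mult_left_le_one_le)
    then show "1 - norm z \<le> norm (1 + of_real a * z)"
      using norm_diff_ineq[of 1 "of_real a * z"] a by (simp add: norm_mult)
  qed (use a z in auto)
  finally show ?thesis .
qed

section \<open>Non-injectivity under perturbation, and perturbed contractions\<close>

lemma blaschke_pair_not_inj:
  assumes a: "0 \<le> a" "a < 1"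
  shows "\<not> inj_on (blaschke_pair a) (ball 0 1)" "\<not> blaschke_pair a constant_on ball 0 1"
proof -
  have const: "False" if "blaschke_pair a constant_on ball 0 1"
  proof -
    define x :: complex where "x = of_real ((1 + a) / 2)"
    have "norm x = (1 + a) / 2" unfolding x_def norm_of_real using a by simp
    then have x: "x \<in> ball 0 1" using a by simp
    have "blaschke_pair a x = blaschke_pair a 0" using that x unfolding constant_on_def by (metis centre_in_ball zero_less_one)
    then have "x * (x + of_real a) = 0"
      using blaschke_denominator_nonzero[of a x] mult_strict_mono[of a 1 "norm x" 1] x a by (simp add: blaschke_pair_def)
    moreover have "x \<noteq> 0" using a by (simp add: x_def del: of_real_add of_real_divide)
    moreover have "x + of_real a = of_real ((1 + a) / 2 + a)" by (simp add: x_def)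
    moreover have "(1 + a) / 2 + a > 0" using a by (intro add_pos_nonneg) auto
    ultimately show False by (simp del: of_real_add of_real_divide)
  qed
  then show "\<not> blaschke_pair a constant_on ball 0 1" by blast
  show "\<not> inj_on (blaschke_pair a) (ball 0 1)"
  proof
    assume inj: "inj_on (blaschke_pair a) (ball 0 1)"
    show False
    \<comment> \<open>The two zeros witness non-injectivity unless they coincide.\<close>
    proof (cases "a = 0")
      case True
      then have "blaschke_pair a (1/2) = blaschke_pair a (-1/2)" by (simp add: blaschke_pair_def)
      then show False using inj_onD[OF inj, of "1/2" "-1/2"] by simp
    next
      case False
      have "blaschke_pair a 0 = blaschke_pair a (- of_real a)" by (simp add: blaschke_pair_def)
      then show False using inj_onD[OF inj, of 0 "- of_real a"] False a by simp
    qed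
  qed
qed

text \<open>Otherwise injective maps would converge to b locally uniformly, and Hurwitz's theorem
  would make b injective. The domain shrinks together with the tolerance because the images of U are
  only known to contain the disc of radius 1 - \<nu>'.\<close>

lemma not_injective_stable:
  assumes b: "b holomorphic_on ball 0 1" "\<not> inj_on b (ball 0 1)" "\<not> b constant_on ball 0 1"
  obtains \<nu> where "\<nu> > 0" "\<And>p \<nu>'. 0 < \<nu>' \<Longrightarrow> \<nu>' \<le> \<nu> \<Longrightarrow> p holomorphic_on ball 0 (1 - \<nu>') \<Longrightarrow>
    (\<And>z. z \<in> ball 0 (1 - \<nu>') \<Longrightarrow> norm (p z - b z) \<le> \<nu>') \<Longrightarrow> \<not> inj_on p (ball 0 (1 - \<nu>'))"
proof (rule ccontr)
  assume no: "\<not> thesis"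
  have "\<exists>p \<nu>'. 0 < \<nu>' \<and> \<nu>' \<le> 1 / real (Suc n) \<and> p holomorphic_on ball 0 (1 - \<nu>') \<and>
    (\<forall>z\<in>ball 0 (1 - \<nu>'). norm (p z - b z) \<le> \<nu>') \<and> inj_on p (ball 0 (1 - \<nu>'))" for n
    using no that[of "1 / real (Suc n)"] by force
  then obtain p \<nu> where p: "\<And>n. 0 < \<nu> n" "\<And>n. \<nu> n \<le> 1 / real (Suc n)" "\<And>n. p n holomorphic_on ball 0 (1 - \<nu> n)"
    "\<And>n z. z \<in> ball 0 (1 - \<nu> n) \<Longrightarrow> norm (p n z - b z) \<le> \<nu> n" "\<And>n. inj_on (p n) (ball 0 (1 - \<nu> n))" by metis
  have \<nu>0: "\<nu> \<longlonglongrightarrow> 0"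
    by (rule tendsto_sandwich[OF _ _ tendsto_const LIMSEQ_inverse_real_of_nat])
      (use p(1,2) in \<open>auto simp: less_imp_le inverse_eq_divide\<close>)
  obtain x y where xy: "x \<in> ball 0 1" "y \<in> ball 0 1" "x \<noteq> y" "b x = b y" using b(2) unfolding inj_on_def by blast
  \<comment> \<open>A fixed disc that contains both witnesses; it lies in all but finitely many of
    the shrinking domains.\<close>
  define s where "s = (1 + max (norm x) (norm y)) / 2"
  have s: "0 < s" "s < 1" "norm x < s" "norm y < s" using xy norm_ge_zero[of x] by (auto simp: s_def max_def simp del: norm_ge_zero)
  have sub: "ball 0 s \<subseteq> ball (0::complex) 1" using s by auto
  obtain M where M: "\<And>n. n \<ge> M \<Longrightarrow> \<nu> n < 1 - s"
    using order_tendstoD(2)[OF \<nu>0, of "1 - s"] s unfolding eventually_sequentially by auto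
  have subn: "ball 0 s \<subseteq> ball (0::complex) (1 - \<nu> (n + M))" for n using M[of "n + M"] by auto
  have "inj_on b (ball 0 s)"
  proof (rule Hurwitz_injective[of "ball 0 s" "\<lambda>n. p (n + M)"])
    show "p (n + M) holomorphic_on ball 0 s" for n using p(3) subn by (rule holomorphic_on_subset)
    show "inj_on (p (n + M)) (ball 0 s)" for n using p(5) subn by (rule inj_on_subset)
    show "b holomorphic_on ball 0 s" using b(1) sub by (rule holomorphic_on_subset)
    show "\<not> b constant_on ball 0 s"
    proof
      assume "b constant_on ball 0 s"
      then obtain v where v: "\<And>z. z \<in> ball 0 s \<Longrightarrow> b z = v" unfolding constant_on_def by blast
      have "b z = v" if z: "z \<in> ball 0 1" for z
      proof (rule analytic_continuation_open[of "ball 0 s" "ball 0 1" b "\<lambda>_. v"])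
        show "ball 0 s \<noteq> ({}::complex set)" using s by auto
      qed (use b(1) s sub z v in auto)
      then show False using b(3) unfolding constant_on_def by blast
    qed
    show "uniform_limit K (\<lambda>n. p (n + M)) b sequentially" if K: "compact K" "K \<subseteq> ball 0 s" for K
      unfolding uniform_limit_iff
    proof (intro allI impI)
      fix e :: real assume "e > 0"
      then have "eventually (\<lambda>n. \<nu> n < e) sequentially" by (rule order_tendstoD(2)[OF \<nu>0])
      then have "eventually (\<lambda>n. \<nu> (n + M) < e) sequentially" by (rule eventually_sequentially_seg[THEN iffD2])
      then show "eventually (\<lambda>n. \<forall>z\<in>K. dist (p (n + M) z) (b z) < e) sequentially"
      proof eventually_elim
        case (elim n)
        show ?case
        proof
          fix z assume "z \<in> K"
          then have "z \<in> ball 0 (1 - \<nu> (n + M))" using K(2) subn by blast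
          then show "dist (p (n + M) z) (b z) < e" using p(4)[of z "n + M"] elim by (simp add: dist_norm)
        qed
      qed
    qed
  qed (use s in auto)
  then show False using xy s unfolding inj_on_def by auto
qed

text \<open>Summing the inequalities bounds 1 - s times any partial sum of a by the first term plus
  the total error, so a is even summable.\<close>

lemma tendsto_0_of_contraction:
  fixes a \<nu> :: "nat \<Rightarrow> real"
  assumes nn: "\<And>k. 0 \<le> a k" and s: "s < 1" and step: "\<And>k. a (Suc k) \<le> s * a k + \<nu> k"
    and \<nu>: "summable \<nu>" "\<And>k. 0 \<le> \<nu> k"
  shows "a \<longlonglongrightarrow> 0"
proof (rule summable_LIMSEQ_zero)
  have "(1 - s) * sum a {..<n} \<le> a 0 + suminf \<nu> - a n" for n
  proof -
    have "(1 - s) * sum a {..<n} \<le> a 0 + sum \<nu> {..<n} - a n"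
    proof (induction n)
      case (Suc n) then show ?case using step[of n] by (simp add: algebra_simps)
    qed simp
    moreover have "sum \<nu> {..<n} \<le> suminf \<nu>" by (rule sum_le_suminf[OF \<nu>(1)]) (use \<nu>(2) in auto)
    ultimately show ?thesis by simp
  qed
  then have "(1 - s) * sum a {..<n} \<le> a 0 + suminf \<nu>" for n by (rule order_trans) (simp add: nn)
  then have "sum a {..<n} \<le> (a 0 + suminf \<nu>) / (1 - s)" for n
    using s by (simp add: pos_le_divide_eq mult.commute)
  then show "summable a" using nn by (intro summableI_nonneg_bounded)
qed

section \<open>Internal dynamics of the model domains\<close>

text \<open>The contraction property is applied to the constant map with value z.\<close>

lemma hyp_dist_nonneg:
  assumes V: "hyperbolic_simply_connected V" and zw: "z \<in> V" "w \<in> V"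
  shows "0 \<le> hyp_dist V z w"
proof -
  obtain h g where hg: "biholomorphic_pair V h g"
    using biholomorphic_pair_exists V unfolding hyperbolic_simply_connected_def by metis
  have "hyp_dist V z z = 0"
    unfolding hyp_dist_eq[OF hg zw(1) zw(1)] by (simp add: disc_hyp_dist_def)
  moreover have "hyp_dist V ((\<lambda>_. z) z) ((\<lambda>_. z) w) \<le> hyp_dist V z w"
    by (rule hyp_dist_contract[OF V V]) (use zw in auto)
  ultimately show ?thesis by simp
qed

text \<open>Cauchy's inequality on discs of radius (R - s)/2 bounds the derivative of P - id, so
  this difference has a small Lipschitz constant on the smaller disc.\<close>

lemma near_identity_expansion:
  assumes P: "P holomorphic_on ball 0 R" "\<And>x. x \<in> ball 0 R \<Longrightarrow> norm (P x - x) \<le> \<eta>"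
    and s: "0 \<le> s" "s < R" and xy: "norm x \<le> s" "norm y \<le> s"
  shows "(1 - 2 * \<eta> / (R - s)) * norm (x - y) \<le> norm (P x - P y)"
proof -
  define E where "E x = P x - x" for x
  have E: "E holomorphic_on ball 0 R" unfolding E_def by (intro holomorphic_intros P)
  have "norm (E x - E y) \<le> 2 * \<eta> / (R - s) * norm (x - y)"
  proof (rule field_differentiable_bound[of "cball 0 s" E "deriv E"])
    fix z :: complex assume z: "z \<in> cball 0 s"
    then have "z \<in> ball 0 R" using s by auto
    then show "(E has_field_derivative deriv E z) (at z within cball 0 s)"
      using holomorphic_derivI[OF E] by simp
    define t where "t = (R - s) / 2"
    have t: "t > 0" "s + t < R" using s by (auto simp: t_def field_simps)
    have sub: "cball z t \<subseteq> ball 0 R"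
    proof
      fix v assume "v \<in> cball z t"
      then have "norm v \<le> t + s" using norm_triangle_ineq[of "v - z" z] z by (simp add: dist_norm norm_minus_commute)
      then show "v \<in> ball 0 R" using t by simp
    qed
    have "norm ((deriv ^^ 1) E z) \<le> fact 1 * \<eta> / t ^ 1"
    proof (rule Cauchy_inequality)
      show "E holomorphic_on ball z t" using E by (rule holomorphic_on_subset) (use sub ball_subset_cball in blast)
      show "continuous_on (cball z t) E"
        using holomorphic_on_imp_continuous_on[OF E] sub by (rule continuous_on_subset)
      fix v assume "norm (z - v) = t"
      then have "v \<in> ball 0 R" using sub by (auto simp: dist_norm)
      then show "norm (E v) \<le> \<eta>" unfolding E_def by (rule P(2))
    qed (use t in simp)
    then show "norm (deriv E z) \<le> 2 * \<eta> / (R - s)" by (simp add: t_def field_simps)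
  qed (use xy in auto)
  moreover have "norm (x - y) - norm (E x - E y) \<le> norm (P x - P y)"
    using norm_diff_ineq[of "x - y" "E x - E y"] by (simp add: E_def)
  ultimately show ?thesis by (simp add: left_diff_distrib)
qed

text \<open>The product of the factors 1 - x is at least 1 minus the sum of the x. Starting where
  the remaining sum is at most 1/2, half of the value survives.\<close>

lemma lower_bound_of_summable_losses:
  fixes a x :: "nat \<Rightarrow> real"
  assumes a: "\<And>k. 0 < a k" and x: "\<And>k. 0 \<le> x k" "summable x"
    and step: "\<And>k. k \<ge> K \<Longrightarrow> (1 - x k) * a k \<le> a (Suc k)"
  obtains m M where "m > 0" "\<And>k. k \<ge> M \<Longrightarrow> m \<le> a k"
proof -
  have "(\<lambda>n. \<Sum>j. x (j + n)) \<longlonglongrightarrow> 0" using suminf_exist_split2[OF x(2)] by simp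
  then have "eventually (\<lambda>n. (\<Sum>j. x (j + n)) < 1/2) sequentially" by (rule order_tendstoD) simp
  then obtain L where L: "\<And>n. n \<ge> L \<Longrightarrow> (\<Sum>j. x (j + n)) < 1/2" unfolding eventually_sequentially by blast
  define M where "M = max K L"
  have part: "(\<Sum>j<n. x (j + M)) \<le> 1/2" for n
  proof -
    have "(\<Sum>j<n. x (j + M)) \<le> (\<Sum>j. x (j + M))"
      by (rule sum_le_suminf) (use x in \<open>auto simp: summable_iff_shift\<close>)
    also have "\<dots> \<le> 1/2" using L[of M] by (simp add: M_def)
    finally show ?thesis .
  qed
  have ind: "(1 - (\<Sum>j<n. x (j + M))) * a M \<le> a (n + M)" for n
  proof (induction n)
    case (Suc n)
    let ?S = "\<Sum>j<n. x (j + M)"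
    have S0: "0 \<le> ?S" using x by (intro sum_nonneg) auto
    have x1: "x (n + M) \<le> 1" using part[of "Suc n"] S0 by simp
    have "1 - (\<Sum>j<Suc n. x (j + M)) \<le> (1 - x (n + M)) * (1 - ?S)"
      using mult_nonneg_nonneg[OF x(1)[of "n + M"] S0] by (simp add: algebra_simps)
    then have "(1 - (\<Sum>j<Suc n. x (j + M))) * a M \<le> (1 - x (n + M)) * ((1 - ?S) * a M)"
      using a[of M] by (subst mult.assoc[symmetric]) (rule mult_right_mono, simp_all)
    also have "\<dots> \<le> (1 - x (n + M)) * a (n + M)" using Suc x1 by (intro mult_left_mono) auto
    also have "\<dots> \<le> a (Suc n + M)" using step[of "n + M"] by (simp add: M_def)
    finally show ?case .
  qed simp
  show thesis
  proof (rule that[of "a M / 2" M])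
    fix k assume "k \<ge> M"
    have "a M / 2 = (1 - 1/2) * a M" by simp
    also have "\<dots> \<le> (1 - (\<Sum>j<k - M. x (j + M))) * a M"
      using part[of "k - M"] a[of M] by (intro mult_right_mono) auto
    also have "\<dots> \<le> a k" using ind[of "k - M"] \<open>k \<ge> M\<close> by simp
    finally show "a M / 2 \<le> a k" .
  qed (use a in simp)
qed

text \<open>The output of the construction, together with geometric smallness of the errors and |b k
  z| \<le> |z|, which keep the orbit of 0 near the centres of the stations.\<close>

locale wandering_model =
  fixes full :: bool and b :: "nat \<Rightarrow> complex \<Rightarrow> complex" and \<nu> far_rad :: "nat \<Rightarrow> real" and ret :: "nat \<Rightarrow> bool"
    and f :: "complex \<Rightarrow> complex" and U :: "complex set" and c :: "nat \<Rightarrow> complex" and r :: "nat \<Rightarrow> real"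
    and N :: "nat \<Rightarrow> nat" and d :: "nat \<Rightarrow> complex" and e :: "nat \<Rightarrow> real"
  assumes \<nu>: "\<And>k. 0 < \<nu> k" "\<And>k. \<nu> k \<le> (1/2) ^ (k + 4)"
    and shrink: "\<And>k z. norm z < 1 \<Longrightarrow> norm (b k z) \<le> norm z"
    and W: "wandering_itinerary f U d e"
    and full_ball: "full \<Longrightarrow> U = ball 0 1" and U0: "0 \<in> U"
    and init: "c 0 = 0" "r 0 = 1" "N 0 = 0"
    and r: "\<And>k. 0 < r k \<and> r k \<le> 1"
    and N: "\<And>k. N (Suc k) = (if ret k then N k + k + 2 else N k + 1)"
    and rS: "\<And>k. if ret k then r (Suc k) \<le> 1 / real (k + 2) else r (Suc k) = far_rad (Suc k)"
    and station: "\<And>k. d (N k) = c k \<and> e (N k) = 2 * r k"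
    and mid: "\<And>k n. N k < n \<Longrightarrow> n < N (Suc k) \<Longrightarrow> e n = 1 / real (k + 1)"
    and outer: "\<And>k z. z \<in> closure U \<Longrightarrow> norm ((f ^^ N k) z - c k) \<le> (1 + \<nu> k) * r k"
    and inner: "\<And>k z. z \<in> frontier U \<Longrightarrow> (1 - \<nu> k) * r k \<le> norm ((f ^^ N k) z - c k)"
    and step: "\<And>k z. z \<in> U \<Longrightarrow> norm (((f ^^ N (Suc k)) z - c (Suc k)) / of_real (r (Suc k)) - b k (((f ^^ N k) z - c k) / of_real (r k))) \<le> \<nu> k"
    and full_step: "\<And>k z. full \<Longrightarrow> z \<in> U \<Longrightarrow> norm (((f ^^ N k) z - c k) / of_real (r k) - z) \<le> \<nu> k"
    and returns: "\<And>k z. ret k \<Longrightarrow> z \<in> U \<Longrightarrow> dist ((f ^^ Suc (N k)) z) 20 \<le> 1"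
    and escape: "filterlim (\<lambda>k. norm (c k)) at_top sequentially"
begin

definition w :: "nat \<Rightarrow> complex \<Rightarrow> complex" where
  "w k z = ((f ^^ N k) z - c k) / of_real (r k)"

lemmas UD = wandering_itineraryD[OF W]

lemma r_nz: "complex_of_real (r k) \<noteq> 0"
  using r[of k] by simp

lemma orbit_of_w: "(f ^^ N k) z = c k + of_real (r k) * w k z"
  using r_nz[of k] by (simp add: w_def)

lemma N_less: "N k < N (Suc k)"
  using N[of k] by auto

lemma strict_mono_N: "strict_mono N"
  using N_less by (rule strict_mono_Suc_iff[THEN iffD2, rule_format])

lemma N_ge: "k \<le> N k"
  using strict_mono_N by (rule strict_mono_imp_increasing)

lemma holomorphic_on_orbit: "(f ^^ n) holomorphic_on S"
  using UD(1) by (rule holomorphic_on_funpow)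

lemma holomorphic_on_w: "w k holomorphic_on S"
  unfolding w_def using r_nz by (intro holomorphic_intros holomorphic_on_orbit)

lemma w_upper: "z \<in> closure U \<Longrightarrow> norm (w k z) \<le> 1 + \<nu> k"
  using outer[of z k] r[of k] by (simp add: w_def norm_divide pos_divide_le_eq)

lemma w_frontier: "z \<in> frontier U \<Longrightarrow> 1 - \<nu> k \<le> norm (w k z)"
  using inner[of z k] r[of k] by (simp add: w_def norm_divide pos_le_divide_eq)

lemma w_0: "w 0 z = z"
  by (simp add: w_def init)

lemma w_step: "z \<in> U \<Longrightarrow> norm (w (Suc k) z - b k (w k z)) \<le> \<nu> k"
  using step[of z k] by (simp add: w_def)

lemma w_full: "full \<Longrightarrow> z \<in> U \<Longrightarrow> norm (w k z - z) \<le> \<nu> k"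
  using full_step[of z k] by (simp add: w_def)

lemma \<nu>_le: "\<nu> k \<le> 1/16"
  using \<nu>(2)[of k] power_decreasing[of 4 "k + 4" "1/2::real"] by (simp add: power4_eq_xxxx)

lemma summable_\<nu>: "summable \<nu>"
proof (rule summable_comparison_test'[of "\<lambda>k. (1/2) ^ k * (1/2) ^ 4" 0])
  show "summable (\<lambda>k. (1/2::real) ^ k * (1/2) ^ 4)" by (intro summable_mult2 summable_geometric) simp
qed (use \<nu> in \<open>auto simp: power_add less_imp_le\<close>)

lemma \<nu>_tendsto: "\<nu> \<longlonglongrightarrow> 0"
  using summable_\<nu> by (rule summable_LIMSEQ_zero)

text \<open>The maps b k do not increase moduli, so only the errors accumulate, and the sum of
  (1/2)^(k + 4) is 1/8.\<close>

lemma w_origin: "norm (w k 0) \<le> 1/8"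
proof -
  have "norm (w k 0) \<le> (1 - (1/2) ^ k) / 8"
  proof (induction k)
    case (Suc k)
    have lt: "norm (w k 0) < 1"
    proof -
      have "(1 - (1/2) ^ k) / 8 \<le> (1/8 :: real)" by simp
      then show ?thesis by (rule le_less_trans[OF order_trans[OF Suc]]) simp
    qed
    have "norm (w (Suc k) 0) \<le> norm (w (Suc k) 0 - b k (w k 0)) + norm (b k (w k 0))"
      using norm_triangle_ineq[of "w (Suc k) 0 - b k (w k 0)" "b k (w k 0)"] by simp
    also have "\<dots> \<le> \<nu> k + norm (w k 0)" using w_step[OF U0, of k] shrink[OF lt, of k] by simp
    also have "\<dots> \<le> (1/2) ^ (k + 4) + (1 - (1/2) ^ k) / 8" using \<nu>(2)[of k] Suc by (rule add_mono)
    also have "\<dots> = (1 - (1/2) ^ Suc k) / 8" by (simp add: power_add power4_eq_xxxx diff_divide_distrib)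
    finally show ?case .
  qed (simp add: w_0)
  also have "\<dots> \<le> 1/8" by simp
  finally show ?thesis .
qed

definition V :: "nat \<Rightarrow> complex set" where
  "V n = (f ^^ n) ` U"

lemma orbit_component_V: "orbit_component f U n = V n"
  unfolding V_def using W by (rule itinerary_orbit_component)

lemma itinerary_V: "wandering_itinerary f (V n) (\<lambda>m. d (m + n)) (\<lambda>m. e (m + n))"
  unfolding V_def using W by (rule wandering_itinerary_shift)

lemma hyperbolic_V: "hyperbolic_simply_connected (V n)"
  unfolding hyperbolic_simply_connected_def
  using wandering_itineraryD(3,5,6)[OF itinerary_V[of n]] itinerary_simply_connected[OF itinerary_V[of n]]
    not_bounded_UNIV[where 'a = complex] by auto

lemma V_subset: "x \<in> V n \<Longrightarrow> norm (x - d n) \<le> e n"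
  using UD(7) by (auto simp: V_def)

lemma V_image: "(f ^^ m) ` V n = V (m + n)"
  by (simp add: V_def funpow_add image_comp)

lemma w_image: "w k ` U = (\<lambda>x. (x - c k) / of_real (r k)) ` V (N k)"
  by (simp add: V_def w_def image_image)

text \<open>The connected ball meets the image at \<open>w k 0\<close>. It misses the frontier of
  the image, which comes from the frontier of U, where |w k| \<ge> 1 - \<nu> k; hence it lies
  inside.\<close>

lemma ball_subset_w_image: "ball 0 (1 - \<nu> k) \<subseteq> w k ` U"
proof (rule ccontr)
  assume "\<not> ball 0 (1 - \<nu> k) \<subseteq> w k ` U"
  then have "ball 0 (1 - \<nu> k) - w k ` U \<noteq> {}" by blast
  moreover have "w k 0 \<in> ball 0 (1 - \<nu> k) \<inter> w k ` U"
    using w_origin[of k] \<nu>_le[of k] U0 by simp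
  ultimately have "ball 0 (1 - \<nu> k) \<inter> frontier (w k ` U) \<noteq> {}"
    by (intro connected_Int_frontier[OF connected_ball]) auto
  then obtain p where p: "p \<in> ball 0 (1 - \<nu> k)" "p \<in> frontier (w k ` U)" by blast
  have aff: "(\<lambda>x. (x - c k) / of_real (r k)) = (\<lambda>x. - c k / of_real (r k) + (1 / r k) *\<^sub>R x)"
    using r_nz[of k] by (auto simp: fun_eq_iff scaleR_conv_of_real diff_divide_distrib)
  have op: "open (w k ` U)"
    unfolding w_image aff by (rule open_affinity[OF wandering_itineraryD(3)[OF itinerary_V]]) (use r[of k] in simp)
  have "closure (w k ` U) \<subseteq> w k ` closure U"
  proof (rule closure_minimal)
    show "closed (w k ` closure U)"
      using UD(5) by (intro compact_imp_closed compact_continuous_image holomorphic_on_imp_continuous_on holomorphic_on_w)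
        (simp add: compact_closure)
  qed (use closure_subset in blast)
  then obtain \<xi> where \<xi>: "\<xi> \<in> closure U" "p = w k \<xi>" using p(2) by (auto simp: frontier_def)
  moreover have "\<xi> \<notin> U" using p(2) op \<xi>(2) by (auto simp: frontier_def interior_open)
  ultimately have "\<xi> \<in> frontier U" using UD(3) by (simp add: frontier_def interior_open)
  then show False using w_frontier[of \<xi> k] p(1) \<xi>(2) by simp
qed

text \<open>By Schwarz-Pick the normalized positions of z and 0 stay at bounded hyperbolic distance
  in the disc, and that of 0 stays within 1/8 of the centre. So that of z cannot approach the
  circle.\<close>

lemma interior_bound:
  assumes z: "z \<in> U"
  obtains s where "0 \<le> s" "s < 1" "eventually (\<lambda>k. norm (w k z) \<le> s) sequentially"
proof -
  have hU: "hyperbolic_simply_connected U" using hyperbolic_V[of 0] by (simp add: V_def)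
  then obtain h g where hg: "biholomorphic_pair U h g"
    using biholomorphic_pair_exists unfolding hyperbolic_simply_connected_def by metis
  note B = biholomorphic_pairD[OF hg]
  define t where "t = norm (Moebius_function 0 (h 0) (h z))"
  have t: "0 \<le> t" "t < 1" using Moebius_function_norm_lt_1'[OF B(3)[OF U0] B(3)[OF z]] by (auto simp: t_def)
  \<comment> \<open>With D = |1 - conj(a) p|, a and p the positions of 0 and z, the pseudohyperbolic
    bound t gives (1 - t^2) D^2 \<le> 1 - |p|^2, and D \<ge> 7/8 because |a| \<le> 1/8.\<close>
  define S where "S = sqrt (1 - (1 - t^2) * (7/8)^2)"
  have t2: "0 < 1 - t^2" "1 - t^2 \<le> 1" using t by (auto simp: power_less_one_iff abs_square_less_1)
  have "(1 - t^2) * (7/8)^2 \<le> 1 * 1" using t2 by (intro mult_mono) (auto simp: power2_eq_square)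
  then have S: "0 \<le> S" "S < 1" using t2 by (auto simp: S_def real_sqrt_lt_1_iff)
  define \<phi> where "\<phi> k x = w k x / of_real (1 + 2 * \<nu> k)" for k x
  have \<phi>b: "\<phi> k x \<in> ball 0 1" if "x \<in> U" for k x
  proof -
    have "norm (w k x) < 1 + 2 * \<nu> k" using w_upper[of x k] \<nu>(1)[of k] that closure_subset[of U] by fastforce
    then show ?thesis using \<nu>(1)[of k] by (simp add: \<phi>_def norm_divide del: of_real_add of_real_mult)
  qed
  have \<phi>S: "norm (\<phi> k z) \<le> S" for k
  proof -
    define a where "a = \<phi> k 0"
    have "norm a \<le> norm (w k 0) / 1"
      unfolding a_def \<phi>_def norm_divide using \<nu>(1)[of k] by (intro frac_le) (auto simp del: of_real_add of_real_mult)
    then have a: "norm a \<le> 1/8" using w_origin[of k] by simp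
    have "\<phi> k holomorphic_on U" unfolding \<phi>_def using \<nu>(1)[of k]
      by (intro holomorphic_intros holomorphic_on_w) (simp del: of_real_add of_real_mult)
    then have "(\<phi> k \<circ> g) holomorphic_on ball 0 1"
      by (intro holomorphic_on_compose_gen[OF B(2)]) (use B(5) in auto)
    moreover have "(\<phi> k \<circ> g) ` ball 0 1 \<subseteq> ball 0 1" using B(5) \<phi>b unfolding o_def by blast
    ultimately have "norm (Moebius_function 0 ((\<phi> k \<circ> g) (h 0)) ((\<phi> k \<circ> g) (h z))) \<le> t"
      unfolding t_def by (rule Schwarz_Pick(1)[OF _ _ B(3)[OF U0] B(3)[OF z]])
    then have M: "norm (a - \<phi> k z) / norm (1 - cnj a * \<phi> k z) \<le> t"
      using B(4) U0 z by (simp add: a_def Moebius_function_simple norm_divide norm_minus_commute)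
    have p1: "norm (\<phi> k z) < 1" using \<phi>b[OF z] by simp
    have "norm (cnj a * \<phi> k z) \<le> 1/8 * 1" unfolding norm_mult using a p1 by (intro mult_mono) auto
    then have D: "7/8 \<le> norm (1 - cnj a * \<phi> k z)" using norm_triangle_ineq2[of 1 "cnj a * \<phi> k z"] by simp
    then have "norm (a - \<phi> k z) \<le> t * norm (1 - cnj a * \<phi> k z)"
      using M by (subst (asm) pos_divide_le_eq) auto
    then have "norm (a - \<phi> k z)^2 \<le> t^2 * norm (1 - cnj a * \<phi> k z)^2"
      by (metis norm_ge_zero power_mono power_mult_distrib)
    then have "(1 - t^2) * norm (1 - cnj a * \<phi> k z)^2 \<le> (1 - norm a^2) * (1 - norm (\<phi> k z)^2)"
      unfolding cmod_diff_identity[symmetric] by (simp add: algebra_simps)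
    also have "\<dots> \<le> 1 * (1 - norm (\<phi> k z)^2)"
      using p1 by (intro mult_right_mono) (auto simp: power_le_one)
    finally have "(1 - t^2) * norm (1 - cnj a * \<phi> k z)^2 \<le> 1 - norm (\<phi> k z)^2" by simp
    moreover have "(1 - t^2) * (7/8)^2 \<le> (1 - t^2) * norm (1 - cnj a * \<phi> k z)^2"
      using t2 D by (intro mult_left_mono power_mono) auto
    ultimately have "norm (\<phi> k z)^2 \<le> 1 - (1 - t^2) * (7/8)^2" by linarith
    then show ?thesis unfolding S_def by (rule real_le_rsqrt)
  qed
  have "eventually (\<lambda>k. \<nu> k < (1 - S) / 4) sequentially"
    using S by (intro order_tendstoD(2)[OF \<nu>_tendsto]) simp
  then have "eventually (\<lambda>k. norm (w k z) \<le> (1 + S) / 2) sequentially"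
  proof eventually_elim
    case (elim k)
    have pos: "0 < 1 + 2 * \<nu> k" using \<nu>(1)[of k] by simp
    have "norm (w k z) = (1 + 2 * \<nu> k) * norm (\<phi> k z)"
      using pos unfolding \<phi>_def norm_divide norm_of_real by simp
    also have "\<dots> \<le> (1 + 2 * \<nu> k) * S" using \<phi>S[of k] pos by (intro mult_left_mono) auto
    also have "\<dots> \<le> S + 2 * \<nu> k" using S \<nu>(1)[of k] mult_left_le[of S "2 * \<nu> k"] by (simp add: algebra_simps)
    also have "\<dots> \<le> (1 + S) / 2" using elim by (simp add: field_simps)
    finally show ?case .
  qed
  then show thesis using S by (intro that[of "(1 + S) / 2"]) auto
qed

end

section \<open>Distance to the boundary, escape and oscillation\<close>

context wandering_model
begin

lemma frontier_V: "frontier (V n) \<noteq> {}" "x \<in> frontier (V n) \<Longrightarrow> norm (x - d n) \<le> e n"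
proof -
  show "frontier (V n) \<noteq> {}"
    using wandering_itineraryD(5,6)[OF itinerary_V[of n]] not_bounded_UNIV[where 'a = complex]
    by (auto simp: frontier_eq_empty)
  have "V n \<subseteq> cball (d n) (e n)" using V_subset by (auto simp: dist_norm norm_minus_commute)
  then have "closure (V n) \<subseteq> cball (d n) (e n)" by (intro closure_minimal) auto
  then show "norm (x - d n) \<le> e n" if "x \<in> frontier (V n)"
    using that by (auto simp: frontier_def dist_norm norm_minus_commute)
qed

lemma boundary_dist_upper:
  assumes "z \<in> U"
  shows "orbit_boundary_dist f U z n \<le> 2 * e n"
proof -
  obtain x where x: "x \<in> frontier (V n)" using frontier_V(1) by blast
  have "(f ^^ n) z \<in> V n" using assms by (simp add: V_def)
  have "orbit_boundary_dist f U z n \<le> dist ((f ^^ n) z) x"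
    unfolding orbit_boundary_dist_def orbit_component_V using x by (rule infdist_le)
  also have "\<dots> \<le> norm ((f ^^ n) z - d n) + norm (x - d n)"
    using norm_triangle_ineq4[of "(f ^^ n) z - d n" "x - d n"] by (simp add: dist_norm)
  finally show ?thesis using V_subset[OF \<open>(f ^^ n) z \<in> V n\<close>] frontier_V(2)[OF x] by simp
qed

text \<open>A boundary point of the image cannot lie in the disc of radius 1 - \<nu> k contained in
  it.\<close>

lemma boundary_dist_lower:
  assumes "z \<in> U"
  shows "r k * (1 - \<nu> k - norm (w k z)) \<le> orbit_boundary_dist f U z (N k)"
proof -
  have "r k * (1 - \<nu> k - norm (w k z)) \<le> dist ((f ^^ N k) z) x" if x: "x \<in> frontier (V (N k))" for x
  proof -
    have "x \<notin> V (N k)" using x wandering_itineraryD(3)[OF itinerary_V] by (auto simp: frontier_def interior_open)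
    then have "(x - c k) / of_real (r k) \<notin> ball 0 (1 - \<nu> k)"
      using ball_subset_w_image[of k] r_nz[of k] unfolding w_image by auto
    then have "(1 - \<nu> k) * r k \<le> norm (x - c k)"
      using r[of k] by (simp add: norm_divide not_less pos_le_divide_eq)
    moreover have "norm ((f ^^ N k) z - c k) = r k * norm (w k z)"
      using r[of k] by (simp add: w_def norm_divide)
    ultimately show ?thesis
      using norm_triangle_ineq2[of "x - c k" "(f ^^ N k) z - c k"]
      by (simp add: dist_norm norm_minus_commute algebra_simps)
  qed
  then show ?thesis
    unfolding orbit_boundary_dist_def orbit_component_V infdist_notempty[OF frontier_V(1)]
    using frontier_V(1) by (intro cINF_greatest) auto
qed

lemma boundary_dist_tendsto_0:
  assumes "(\<lambda>j. e (n j)) \<longlonglongrightarrow> 0" "z \<in> U"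
  shows "(\<lambda>j. orbit_boundary_dist f U z (n j)) \<longlonglongrightarrow> 0"
proof (rule tendsto_sandwich[OF _ _ tendsto_const])
  show "(\<lambda>j. 2 * e (n j)) \<longlonglongrightarrow> 0" using tendsto_mult[OF tendsto_const assms(1), of 2] by simp
qed (use boundary_dist_upper[OF assms(2)] in \<open>auto simp: orbit_boundary_dist_def infdist_nonneg\<close>)

lemma boundary_dist_liminf:
  assumes k: "strict_mono k" "\<And>j. r (k j) = 1" and z: "z \<in> U"
  shows "liminf (\<lambda>j. ereal (orbit_boundary_dist f U z (N (k j)))) > 0"
proof -
  obtain s where s: "0 \<le> s" "s < 1" "eventually (\<lambda>k. norm (w k z) \<le> s) sequentially"
    using interior_bound[OF z] by blast
  have "eventually (\<lambda>i. \<nu> i < (1 - s) / 2) sequentially"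
    using s by (intro order_tendstoD(2)[OF \<nu>_tendsto]) simp
  with s(3) have "eventually (\<lambda>i. norm (w i z) \<le> s \<and> \<nu> i < (1 - s) / 2) sequentially"
    by (rule eventually_conj)
  then have "eventually (\<lambda>j. norm (w (k j) z) \<le> s \<and> \<nu> (k j) < (1 - s) / 2) sequentially"
    using filterlim_subseq[OF k(1)] by (rule eventually_compose_filterlim)
  then have "eventually (\<lambda>j. ereal ((1 - s) / 2) \<le> ereal (orbit_boundary_dist f U z (N (k j)))) sequentially"
  proof eventually_elim
    case (elim j)
    have "(1 - s) / 2 \<le> 1 - \<nu> (k j) - norm (w (k j) z)"
      using elim by (simp add: field_simps)
    then show ?case using boundary_dist_lower[OF z, of "k j"] k(2)[of j] by simp
  qed
  then have "ereal ((1 - s) / 2) \<le> liminf (\<lambda>j. ereal (orbit_boundary_dist f U z (N (k j))))"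
    by (rule Liminf_bounded)
  moreover have "0 < ereal ((1 - s) / 2)" using s by simp
  ultimately show ?thesis by (rule less_le_trans[rotated])
qed

lemma boundary_type_bounded_away:
  assumes "\<And>k. \<not> ret k" "\<And>k. r k = 1"
  shows "has_boundary_type f U Bounded_away"
proof -
  have "N k = k" for k using assms(1) init N by (induction k) auto
  then show ?thesis using boundary_dist_liminf[of "\<lambda>k. k"] assms(2) by (simp add: strict_mono_def)
qed

lemma boundary_type_alternating:
  assumes "\<And>j. r (2 * j + 1) \<le> 1 / real (2 * j + 2)" "\<And>j. r (2 * j + 2) = 1"
  shows "has_boundary_type f U Alternating"
  unfolding has_boundary_type.simps
proof (rule exI[of _ "\<lambda>j. N (2 * j + 1)"], rule exI[of _ "\<lambda>j. N (2 * j + 2)"], intro conjI ballI)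
  show "strict_mono (\<lambda>j. N (2 * j + 1))" "strict_mono (\<lambda>j. N (2 * j + 2))"
    using strict_mono_N by (auto simp: strict_mono_def)
  have "(\<lambda>j. e (N (2 * j + 1))) \<longlonglongrightarrow> 0"
  proof (rule tendsto_sandwich[OF _ _ tendsto_const])
    show "eventually (\<lambda>j. e (N (2 * j + 1)) \<le> 1 / real (Suc j)) sequentially"
    proof (intro always_eventually allI)
      fix j
      have "e (N (2 * j + 1)) \<le> 2 * (1 / real (2 * j + 2))" using assms(1)[of j] station[of "2 * j + 1"] by simp
      then show "e (N (2 * j + 1)) \<le> 1 / real (Suc j)" by (simp add: field_simps)
    qed
    show "(\<lambda>j. 1 / real (Suc j)) \<longlonglongrightarrow> 0"
      using LIMSEQ_inverse_real_of_nat by (simp add: inverse_eq_divide)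
    show "eventually (\<lambda>j. 0 \<le> e (N (2 * j + 1))) sequentially"
      using station r by (simp add: less_imp_le)
  qed
  then show "(\<lambda>j. orbit_boundary_dist f U z (N (2 * j + 1))) \<longlonglongrightarrow> 0" if "z \<in> U" for z
    using that by (rule boundary_dist_tendsto_0)
  show "0 < liminf (\<lambda>j. ereal (orbit_boundary_dist f U z (N (2 * j + 2))))" if "z \<in> U" for z
    using assms(2) that by (intro boundary_dist_liminf) (auto simp: strict_mono_def)
qed

text \<open>Each image lies in a disc of radius \<open>e n\<close>. The bound 2/(k + 1) holds for
  this radius at station times and at the intermediate times of a return alike.\<close>

lemma boundary_type_converging:
  assumes "\<And>k. r (Suc k) \<le> 1 / real (k + 2)"
  shows "has_boundary_type f U Converging"
  unfolding has_boundary_type.simps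
proof
  fix z assume z: "z \<in> U"
  have rk: "r k \<le> 1 / real (k + 1)" for k
    using assms[of "k - 1"] init(2) by (cases k) auto
  have "e \<longlonglongrightarrow> 0"
    unfolding LIMSEQ_iff
  proof (intro allI impI)
    fix \<eta> :: real assume "\<eta> > 0"
    then obtain K where K: "2 / \<eta> < real K" using reals_Archimedean2 by blast
    show "\<exists>M. \<forall>n\<ge>M. norm (e n - 0) < \<eta>"
    proof (intro exI[of _ "N K"] allI impI)
      fix n assume n: "n \<ge> N K"
      obtain k where k: "N k \<le> n" "n < N (Suc k)" using strict_mono_interval[OF strict_mono_N init(3)] by blast
      then have "N K < N (Suc k)" using n by simp
      then have "K \<le> k" using strict_mono_less[OF strict_mono_N] by (simp add: less_Suc_eq_le)
      have "0 \<le> e n \<and> e n \<le> 2 / real (k + 1)"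
      proof (cases "n = N k")
        case True then show ?thesis using station[of k] rk[of k] r[of k] by simp
      next
        case False then show ?thesis using mid[of k n] k by (simp add: divide_right_mono)
      qed
      moreover have "2 / real (k + 1) < \<eta>"
      proof -
        have "2 / \<eta> < real (k + 1)" using K \<open>K \<le> k\<close> by simp
        then show ?thesis using \<open>\<eta> > 0\<close> by (simp add: field_simps)
      qed
      ultimately show "norm (e n - 0) < \<eta>" by simp
    qed
  qed
  then show "orbit_boundary_dist f U z \<longlonglongrightarrow> 0"
    using boundary_dist_tendsto_0[of "\<lambda>n. n", OF _ z] by simp
qed

lemma station_norm:
  assumes "z \<in> U"
  shows "norm (c k) - 2 \<le> norm ((f ^^ N k) z)"
proof -
  have "norm ((f ^^ N k) z - c k) \<le> 2"
    using UD(7)[OF assms, of "N k"] station[of k] r[of k] by simp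
  then show ?thesis using norm_triangle_ineq2[of "c k" "(f ^^ N k) z"] by (simp add: norm_minus_commute)
qed

lemma station_tendsto:
  assumes "z \<in> U"
  shows "filterlim (\<lambda>k. norm ((f ^^ N k) z)) at_top sequentially"
proof (rule filterlim_at_top_mono)
  show "filterlim (\<lambda>k. norm (c k) - 2) at_top sequentially"
    using filterlim_tendsto_add_at_top[OF tendsto_const[of "-2::real"] escape] by simp
qed (use station_norm[OF assms] in auto)

lemma escaping_model:
  assumes "\<And>k. \<not> ret k"
  shows "escaping_wandering_domain f U"
proof -
  have "N k = k" for k using assms init N by (induction k) auto
  then show ?thesis
    unfolding escaping_wandering_domain_def escaping_set_def
    using itinerary_wandering[OF W] station_tendsto by (auto intro: filterlim_norm_at_top_imp_at_infinity)
qed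

lemma oscillating_model:
  fixes k :: "nat \<Rightarrow> nat"
  assumes k: "strict_mono k" "\<And>j. ret (k j)"
  shows "oscillating_wandering_domain f U"
  unfolding oscillating_wandering_domain_def
proof (intro conjI subsetI)
  show "wandering_domain f U" using W by (rule itinerary_wandering)
  fix z assume z: "z \<in> U"
  let ?X = "\<lambda>n. ereal (norm ((f ^^ n) z))"
  have "liminf ?X \<le> liminf (?X \<circ> (\<lambda>j. Suc (N (k j))))"
    by (rule liminf_subseq_mono) (use strict_mono_N k(1) in \<open>simp add: strict_mono_def\<close>)
  also have "\<dots> \<le> limsup (?X \<circ> (\<lambda>j. Suc (N (k j))))"
    by (rule Liminf_le_Limsup) simp
  also have "\<dots> \<le> ereal 21"
  proof (rule Limsup_bounded, intro always_eventually allI)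
    fix j
    have "norm ((f ^^ Suc (N (k j))) z) \<le> 21"
      using returns[OF k(2) z, of j] norm_triangle_ineq2[of "(f ^^ Suc (N (k j))) z" 20] by (simp add: dist_norm)
    then show "(?X \<circ> (\<lambda>j. Suc (N (k j)))) j \<le> ereal 21" by simp
  qed
  finally have "liminf ?X < \<infinity>" by (rule le_less_trans) simp
  moreover have "limsup ?X = \<infinity>"
  proof -
    have "filterlim (\<lambda>n. ereal (norm ((f ^^ N n) z))) (nhds \<infinity>) sequentially"
      using station_tendsto[OF z] unfolding tendsto_PInfty_eq_at_top .
    then have "limsup (?X \<circ> N) = \<infinity>" unfolding o_def by (intro lim_imp_Limsup) auto
    then show ?thesis using limsup_subseq_mono[OF strict_mono_N, of ?X] by simp
  qed
  ultimately show "z \<in> bungee_set f" by (simp add: bungee_set_def)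
qed

end

lemma funpow_diff: "m \<le> n \<Longrightarrow> (f ^^ n) x = (f ^^ (n - m)) ((f ^^ m) x)"
  by (simp add: funpow_add[symmetric] flip: comp_apply[of "f ^^ (n - m)"])

section \<open>Hyperbolic types\<close>

context wandering_model
begin

lemma orbit_hyp_dist_V: "orbit_hyp_dist f U z z' n = hyp_dist (V n) ((f ^^ n) z) ((f ^^ n) z')"
  by (simp add: orbit_hyp_dist_def orbit_component_V)

lemma orbit_in_V: "z \<in> U \<Longrightarrow> (f ^^ n) z \<in> V n"
  by (simp add: V_def)

lemma orbit_hyp_dist_antimono:
  assumes "z \<in> U" "z' \<in> U" "m \<le> n"
  shows "orbit_hyp_dist f U z z' n \<le> orbit_hyp_dist f U z z' m"
proof -
  have "(f ^^ (n - m)) ` V m \<subseteq> V n" using V_image[of "n - m" m] assms(3) by simp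
  from hyp_dist_contract[OF hyperbolic_V hyperbolic_V holomorphic_on_orbit this orbit_in_V[OF assms(1)] orbit_in_V[OF assms(2)]]
  show ?thesis unfolding orbit_hyp_dist_V funpow_diff[OF assms(3), symmetric] .
qed

lemma orbit_hyp_dist_nonneg: "z \<in> U \<Longrightarrow> z' \<in> U \<Longrightarrow> 0 \<le> orbit_hyp_dist f U z z' n"
  unfolding orbit_hyp_dist_V by (intro hyp_dist_nonneg hyperbolic_V orbit_in_V)

text \<open>The image at a station lies in a disc of relative radius 1 + 2 \<nu> k, at most 2.
  Passing to this larger domain only decreases the distance, and there it is explicit.\<close>

lemma orbit_hyp_dist_lower:
  assumes z: "z \<in> U" "z' \<in> U"
  shows "2 * artanh (norm (w k z - w k z') / 4) \<le> orbit_hyp_dist f U z z' (N k)"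
proof -
  define t where "t = 1 + 2 * \<nu> k"
  have t: "1 < t" "t \<le> 2" using \<nu>(1)[of k] \<nu>_le[of k] by (auto simp: t_def)
  define \<phi> where "\<phi> x = (x - c k) / of_real (r k) / of_real t" for x
  have \<phi>w: "\<phi> ((f ^^ N k) x) = w k x / of_real t" for x by (simp add: \<phi>_def w_def)
  have wt: "w k x / of_real t \<in> ball 0 1" if "x \<in> U" for x
  proof -
    have "norm (w k x) \<le> 1 + \<nu> k" using w_upper[of x k] that closure_subset[of U] by blast
    then show ?thesis using t \<nu>(1)[of k] by (simp add: norm_divide t_def del: of_real_add of_real_mult)
  qed
  have "\<phi> holomorphic_on V (N k)" unfolding \<phi>_def using r_nz t by (intro holomorphic_intros) auto
  moreover have "\<phi> ` V (N k) \<subseteq> ball 0 1" using wt by (auto simp: V_def \<phi>w simp del: mem_ball)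
  ultimately have "hyp_dist (ball 0 1) (\<phi> ((f ^^ N k) z)) (\<phi> ((f ^^ N k) z')) \<le> orbit_hyp_dist f U z z' (N k)"
    unfolding orbit_hyp_dist_V
    by (rule hyp_dist_contract[OF hyperbolic_V hyperbolic_simply_connected_ball _ _ orbit_in_V[OF z(1)] orbit_in_V[OF z(2)]])
  then have le: "disc_hyp_dist (w k z / of_real t) (w k z' / of_real t) \<le> orbit_hyp_dist f U z z' (N k)"
    unfolding \<phi>w by (simp only: hyp_dist_ball[OF wt[OF z(1)] wt[OF z(2)]])
  have "norm (w k z / of_real t - w k z' / of_real t) = norm (w k z - w k z') / t"
    using t by (simp add: norm_divide diff_divide_distrib[symmetric])
  moreover have "norm (w k z - w k z') / 2 \<le> norm (w k z - w k z') / t"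
    using t by (intro frac_le) auto
  ultimately have "norm (w k z - w k z') / 2 \<le> norm (w k z / of_real t - w k z' / of_real t)" by simp
  then have "2 * artanh (norm (w k z - w k z') / 2 / 2) \<le> disc_hyp_dist (w k z / of_real t) (w k z' / of_real t)"
    by (intro disc_hyp_dist_lower wt z) auto
  then show ?thesis using le by simp
qed

text \<open>The counterpart from inside: the image contains a disc of relative radius 1 - \<nu> k,
  whose distance is larger.\<close>

lemma orbit_hyp_dist_upper:
  assumes z: "z \<in> U" "z' \<in> U" and small: "norm (w k z) < 1 - \<nu> k" "norm (w k z') < 1 - \<nu> k"
  shows "orbit_hyp_dist f U z z' (N k) \<le> disc_hyp_dist (w k z / of_real (1 - \<nu> k)) (w k z' / of_real (1 - \<nu> k))"
proof -
  define t where "t = 1 - \<nu> k"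
  have t: "0 < t" "complex_of_real t \<noteq> 0" using \<nu>_le[of k] by (auto simp: t_def)
  define \<phi> where "\<phi> x = c k + of_real (r k) * (of_real t * x)" for x
  have inb: "w k z / of_real t \<in> ball 0 1" "w k z' / of_real t \<in> ball 0 1"
    using small t unfolding t_def[symmetric] by (auto simp: norm_divide)
  have im: "\<phi> ` ball 0 1 \<subseteq> V (N k)"
  proof
    fix y assume "y \<in> \<phi> ` ball 0 1"
    then obtain x where x: "norm x < 1" "y = \<phi> x" by auto
    then have "of_real t * x \<in> ball 0 t" using t by (simp add: norm_mult)
    then obtain v where "v \<in> U" "of_real t * x = w k v" using ball_subset_w_image[of k] unfolding t_def by blast
    then show "y \<in> V (N k)" unfolding x(2) \<phi>_def by (auto simp: V_def orbit_of_w)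
  qed
  have "\<phi> holomorphic_on ball 0 1" unfolding \<phi>_def by (intro holomorphic_intros)
  then have "hyp_dist (V (N k)) (\<phi> (w k z / of_real t)) (\<phi> (w k z' / of_real t))
      \<le> hyp_dist (ball 0 1) (w k z / of_real t) (w k z' / of_real t)"
    by (rule hyp_dist_contract[OF hyperbolic_simply_connected_ball hyperbolic_V _ im inb])
  moreover have "\<phi> (w k x / of_real t) = (f ^^ N k) x" for x using t by (simp add: \<phi>_def orbit_of_w)
  ultimately show ?thesis unfolding orbit_hyp_dist_V t_def[symmetric] by (simp only: hyp_dist_ball[OF inb])
qed

text \<open>The coordinates \<open>w k z\<close> tend to z. Two points merged by an iterate would
  share all later coordinates and hence coincide, so every iterate is injective on the disc and is a
  Riemann map of its image.\<close>

lemma hyperbolic_type_isometric: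
  assumes full
  shows "has_hyperbolic_type f U Eventually_isometric"
proof -
  note UB = full_ball[OF assms]
  have inj: "inj_on (f ^^ n) U" for n
  proof (rule inj_onI)
    fix x y assume xy: "x \<in> U" "y \<in> U" "(f ^^ n) x = (f ^^ n) y"
    have conv: "(\<lambda>k. w k z) \<longlonglongrightarrow> z" if "z \<in> U" for z
      by (rule Lim_null_comparison[OF _ \<nu>_tendsto, THEN LIM_zero_cancel])
        (use w_full[OF assms that] in auto)
    have "eventually (\<lambda>k. w k x = w k y) sequentially"
    proof (rule eventually_sequentiallyI)
      fix k assume "k \<ge> n"
      then have "n \<le> N k" using N_ge[of k] by simp
      then have "(f ^^ N k) v = (f ^^ (N k - n)) ((f ^^ n) v)" for v
        by (rule funpow_diff)
      then show "w k x = w k y" using xy(3) by (simp add: w_def)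
    qed
    then have "(\<lambda>k. w k y) \<longlonglongrightarrow> x" using conv[OF xy(1)] by (rule Lim_transform_eventually[rotated])
    then show "x = y" using conv[OF xy(2)] by (rule LIMSEQ_unique)
  qed
  have D: "orbit_hyp_dist f U z z' n = disc_hyp_dist z z'" if z: "z \<in> U" "z' \<in> U" for z z' n
  proof -
    obtain h where h: "biholomorphic_pair ((f ^^ n) ` ball 0 1) h (f ^^ n)"
      using biholomorphic_pair_inj[OF inj[of n, unfolded UB] holomorphic_on_orbit] by blast
    have "h ((f ^^ n) x) = x" if "x \<in> U" for x using biholomorphic_pairD(6)[OF h] that UB by blast
    then show ?thesis
      unfolding orbit_hyp_dist_V unfolding V_def unfolding UB
      using hyp_dist_eq[OF h, of "(f ^^ n) z" "(f ^^ n) z'"] z UB by simp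
  qed
  show ?thesis unfolding has_hyperbolic_type.simps
  proof (intro exI[of _ disc_hyp_dist] exI[of _ 1] conjI allI impI ballI)
    fix n p assume p: "p \<in> U \<times> U - merging_pairs f U"
    obtain z z' where zz: "p = (z, z')" by fastforce
    have z: "z \<in> U" "z' \<in> U" "z \<noteq> z'" using p zz by (auto simp: merging_pairs_def)
    then have "disc_hyp_dist z z' > 0" using UB by (intro disc_hyp_dist_pos) auto
    then show "case p of (z, z') \<Rightarrow> disc_hyp_dist z z' > 0 \<and> orbit_hyp_dist f U z z' n = disc_hyp_dist z z'"
      using D[OF z(1,2)] zz by simp
  qed simp
qed

text \<open>Squaring contracts by the factor s once |w k z| \<le> s < 1, so all coordinates tend to
  0 and the distances at station times vanish. Monotonicity of the distance extends this to all
  times.\<close>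

lemma hyperbolic_type_contracting:
  assumes b: "\<And>k. b k = blaschke_pair 0"
  shows "has_hyperbolic_type f U Contracting"
  unfolding has_hyperbolic_type.simps
proof (intro ballI)
  have w0: "(\<lambda>k. w k z) \<longlonglongrightarrow> 0" if z: "z \<in> U" for z
  proof -
    obtain s where s: "0 \<le> s" "s < 1" "eventually (\<lambda>k. norm (w k z) \<le> s) sequentially"
      using interior_bound[OF z] by blast
    then obtain K where K: "\<And>k. k \<ge> K \<Longrightarrow> norm (w k z) \<le> s" unfolding eventually_sequentially by blast
    have "(\<lambda>k. norm (w (k + K) z)) \<longlonglongrightarrow> 0"
    proof (rule tendsto_0_of_contraction[OF _ s(2), where \<nu> = "\<lambda>k. \<nu> (k + K)"])
      fix k
      have "norm (b (k + K) (w (k + K) z)) = norm (w (k + K) z) * norm (w (k + K) z)"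
        by (simp add: b blaschke_pair_def norm_mult)
      also have "\<dots> \<le> s * norm (w (k + K) z)" using K[of "k + K"] by (intro mult_right_mono) auto
      finally show "norm (w (Suc k + K) z) \<le> s * norm (w (k + K) z) + \<nu> (k + K)"
        using w_step[OF z, of "k + K"] norm_triangle_ineq2[of "w (Suc k + K) z" "b (k + K) (w (k + K) z)"] by simp
    qed (use summable_\<nu> \<nu>(1) in \<open>auto simp: summable_iff_shift less_imp_le\<close>)
    then have "(\<lambda>k. norm (w k z)) \<longlonglongrightarrow> 0" by (rule LIMSEQ_offset)
    then show ?thesis by (rule tendsto_norm_zero_cancel)
  qed
  fix z z' assume z: "z \<in> U" "z' \<in> U"
  have disc: "(\<lambda>k. disc_hyp_dist (w k z / of_real (1 - \<nu> k)) (w k z' / of_real (1 - \<nu> k))) \<longlonglongrightarrow> 0"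
  proof (rule tendsto_disc_hyp_dist_0)
    have "(\<lambda>k. w k x / of_real (1 - \<nu> k)) \<longlonglongrightarrow> 0 / of_real (1 - 0)" if "x \<in> U" for x
      using w0[OF that] \<nu>_tendsto by (intro tendsto_intros) auto
    then show "(\<lambda>k. w k z / of_real (1 - \<nu> k)) \<longlonglongrightarrow> 0" "(\<lambda>k. w k z' / of_real (1 - \<nu> k)) \<longlonglongrightarrow> 0"
      using z by auto
  qed
  have ev: "eventually (\<lambda>k. orbit_hyp_dist f U z z' (N k) \<le> disc_hyp_dist (w k z / of_real (1 - \<nu> k)) (w k z' / of_real (1 - \<nu> k))) sequentially"
  proof -
    have "eventually (\<lambda>k. norm (w k x) < 1/2) sequentially" if "x \<in> U" for x
      by (rule order_tendstoD(2)[OF tendsto_norm[OF w0[OF that]]]) simp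
    from this[OF z(1)] this[OF z(2)] show ?thesis
    proof eventually_elim
      case (elim k)
      then show ?case using \<nu>_le[of k] by (intro orbit_hyp_dist_upper z) auto
    qed
  qed
  have lim: "(\<lambda>k. orbit_hyp_dist f U z z' (N k)) \<longlonglongrightarrow> 0"
    by (rule tendsto_sandwich[OF always_eventually[OF allI[OF orbit_hyp_dist_nonneg[OF z]]] ev tendsto_const disc])
  show "orbit_hyp_dist f U z z' \<longlonglongrightarrow> 0"
  proof (rule LIMSEQ_I)
    fix \<eta> :: real assume "\<eta> > 0"
    then have "eventually (\<lambda>k. orbit_hyp_dist f U z z' (N k) < \<eta>) sequentially" by (rule order_tendstoD(2)[OF lim])
    then obtain k where k: "orbit_hyp_dist f U z z' (N k) < \<eta>" unfolding eventually_sequentially by blast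
    show "\<exists>M. \<forall>n\<ge>M. norm (orbit_hyp_dist f U z z' n - 0) < \<eta>"
    proof (intro exI[of _ "N k"] allI impI)
      fix n assume "n \<ge> N k"
      then have "orbit_hyp_dist f U z z' n < \<eta>"
        by (rule le_less_trans[OF orbit_hyp_dist_antimono[OF z] k])
      then show "norm (orbit_hyp_dist f U z z' n - 0) < \<eta>" using orbit_hyp_dist_nonneg[OF z, of n] by simp
    qed
  qed
qed

text \<open>The passage from one station to the next in normalized coordinates. As an entire
  function of the coordinate it can be compared with b k on a disc.\<close>

definition stage :: "nat \<Rightarrow> complex \<Rightarrow> complex" where
  "stage k x = ((f ^^ (N (Suc k) - N k)) (c k + of_real (r k) * x) - c (Suc k)) / of_real (r (Suc k))"

lemma orbit_next_station: "(f ^^ (N (Suc k) - N k)) ((f ^^ N k) z) = (f ^^ N (Suc k)) z"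
  by (rule funpow_diff[symmetric]) (use N_less[of k] in simp)

lemma stage_w: "stage k (w k z) = w (Suc k) z"
  unfolding stage_def orbit_of_w[symmetric] orbit_next_station by (simp add: w_def)

lemma holomorphic_on_stage: "stage k holomorphic_on S"
proof -
  have "((f ^^ (N (Suc k) - N k)) \<circ> (\<lambda>x. c k + of_real (r k) * x)) holomorphic_on S"
    by (intro holomorphic_on_compose holomorphic_on_orbit holomorphic_intros)
  then show ?thesis unfolding stage_def o_def using r_nz by (intro holomorphic_intros) auto
qed

lemma stage_near: "x \<in> ball 0 (1 - \<nu> k) \<Longrightarrow> norm (stage k x - b k x) \<le> \<nu> k"
proof -
  assume "x \<in> ball 0 (1 - \<nu> k)"
  then obtain z where "z \<in> U" "x = w k z" using ball_subset_w_image by blast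
  then show ?thesis using w_step by (simp add: stage_w)
qed

text \<open>Equality would make the passage injective on the whole image of U, and hence
  \<open>stage k\<close> injective on the disc that this image contains.\<close>

lemma orbit_hyp_dist_decreases:
  assumes not_inj: "\<not> inj_on (stage k) (ball 0 (1 - \<nu> k))"
    and z: "z \<in> U" "z' \<in> U" "(f ^^ N k) z \<noteq> (f ^^ N k) z'"
  shows "orbit_hyp_dist f U z z' (N (Suc k)) < orbit_hyp_dist f U z z' (N k)"
proof (rule ccontr)
  let ?g = "f ^^ (N (Suc k) - N k)"
  assume "\<not> ?thesis"
  then have eq: "orbit_hyp_dist f U z z' (N (Suc k)) = orbit_hyp_dist f U z z' (N k)"
    using orbit_hyp_dist_antimono[OF z(1,2), of "N k" "N (Suc k)"] N_less[of k] by simp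
  have im: "?g ` V (N k) \<subseteq> V (N (Suc k))" using V_image[of "N (Suc k) - N k" "N k"] N_less[of k] by simp
  have inj: "inj_on ?g (V (N k))"
    by (rule hyp_dist_eq_imp_inj[OF hyperbolic_V hyperbolic_V holomorphic_on_orbit im
          orbit_in_V[OF z(1)] orbit_in_V[OF z(2)] _ z(3)])
      (use eq in \<open>simp add: orbit_hyp_dist_V orbit_next_station\<close>)
  have "inj_on (stage k) (ball 0 (1 - \<nu> k))"
  proof (rule inj_onI)
    fix x y assume xy: "x \<in> ball 0 (1 - \<nu> k)" "y \<in> ball 0 (1 - \<nu> k)" "stage k x = stage k y"
    then obtain u v where uv: "u \<in> U" "x = w k u" "v \<in> U" "y = w k v" using ball_subset_w_image by blast
    have "?g ((f ^^ N k) u) = ?g ((f ^^ N k) v)"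
      using xy(3) r_nz[of "Suc k"] unfolding uv(2,4) stage_w orbit_next_station by (simp add: w_def)
    then have "(f ^^ N k) u = (f ^^ N k) v"
      by (rule inj_onD[OF inj _ orbit_in_V[OF uv(1)] orbit_in_V[OF uv(3)]])
    then show "x = y" unfolding uv(2,4) by (simp add: w_def)
  qed
  then show False using not_inj by blast
qed

text \<open>The distances decrease to their infimum c. It is never attained, as each station still
  brings a strict decrease. It is positive because \<open>stage k\<close> is within a summable error
  of the identity, so the coordinates of z and z' stay apart.\<close>

lemma hyperbolic_type_semi_contracting:
  assumes b: "\<And>k. b k = blaschke_pair (a k)" and a: "\<And>k. 0 \<le> a k" "\<And>k. a k < 1" "summable (\<lambda>k. 1 - a k)"
    and not_inj: "\<And>k. \<not> inj_on (stage k) (ball 0 (1 - \<nu> k))"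
  shows "has_hyperbolic_type f U Semi_contracting"
  unfolding has_hyperbolic_type.simps
proof (intro exI[of _ "\<lambda>z z'. Inf (range (orbit_hyp_dist f U z z'))"] ballI)
  fix p assume p: "p \<in> U \<times> U - merging_pairs f U"
  obtain z z' where zz: "p = (z, z')" by fastforce
  have z: "z \<in> U" "z' \<in> U" "\<And>k. (f ^^ k) z \<noteq> (f ^^ k) z'" using p zz by (auto simp: merging_pairs_def)
  let ?D = "orbit_hyp_dist f U z z'"
  let ?c = "Inf (range ?D)"
  have bdd: "bdd_below (range ?D)" using orbit_hyp_dist_nonneg[OF z(1,2)] by (intro bdd_belowI[of _ 0]) auto
  have "decseq ?D" using orbit_hyp_dist_antimono[OF z(1,2)] by (simp add: decseq_def)
  then have lim: "?D \<longlonglongrightarrow> ?c" using bdd by (intro LIMSEQ_decseq_INF)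
  have neq: "?D n \<noteq> ?c" for n
  proof
    assume "?D n = ?c"
    moreover have "?c \<le> ?D (N (Suc n))" using bdd by (intro cINF_lower) auto
    moreover have "?D (N (Suc n)) < ?D (N n)" by (rule orbit_hyp_dist_decreases[OF not_inj z])
    moreover have "?D (N n) \<le> ?D n" using orbit_hyp_dist_antimono[OF z(1,2) N_ge[of n]] .
    ultimately show False by simp
  qed
  obtain s1 s2 where s12: "s1 < 1" "eventually (\<lambda>k. norm (w k z) \<le> s1) sequentially"
      "s2 < 1" "eventually (\<lambda>k. norm (w k z') \<le> s2) sequentially" "0 \<le> s1"
    using interior_bound[OF z(1)] interior_bound[OF z(2)] by metis
  define s where "s = max s1 s2"
  \<comment> \<open>A radius strictly between s and 1: both coordinates stay in the disc of radius
    s, and the ring up to R is the room for the Cauchy estimate.\<close>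
  define R where "R = (1 + s) / 2"
  have s: "0 \<le> s" "s < R" "R < 1" using s12 by (auto simp: s_def R_def)
  have "eventually (\<lambda>k. \<nu> k < 1 - R) sequentially" using s by (intro order_tendstoD(2)[OF \<nu>_tendsto]) simp
  with s12(2,4) have "eventually (\<lambda>k. norm (w k z) \<le> s \<and> norm (w k z') \<le> s \<and> R \<le> 1 - \<nu> k) sequentially"
    by eventually_elim (auto simp: s_def)
  then obtain K where K: "\<And>k. k \<ge> K \<Longrightarrow> norm (w k z) \<le> s \<and> norm (w k z') \<le> s \<and> R \<le> 1 - \<nu> k"
    unfolding eventually_sequentially by blast
  define \<eta> where "\<eta> k = \<nu> k + 2 * (1 - a k) / (1 - R)" for k
  obtain m M where m: "m > 0" "\<And>k. k \<ge> M \<Longrightarrow> m \<le> norm (w k z - w k z')"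
  proof (rule lower_bound_of_summable_losses[of "\<lambda>k. norm (w k z - w k z')" "\<lambda>k. 2 * \<eta> k / (R - s)" K])
    show "0 < norm (w k z - w k z')" for k using z(3)[of "N k"] r_nz[of k] by (simp add: w_def)
    show "0 \<le> 2 * \<eta> k / (R - s)" for k
      using \<nu>(1)[of k] a(2)[of k] s by (simp add: \<eta>_def)
    show "summable (\<lambda>k. 2 * \<eta> k / (R - s))"
      unfolding \<eta>_def by (intro summable_divide summable_mult summable_add summable_\<nu> a(3))
    fix k assume k: "k \<ge> K"
    have "(1 - 2 * \<eta> k / (R - s)) * norm (w k z - w k z') \<le> norm (stage k (w k z) - stage k (w k z'))"
    proof (rule near_identity_expansion[OF holomorphic_on_stage _ s(1,2)])
      fix x :: complex assume x: "x \<in> ball 0 R"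
      then have "x \<in> ball 0 (1 - \<nu> k)" using K[OF k] by auto
      then have 1: "norm (stage k x - b k x) \<le> \<nu> k" by (rule stage_near)
      have "norm (b k x - x) \<le> 2 * (1 - a k) / (1 - norm x)"
        unfolding b using x s a by (intro blaschke_pair_near_id) auto
      also have "\<dots> \<le> 2 * (1 - a k) / (1 - R)" using x s a(2)[of k] by (intro divide_left_mono mult_pos_pos) auto
      finally show "norm (stage k x - x) \<le> \<eta> k"
        using 1 norm_triangle_ineq[of "stage k x - b k x" "b k x - x"] by (simp add: \<eta>_def)
    qed (use K[OF k] in auto)
    then show "(1 - 2 * \<eta> k / (R - s)) * norm (w k z - w k z') \<le> norm (w (Suc k) z - w (Suc k) z')"
      unfolding stage_w .
  qed (rule that; assumption)
  have zc: "z \<in> closure U" "z' \<in> closure U" using z closure_subset by auto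
  have up: "norm (w k z - w k z') / 4 < 1" for k
    using w_upper[OF zc(1), of k] w_upper[OF zc(2), of k] norm_triangle_ineq4[of "w k z" "w k z'"] \<nu>_le[of k] by simp
  have "m / 4 < 1" using m(2)[of M] up[of M] by simp
  then have pos: "0 < artanh (m / 4)" using artanh_strict_mono_real[of 0 "m / 4"] m(1) by simp
  have "2 * artanh (m / 4) \<le> ?D n" for n
  proof -
    \<comment> \<open>The bound is obtained at the station time N k \<ge> n and passes back to n,
      since distances decrease with time.\<close>
    define k where "k = max M n"
    have "artanh (m / 4) \<le> artanh (norm (w k z - w k z') / 4)"
      using m(1) m(2)[of k] up[of k] by (intro artanh_mono_real) (auto simp: k_def)
    also have "2 * \<dots> \<le> ?D (N k)" by (rule orbit_hyp_dist_lower[OF z(1,2)])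
    also have "\<dots> \<le> ?D n"
      using N_ge[of k] by (intro orbit_hyp_dist_antimono[OF z(1,2)]) (simp add: k_def)
    finally show ?thesis by simp
  qed
  then have "2 * artanh (m / 4) \<le> ?c" by (intro cINF_greatest) auto
  then show "case p of (z, z') \<Rightarrow> 0 < Inf (range (orbit_hyp_dist f U z z')) \<and>
      orbit_hyp_dist f U z z' \<longlonglongrightarrow> Inf (range (orbit_hyp_dist f U z z')) \<and>
      (\<forall>n. orbit_hyp_dist f U z z' n \<noteq> Inf (range (orbit_hyp_dist f U z z')))"
    using pos lim neq unfolding zz by simp
qed

end

section \<open>Choice of the parameters for each combination of types\<close>

lemma wandering_domain_of_type:
  fixes h :: hyperbolic_type and bt :: boundary_type and osc :: bool
  assumes osc: "osc \<Longrightarrow> bt \<noteq> Bounded_away"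
  obtains f U where "transcendental_entire f" "simply_connected U"
    "if osc then oscillating_wandering_domain f U else escaping_wandering_domain f U"
    "has_hyperbolic_type f U h" "has_boundary_type f U bt" "smooth_Jordan_curve (frontier U)"
    "h = Eventually_isometric \<Longrightarrow> U = ball 0 1"
proof -
  define full where "full \<longleftrightarrow> h = Eventually_isometric"
  \<comment> \<open>Zero gives the square for contraction; otherwise 1 - a k = (1/2)^(k + 1) is
    summable, as the positive limit of the distances requires.\<close>
  define a :: "nat \<Rightarrow> real" where "a k = (if h = Semi_contracting then 1 - (1/2) ^ Suc k else 0)" for k
  define b where "b k = (if full then \<lambda>z. z else blaschke_pair (a k))" for k
  \<comment> \<open>In the alternating case even stations keep radius 1 and odd ones shrink.\<close>
  define far_rad :: "nat \<Rightarrow> real" where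
    "far_rad k = (if bt = Bounded_away \<or> bt = Alternating \<and> even k then 1 else 1 / real (k + 1))" for k
  \<comment> \<open>A return at stage k shrinks station k + 1. So returns at even stages are
    compatible with even stations of radius 1, and returning at every stage gives convergence to the
    boundary.\<close>
  define ret where "ret k \<longleftrightarrow> osc \<and> (bt = Converging \<or> even k)" for k :: nat
  have a: "0 \<le> a k" "a k < 1" for k
  proof -
    have "(1/2::real) ^ Suc k \<le> 1" by (rule power_le_one) auto
    then show "0 \<le> a k" by (simp add: a_def del: power_Suc)
    show "a k < 1" by (simp add: a_def del: power_Suc)
  qed
  have "\<exists>\<mu>>0. \<forall>p \<nu>'. 0 < \<nu>' \<longrightarrow> \<nu>' \<le> \<mu> \<longrightarrow> p holomorphic_on ball 0 (1 - \<nu>') \<longrightarrow>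
    (\<forall>z\<in>ball 0 (1 - \<nu>'). norm (p z - blaschke_pair (a k) z) \<le> \<nu>') \<longrightarrow> \<not> inj_on p (ball 0 (1 - \<nu>'))" for k
  proof -
    have "a k * norm z < 1" if "z \<in> ball 0 1" for z :: complex
      using mult_strict_mono[of "a k" 1 "norm z" 1] a[of k] that by simp
    then have hol: "blaschke_pair (a k) holomorphic_on ball 0 1" by (rule holomorphic_on_blaschke_pair[OF a(1)])
    show ?thesis by (rule not_injective_stable[OF hol blaschke_pair_not_inj[OF a]]) metis
  qed
  then obtain \<mu> where \<mu>: "\<And>k. 0 < \<mu> k" "\<And>k p \<nu>'. 0 < \<nu>' \<Longrightarrow> \<nu>' \<le> \<mu> k \<Longrightarrow> p holomorphic_on ball 0 (1 - \<nu>') \<Longrightarrow>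
    \<forall>z\<in>ball 0 (1 - \<nu>'). norm (p z - blaschke_pair (a k) z) \<le> \<nu>' \<Longrightarrow> \<not> inj_on p (ball 0 (1 - \<nu>'))"
    by metis
  \<comment> \<open>Small enough both to preserve non-injectivity at each stage and to have the
    geometric decay of the model.\<close>
  define \<nu> where "\<nu> k = min (\<mu> k) ((1/2) ^ (k + 4))" for k
  have \<nu>: "0 < \<nu> k" "\<nu> k \<le> (1/2) ^ (k + 4)" "\<nu> k \<le> \<mu> k" for k using \<mu>(1)[of k] by (auto simp: \<nu>_def)
  have bl: "blaschke_like (b k)" for k using blaschke_like_id blaschke_like_pair[OF a] by (simp add: b_def)
  have full_id: "full \<Longrightarrow> b k = (\<lambda>z. z)" for k by (simp add: b_def)
  have rad: "0 < far_rad k \<and> far_rad k \<le> 1" for k by (simp add: far_rad_def)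
  have shrink: "norm (b k z) \<le> norm z" if "norm z < 1" for k z
  proof -
    have "a k * norm z < 1" using mult_strict_mono[of "a k" 1 "norm z" 1] a[of k] that by simp
    then show ?thesis using blaschke_pair_le[OF a, of k z] that by (simp add: b_def)
  qed
  obtain f U c r N d e where
    curve: "smooth_Jordan_curve (frontier U)" and
    model: "wandering_itinerary f U d e" "full \<Longrightarrow> U = ball 0 1" "0 \<in> U"
      "c 0 = 0" "r 0 = 1" "N 0 = 0" "\<And>k. 0 < r k \<and> r k \<le> 1"
      "\<And>k. N (Suc k) = (if ret k then N k + k + 2 else N k + 1)"
      "\<And>k. if ret k then r (Suc k) \<le> 1 / real (k + 2) else r (Suc k) = far_rad (Suc k)"
      "\<And>k. d (N k) = c k \<and> e (N k) = 2 * r k"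
      "\<And>k n. N k < n \<Longrightarrow> n < N (Suc k) \<Longrightarrow> e n = 1 / real (k + 1)"
      "\<And>k z. z \<in> closure U \<Longrightarrow> norm ((f ^^ N k) z - c k) \<le> (1 + \<nu> k) * r k"
      "\<And>k z. z \<in> frontier U \<Longrightarrow> (1 - \<nu> k) * r k \<le> norm ((f ^^ N k) z - c k)"
      "\<And>k z. z \<in> U \<Longrightarrow> norm (((f ^^ N (Suc k)) z - c (Suc k)) / of_real (r (Suc k)) - b k (((f ^^ N k) z - c k) / of_real (r k))) \<le> \<nu> k"
      "\<And>k z. full \<Longrightarrow> z \<in> U \<Longrightarrow> norm (((f ^^ N k) z - c k) / of_real (r k) - z) \<le> \<nu> k"
      "\<And>k z. ret k \<Longrightarrow> z \<in> U \<Longrightarrow> dist ((f ^^ Suc (N k)) z) 20 \<le> 1"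
      "filterlim (\<lambda>k. norm (c k)) at_top sequentially"
    by (rule wandering_model_exists[where full = full and b = b and \<nu> = \<nu> and far_rad = far_rad and ret = ret,
          OF bl full_id \<nu>(1) rad]) (assumption, (rule that; assumption))
  interpret M: wandering_model full b \<nu> far_rad ret f U c r N d e
    by unfold_locales (rule \<nu>(1,2) shrink model; assumption)+
  have odd_stage: "r (Suc k) \<le> 1 / real (k + 2)" if "bt = Converging \<or> bt = Alternating \<and> even k" for k
    using model(9)[of k] that by (auto simp: far_rad_def ret_def add.commute split: if_splits)
  have even_stage: "r (Suc k) = 1" if "bt = Bounded_away \<or> bt = Alternating \<and> odd k" for k
    using model(9)[of k] that osc by (auto simp: far_rad_def ret_def split: if_splits)
  show thesis
  proof (rule that[of f U])
    show "transcendental_entire f" using model(1) by (rule itinerary_transcendental)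
    show "simply_connected U" using model(1) by (rule itinerary_simply_connected)
    show "smooth_Jordan_curve (frontier U)" by (rule curve)
    show "U = ball 0 1" if "h = Eventually_isometric" using model(2) that by (simp add: full_def)
    show "if osc then oscillating_wandering_domain f U else escaping_wandering_domain f U"
    proof (cases osc)
      case True
      have "oscillating_wandering_domain f U"
        by (rule M.oscillating_model[of "\<lambda>j. 2 * j"]) (use True in \<open>auto simp: strict_mono_def ret_def\<close>)
      then show ?thesis using True by simp
    next
      case False
      then show ?thesis using M.escaping_model by (simp add: ret_def)
    qed
    show "has_boundary_type f U bt"
    proof (cases bt)
      case Bounded_away
      moreover have "r k = 1" for k using model(5) even_stage[of "k - 1"] Bounded_away by (cases k) auto
      moreover have "\<not> ret k" for k using Bounded_away osc by (auto simp: ret_def)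
      ultimately show ?thesis using M.boundary_type_bounded_away by simp
    next
      case Alternating
      have "has_boundary_type f U Alternating"
      proof (rule M.boundary_type_alternating)
        fix j
        show "r (2 * j + 1) \<le> 1 / real (2 * j + 2)" using odd_stage[of "2 * j"] Alternating by simp
        show "r (2 * j + 2) = 1" using even_stage[of "2 * j + 1"] Alternating by simp
      qed
      then show ?thesis using Alternating by simp
    next
      case Converging
      then show ?thesis using M.boundary_type_converging odd_stage by simp
    qed
    show "has_hyperbolic_type f U h"
    proof (cases h)
      case Contracting
      have "has_hyperbolic_type f U Contracting"
        by (rule M.hyperbolic_type_contracting) (simp add: b_def full_def a_def Contracting)
      then show ?thesis using Contracting by simp
    next
      case Semi_contracting
      have "has_hyperbolic_type f U Semi_contracting"
      proof (rule M.hyperbolic_type_semi_contracting[of a])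
        show ba: "b k = blaschke_pair (a k)" for k by (simp add: b_def full_def Semi_contracting)
        have "summable (\<lambda>k. (1/2::real) ^ Suc k)" unfolding summable_Suc_iff by (rule summable_geometric) simp
        then show "summable (\<lambda>k. 1 - a k)" by (simp add: a_def Semi_contracting del: power_Suc)
        show "\<not> inj_on (M.stage k) (ball 0 (1 - \<nu> k))" for k
        proof (rule \<mu>(2)[OF \<nu>(1,3) M.holomorphic_on_stage])
          show "\<forall>z\<in>ball 0 (1 - \<nu> k). norm (M.stage k z - blaschke_pair (a k) z) \<le> \<nu> k"
            using M.stage_near[of _ k] unfolding ba by blast
        qed
      qed (use a in auto)
      then show ?thesis using Semi_contracting by simp
    next
      case Eventually_isometric
      then show ?thesis using M.hyperbolic_type_isometric by (simp add: full_def)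
    qed
  qed
qed

theorem corollary1p9:
  shows "(\<forall>(h :: hyperbolic_type) (b :: boundary_type). \<exists>f U.
            transcendental_entire f \<and> escaping_wandering_domain f U \<and> simply_connected U \<and>
            has_hyperbolic_type f U h \<and> has_boundary_type f U b \<and>
            smooth_Jordan_curve (frontier U) \<and>
            (h = Eventually_isometric \<longrightarrow> U = ball 0 1)) \<and>
         (\<forall>(h :: hyperbolic_type) (b :: boundary_type). b \<noteq> Bounded_away \<longrightarrow> (\<exists>f U.
            transcendental_entire f \<and> oscillating_wandering_domain f U \<and> simply_connected U \<and>
            has_hyperbolic_type f U h \<and> has_boundary_type f U b \<and>
            smooth_Jordan_curve (frontier U) \<and>
            (h = Eventually_isometric \<longrightarrow> U = ball 0 1)))"
proof (intro conjI allI impI)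
  fix h :: hyperbolic_type and b :: boundary_type
  show "\<exists>f U. transcendental_entire f \<and> escaping_wandering_domain f U \<and> simply_connected U \<and>
      has_hyperbolic_type f U h \<and> has_boundary_type f U b \<and> smooth_Jordan_curve (frontier U) \<and>
      (h = Eventually_isometric \<longrightarrow> U = ball 0 1)"
    by (rule wandering_domain_of_type[of False b h]) auto
  show "\<exists>f U. transcendental_entire f \<and> oscillating_wandering_domain f U \<and> simply_connected U \<and>
      has_hyperbolic_type f U h \<and> has_boundary_type f U b \<and> smooth_Jordan_curve (frontier U) \<and>
      (h = Eventually_isometric \<longrightarrow> U = ball 0 1)" if "b \<noteq> Bounded_away"
    by (rule wandering_domain_of_type[of True b h]) (use that in auto)
qed

end
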